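(* Let $n\ge2$ and $1\le p<n$. Let $g:\mathbb R^{n-p}\to\mathbb R^{n-p}$ be a quasiconformal mapping when $n-p\ge2$, or a quasisymmetric mapping when $n-p=1$. Let $f:\mathbb R^n\to\mathbb R^n$ be the Tukia–Väisälä quasiconformal extension of $g$. Then the following hold. (i) $J_f,\,J_{f^{-1}}\in A_1(\mathbb R^n;\mathbb R^{n-p})$. (ii) ${\bf C}_f$ and ${\bf C}_{f^{-1}}$ are bounded on $Q_\alpha(\mathbb R^n)$ for all $0<\alpha<\frac12$ when $p=1$, and for all $0<\alpha<1$ when $p\ge2$. Consequently, for such $\alpha$, $u\in Q_\alpha(\mathbb R^n)$ if and only if $u\circ f\in Q_\alpha(\mathbb R^n)$.
   Context: $\mathbb R^{n-p}$ is identified with $\mathbb R^{n-p}\times\{0\}\subset\mathbb R^n$; points of $\mathbb R^n$ are written $z=(x,y)$ with $x\in\mathbb R^{n-p}$, $y\in\mathbb R^p$. Quasiconformal: a homeomorphism $h:\mathbb R^m\to\mathbb R^m$, $m\ge2$, is quasiconformal if $h\in W^{1,1}_{\rm loc}(\mathbb R^m;\mathbb R^m)$ and there is $K\ge1$ with $|Dh(x)|^m\le K J_h(x)$ for a.e. $x$, where $J_h=|\det Dh|$. A homeomorphism $h$ of $\mathbb R$ is quasisymmetric if there is a homeomorphism $\eta:[0,\infty)\to[0,\infty)$ with $\frac{|h(a)-h(b)|}{|h(c)-h(b)|}\le\eta\left(\frac{|a-b|}{|c-b|}\right)$ for all $a,b,c\in\mathbb R$ with $c\neq b$. Tukia–Väisälä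 extension (its existence is due to Tukia and Väisälä): Case $p\ge2$: equip $\mathbb H^{n,p}=\mathbb R^n\setminus\mathbb R^{n-p}=\{(x,y):x\in\mathbb R^{n-p},\,0\ne y\in\mathbb R^p\}$ with the distance $d_{\mathbb H^{n,p}}(w,w')=\inf_\gamma\int_\gamma\frac{|dz|}{|y|}$, the infimum over all rectifiable curves $\gamma$ in $\mathbb H^{n,p}$ joining $w$ and $w'$. The extension is a quasiconformal mapping $f:\mathbb R^n\to\mathbb R^n$ with $f|_{\mathbb R^{n-p}}=g$ and such that, for some constant $L\ge1$, $\frac1L d_{\mathbb H^{n,p}}(w,w')\le d_{\mathbb H^{n,p}}(f(w),f(w'))\le L\,d_{\mathbb H^{n,p}}(w,w')$ for all $w,w'\in\mathbb H^{n,p}$. Case $p=1$: let $\mathbb H^n=\{(x,y):x\in\mathbb R^{n-1},\,y>0\}$ with the hyperbolic distance $d_{\mathbb H^n}(w,w')=\inf_\gamma\int_\gamma\frac{|dz|}{y}$ (infimum over rectifiable curves in $\mathbb H^n$ joining $w,w'$). The extension is first a quasiconformal homeomorphism $f$ of the closed half-space $\mathbb H^n\cup\mathbb R^{n-1}$ onto itself with $f|_{\mathbb R^{n-1}}=g$ and $\frac1Ld_{\mathbb H^n}(w,w')\le d_{\mathbb H^n}(f(w),f(w'))\le L\,d_{\mathbb H^n}(w,w')$ for all $w,w'\in\mathbb H^n$ and some $L\ge1$; it is then extended to $\mathbb R^n$ by reflection, i.e. $f(z)=R(f(R(z)))$ for $z=(x,y)$ with $y<0$, where $R(x,y)=(x,-y)$.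 Local Muckenhoupt class: for a closed set $E\subseteq\mathbb R^n$ and a nonnegative function $w:\mathbb R^n\to\mathbb R$, $w\in A_1(\mathbb R^n;E)$ means there is $C>0$ such that $\frac1{|B|}\int_B w(z)\,dz\le C\,\operatorname*{ess\,inf}_{x\in B}w(x)$ for every ball $B=B(x_B,r_B)\subset\mathbb R^n$ with $2r_B<d(x_B,E)$, where $d(x,E)=\inf_{z\in E}|x-z|$. $Q$-spaces: for $\alpha\in(0,1)$, $Q_\alpha(\mathbb R^n)$ consists of all $u\in L^2_{\rm loc}(\mathbb R^n)$ with $$\|u\|_{Q_\alpha(\mathbb R^n)}=\sup_{x_0\in\mathbb R^n,\,r>0}\left(r^{2\alpha-n}\int_{B(x_0,r)}\int_{B(x_0,r)}\frac{|u(x)-u(y)|^2}{|x-y|^{n+2\alpha}}\,dx\,dy\right)^{1/2}<\infty .$$ ${\bf C}_f(u)=u\circ f$ is bounded on $Q_\alpha(\mathbb R^n)$ if there is a constant $C$ such that $u\circ f\in Q_\alpha(\mathbb R^n)$ and $\|u\circ f\|_{Q_\alpha(\mathbb R^n)}\le C\|u\|_{Q_\alpha(\mathbb R^n)}$ for all $u\in Q_\alpha(\mathbb R^n)$. *)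

theory Defs
  imports "HOL-Analysis.Analysis"
begin

text \<open>The space of dimension n is \<open>real ^ ('k + 'p)\<close>, so that n - p = \<open>CARD('k)\<close> and p = \<open>CARD('p)\<close>:
  the coordinates \<open>Inl i\<close> form x and the coordinates \<open>Inr j\<close> form y in z = (x, y).\<close>

definition embed :: "real ^ 'k::finite \<Rightarrow> real ^ ('k + 'p::finite)" where
  "embed x = (\<chi> i. case i of Inl a \<Rightarrow> x $ a | Inr b \<Rightarrow> 0)"

definition ypart :: "real ^ ('k::finite + 'p::finite) \<Rightarrow> real ^ 'p" where
  "ypart z = (\<chi> j. z $ Inr j)"

definition reflect :: "real ^ ('k::finite + 'p::finite) \<Rightarrow> real ^ ('k + 'p)" where
  "reflect z = (\<chi> i. case i of Inl a \<Rightarrow> z $ Inl a | Inr b \<Rightarrow> - (z $ Inr b))"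


subsection \<open>Weak derivatives and quasiconformal mappings\<close>

fun Ck :: "nat \<Rightarrow> ('a::euclidean_space \<Rightarrow> real) \<Rightarrow> bool" where
  "Ck 0 \<phi> \<longleftrightarrow> continuous_on UNIV \<phi>"
| "Ck (Suc k) \<phi> \<longleftrightarrow> (\<forall>x. \<phi> differentiable (at x)) \<and>
     (\<forall>b\<in>Basis. Ck k (\<lambda>x. frechet_derivative \<phi> (at x) b))"

definition test_function :: "'a set \<Rightarrow> ('a::euclidean_space \<Rightarrow> real) \<Rightarrow> bool" where
  "test_function U \<phi> \<longleftrightarrow> (\<forall>k. Ck k \<phi>) \<and>
     compact (closure {x. \<phi> x \<noteq> 0}) \<and> closure {x. \<phi> x \<noteq> 0} \<subseteq> U"

definition locally_integrable :: "'a set \<Rightarrow> ('a::euclidean_space \<Rightarrow> 'b::euclidean_space) \<Rightarrow> bool" where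
  "locally_integrable U h \<longleftrightarrow> (\<forall>K. compact K \<and> K \<subseteq> U \<longrightarrow> h absolutely_integrable_on K)"

text \<open>\<open>D\<close> is the weak derivative of \<open>h\<close> on the open set \<open>U\<close>, with both \<open>h\<close> and \<open>D\<close> locally integrable;
  the mapping \<open>h\<close> is of class \<open>W\<close>-(1,1)-loc on \<open>U\<close> iff such a \<open>D\<close> exists. The integrals may
  be taken over the whole space, since the test functions vanish off a compact subset of \<open>U\<close>.\<close>

definition has_weak_derivative_on ::
    "(real ^ 'm \<Rightarrow> real ^ 'm) \<Rightarrow> (real ^ 'm \<Rightarrow> real ^ 'm ^ 'm) \<Rightarrow> (real ^ 'm) set \<Rightarrow> bool" where
  "has_weak_derivative_on h D U \<longleftrightarrow>
     locally_integrable U h \<and> locally_integrable U D \<and>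
     (\<forall>\<phi> j. test_function U \<phi> \<longrightarrow>
        (LINT x|lebesgue. frechet_derivative \<phi> (at x) (axis j 1) *\<^sub>R h x) =
        - (LINT x|lebesgue. \<phi> x *\<^sub>R column j (D x)))"

definition bounded_distortion_on :: "(real ^ 'm \<Rightarrow> real ^ 'm) \<Rightarrow> (real ^ 'm) set \<Rightarrow> bool" where
  "bounded_distortion_on h U \<longleftrightarrow>
     (\<exists>D. has_weak_derivative_on h D U \<and>
       (\<exists>K\<ge>1. AE x in lebesgue_on U. onorm ((*v) (D x)) ^ CARD('m) \<le> K * \<bar>det (D x)\<bar>))"

definition quasiconformal :: "(real ^ 'm \<Rightarrow> real ^ 'm) \<Rightarrow> bool" where
  "quasiconformal h \<longleftrightarrow>
     (\<exists>h'. homeomorphism UNIV UNIV h h') \<and> bounded_distortion_on h UNIV"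

definition quasisymmetric :: "('a::metric_space \<Rightarrow> 'a) \<Rightarrow> bool" where
  "quasisymmetric h \<longleftrightarrow>
     (\<exists>h'. homeomorphism UNIV UNIV h h') \<and>
     (\<exists>\<eta> \<eta>'. homeomorphism {0::real..} {0::real..} \<eta> \<eta>' \<and>
       (\<forall>a b c. c \<noteq> b \<longrightarrow> dist (h a) (h b) / dist (h c) (h b) \<le> \<eta> (dist a b / dist c b)))"

text \<open>A weak derivative is unique almost everywhere, so the choice below is immaterial
  for mappings of class \<open>W\<close>-(1,1)-loc; for other mappings the value is unspecified.\<close>

definition jacobian :: "(real ^ 'm \<Rightarrow> real ^ 'm) \<Rightarrow> real ^ 'm \<Rightarrow> real" where
  "jacobian h x = \<bar>det ((SOME D. has_weak_derivative_on h D UNIV) x)\<bar>"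


subsection \<open>Rectifiable curves and the distances on the half-space and on the complement of
  the subspace\<close>

definition curve_length :: "(real \<Rightarrow> 'a::metric_space) \<Rightarrow> real \<Rightarrow> real \<Rightarrow> ennreal" where
  "curve_length \<gamma> a b =
     (SUP ts\<in>{ts. sorted ts \<and> set ts \<subseteq> {a..b}}.
        \<Sum>i<length ts - 1. ennreal (dist (\<gamma> (ts ! i)) (\<gamma> (ts ! Suc i))))"

definition rectifiable_path :: "(real \<Rightarrow> 'a::metric_space) \<Rightarrow> bool" where
  "rectifiable_path \<gamma> \<longleftrightarrow> path \<gamma> \<and> curve_length \<gamma> 0 1 < top"

text \<open>The integral of \<open>\<rho>\<close> along \<open>\<gamma>\<close> with respect to arc length is the Lebesgue-Stieltjes integral
  against the length function t |-> length of \<open>\<gamma>\<close> on [0, t], extended by constants outside [0, 1]; this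
  function is continuous and nondecreasing when \<open>\<gamma>\<close> is a rectifiable path.\<close>

definition arclength_integral :: "('a::metric_space \<Rightarrow> real) \<Rightarrow> (real \<Rightarrow> 'a) \<Rightarrow> ennreal" where
  "arclength_integral \<rho> \<gamma> =
     (\<integral>\<^sup>+t\<in>{0..1}. ennreal (\<rho> (\<gamma> t))
        \<partial>interval_measure (\<lambda>t. enn2real (curve_length \<gamma> 0 (max 0 (min 1 t)))))"

definition hdist ::
    "(real ^ ('k::finite + 'p::finite)) set \<Rightarrow> real ^ ('k + 'p) \<Rightarrow> real ^ ('k + 'p) \<Rightarrow> ennreal" where
  "hdist H w w' =
     (INF \<gamma>\<in>{\<gamma>. rectifiable_path \<gamma> \<and> path_image \<gamma> \<subseteq> H \<and> pathstart \<gamma> = w \<and> pathfinish \<gamma> = w'}.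
        arclength_integral (\<lambda>z. 1 / norm (ypart z)) \<gamma>)"

definition hdist_bilipschitz ::
    "(real ^ ('k::finite + 'p::finite)) set \<Rightarrow> (real ^ ('k + 'p) \<Rightarrow> real ^ ('k + 'p)) \<Rightarrow> bool" where
  "hdist_bilipschitz H f \<longleftrightarrow>
     (\<exists>L::real. L \<ge> 1 \<and> (\<forall>w\<in>H. \<forall>w'\<in>H.
        ennreal (1 / L) * hdist H w w' \<le> hdist H (f w) (f w') \<and>
        hdist H (f w) (f w') \<le> ennreal L * hdist H w w'))"


subsection \<open>Tukia-Vaisala extensions\<close>

definition complement_space :: "(real ^ ('k::finite + 'p::finite)) set" where
  "complement_space = {z. ypart z \<noteq> 0}"

text \<open>The following two sets are used for \<open>CARD('p) = 1\<close> only, when \<open>ypart z\<close> has a single coordinate.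
  On the open half-space \<open>norm (ypart z)\<close> is this coordinate, so that \<open>hdist upper_half_space\<close> is the
  hyperbolic distance.\<close>

definition upper_half_space :: "(real ^ ('k::finite + 'p::finite)) set" where
  "upper_half_space = {z. \<forall>j. 0 < ypart z $ j}"

definition closed_half_space :: "(real ^ ('k::finite + 'p::finite)) set" where
  "closed_half_space = {z. \<forall>j. 0 \<le> ypart z $ j}"

definition tukia_vaisala_extension ::
    "(real ^ 'k \<Rightarrow> real ^ 'k) \<Rightarrow> (real ^ ('k::finite + 'p::finite) \<Rightarrow> real ^ ('k + 'p)) \<Rightarrow> bool" where
  "tukia_vaisala_extension g f \<longleftrightarrow>
     (\<forall>x. f (embed x) = embed (g x)) \<and>
     (if CARD('p) = 1
      then (\<exists>f'. homeomorphism closed_half_space closed_half_space f f') \<and>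
           bounded_distortion_on f upper_half_space \<and>
           hdist_bilipschitz upper_half_space f \<and>
           (\<forall>z. z \<notin> closed_half_space \<longrightarrow> f z = reflect (f (reflect z)))
      else quasiconformal f \<and> hdist_bilipschitz complement_space f)"


subsection \<open>The local Muckenhoupt class and the spaces Q\<close>

definition local_A1 :: "'a set \<Rightarrow> ('a::euclidean_space \<Rightarrow> real) \<Rightarrow> bool" where
  "local_A1 E w \<longleftrightarrow>
     w \<in> borel_measurable lebesgue \<and> (\<forall>x. 0 \<le> w x) \<and>
     (\<exists>C>0. \<forall>x r. 0 < r \<and> 2 * r < infdist x E \<longrightarrow>
        (\<integral>\<^sup>+z\<in>ball x r. ennreal (w z) \<partial>lebesgue) / emeasure lebesgue (ball x r)
          \<le> ennreal C * Liminf (ae_filter (lebesgue_on (ball x r))) (\<lambda>z. ennreal (w z)))"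

definition ennreal_sqrt :: "ennreal \<Rightarrow> ennreal" where
  "ennreal_sqrt t = (if t = top then top else ennreal (sqrt (enn2real t)))"

definition Q_norm :: "real \<Rightarrow> (real ^ 'n \<Rightarrow> real) \<Rightarrow> ennreal" where
  "Q_norm \<alpha> u =
     (SUP (x0, r)\<in>UNIV \<times> {0<..}. ennreal_sqrt
        (ennreal (r powr (2 * \<alpha> - real CARD('n))) *
         (\<integral>\<^sup>+y\<in>ball x0 r. (\<integral>\<^sup>+x\<in>ball x0 r.
            ennreal (\<bar>u x - u y\<bar>\<^sup>2 / norm (x - y) powr (real CARD('n) + 2 * \<alpha>))
              \<partial>lebesgue) \<partial>lebesgue)))"

definition Q_space :: "real \<Rightarrow> (real ^ 'n \<Rightarrow> real) set" where
  "Q_space \<alpha> = {u. u \<in> borel_measurable lebesgue \<and> locally_integrable UNIV (\<lambda>x. (u x)\<^sup>2) \<and>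
     Q_norm \<alpha> u < top}"

definition composition_bounded :: "real \<Rightarrow> (real ^ 'n \<Rightarrow> real ^ 'n) \<Rightarrow> bool" where
  "composition_bounded \<alpha> f \<longleftrightarrow>
     (\<exists>C::real. \<forall>u\<in>Q_space \<alpha>. u \<circ> f \<in> Q_space \<alpha> \<and> Q_norm \<alpha> (u \<circ> f) \<le> ennreal C * Q_norm \<alpha> u)"

end

theory Submission
  imports Defs
begin

text \<open>Let \<open>depth z\<close> be the distance from \<open>z\<close> to the subspace. Comparing the hyperbolic distances of nearby points
  with their Euclidean distances shows that \<open>f\<close> and its inverse are bilipschitz on Whitney balls, i.e. balls around
  \<open>z\<close> of radius a small multiple of \<open>depth z\<close>, up to the scaling factor \<open>ratio z = depth (f z) / depth z\<close>.
  This is the only property of \<open>f\<close> that matters, together with its symmetry under reflection when \<open>p = 1\<close>.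

  For the Q-spaces, write \<open>v = u \<circ> f\<close>. On a Whitney ball a change of variables bounds the energy of \<open>v\<close>, and averaging
  over Whitney balls handles all pairs \<open>x, y\<close> with \<open>|x - y|\<close> small compared to the depth. For the other pairs, the
  mean values of \<open>v\<close> on the Whitney balls at \<open>x\<close> and \<open>y\<close> are compared along a chain of Whitney balls that first moves
  away from the subspace. Its length is logarithmic in \<open>|x - y| / depth x\<close> and \<open>|x - y| / depth y\<close>, hence
  bounded by small powers of these, and the square of the difference is integrated with the help of the integrability of
  \<open>depth powr (- 2 * \<alpha>)\<close> for \<open>2 * \<alpha> < p\<close>. For \<open>p \<ge> 2\<close> the chain can be led around the subspace; for \<open>p = 1\<close> one
  compares the means at \<open>z\<close> and at its mirror image directly, using the symmetry of \<open>f\<close>.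

  For the Jacobian, Vitali coverings make \<open>f\<close> differentiable almost everywhere along lines off the subspace, and a line
  through a point off the subspace meets the subspace at most once. The fundamental theorem of calculus on lines thus
  identifies the weak derivative with the directional derivatives. These have size comparable to \<open>ratio\<close> by the bilipschitz
  estimate, so that the Jacobian is comparable to \<open>ratio ^ n\<close>, which is essentially constant on the balls in question.\<close>

section \<open>Lipschitz images and Lebesgue measure\<close>

text \<open>The Q-energy is scale invariant: under a map that is bilipschitz up to the factor
  \<open>ratio\<close>, the kernel contributes the power n + 2 * \<alpha> of \<open>ratio\<close>,
  the two changes of variables contribute -2 * n, and the radius of the image ball n - 2 * \<alpha>.
  These add up to zero, so a single Whitney ball causes no loss and the difficulty lies in summing
  over balls that shrink towards the subspace. Averaging puts the density depth^(-n) on their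
  centres; together with the energy bound depth^(n - 2 * \<alpha>) on each ball this produces the
  weight \<open>depth powr (- 2 * \<alpha>)\<close>. For distant pairs the value of \<open>v\<close>
  at a single point cannot be controlled by the norm alone. Its deviation from the local mean is
  therefore kept as an energy density (\<open>Near\<close>), which is integrable by the estimate for
  close pairs. Volumes are compared only through Lipschitz bounds and Vitali coverings, at the cost
  of factors such as 2^n. They are harmless, since all constants depend only on the dimensions,
  \<alpha>, the constants of the map and \<open>CD\<close>, never on \<open>u\<close>.\<close>

declare emeasure_completion [simp del]

text \<open>The sets may overlap: in the Vitali argument the balls are disjoint, but the sets
  covering their images need not be. The inequality is the integrated form of a pointwise one
  between indicators.\<close>

lemma emeasure_UN_countable_le:
  assumes C: "countable C" and T: "\<And>i. i \<in> C \<Longrightarrow> T i \<in> sets M"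
  shows "emeasure M (\<Union>i\<in>C. T i) \<le> (\<integral>\<^sup>+i. emeasure M (T i) \<partial>count_space C)"
proof -
  have "emeasure M (\<Union>i\<in>C. T i) = (\<integral>\<^sup>+x. indicator (\<Union>i\<in>C. T i) x \<partial>M)"
    using assms by (subst nn_integral_indicator) auto
  also have "\<dots> \<le> (\<integral>\<^sup>+x. \<integral>\<^sup>+i. indicator (T i) x \<partial>count_space C \<partial>M)"
  proof (rule nn_integral_mono)
    fix x
    show "indicator (\<Union>i\<in>C. T i) x \<le> (\<integral>\<^sup>+i. indicator (T i) x \<partial>count_space C)"
    proof (cases "\<exists>i\<in>C. x \<in> T i")
      case True
      then obtain i where i: "i \<in> C" "x \<in> T i" by auto
      have "indicator (T i) x \<le> (\<integral>\<^sup>+i. indicator (T i) x \<partial>count_space C)"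
        by (rule nn_integral_ge_point[OF i(1)])
      then show ?thesis using i by (auto simp: indicator_def split: if_splits)
    qed auto
  qed
  also have "\<dots> = (\<integral>\<^sup>+i. \<integral>\<^sup>+x. indicator (T i) x \<partial>M \<partial>count_space C)"
    using assms by (intro nn_integral_count_space_nn_integral) auto
  also have "\<dots> = (\<integral>\<^sup>+i. emeasure M (T i) \<partial>count_space C)"
    using T by (intro nn_integral_cong) (auto intro!: nn_integral_indicator)
  finally show ?thesis .
qed

text \<open>The balls with a good image bound form a Vitali cover of S inside U, so countably many
  disjoint ones cover S up to a null set. Summing the bounds costs at most \<kappa> times the
  measure of U, and \<open>neg\<close> disposes of the image of the null set. The measurable
  superset T spares any discussion of the measurability of the pieces of the image. The point x need
  not be the centre of its ball, which matters for intervals with x as an endpoint.\<close>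

lemma vitali_image_bound_open:
  fixes f :: "'a::euclidean_space \<Rightarrow> 'a"
  assumes fine: "\<And>x d. x \<in> S \<Longrightarrow> d > 0 \<Longrightarrow> \<exists>a r. 0 < r \<and> r < d \<and> x \<in> cball a r \<and> cball a r \<subseteq> U \<and>
      (\<exists>T\<in>sets lebesgue. f ` (S \<inter> cball a r) \<subseteq> T \<and>
        emeasure lebesgue T \<le> ennreal \<kappa> * emeasure lebesgue (cball a r))"
    and neg: "\<And>N. negligible N \<Longrightarrow> N \<subseteq> S \<Longrightarrow> negligible (f ` N)"
    and U: "open U"
  shows "emeasure lebesgue (f ` S) \<le> ennreal \<kappa> * emeasure lebesgue U"
proof -
  define K where "K = {i. 0 < snd i \<and> cball (fst i) (snd i) \<subseteq> U \<and> (\<exists>T\<in>sets lebesgue. f ` (S \<inter> cball (fst i) (snd i)) \<subseteq> T \<and>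
        emeasure lebesgue T \<le> ennreal \<kappa> * emeasure lebesgue (cball (fst i) (snd i)))}"
  obtain C where C: "countable C" "C \<subseteq> K"
     "pairwise (\<lambda>i j. disjnt (cball (fst i) (snd i)) (cball (fst j) (snd j))) C"
     "negligible (S - (\<Union>i \<in> C. cball (fst i) (snd i)))"
  proof (rule Vitali_covering_theorem_cballs [of K snd S fst])
    show "\<And>i. i \<in> K \<Longrightarrow> 0 < snd i" by (auto simp: K_def)
    fix x d assume "x \<in> S" "0 < (d::real)"
    from fine[OF this] obtain a r where ar: "0 < r \<and> r < d \<and> x \<in> cball a r \<and> cball a r \<subseteq> U \<and>
      (\<exists>T\<in>sets lebesgue. f ` (S \<inter> cball a r) \<subseteq> T \<and>
        emeasure lebesgue T \<le> ennreal \<kappa> * emeasure lebesgue (cball a r))" by metis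
    show "\<exists>i. i \<in> K \<and> x \<in> cball (fst i) (snd i) \<and> snd i < d"
      by (rule exI[of _ "(a, r)"]) (use ar in \<open>auto simp: K_def\<close>)
  qed blast
  have "\<forall>i\<in>C. \<exists>T. T \<in> sets lebesgue \<and> f ` (S \<inter> cball (fst i) (snd i)) \<subseteq> T \<and>
        emeasure lebesgue T \<le> ennreal \<kappa> * emeasure lebesgue (cball (fst i) (snd i))"
  proof
    fix i assume "i \<in> C"
    then have "i \<in> K" using C(2) by auto
    then show "\<exists>T. T \<in> sets lebesgue \<and> f ` (S \<inter> cball (fst i) (snd i)) \<subseteq> T \<and>
        emeasure lebesgue T \<le> ennreal \<kappa> * emeasure lebesgue (cball (fst i) (snd i))"
      unfolding K_def by (simp add: Bex_def)
  qed
  from bchoice[OF this] obtain T where T: "\<And>i. i \<in> C \<Longrightarrow> T i \<in> sets lebesgue \<and> f ` (S \<inter> cball (fst i) (snd i)) \<subseteq> T i \<and>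
        emeasure lebesgue (T i) \<le> ennreal \<kappa> * emeasure lebesgue (cball (fst i) (snd i))" by blast
  define N where "N = S - (\<Union>i \<in> C. cball (fst i) (snd i))"
  have N: "f ` N \<in> null_sets lebesgue"
    using neg[of N] C(4) by (auto simp: N_def negligible_iff_null_sets)
  have TU: "(\<Union>i\<in>C. T i) \<in> sets lebesgue"
    using C(1) T by (intro sets.countable_UN') auto
  have sub: "f ` S \<subseteq> f ` N \<union> (\<Union>i\<in>C. T i)"
    using T unfolding N_def by blast
  have "emeasure lebesgue (f ` S) \<le> emeasure lebesgue (f ` N \<union> (\<Union>i\<in>C. T i))"
    by (rule emeasure_mono[OF sub]) (use TU N in auto)
  also have "\<dots> \<le> emeasure lebesgue (f ` N) + emeasure lebesgue (\<Union>i\<in>C. T i)"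
    by (rule emeasure_subadditive) (use TU N in auto)
  also have "emeasure lebesgue (f ` N) = 0" using N by auto
  also have "emeasure lebesgue (\<Union>i\<in>C. T i) \<le> (\<integral>\<^sup>+i. emeasure lebesgue (T i) \<partial>count_space C)"
    using C(1) T by (intro emeasure_UN_countable_le) auto
  also have "\<dots> \<le> (\<integral>\<^sup>+i. ennreal \<kappa> * emeasure lebesgue (cball (fst i) (snd i)) \<partial>count_space C)"
    using T by (intro nn_integral_mono) auto
  also have "\<dots> = ennreal \<kappa> * (\<integral>\<^sup>+i. emeasure lebesgue (cball (fst i) (snd i)) \<partial>count_space C)"
    by (subst nn_integral_cmult) auto
  also have "(\<integral>\<^sup>+i. emeasure lebesgue (cball (fst i) (snd i)) \<partial>count_space C)
     = emeasure lebesgue (\<Union>i\<in>C. cball (fst i) (snd i))"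
    using C(1,3) by (intro emeasure_UN_countable[symmetric])
       (auto simp: disjoint_family_on_def pairwise_def disjnt_def)
  also have "\<dots> \<le> emeasure lebesgue U"
    using C(2) U by (intro emeasure_mono) (auto simp: K_def)
  finally show ?thesis by (auto simp: mult_left_mono)
qed

text \<open>Outer regularity of Lebesgue measure. For \<kappa> \<le> 0 the coefficient is zero in
  \<open>ennreal\<close>; otherwise the excess of U over S is chosen below e / \<kappa>.\<close>

lemma emeasure_outer_open_le:
  fixes S :: "'a::euclidean_space set"
  assumes S: "S \<in> sets lebesgue"
    and le: "\<And>U. open U \<Longrightarrow> S \<subseteq> U \<Longrightarrow> m \<le> ennreal \<kappa> * emeasure lebesgue U"
  shows "m \<le> ennreal \<kappa> * emeasure lebesgue S"
proof (cases "\<kappa> \<le> 0")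
  case True
  then have "ennreal \<kappa> = 0" by (simp add: ennreal_neg)
  then show ?thesis using le[of UNIV] by auto
next
  case False
  show ?thesis
  proof (rule ennreal_le_epsilon)
    fix e :: real assume e: "0 < e"
    obtain U where U: "open U" "S \<subseteq> U" "(U - S) \<in> lmeasurable" "emeasure lebesgue (U - S) < ennreal (e / \<kappa>)"
      by (rule sets_lebesgue_outer_open[OF S, of "e / \<kappa>"]) (use e False in auto)
    have "emeasure lebesgue U = emeasure lebesgue S + emeasure lebesgue (U - S)"
      using U S by (subst plus_emeasure) (auto simp: Un_absorb1)
    also have "ennreal \<kappa> * \<dots> = ennreal \<kappa> * emeasure lebesgue S + ennreal \<kappa> * emeasure lebesgue (U - S)"
      by (rule distrib_left)
    also have "ennreal \<kappa> * emeasure lebesgue (U - S) \<le> ennreal \<kappa> * ennreal (e / \<kappa>)"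
      using U(4) by (intro mult_left_mono) auto
    also have "\<dots> = ennreal e" using False e by (subst ennreal_mult[symmetric]) auto
    finally show "m \<le> ennreal \<kappa> * emeasure lebesgue S + ennreal e"
      using le[OF U(1,2)] by (auto simp: add_left_mono intro: order_trans)
  qed
qed

lemma emeasure_lebesgue_cball:
  "0 \<le> r \<Longrightarrow> emeasure lebesgue (cball (c::'a::euclidean_space) r) = ennreal (unit_ball_vol (DIM('a)) * r ^ DIM('a))"
  by (simp add: emeasure_cball emeasure_completion)

text \<open>A ball of radius r centred in S has its image in a ball of radius 2 * M * r, which is a
  sufficient Vitali cover. Only comparability of volumes is wanted, so the constant is not
  optimised. The applications establish that the image is measurable, as \<open>emeasure\<close> is
  zero by convention otherwise.\<close>

lemma emeasure_lipschitz_image_le: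
  fixes f :: "'a::euclidean_space \<Rightarrow> 'a"
  assumes S: "S \<in> sets lebesgue" and M: "M \<ge> 0"
    and lip: "\<And>x y. x \<in> S \<Longrightarrow> y \<in> S \<Longrightarrow> dist (f x) (f y) \<le> M * dist x y"
  shows "emeasure lebesgue (f ` S) \<le> ennreal ((2 * M) ^ DIM('a)) * emeasure lebesgue S"
proof (rule emeasure_outer_open_le[OF S], rule vitali_image_bound_open)
  fix U :: "'a set" assume U: "open U" "S \<subseteq> U"
  { fix N assume "negligible N" "N \<subseteq> S"
    then show "negligible (f ` N)"
      using lip by (intro negligible_locally_Lipschitz_image)
        (auto simp: dist_norm intro!: exI[of _ UNIV] exI[of _ M]) }
  fix x and d :: real assume x: "x \<in> S" and d: "0 < d"
  obtain e where e: "e > 0" "cball x e \<subseteq> U" using U x open_contains_cball by blast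
  define r where "r = min e (d/2)"
  have r: "r > 0" "r < d" "cball x r \<subseteq> U" using e d by (auto simp: r_def)
  show "\<exists>a r. 0 < r \<and> r < d \<and> x \<in> cball a r \<and> cball a r \<subseteq> U \<and>
      (\<exists>T\<in>sets lebesgue. f ` (S \<inter> cball a r) \<subseteq> T \<and>
        emeasure lebesgue T \<le> ennreal ((2 * M) ^ DIM('a)) * emeasure lebesgue (cball a r))"
  proof (intro exI conjI bexI)
    show "f ` (S \<inter> cball x r) \<subseteq> cball (f x) (2 * M * r)"
    proof clarsimp
      fix y assume y: "y \<in> S" "dist x y \<le> r"
      have "dist (f x) (f y) \<le> M * r"
        using lip[OF x y(1)] mult_left_mono[OF y(2) M] by linarith
      also have "\<dots> \<le> 2 * M * r" using M r by simp
      finally show "dist (f x) (f y) \<le> 2 * M * r" .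
    qed
    have eq: "unit_ball_vol (real DIM('a)) * (2 * M * r) ^ DIM('a) =
        (2 * M) ^ DIM('a) * (unit_ball_vol (real DIM('a)) * r ^ DIM('a))"
      by (simp add: power_mult_distrib)
    have "emeasure lebesgue (cball (f x) (2 * M * r)) = ennreal (unit_ball_vol (real DIM('a)) * (2 * M * r) ^ DIM('a))"
      using M r by (intro emeasure_lebesgue_cball) auto
    also have "\<dots> = ennreal ((2 * M) ^ DIM('a)) * emeasure lebesgue (cball x r)"
      unfolding emeasure_lebesgue_cball[OF less_imp_le[OF r(1)]] eq using M r by (intro ennreal_mult) auto
    finally show "emeasure lebesgue (cball (f x) (2 * M * r)) \<le> ennreal ((2 * M) ^ DIM('a)) * emeasure lebesgue (cball x r)"
      by simp
  qed (use r in auto)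
qed auto

text \<open>A change of variables without a Jacobian: the hypothesis on preimages says that the
  push-forward under T of Lebesgue measure on W is dominated by c times Lebesgue measure on V, and F
  is integrated against both.\<close>

lemma nn_integral_image_le:
  fixes T :: "'a::euclidean_space \<Rightarrow> 'a"
  assumes W: "W \<in> sets borel" and T: "T \<in> borel \<rightarrow>\<^sub>M borel" and V: "V \<in> sets borel"
    and TV: "T ` W \<subseteq> V"
    and le: "\<And>A. A \<in> sets borel \<Longrightarrow> A \<subseteq> V \<Longrightarrow> emeasure lborel (W \<inter> T -` A) \<le> c * emeasure lborel A"
    and F: "F \<in> borel_measurable borel"
  shows "(\<integral>\<^sup>+x\<in>W. F (T x) \<partial>lborel) \<le> c * (\<integral>\<^sup>+x\<in>V. F x \<partial>lborel)"
proof -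
  note [measurable] = T W V F
  let ?N = "distr (density lborel (indicator W)) borel T"
  let ?M = "density lborel (\<lambda>x. c * indicator V x)"
  have "?N \<le> ?M"
  proof (subst le_measure)
    show "\<forall>A\<in>sets ?N. emeasure ?N A \<le> emeasure ?M A"
    proof
      fix A assume "A \<in> sets ?N"
      then have A[measurable]: "A \<in> sets borel" by auto
      have TA: "T -` A \<in> sets borel" using measurable_sets[OF T A] by simp
      then have TW: "T -` A \<inter> W \<in> sets borel" using W by auto
      have "emeasure ?N A = emeasure (density lborel (indicator W)) (T -` A)"
        by (subst emeasure_distr) auto
      also have "\<dots> = (\<integral>\<^sup>+x. indicator W x * indicator (T -` A) x \<partial>lborel)"
        using TA W by (subst emeasure_density) auto
      also have "\<dots> = (\<integral>\<^sup>+x. indicator (T -` A \<inter> W) x \<partial>lborel)"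
        by (rule nn_integral_cong) (auto split: split_indicator)
      also have "\<dots> = emeasure lborel (W \<inter> T -` (A \<inter> V))"
        using TV TW by (subst nn_integral_indicator) (auto intro!: arg_cong[of _ _ "emeasure lborel"])
      also have "\<dots> \<le> c * emeasure lborel (A \<inter> V)" by (rule le) auto
      also have "\<dots> = emeasure ?M A"
        by (subst emeasure_density)
          (auto simp: mult.assoc nn_integral_cmult indicator_inter_arith[symmetric] Int_commute)
      finally show "emeasure ?N A \<le> emeasure ?M A" .
    qed
  qed auto
  then have "nn_integral ?N F \<le> nn_integral ?M F" by (intro nn_integral_mono_measure) auto
  moreover have "nn_integral ?N F = (\<integral>\<^sup>+x\<in>W. F (T x) \<partial>lborel)"
    by (subst nn_integral_distr) (auto simp: nn_integral_density mult.commute)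
  moreover have "nn_integral ?M F = c * (\<integral>\<^sup>+x\<in>V. F x \<partial>lborel)"
    by (subst nn_integral_density) (auto simp: mult.assoc nn_integral_cmult[symmetric] mult.left_commute mult.commute intro!: nn_integral_cong)
  ultimately show ?thesis by simp
qed

section \<open>Locally Lipschitz functions of one variable\<close>

text \<open>Rational levels strictly between the lower and the upper limit. Taking them rational
  later writes the set of bad points as a countable union.\<close>

lemma not_convergent_bounded_oscillation:
  fixes X :: "nat \<Rightarrow> real"
  assumes bd: "\<And>k. \<bar>X k\<bar> \<le> B" and nc: "\<not> convergent X"
  shows "\<exists>p q. p \<in> \<rat> \<and> q \<in> \<rat> \<and> p < q \<and> (\<forall>N. \<exists>k\<ge>N. X k < p) \<and> (\<forall>N. \<exists>k\<ge>N. q < X k)"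
proof -
  let ?X = "\<lambda>k. ereal (X k)"
  have "liminf ?X \<noteq> limsup ?X"
  proof
    assume eq: "liminf ?X = limsup ?X"
    then have lim: "?X \<longlonglongrightarrow> limsup ?X" by (intro Liminf_eq_Limsup) auto
    have "\<bar>limsup ?X\<bar> \<noteq> \<infinity>"
    proof -
      have b: "X k \<le> B" "-B \<le> X k" for k using bd[of k] by linarith+
      have "limsup ?X \<le> ereal B" by (intro Limsup_bounded always_eventually allI) (simp add: b)
      moreover have "ereal (-B) \<le> liminf ?X"
        by (intro Liminf_bounded always_eventually allI) (simp only: ereal_less_eq b)
      ultimately show ?thesis using eq by (cases "limsup ?X") auto
    qed
    then obtain l where "limsup ?X = ereal l" by auto
    then have "X \<longlonglongrightarrow> l" using lim by auto
    then show False using nc by (auto simp: convergent_def)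
  qed
  then have "liminf ?X < limsup ?X" using Liminf_le_Limsup[of sequentially ?X] by auto
  then obtain r1 where r1: "liminf ?X < ereal r1" "ereal r1 < limsup ?X" using ereal_dense2 by blast
  then obtain r2 where r2: "ereal r1 < ereal r2" "ereal r2 < limsup ?X" using ereal_dense2 by blast
  obtain p where p: "p \<in> \<rat>" "r1 < p" "p < (r1+r2)/2" using Rats_dense_in_real[of r1 "(r1+r2)/2"] r2 by auto
  obtain q where q: "q \<in> \<rat>" "(r1+r2)/2 < q" "q < r2" using Rats_dense_in_real[of "(r1+r2)/2" r2] r2 by auto
  have "\<exists>k\<ge>N. X k < p" for N
  proof (rule ccontr)
    assume "\<not> ?thesis"
    then have "eventually (\<lambda>k. ereal p \<le> ?X k) sequentially"
      by (auto simp: eventually_sequentially not_less intro!: exI[of _ N])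
    then have "ereal p \<le> liminf ?X" by (rule Liminf_bounded)
    also have "\<dots> < ereal r1" by fact
    finally show False using p by auto
  qed
  moreover have "\<exists>k\<ge>N. q < X k" for N
  proof (rule ccontr)
    assume "\<not> ?thesis"
    then have "eventually (\<lambda>k. ?X k \<le> ereal q) sequentially"
      by (auto simp: eventually_sequentially not_less intro!: exI[of _ N])
    then have "limsup ?X \<le> ereal q" by (rule Limsup_bounded)
    with r2(2) have "ereal r2 < ereal q" by (rule less_le_trans)
    then show False using q by auto
  qed
  ultimately show ?thesis using p q by (intro exI[of _ p] exI[of _ q]) auto
qed

text \<open>Monotonicity puts the image of {a..b} inside {F a..F b}, so short intervals on which F
  grows with slope at most p form a Vitali cover of the required kind. The Lipschitz bound is there
  to make images of null sets null.\<close>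

lemma emeasure_mono_image_le:
  fixes F :: "real \<Rightarrow> real"
  assumes mono: "\<And>x y. x \<le> y \<Longrightarrow> F x \<le> F y" and lip: "\<And>x y. \<bar>F x - F y\<bar> \<le> L * \<bar>x - y\<bar>"
    and A: "A \<in> sets lebesgue" and p: "p \<ge> 0"
    and fine: "\<And>x d. x \<in> A \<Longrightarrow> 0 < d \<Longrightarrow> \<exists>a b. a < b \<and> a \<le> x \<and> x \<le> b \<and> b - a < d \<and> F b - F a \<le> p * (b - a)"
  shows "emeasure lebesgue (F ` A) \<le> ennreal p * emeasure lebesgue A"
proof (rule emeasure_outer_open_le[OF A], rule vitali_image_bound_open)
  fix U :: "real set" assume U: "open U" "A \<subseteq> U"
  { fix N assume "negligible N" "N \<subseteq> A"
    then show "negligible (F ` N)"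
      using lip by (intro negligible_locally_Lipschitz_image)
        (auto simp: dist_norm intro!: exI[of _ UNIV] exI[of _ L]) }
  fix x and d :: real assume x: "x \<in> A" and d: "0 < d"
  obtain e where e: "e > 0" "cball x e \<subseteq> U" using U x open_contains_cball by blast
  obtain a b where ab: "a < b" "a \<le> x" "x \<le> b" "b - a < min d e" "F b - F a \<le> p * (b - a)"
    using fine[OF x, of "min d e"] e d by auto
  have cb: "cball ((a+b)/2) ((b-a)/2) = {a..b}"
    by (auto simp: cball_eq_atLeastAtMost field_simps)
  have sub: "{a..b} \<subseteq> U"
    using e ab by (auto simp: cball_eq_atLeastAtMost subset_iff)
  show "\<exists>a r. 0 < r \<and> r < d \<and> x \<in> cball a r \<and> cball a r \<subseteq> U \<and>
      (\<exists>T\<in>sets lebesgue. F ` (A \<inter> cball a r) \<subseteq> T \<and>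
        emeasure lebesgue T \<le> ennreal p * emeasure lebesgue (cball a r))"
  proof (rule exI[of _ "(a+b)/2"], rule exI[of _ "(b-a)/2"], unfold cb, intro conjI bexI[of _ "{F a..F b}"])
    have "emeasure lebesgue {F a..F b} = ennreal (F b - F a)"
      using mono[of a b] ab by (simp add: emeasure_completion)
    also have "\<dots> \<le> ennreal (p * (b - a))" using ab by (intro ennreal_leI) auto
    also have "\<dots> = ennreal p * emeasure lebesgue {a..b}"
      using p ab by (simp add: emeasure_completion ennreal_mult)
    finally show "emeasure lebesgue {F a..F b} \<le> ennreal p * emeasure lebesgue {a..b}" .
  qed (use ab sub mono in auto)
qed auto

lemma lipschitz_oscillation_negligible:
  fixes F :: "real \<Rightarrow> real"
  assumes incr: "\<And>x y. x \<le> y \<Longrightarrow> y - x \<le> F y - F x" and lip: "\<And>x y. \<bar>F x - F y\<bar> \<le> L * \<bar>x - y\<bar>"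
    and pq: "0 < p" "p < q" and h: "\<And>k. 0 < h k" "h \<longlonglongrightarrow> 0"
  shows "negligible {t. (\<forall>N. \<exists>k\<ge>N. F (t + h k) - F t < p * h k) \<and> (\<forall>N. \<exists>k\<ge>N. q * h k < F (t + h k) - F t)}"
    (is "negligible ?A")
proof -
  have L: "L \<ge> 1" using incr[of 0 1] lip[of 1 0] by auto
  have cont: "continuous_on UNIV F"
    by (rule lipschitz_on_continuous_on[of L]) (use lip L in \<open>auto simp: lipschitz_on_def dist_real_def\<close>)
  have ex: "\<exists>x. F x = s" for s
  proof -
    have "F (min 0 (s - F 0)) \<le> s" using incr[of "min 0 (s - F 0)" 0] by auto
    moreover have "s \<le> F (max 0 (s - F 0))" using incr[of 0 "max 0 (s - F 0)"] by auto
    moreover have "min 0 (s - F 0) \<le> max 0 (s - F 0)" by simp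
    ultimately show ?thesis
      using IVT'[of F "min 0 (s - F 0)" s "max 0 (s - F 0)", OF _ _ _ continuous_on_subset[OF cont]] by blast
  qed
  have inj: "x = y" if "F x = F y" for x y
  proof (cases "x \<le> y")
    case True then show ?thesis using incr[OF True] that by linarith
  next
    case False then have "y \<le> x" by simp
    then show ?thesis using incr[of y x] that by linarith
  qed
  define G where "G = inv F"
  have FG: "F (G s) = s" for s unfolding G_def inv_def by (rule someI_ex[OF ex])
  have GF: "G (F x) = x" for x using inj[OF FG] by auto
  have Gmono: "G s \<le> G t" if "s \<le> t" for s t
  proof (rule ccontr)
    assume "\<not> ?thesis"
    then show False using incr[of "G t" "G s"] that by (simp add: FG)
  qed
  have Glip: "\<bar>G s - G t\<bar> \<le> 1 * \<bar>s - t\<bar>" for s t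
    using incr[of "G t" "G s"] incr[of "G s" "G t"] Gmono[of s t] Gmono[of t s]
    by (cases "s \<le> t") (auto simp: FG)
  have contG: "continuous_on UNIV G"
    by (rule lipschitz_on_continuous_on[of 1]) (use Glip in \<open>auto simp: lipschitz_on_def dist_real_def\<close>)
  have [measurable]: "F \<in> borel_measurable borel" "G \<in> borel_measurable borel"
    using cont contG by (auto intro: borel_measurable_continuous_onI)
  have Ab: "?A \<in> sets borel" by measurable
  \<comment> \<open>Cutting down to a bounded interval makes the measure finite, so that it can be
    cancelled in the final inequality.\<close>
  have "negligible (?A \<inter> {-real n..real n})" for n
  proof -
    define A where "A = ?A \<inter> {-real n..real n}"
    have A[measurable]: "A \<in> sets borel" using Ab by (auto simp: A_def)
    have FA: "F ` A = G -` A \<inter> space borel" by (auto simp: FG GF intro!: image_eqI[of _ F "G _"])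
    have FAm: "F ` A \<in> sets borel" unfolding FA by measurable
    have 1: "emeasure lebesgue (F ` A) \<le> ennreal p * emeasure lebesgue A"
    proof (rule emeasure_mono_image_le)
      show "F x \<le> F y" if "x \<le> y" for x y using incr[OF that] that by auto
      show "\<bar>F x - F y\<bar> \<le> L * \<bar>x - y\<bar>" for x y by (rule lip)
      fix x d :: real assume x: "x \<in> A" and d: "0 < d"
      obtain N where N: "\<And>k. k \<ge> N \<Longrightarrow> h k < d"
        using order_tendstoD(2)[OF h(2) d] by (auto simp: eventually_sequentially)
      obtain k where "k \<ge> N" "F (x + h k) - F x < p * h k" using x by (auto simp: A_def)
      then show "\<exists>a b. a < b \<and> a \<le> x \<and> x \<le> b \<and> b - a < d \<and> F b - F a \<le> p * (b - a)"
        using N[of k] h(1)[of k] by (intro exI[of _ x] exI[of _ "x + h k"]) auto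
    qed (use A pq in auto)
    have 2: "emeasure lebesgue (G ` (F ` A)) \<le> ennreal (1/q) * emeasure lebesgue (F ` A)"
    proof (rule emeasure_mono_image_le[where L = 1])
      fix s d :: real assume s: "s \<in> F ` A" and d: "0 < d"
      then obtain x where x: "x \<in> A" "s = F x" by auto
      obtain N where N: "\<And>k. k \<ge> N \<Longrightarrow> h k < d / L"
        using order_tendstoD(2)[OF h(2), of "d / L"] d L by (auto simp: eventually_sequentially)
      obtain k where k: "k \<ge> N" "q * h k < F (x + h k) - F x" using x by (auto simp: A_def)
      have "F (x + h k) - F x \<le> L * h k" using lip[of "x + h k" x] h(1)[of k] by auto
      also have "\<dots> < d" using N[OF k(1)] L by (auto simp: field_simps)
      finally have "F (x + h k) - F x < d" .
      moreover have "F x < F (x + h k)" using incr[of x "x + h k"] h(1)[of k] by linarith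
      ultimately show "\<exists>a b. a < b \<and> a \<le> s \<and> s \<le> b \<and> b - a < d \<and> G b - G a \<le> 1/q * (b - a)"
        using k pq by (intro exI[of _ "F x"] exI[of _ "F (x + h k)"]) (auto simp: GF x field_simps)
    qed (use FAm pq Gmono Glip in auto)
    have GFA: "G ` (F ` A) = A" by (force simp: GF image_iff)
    have "emeasure lebesgue A \<le> emeasure lebesgue {-real n..real n}" using A by (intro emeasure_mono) (auto simp: A_def)
    also have "\<dots> < \<infinity>" by (simp add: emeasure_completion)
    finally obtain a where a: "a \<ge> 0" "emeasure lebesgue A = ennreal a"
      by (cases "emeasure lebesgue A") auto
    have "emeasure lebesgue A \<le> ennreal (1/q) * (ennreal p * emeasure lebesgue A)"
      using 2 mult_left_mono[OF 1, of "ennreal (1/q)"] by (auto simp: GFA intro: order_trans)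
    also have "\<dots> = ennreal (p/q * a)" using a pq by (simp add: ennreal_mult[symmetric])
    finally have "a \<le> p / q * a" using a pq by (simp add: ennreal_le_iff)
    then have "a * (1 - p/q) \<le> 0" by (simp add: algebra_simps)
    moreover have "0 < 1 - p/q" using pq by simp
    ultimately have "a = 0" using a by (smt (verit) mult_pos_pos)
    then show ?thesis using a A by (auto simp: A_def[symmetric] negligible_iff_null_sets null_sets_def)
  qed
  then have "negligible (\<Union>n. ?A \<inter> {-real n..real n})" by (intro negligible_countable_Union) auto
  also have "(\<Union>n. ?A \<inter> {-real n..real n}) = ?A \<inter> (\<Union>n. {-real n..real n})" by blast
  also have "(\<Union>n. {-real n..real n}) = UNIV"
  proof (intro set_eqI iffI UNIV_I)
    fix x :: real
    obtain n where "\<bar>x\<bar> \<le> real n" using real_arch_simple by blast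
    then show "x \<in> (\<Union>n. {-real n..real n})" by (intro UN_I[of n]) auto
  qed
  finally show ?thesis by simp
qed

text \<open>Adding (L + 1) * t yields a function with slope at least 1 and shifts every quotient by
  the constant L + 1, which does not affect convergence. Limits along one fixed null sequence
  suffice for the fundamental theorem below, so full differentiability is never established.\<close>

lemma lipschitz_difference_quotients_converge:
  fixes u :: "real \<Rightarrow> real"
  assumes lip: "\<And>x y. \<bar>u x - u y\<bar> \<le> L * \<bar>x - y\<bar>" and h: "\<And>k. 0 < h k" "h \<longlonglongrightarrow> 0"
  shows "negligible {t. \<not> convergent (\<lambda>k. (u (t + h k) - u t) / h k)}"
proof -
  have L: "L \<ge> 0" using lip[of 1 0] by auto
  define F where "F t = u t + (L + 1) * t" for t
  have incr: "y - x \<le> F y - F x" if "x \<le> y" for x y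
    using lip[of x y] that by (auto simp: F_def algebra_simps)
  have lipF: "\<bar>F x - F y\<bar> \<le> (2 * L + 1) * \<bar>x - y\<bar>" for x y
  proof -
    have "F x - F y = (u x - u y) + (L + 1) * (x - y)" by (simp add: F_def algebra_simps)
    then have "\<bar>F x - F y\<bar> \<le> \<bar>u x - u y\<bar> + \<bar>(L + 1) * (x - y)\<bar>" by simp
    also have "\<bar>(L + 1) * (x - y)\<bar> = (L + 1) * \<bar>x - y\<bar>" using L by (simp add: abs_mult)
    finally show ?thesis using lip[of x y] by (simp add: algebra_simps)
  qed
  define B where "B p q = {t. (\<forall>N. \<exists>k\<ge>N. F (t + h k) - F t < p * h k) \<and> (\<forall>N. \<exists>k\<ge>N. q * h k < F (t + h k) - F t)}" for p q
  have "{t. \<not> convergent (\<lambda>k. (u (t + h k) - u t) / h k)} \<subseteq> (\<Union>(p,q)\<in>{(p,q). p \<in> \<rat> \<and> q \<in> \<rat> \<and> 0 < p \<and> p < q}. B p q)"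
  proof clarify
    fix t assume nc: "\<not> convergent (\<lambda>k. (u (t + h k) - u t) / h k)"
    define X where "X k = (F (t + h k) - F t) / h k" for k
    have "X k = (u (t + h k) - u t) / h k + (L + 1)" for k
      using h(1)[of k] by (simp add: X_def F_def field_simps)
    then have "(u (t + h k) - u t) / h k = X k - (L + 1)" for k by simp
    then have ncX: "\<not> convergent X"
      using nc convergent_diff[OF _ convergent_const, of X "L + 1"] by (auto simp: fun_eq_iff[symmetric])
    have X1: "X k \<ge> 1" for k
      using incr[of t "t + h k"] h(1)[of k] by (simp add: X_def field_simps)
    have "\<bar>X k\<bar> \<le> 2 * L + 1" for k
      using lipF[of "t + h k" t] h(1)[of k] by (auto simp: X_def abs_div divide_le_eq)
    from not_convergent_bounded_oscillation[OF this ncX] obtain p q where pq: "p \<in> \<rat>" "q \<in> \<rat>" "p < q"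
      "\<forall>N. \<exists>k\<ge>N. X k < p" "\<forall>N. \<exists>k\<ge>N. q < X k" by blast
    have "p > 0" using pq(4) X1 by (meson dual_order.strict_trans2 less_le_trans order.strict_trans zero_less_one)
    moreover have "t \<in> B p q"
      using pq(4,5) h(1) by (auto simp: B_def X_def pos_divide_less_eq pos_less_divide_eq)
    ultimately show "t \<in> (\<Union>(p,q)\<in>{(p,q). p \<in> \<rat> \<and> q \<in> \<rat> \<and> 0 < p \<and> p < q}. B p q)"
      using pq by blast
  qed
  moreover have "negligible (\<Union>(p,q)\<in>{(p,q). p \<in> \<rat> \<and> q \<in> \<rat> \<and> 0 < p \<and> p < q}. B p q)"
  proof (rule negligible_countable_Union)
    have "countable ((\<rat>::real set) \<times> (\<rat>::real set))" by (intro countable_SIGMA countable_rat)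
    then have "countable {(p::real,q). p \<in> \<rat> \<and> q \<in> \<rat> \<and> 0 < p \<and> p < q}"
      by (rule countable_subset[rotated]) auto
    then show "countable ((\<lambda>(p,q). B p q) ` {(p,q). p \<in> \<rat> \<and> q \<in> \<rat> \<and> 0 < p \<and> p < q})" by simp
  next
    fix S assume "S \<in> (\<lambda>(p,q). B p q) ` {(p,q). p \<in> \<rat> \<and> q \<in> \<rat> \<and> 0 < p \<and> p < q}"
    then show "negligible S" using lipschitz_oscillation_negligible[OF incr lipF _ _ h] by (auto simp: B_def)
  qed
  ultimately show ?thesis by (rule negligible_subset[rotated])
qed

text \<open>Clamping the argument to a rational interval on which u is Lipschitz gives a globally
  Lipschitz function that agrees with u near interior points. There are countably many such
  intervals, and each point of U is interior to one.\<close>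

lemma locally_lipschitz_quotients_converge:
  fixes u :: "real \<Rightarrow> real"
  assumes loc: "\<And>t. t \<in> U \<Longrightarrow> \<exists>e>0. \<exists>L. \<forall>x\<in>ball t e. \<forall>y\<in>ball t e. \<bar>u x - u y\<bar> \<le> L * \<bar>x - y\<bar>"
    and h: "\<And>k. 0 < h k" "h \<longlonglongrightarrow> 0"
  shows "negligible {t\<in>U. \<not> convergent (\<lambda>k. (u (t + h k) - u t) / h k)}"
proof -
  define I where "I = {(c, d). c \<in> \<rat> \<and> d \<in> \<rat> \<and> c < d \<and> (\<exists>L. \<forall>x\<in>{c..d}. \<forall>y\<in>{c..d}. \<bar>u x - u y\<bar> \<le> L * \<bar>x - y\<bar>)}"
  define w where "w c d t = u (max c (min d t))" for c d t
  define N where "N i = {t. \<not> convergent (\<lambda>k. (w (fst i) (snd i) (t + h k) - w (fst i) (snd i) t) / h k)}" for i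
  have "negligible (N i)" if i: "i \<in> I" for i
  proof -
    obtain c d L where cd: "i = (c, d)" "c < d" "\<And>x y. x \<in> {c..d} \<Longrightarrow> y \<in> {c..d} \<Longrightarrow> \<bar>u x - u y\<bar> \<le> L * \<bar>x - y\<bar>"
      using i unfolding I_def by fast
    have L: "L \<ge> 0" using cd(3)[of c d] cd(2) by (smt (verit) atLeastAtMost_iff mult_neg_pos)
    have "\<bar>w c d x - w c d y\<bar> \<le> L * \<bar>x - y\<bar>" for x y
    proof -
      have "\<bar>w c d x - w c d y\<bar> \<le> L * \<bar>max c (min d x) - max c (min d y)\<bar>"
        unfolding w_def using cd(2) by (intro cd(3)) auto
      also have "\<dots> \<le> L * \<bar>x - y\<bar>" using L by (intro mult_left_mono) auto
      finally show ?thesis .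
    qed
    from lipschitz_difference_quotients_converge[OF this h] show ?thesis by (simp add: N_def cd)
  qed
  moreover have "countable I"
  proof -
    have "countable ((\<rat>::real set) \<times> (\<rat>::real set))" by (intro countable_SIGMA countable_rat)
    then show ?thesis by (rule countable_subset[rotated]) (auto simp: I_def)
  qed
  ultimately have neg: "negligible (\<Union>i\<in>I. N i)"
    by (intro negligible_countable_Union) auto
  have "{t\<in>U. \<not> convergent (\<lambda>k. (u (t + h k) - u t) / h k)} \<subseteq> (\<Union>i\<in>I. N i)"
  proof clarify
    fix t assume t: "t \<in> U" and nc: "\<not> convergent (\<lambda>k. (u (t + h k) - u t) / h k)"
    obtain e L where e: "e > 0" "\<And>x y. x \<in> ball t e \<Longrightarrow> y \<in> ball t e \<Longrightarrow> \<bar>u x - u y\<bar> \<le> L * \<bar>x - y\<bar>"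
      using loc[OF t] by blast
    obtain c where c: "c \<in> \<rat>" "t - e < c" "c < t" using Rats_dense_in_real[of "t - e" t] e by auto
    obtain d where d: "d \<in> \<rat>" "t < d" "d < t + e" using Rats_dense_in_real[of t "t + e"] e by auto
    have I: "(c, d) \<in> I"
      using c d e by (auto simp: I_def dist_real_def intro!: exI[of _ L])
    have ev: "eventually (\<lambda>k. (w c d (t + h k) - w c d t) / h k = (u (t + h k) - u t) / h k) sequentially"
    proof -
      have "eventually (\<lambda>k. h k < d - t) sequentially"
        using order_tendstoD(2)[OF h(2), of "d - t"] d by simp
      then show ?thesis
      proof eventually_elim
        case (elim k)
      then show ?case using c d h(1)[of k] by (simp add: w_def min_def max_def)
      qed
    qed
    have "\<not> convergent (\<lambda>k. (w c d (t + h k) - w c d t) / h k)"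
    proof
      assume "convergent (\<lambda>k. (w c d (t + h k) - w c d t) / h k)"
      then obtain l where "(\<lambda>k. (w c d (t + h k) - w c d t) / h k) \<longlonglongrightarrow> l" by (auto simp: convergent_def)
      from Lim_transform_eventually[OF this ev] have "(\<lambda>k. (u (t + h k) - u t) / h k) \<longlonglongrightarrow> l" .
      then show False using nc by (auto simp: convergent_def)
    qed
    then have "t \<in> N (c, d)" by (simp add: N_def)
    then show "t \<in> (\<Union>i\<in>I. N i)" using I by blast
  qed
  then show ?thesis by (rule negligible_subset[OF neg])
qed

text \<open>The Lebesgue number of a finite cover by Lipschitz balls. The point y may lie outside K,
  because difference quotients at the right end of an interval look beyond it.\<close>

lemma locally_lipschitz_compact_bound:
  fixes u :: "real \<Rightarrow> real"
  assumes loc: "\<And>t. t \<in> K \<Longrightarrow> \<exists>e>0. \<exists>L. \<forall>x\<in>ball t e. \<forall>y\<in>ball t e. \<bar>u x - u y\<bar> \<le> L * \<bar>x - y\<bar>"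
    and K: "compact K"
  obtains L e where "0 < e" "\<And>x y. x \<in> K \<Longrightarrow> \<bar>x - y\<bar> < e \<Longrightarrow> \<bar>u x - u y\<bar> \<le> L * \<bar>x - y\<bar>"
proof -
  define P where "P t e L \<longleftrightarrow> (\<forall>x\<in>ball t e. \<forall>y\<in>ball t e. \<bar>u x - u y\<bar> \<le> L * \<bar>x - y\<bar>)" for t e L
  from loc have "\<forall>t\<in>K. \<exists>e L. e > 0 \<and> P t e L" by (auto simp: P_def)
  then obtain e L where eL: "\<And>t. t \<in> K \<Longrightarrow> e t > 0 \<and> P t (e t) (L t)" by metis
  obtain T where T: "T \<subseteq> K" "finite T" "K \<subseteq> (\<Union>t\<in>T. ball t (e t))"
    by (rule compactE_image[OF K, of K "\<lambda>t. ball t (e t)"]) (use eL in force)+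
  obtain \<epsilon> where \<epsilon>: "\<epsilon> > 0" "\<forall>x\<in>K. \<exists>G\<in>(\<lambda>t. ball t (e t)) ` T. ball x \<epsilon> \<subseteq> G"
    by (rule Heine_Borel_lemma[OF K T(3)]) auto
  show thesis
  proof (rule that[OF \<epsilon>(1)])
    fix x y assume x: "x \<in> K" and y: "\<bar>x - y\<bar> < \<epsilon>"
    obtain t where t: "t \<in> T" "ball x \<epsilon> \<subseteq> ball t (e t)" using \<epsilon>(2) x by auto
    have "x \<in> ball x \<epsilon>" "y \<in> ball x \<epsilon>" using \<epsilon>(1) y by (auto simp: dist_real_def)
    then have "\<bar>u x - u y\<bar> \<le> L t * \<bar>x - y\<bar>" using eL[of t] t T(1) unfolding P_def by blast
    also have "\<dots> \<le> (\<Sum>t\<in>T. \<bar>L t\<bar>) * \<bar>x - y\<bar>"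
      using member_le_sum[of t T "\<lambda>t. \<bar>L t\<bar>"] t(1) T(2) by (intro mult_right_mono) auto
    finally show "\<bar>u x - u y\<bar> \<le> (\<Sum>t\<in>T. \<bar>L t\<bar>) * \<bar>x - y\<bar>" .
  qed
qed

text \<open>The translated integral and the original one overlap on most of the interval; only the
  averages over [b, b + h] and [a, a + h] survive.\<close>

lemma difference_quotient_has_integral:
  fixes u :: "real \<Rightarrow> real"
  assumes cont: "continuous_on UNIV u" and ab: "a \<le> b" and h: "0 < h"
  shows "((\<lambda>t. (u (t + h) - u t) / h) has_integral (integral {b..b+h} u - integral {a..a+h} u) / h) {a..b}"
proof -
  have ci: "u integrable_on {x..y}" for x y
    by (rule integrable_continuous_interval) (rule continuous_on_subset[OF cont], auto)
  have "(u has_integral integral {a+h..b+h} u) (cbox (a + h) (b + h))"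
    using ci by (auto simp: integrable_integral)
  from has_integral_affinity[OF this, of 1 h]
  have 1: "((\<lambda>t. u (t + h)) has_integral integral {a+h..b+h} u) {a..b}"
    using ab by (auto simp: add.commute image_affinity_cbox)
  have eq: "integral {a..b+h} u = integral {a..b} u + integral {b..b+h} u"
    "integral {a..b+h} u = integral {a..a+h} u + integral {a+h..b+h} u"
    using ab h ci by (auto intro!: Henstock_Kurzweil_Integration.integral_combine[symmetric])
  have "((\<lambda>t. (u (t + h) - u t) / h) has_integral (integral {a+h..b+h} u - integral {a..b} u) / h) {a..b}"
    by (intro has_integral_divide has_integral_diff 1 integrable_integral ci)
  moreover have "integral {a+h..b+h} u - integral {a..b} u = integral {b..b+h} u - integral {a..a+h} u"
    using eq by simp
  ultimately show ?thesis by simp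
qed

lemma average_tendsto:
  fixes u :: "real \<Rightarrow> real"
  assumes cont: "continuous_on UNIV u" and h: "\<And>k. 0 < h k" "h \<longlonglongrightarrow> 0"
  shows "(\<lambda>k. integral {b..b + h k} u / h k) \<longlonglongrightarrow> u b"
proof -
  have "((\<lambda>x. integral {b..x} u) has_real_derivative u b) (at b within {b..b+1})"
    by (rule integral_has_real_derivative) (auto intro: continuous_on_subset[OF cont])
  then have lim: "((\<lambda>x. (integral {b..x} u - integral {b..b} u) / (x - b)) \<longlongrightarrow> u b) (at b within {b..b+1})"
    by (simp add: has_field_derivative_iff)
  have "filterlim (\<lambda>k. b + h k) (at b within {b..b+1}) sequentially"
    unfolding filterlim_at
  proof
    show "(\<lambda>k. b + h k) \<longlonglongrightarrow> b" using tendsto_add[OF tendsto_const[of b] h(2)] by simp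
    show "\<forall>\<^sub>F k in sequentially. b + h k \<in> {b..b + 1} \<and> b + h k \<noteq> b"
    proof -
      have "eventually (\<lambda>k. h k < 1) sequentially"
        using order_tendstoD(2)[OF h(2), of 1] by simp
      then show ?thesis
      proof eventually_elim
        case (elim k)
        then show ?case using h(1)[of k] by simp
      qed
    qed
  qed
  from filterlim_compose[OF lim this] show ?thesis by simp
qed

text \<open>The quotients are uniformly bounded and converge almost everywhere, so their integrals
  converge to the integral of the limit. Those integrals are differences of endpoint averages, which
  tend to u b - u a by continuity.\<close>

lemma locally_lipschitz_FTC:
  fixes u :: "real \<Rightarrow> real"
  assumes cont: "continuous_on UNIV u" and ab: "a \<le> b"
    and loc: "\<And>t. t \<in> {a..b} \<Longrightarrow> \<exists>e>0. \<exists>L. \<forall>x\<in>ball t e. \<forall>y\<in>ball t e. \<bar>u x - u y\<bar> \<le> L * \<bar>x - y\<bar>"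
    and h: "\<And>k. 0 < h k" "h \<longlonglongrightarrow> 0"
  shows "((\<lambda>t. lim (\<lambda>k. (u (t + h k) - u t) / h k)) has_integral (u b - u a)) {a..b}"
proof -
  obtain L e where e: "0 < e" and L: "\<And>x y. x \<in> {a..b} \<Longrightarrow> \<bar>x - y\<bar> < e \<Longrightarrow> \<bar>u x - u y\<bar> \<le> L * \<bar>x - y\<bar>"
    by (rule locally_lipschitz_compact_bound[of "{a..b}" u, OF loc compact_Icc]) (use that in auto)
  obtain K where K: "\<And>k. k \<ge> K \<Longrightarrow> h k < e"
    using order_tendstoD(2)[OF h(2) e] by (auto simp: eventually_sequentially)
  define N where "N = {t\<in>{a..b}. \<not> convergent (\<lambda>k. (u (t + h k) - u t) / h k)}"
  have N: "negligible N" unfolding N_def by (rule locally_lipschitz_quotients_converge[OF loc h])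
  \<comment> \<open>The shift by K starts the sequence where h is below e, so that the uniform
    Lipschitz bound applies. Setting the functions to zero on N gives convergence
    everywhere.\<close>
  define q where "q k t = (if t \<in> N then 0 else (u (t + h (k + K)) - u t) / h (k + K))" for k t
  define w where "w t = (if t \<in> N then 0 else lim (\<lambda>k. (u (t + h k) - u t) / h k))" for t
  define I where "I k = (integral {b..b+h (k+K)} u - integral {a..a+h (k+K)} u) / h (k+K)" for k
  have q: "(q k has_integral I k) {a..b}" for k
    unfolding I_def
    by (rule has_integral_spike[OF N _ difference_quotient_has_integral[OF cont ab h(1)]]) (auto simp: q_def)
  have lim: "(\<lambda>k. q k t) \<longlonglongrightarrow> w t" if "t \<in> {a..b}" for t
  proof (cases "t \<in> N")
    case False
    then have "convergent (\<lambda>k. (u (t + h k) - u t) / h k)" using that by (auto simp: N_def)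
    then have "(\<lambda>k. (u (t + h k) - u t) / h k) \<longlonglongrightarrow> w t" using False by (auto simp: w_def convergent_LIMSEQ_iff)
    from LIMSEQ_ignore_initial_segment[OF this, of K] show ?thesis using False by (simp add: q_def)
  qed (simp add: q_def w_def)
  have bd: "norm (q k t) \<le> \<bar>L\<bar>" if "t \<in> {a..b}" for k t
  proof (cases "t \<in> N")
    case False
    have "\<bar>u (t + h (k+K)) - u t\<bar> \<le> L * h (k + K)"
      using L[OF that, of "t + h (k+K)"] K[of "k+K"] h(1)[of "k+K"] by (auto simp: abs_minus_commute)
    also have "\<dots> \<le> \<bar>L\<bar> * h (k+K)" using h(1)[of "k+K"] by (intro mult_right_mono) auto
    finally show ?thesis using False h(1)[of "k+K"] by (simp add: q_def abs_div divide_le_eq)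
  qed (simp add: q_def)
  have qi: "q k integrable_on {a..b}" for k using q by (rule has_integral_integrable)
  have w: "w integrable_on {a..b}" "(\<lambda>k. integral {a..b} (q k)) \<longlonglongrightarrow> integral {a..b} w"
    using dominated_convergence[of q "{a..b}" "\<lambda>_. \<bar>L\<bar>" w, OF qi _ bd lim] by auto
  have qI: "(\<lambda>k. integral {a..b} (q k)) = I" using integral_unique[OF q] by auto
  have "I \<longlonglongrightarrow> u b - u a"
    unfolding I_def diff_divide_distrib
    by (intro tendsto_diff average_tendsto[OF cont]) (use h LIMSEQ_ignore_initial_segment[OF h(2)] in auto)
  then have "integral {a..b} w = u b - u a" using LIMSEQ_unique[OF w(2)[unfolded qI]] by simp
  then have "(w has_integral (u b - u a)) {a..b}" using integrable_integral[OF w(1)] by simp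
  then show ?thesis by (rule has_integral_spike[OF N, rotated]) (auto simp: w_def)
qed

text \<open>The point t0 models the crossing of a line with the subspace, where the Lipschitz
  control degenerates. The formula holds on intervals avoiding t0 and extends up to t0, since both u
  and the indefinite integral are continuous. Integrability has to be assumed because the quotients
  may be unbounded near t0.\<close>

lemma punctured_locally_lipschitz_FTC:
  fixes u :: "real \<Rightarrow> real"
  assumes cont: "continuous_on UNIV u" and ab: "a \<le> b"
    and loc: "\<And>t. t \<in> {a..b} - {t0} \<Longrightarrow> \<exists>e>0. \<exists>L. \<forall>x\<in>ball t e. \<forall>y\<in>ball t e. \<bar>u x - u y\<bar> \<le> L * \<bar>x - y\<bar>"
    and h: "\<And>k. 0 < h k" "h \<longlonglongrightarrow> 0"
    and int: "(\<lambda>t. lim (\<lambda>k. (u (t + h k) - u t) / h k)) integrable_on {a..b}" (is "?w integrable_on _")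
  shows "integral {a..b} (\<lambda>t. lim (\<lambda>k. (u (t + h k) - u t) / h k)) = u b - u a"
proof (cases "t0 \<in> {a..b}")
  case False
  then have "(?w has_integral (u b - u a)) {a..b}"
    by (intro locally_lipschitz_FTC[OF cont ab loc h]) auto
  then show ?thesis by blast
next
  case True
  have left: "integral {a..t0} ?w = u t0 - u a"
  proof (cases "a = t0")
    case False
    then have at: "a < t0" using True by auto
    have "?w integrable_on {a..t0}" using int by (rule integrable_on_subinterval) (use True in auto)
    then have c: "continuous_on {a..t0} (\<lambda>x. integral {a..x} ?w - u x)"
      by (intro continuous_intros indefinite_integral_continuous_1 continuous_on_subset[OF cont]) auto
    have "integral {a..x} ?w - u x = - u a" if "x \<in> {a..<t0}" for x
    proof -
      have "(?w has_integral (u x - u a)) {a..x}"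
        by (intro locally_lipschitz_FTC[OF cont _ loc h]) (use that True in auto)
      then show ?thesis by (auto simp: integral_unique)
    qed
    with c have "integral {a..t0} ?w - u t0 = - u a"
      using continuous_constant_on_closure[of "{a..<t0}" "\<lambda>x. integral {a..x} ?w - u x" "- u a" t0] at
      by auto
    then show ?thesis by simp
  qed auto
  have right: "integral {t0..b} ?w = u b - u t0"
  proof (cases "t0 = b")
    case False
    then have at: "t0 < b" using True by auto
    have "?w integrable_on {t0..b}" using int by (rule integrable_on_subinterval) (use True in auto)
    then have c: "continuous_on {t0..b} (\<lambda>x. integral {x..b} ?w + u x)"
      by (intro continuous_intros indefinite_integral_continuous_1' continuous_on_subset[OF cont]) auto
    have "integral {x..b} ?w + u x = u b" if "x \<in> {t0<..b}" for x
    proof -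
      have "(?w has_integral (u b - u x)) {x..b}"
        by (intro locally_lipschitz_FTC[OF cont _ loc h]) (use that True in auto)
      then show ?thesis by (auto simp: integral_unique)
    qed
    with c have "integral {t0..b} ?w + u t0 = u b"
      using continuous_constant_on_closure[of "{t0<..b}" "\<lambda>x. integral {x..b} ?w + u x" "u b" t0] at
      by auto
    then show ?thesis by simp
  qed auto
  have "integral {a..b} ?w = integral {a..t0} ?w + integral {t0..b} ?w"
    using True int by (intro Henstock_Kurzweil_Integration.integral_combine[symmetric]) auto
  then show ?thesis using left right by simp
qed

section \<open>Quasihyperbolic distance and Whitney balls\<close>

definition depth :: "real ^ ('k::finite + 'p::finite) \<Rightarrow> real" where
  "depth z = norm (ypart z)"

lemma ypart_add [simp]: "ypart (a + b) = ypart a + ypart b"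
  by (simp add: ypart_def vec_eq_iff)

lemma ypart_diff [simp]: "ypart (a - b) = ypart a - ypart b"
  by (simp add: ypart_def vec_eq_iff)

lemma ypart_scaleR [simp]: "ypart (c *\<^sub>R a) = c *\<^sub>R ypart a"
  by (simp add: ypart_def vec_eq_iff)

lemma norm_ypart_le: "norm (ypart z) \<le> norm z"
proof -
  have "(\<Sum>j\<in>UNIV. (z $ Inr j)\<^sup>2) \<le> (\<Sum>i\<in>UNIV <+> UNIV. (z $ i)\<^sup>2)"
    by (subst sum.Plus) (auto intro: sum_nonneg)
  then show ?thesis
    by (simp add: norm_vec_def L2_set_def ypart_def UNIV_Plus_UNIV)
qed

lemma depth_nonneg [simp]: "0 \<le> depth z"
  by (simp add: depth_def)

lemma depth_lipschitz: "\<bar>depth z - depth w\<bar> \<le> dist z w"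
  using norm_triangle_ineq3[of "ypart z" "ypart w"] norm_ypart_le[of "z - w"]
  by (simp add: depth_def dist_norm)

lemma depth_dist_le: "depth z \<le> depth w + dist z w" "depth w \<le> depth z + dist z w"
  using depth_lipschitz[of z w] by auto

lemma continuous_on_depth [continuous_intros]:
  "continuous_on S f \<Longrightarrow> continuous_on S (\<lambda>x. depth (f x))"
proof -
  have "1-lipschitz_on UNIV (depth :: real ^ ('b + 'c) \<Rightarrow> real)"
    using depth_lipschitz by (auto simp: lipschitz_on_def dist_real_def)
  then have "continuous_on UNIV (depth :: real ^ ('b + 'c) \<Rightarrow> real)" by (rule lipschitz_on_continuous_on)
  then show "continuous_on S f \<Longrightarrow> continuous_on S (\<lambda>x. depth (f x))"
    by (rule continuous_on_compose2) auto
qed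

section \<open>Lengths of curves and the length function as an integrator\<close>

fun polygon_length :: "(real \<Rightarrow> 'a::metric_space) \<Rightarrow> real list \<Rightarrow> ennreal" where
  "polygon_length \<gamma> (x # y # ts) = ennreal (dist (\<gamma> x) (\<gamma> y)) + polygon_length \<gamma> (y # ts)"
| "polygon_length \<gamma> ts = 0"

text \<open>Recursion over the list of parameters replaces the indexed sum, so that partitions can
  be split and joined by induction.\<close>

lemma sum_eq_polygon_length:
  "(\<Sum>i<length ts - 1. ennreal (dist (\<gamma> (ts ! i)) (\<gamma> (ts ! Suc i)))) = polygon_length \<gamma> ts"
proof (induction \<gamma> ts rule: polygon_length.induct)
  case (1 \<gamma> x y ts)
  then show ?case by (simp add: sum.lessThan_Suc_shift del: sum.lessThan_Suc)
qed auto

lemma curve_length_eq: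
  "curve_length \<gamma> a b = (SUP ts\<in>{ts. sorted ts \<and> set ts \<subseteq> {a..b}}. polygon_length \<gamma> ts)"
  unfolding curve_length_def sum_eq_polygon_length ..

lemma polygon_length_le_curve_length:
  "sorted ts \<Longrightarrow> set ts \<subseteq> {a..b} \<Longrightarrow> polygon_length \<gamma> ts \<le> curve_length \<gamma> a b"
  unfolding curve_length_eq by (rule SUP_upper) auto

lemma polygon_length_Cons: "polygon_length \<gamma> ts \<le> polygon_length \<gamma> (s # ts)"
  by (cases ts) auto

lemma polygon_length_append: "polygon_length \<gamma> ts + polygon_length \<gamma> us \<le> polygon_length \<gamma> (ts @ us)"
proof (induction \<gamma> ts rule: polygon_length.induct)
  case (1 \<gamma> x y ts)
  then show ?case by (simp add: add.assoc add_left_mono)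
next
  case ("2_2" \<gamma> v)
  then show ?case by (simp add: polygon_length_Cons)
qed auto

lemma ennreal_dist_triangle: "ennreal (dist x z) \<le> ennreal (dist x y) + ennreal (dist y z)"
  by (simp add: ennreal_plus[symmetric] ennreal_leI dist_triangle del: ennreal_plus)

text \<open>A detour through two extra points at the junction can only lengthen the polygon, by the
  triangle inequality. The jump from t to s is kept apart since continuity makes it small.\<close>

lemma polygon_length_split:
  "polygon_length \<gamma> (A @ B) \<le> polygon_length \<gamma> (A @ [t]) + ennreal (dist (\<gamma> t) (\<gamma> s)) + polygon_length \<gamma> (s # B)"
proof (induction \<gamma> A rule: polygon_length.induct)
  case (1 \<gamma> x y ts)
  then show ?case by (simp add: add.assoc add_left_mono)
next
  case ("2_1" \<gamma>)
  have "polygon_length \<gamma> B \<le> polygon_length \<gamma> (s # B)" by (rule polygon_length_Cons)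
  then show ?case by (simp add: add_increasing)
next
  case ("2_2" \<gamma> x)
  show ?case
  proof (cases B)
    case (Cons b C)
    have "ennreal (dist (\<gamma> x) (\<gamma> b)) \<le> ennreal (dist (\<gamma> x) (\<gamma> t)) + (ennreal (dist (\<gamma> t) (\<gamma> s)) + ennreal (dist (\<gamma> s) (\<gamma> b)))"
      using ennreal_dist_triangle[of "\<gamma> x" "\<gamma> b" "\<gamma> t"] ennreal_dist_triangle[of "\<gamma> t" "\<gamma> b" "\<gamma> s"]
      by (meson add_left_mono order_trans)
    from add_right_mono[OF this, of "polygon_length \<gamma> (b # C)"] Cons show ?thesis by (simp add: add.assoc)
  qed simp
qed

lemma curve_length_mono: "a' \<le> a \<Longrightarrow> b \<le> b' \<Longrightarrow> curve_length \<gamma> a b \<le> curve_length \<gamma> a' b'"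
  unfolding curve_length_eq by (rule SUP_subset_mono) auto

lemma curve_length_approx:
  assumes "curve_length \<gamma> a b < top" "0 < e"
  obtains ts where "sorted ts" "set ts \<subseteq> {a..b}" "curve_length \<gamma> a b < polygon_length \<gamma> ts + ennreal e"
proof -
  have "\<exists>ts\<in>{ts. sorted ts \<and> set ts \<subseteq> {a..b}}. curve_length \<gamma> a b < polygon_length \<gamma> ts + ennreal e"
  proof (rule SUP_approx_ennreal)
    show "{ts. sorted ts \<and> set ts \<subseteq> {a..b}} \<noteq> {}" by (auto intro!: exI[of _ "[]"])
  qed (use assms curve_length_eq in auto)
  then show ?thesis using that by auto
qed

text \<open>Near-optimal partitions of the two halves concatenate to a partition of the whole
  interval.\<close>

lemma curve_length_superadditive:
  assumes "a \<le> t" "t \<le> b" and fin: "curve_length \<gamma> a b < top"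
  shows "curve_length \<gamma> a t + curve_length \<gamma> t b \<le> curve_length \<gamma> a b"
proof (rule ennreal_le_epsilon)
  fix e :: real assume e: "0 < e"
  have f1: "curve_length \<gamma> a t < top" and f2: "curve_length \<gamma> t b < top"
    using fin curve_length_mono[of a a t b \<gamma>] curve_length_mono[of a t b b \<gamma>] assms by (auto intro: le_less_trans)
  obtain ts where ts: "sorted ts" "set ts \<subseteq> {a..t}" "curve_length \<gamma> a t < polygon_length \<gamma> ts + ennreal (e/2)"
    using curve_length_approx[OF f1, of "e/2"] e by auto
  obtain us where us: "sorted us" "set us \<subseteq> {t..b}" "curve_length \<gamma> t b < polygon_length \<gamma> us + ennreal (e/2)"
    using curve_length_approx[OF f2, of "e/2"] e by auto
  have "curve_length \<gamma> a t + curve_length \<gamma> t b \<le> (polygon_length \<gamma> ts + ennreal (e/2)) + (polygon_length \<gamma> us + ennreal (e/2))"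
    using ts us by (intro add_mono) auto
  also have "\<dots> = (polygon_length \<gamma> ts + polygon_length \<gamma> us) + (ennreal (e/2) + ennreal (e/2))"
    by (simp add: algebra_simps)
  also have "ennreal (e/2) + ennreal (e/2) = ennreal e" using e by (subst ennreal_plus[symmetric]) auto
  also have "polygon_length \<gamma> ts + polygon_length \<gamma> us \<le> polygon_length \<gamma> (ts @ us)"
    by (rule polygon_length_append)
  also have "\<dots> \<le> curve_length \<gamma> a b"
    using ts us assms by (intro polygon_length_le_curve_length) (fastforce simp: sorted_append)+
  finally show "curve_length \<gamma> a t + curve_length \<gamma> t b \<le> curve_length \<gamma> a b + ennreal e"
    by (simp add: add_right_mono)
qed

text \<open>Take a partition that almost exhausts the total length and s so close to t that no
  partition point lies strictly between them. Inserting t and s bounds the total length by the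
  length up to t, a small jump and the length from s on; superadditivity then allows the last term
  to be cancelled.\<close>

lemma curve_length_right_continuous_aux:
  assumes t: "0 \<le> t" "t < 1" and fin: "curve_length \<gamma> 0 1 < top" and path: "path \<gamma>" and e: "0 < e"
  shows "\<exists>d>0. \<forall>s. t < s \<and> s < t + d \<longrightarrow> s \<le> 1 \<and> curve_length \<gamma> 0 s \<le> curve_length \<gamma> 0 t + ennreal e"
proof -
  obtain ts where ts: "sorted ts" "set ts \<subseteq> {0..1}" "curve_length \<gamma> 0 1 < polygon_length \<gamma> ts + ennreal (e/2)"
    using curve_length_approx[OF fin, of "e/2"] e by auto
  define A where "A = takeWhile (\<lambda>x. x \<le> t) ts"
  define B where "B = dropWhile (\<lambda>x. x \<le> t) ts"
  have AB: "ts = A @ B" by (simp add: A_def B_def)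
  have A: "sorted A" "\<And>x. x \<in> set A \<Longrightarrow> x \<le> t"
    using ts(1) by (auto simp: A_def sorted_takeWhile dest: set_takeWhileD)
  have B: "sorted B" using ts(1) by (simp add: B_def sorted_dropWhile)
  have Bt: "x > t" if "x \<in> set B" for x
  proof (cases B)
    case (Cons b C)
    have "\<not> b \<le> t" using Cons by (simp add: B_def dropWhile_eq_Cons_conv)
    moreover have "b \<le> x" using B that Cons by auto
    ultimately show ?thesis by simp
  qed (use that in auto)
  obtain \<delta> where \<delta>: "\<delta> > 0" "\<And>s. s \<in> {0..1} \<Longrightarrow> dist s t < \<delta> \<Longrightarrow> dist (\<gamma> s) (\<gamma> t) < e/2"
    using path[unfolded path_def continuous_on_iff, THEN bspec, of t, THEN spec, of "e/2"] t e by auto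
  \<comment> \<open>The minimum of the modulus of continuity, the distance to the end of the
    interval and the gaps to the later partition points.\<close>
  define d where "d = Min (insert \<delta> (insert (1 - t) ((\<lambda>x. x - t) ` set B)))"
  have d: "d > 0" using \<delta> t Bt by (auto simp: d_def)
  show ?thesis
  proof (intro exI[of _ d] conjI d allI impI; elim conjE)
    fix s assume s: "t < s" "s < t + d"
    have "d \<le> \<delta>" "d \<le> 1 - t" unfolding d_def by (rule Min_le; simp)+
    then have s1: "s \<le> 1" "dist (\<gamma> s) (\<gamma> t) < e/2" using s t \<delta>(2)[of s] by (auto simp: dist_real_def)
    show "s \<le> 1" by fact
    have Bs: "s \<le> x" if "x \<in> set B" for x
    proof -
      have "d \<le> x - t" unfolding d_def using that by (intro Min_le) auto
      then show ?thesis using s by simp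
    qed
    have fs: "curve_length \<gamma> s 1 < top" using fin curve_length_mono[of 0 s 1 1 \<gamma>] s t by (auto intro: le_less_trans)
    have "curve_length \<gamma> 0 s + curve_length \<gamma> s 1 \<le> curve_length \<gamma> 0 1"
      using s s1 t fin by (intro curve_length_superadditive) auto
    also have "\<dots> \<le> polygon_length \<gamma> (A @ B) + ennreal (e/2)" using ts(3) AB by simp
    also have "polygon_length \<gamma> (A @ B) \<le> polygon_length \<gamma> (A @ [t]) + ennreal (dist (\<gamma> t) (\<gamma> s)) + polygon_length \<gamma> (s # B)"
      by (rule polygon_length_split)
    also have "polygon_length \<gamma> (A @ [t]) \<le> curve_length \<gamma> 0 t"
      using A ts(2) t by (intro polygon_length_le_curve_length) (auto simp: AB sorted_append)
    also have "polygon_length \<gamma> (s # B) \<le> curve_length \<gamma> s 1"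
      using B Bs ts(2) s1 by (intro polygon_length_le_curve_length) (auto simp: AB)
    also have "ennreal (dist (\<gamma> t) (\<gamma> s)) \<le> ennreal (e/2)" using s1 by (intro ennreal_leI) (simp add: dist_commute)
    finally have "curve_length \<gamma> 0 s + curve_length \<gamma> s 1 \<le> curve_length \<gamma> 0 t + ennreal (e/2) + curve_length \<gamma> s 1 + ennreal (e/2)"
      by (simp add: add_mono)
    also have "\<dots> = curve_length \<gamma> 0 t + (ennreal (e/2) + ennreal (e/2)) + curve_length \<gamma> s 1" by (simp add: algebra_simps)
    also have "ennreal (e/2) + ennreal (e/2) = ennreal e" using e by (subst ennreal_plus[symmetric]) auto
    finally show "curve_length \<gamma> 0 s \<le> curve_length \<gamma> 0 t + ennreal e"
      using fs by (auto simp: add.commute[of _ "curve_length \<gamma> s 1"] ennreal_add_left_cancel_le)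
  qed
qed

text \<open>The integrator of \<open>arclength_integral\<close>. Monotonicity and right continuity
  are what \<open>interval_measure\<close> requires in order to assign increments to
  intervals.\<close>

definition length_fun :: "(real \<Rightarrow> 'a::metric_space) \<Rightarrow> real \<Rightarrow> real" where
  "length_fun \<gamma> t = enn2real (curve_length \<gamma> 0 (max 0 (min 1 t)))"

lemma length_fun_finite:
  "curve_length \<gamma> 0 1 < top \<Longrightarrow> curve_length \<gamma> 0 (max 0 (min 1 t)) = ennreal (length_fun \<gamma> t)"
  using curve_length_mono[of 0 0 "max 0 (min 1 t)" 1 \<gamma>]
  by (simp add: length_fun_def ennreal_enn2real_if)

lemma length_fun_mono:
  assumes "curve_length \<gamma> 0 1 < top" "x \<le> y"
  shows "length_fun \<gamma> x \<le> length_fun \<gamma> y"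
proof -
  have "ennreal (length_fun \<gamma> x) \<le> ennreal (length_fun \<gamma> y)"
    unfolding length_fun_finite[OF assms(1), symmetric] using assms by (intro curve_length_mono) auto
  then show ?thesis by (simp add: length_fun_def ennreal_le_iff)
qed

lemma length_fun_right_continuous:
  assumes rp: "rectifiable_path \<gamma>"
  shows "continuous (at_right t) (length_fun \<gamma>)"
proof -
  have fin: "curve_length \<gamma> 0 1 < top" and path: "path \<gamma>" using rp by (auto simp: rectifiable_path_def)
  show ?thesis
    unfolding continuous_within tendsto_iff eventually_at_right_field
  proof (intro allI impI)
    fix e :: real assume e: "0 < e"
    consider "t < 0" | "0 \<le> t" "t < 1" | "1 \<le> t" by linarith
    then show "\<exists>b>t. \<forall>s>t. s < b \<longrightarrow> dist (length_fun \<gamma> s) (length_fun \<gamma> t) < e"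
    proof cases
      case 1
      then show ?thesis using e by (intro exI[of _ 0]) (auto simp: length_fun_def max_def min_def)
    next
      case 2
      obtain d where d: "d > 0" "\<And>s. t < s \<Longrightarrow> s < t + d \<Longrightarrow> s \<le> 1 \<and> curve_length \<gamma> 0 s \<le> curve_length \<gamma> 0 t + ennreal (e/2)"
        using curve_length_right_continuous_aux[OF 2 fin path, of "e/2"] e by auto
      show ?thesis
      proof (intro exI[of _ "t + d"] conjI allI impI)
        fix s assume s: "t < s" "s < t + d"
        have "ennreal (length_fun \<gamma> s) \<le> ennreal (length_fun \<gamma> t) + ennreal (e/2)"
          using d(2)[OF s] s 2 length_fun_finite[OF fin, of s] length_fun_finite[OF fin, of t]
          by (simp add: max_def min_def split: if_splits)
        also have "\<dots> = ennreal (length_fun \<gamma> t + e/2)"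
          using e by (subst ennreal_plus) (auto simp: length_fun_def)
        finally have "length_fun \<gamma> s \<le> length_fun \<gamma> t + e/2"
          using e by (subst (asm) ennreal_le_iff) (auto simp: length_fun_def)
        with length_fun_mono[OF fin, of t s] s e show "dist (length_fun \<gamma> s) (length_fun \<gamma> t) < e"
          by (auto simp: dist_real_def)
      qed (use d in auto)
    next
      case 3
      then show ?thesis using e by (intro exI[of _ "t + 1"]) (auto simp: length_fun_def max_def min_def)
    qed
  qed
qed

lemma arclength_integral_ge:
  assumes rp: "rectifiable_path \<gamma>" and t0: "0 \<le> t0" "t0 \<le> 1" and m: "0 \<le> m"
    and \<rho>: "\<And>t. 0 \<le> t \<Longrightarrow> t \<le> t0 \<Longrightarrow> m \<le> \<rho> (\<gamma> t)"
  shows "ennreal (m * dist (\<gamma> 0) (\<gamma> t0)) \<le> arclength_integral \<rho> \<gamma>"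
proof -
  have fin: "curve_length \<gamma> 0 1 < top" using rp by (auto simp: rectifiable_path_def)
  let ?M = "interval_measure (length_fun \<gamma>)"
  have l0: "length_fun \<gamma> 0 = 0"
  proof -
    have "polygon_length \<gamma> ts = 0" if "set ts \<subseteq> {0}" for ts
      using that by (induction \<gamma> ts rule: polygon_length.induct) auto
    then have "curve_length \<gamma> 0 0 = 0" unfolding curve_length_eq
      by (auto intro!: antisym SUP_least)
    then show ?thesis by (simp add: length_fun_def)
  qed
  have "ennreal (dist (\<gamma> 0) (\<gamma> t0)) = polygon_length \<gamma> [0, t0]" by simp
  also have "\<dots> \<le> curve_length \<gamma> 0 t0" using t0 by (intro polygon_length_le_curve_length) auto
  also have "\<dots> = ennreal (length_fun \<gamma> t0)" using length_fun_finite[OF fin, of t0] t0 by simp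
  finally have "dist (\<gamma> 0) (\<gamma> t0) \<le> length_fun \<gamma> t0" by (simp add: ennreal_le_iff length_fun_def)
  then have "ennreal (m * dist (\<gamma> 0) (\<gamma> t0)) \<le> ennreal (m * (length_fun \<gamma> t0 - length_fun \<gamma> 0))"
    using m l0 by (intro ennreal_leI mult_left_mono) auto
  also have "\<dots> = ennreal m * emeasure ?M {0<..t0}"
    using t0 m length_fun_mono[OF fin, of 0 t0]
    by (subst emeasure_interval_measure_Ioc) (auto simp: length_fun_mono[OF fin] length_fun_right_continuous[OF rp] ennreal_mult)
  also have "\<dots> = (\<integral>\<^sup>+t. ennreal m * indicator {0<..t0} t \<partial>?M)"
    by (subst nn_integral_cmult_indicator) auto
  also have "\<dots> \<le> (\<integral>\<^sup>+t. ennreal (\<rho> (\<gamma> t)) * indicator {0..1} t \<partial>?M)"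
    by (rule nn_integral_mono) (use \<rho> t0 in \<open>auto split: split_indicator intro: ennreal_leI\<close>)
  finally show ?thesis by (simp add: arclength_integral_def length_fun_def[abs_def])
qed

text \<open>Follow a curve only until it first leaves the ball of radius r around a, where r is at
  most half the depth of a. Up to then the depth is at most 3/2 of that of a, so the density is at
  least 2 / (3 * depth a), and the piece has length at least r.\<close>

lemma hdist_ge:
  assumes H: "\<And>z. z \<in> H \<Longrightarrow> 0 < depth z" and a: "a \<in> H"
  shows "ennreal (min (1/4) (dist a b / (2 * depth a))) \<le> hdist H a b"
  unfolding hdist_def
proof (rule INF_greatest)
  fix \<gamma> assume "\<gamma> \<in> {\<gamma>. rectifiable_path \<gamma> \<and> path_image \<gamma> \<subseteq> H \<and> pathstart \<gamma> = a \<and> pathfinish \<gamma> = b}"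
  then have rp: "rectifiable_path \<gamma>" and im: "path_image \<gamma> \<subseteq> H"
    and a': "a = pathstart \<gamma>" and b': "b = pathfinish \<gamma>" by auto
  have \<delta>: "depth a > 0" using H a by auto
  have cont: "continuous_on {0..1} \<gamma>" using rp by (auto simp: rectifiable_path_def path_def)
  define r where "r = min (depth a / 2) (dist a b)"
  have r: "0 \<le> r" "r \<le> depth a / 2" "r \<le> dist a b" using \<delta> by (auto simp: r_def)
  \<comment> \<open>The minimum of this compact set is the first exit time; the set contains 1
    because r is at most dist a b.\<close>
  define S where "S = {t\<in>{0..1}. r \<le> dist a (\<gamma> t)}"
  have contd: "continuous_on {0..1} (\<lambda>t. dist a (\<gamma> t))" by (intro continuous_intros cont)
  have "S = {0..1} \<inter> (\<lambda>t. dist a (\<gamma> t)) -` {r..}" by (auto simp: S_def)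
  then have "closed S" using continuous_closed_preimage[OF contd] by auto
  then have "compact S" using compact_Int_closed[of "{0..1::real}" S] by (auto simp: S_def Int_absorb1 subset_iff Int_def conj_ac)
  moreover have "1 \<in> S" using r b' by (auto simp: S_def pathfinish_def)
  ultimately obtain t0 where t0: "t0 \<in> S" "\<And>t. t \<in> S \<Longrightarrow> t0 \<le> t"
    using compact_attains_inf[of S] by blast
  have "\<exists>t\<ge>0. t \<le> t0 \<and> dist a (\<gamma> t) = r"
    using t0(1) a' r by (intro IVT' continuous_on_subset[OF contd]) (auto simp: S_def pathstart_def)
  then have at_t0: "dist a (\<gamma> t0) = r" using t0 by (force simp: S_def)
  have le: "dist a (\<gamma> t) \<le> r" if "0 \<le> t" "t \<le> t0" for t
  proof (cases "t = t0")
    case False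
    then have "t \<notin> S" using that t0(2)[of t] by auto
    then show ?thesis using that t0(1) by (auto simp: S_def)
  qed (simp add: at_t0)
  have \<rho>: "2 / (3 * depth a) \<le> 1 / norm (ypart (\<gamma> t))" if "0 \<le> t" "t \<le> t0" for t
  proof -
    have "depth (\<gamma> t) \<le> depth a + r" using depth_dist_le(1)[of "\<gamma> t" a] le[OF that] by (simp add: dist_commute)
    moreover have "\<gamma> t \<in> H" using im that t0(1) by (auto simp: path_image_def S_def image_subset_iff)
    then have "depth (\<gamma> t) > 0" by (rule H)
    ultimately show ?thesis using r \<delta> by (simp add: depth_def field_simps)
  qed
  \<comment> \<open>The right side is 1/3 when r is half the depth, and 2/3 of dist a b / depth a
    when r is dist a b.\<close>
  have "min (1/4) (dist a b / (2 * depth a)) \<le> 2 / (3 * depth a) * r"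
    using \<delta> by (auto simp: r_def min_def field_simps)
  also have "r = dist (\<gamma> 0) (\<gamma> t0)" using at_t0 a' by (simp add: pathstart_def)
  finally have "ennreal (min (1/4) (dist a b / (2 * depth a))) \<le> ennreal (2 / (3 * depth a) * dist (\<gamma> 0) (\<gamma> t0))"
    by (rule ennreal_leI)
  also have "\<dots> \<le> arclength_integral (\<lambda>z. 1 / norm (ypart z)) \<gamma>"
  proof (rule arclength_integral_ge[OF rp])
    show "0 \<le> t0" "t0 \<le> 1" "0 \<le> 2 / (3 * depth a)" using t0(1) \<delta> by (auto simp: S_def)
  qed (use \<rho> in auto)
  finally show "ennreal (min (1/4) (dist a b / (2 * depth a))) \<le> arclength_integral (\<lambda>z. 1 / norm (ypart z)) \<gamma>" .
qed

lemma dist_linepath: "dist (linepath v w s) (linepath v w t) = \<bar>s - t\<bar> * dist v (w :: 'a::real_normed_vector)"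
proof -
  have "linepath v w s - linepath v w t = (t - s) *\<^sub>R (v - w)" by (simp add: linepath_def algebra_simps)
  then show ?thesis by (simp add: dist_norm abs_minus_commute)
qed

lemma polygon_length_linepath:
  "sorted (x # ts) \<Longrightarrow> polygon_length (linepath v w) (x # ts) = ennreal ((last (x # ts) - x) * dist v (w :: 'a::real_normed_vector))"
proof (induction ts arbitrary: x)
  case (Cons y ts)
  have le: "x \<le> y" "y \<le> last (y # ts)" using Cons.prems last_in_set[of "y # ts"] by auto
  have "polygon_length (linepath v w) (x # y # ts) = ennreal ((y - x) * dist v w) + ennreal ((last (y # ts) - y) * dist v w)"
    using Cons le by (simp add: dist_linepath)
  also have "\<dots> = ennreal ((y - x) * dist v w + (last (y # ts) - y) * dist v w)"
    using le by (subst ennreal_plus) auto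
  finally show ?case by (simp add: algebra_simps)
qed simp

lemma curve_length_linepath:
  assumes "0 \<le> t"
  shows "curve_length (linepath v w) 0 t = ennreal (t * dist v (w :: 'a::real_normed_vector))"
proof (rule antisym)
  show "curve_length (linepath v w) 0 t \<le> ennreal (t * dist v w)"
    unfolding curve_length_eq
  proof (rule SUP_least, clarify)
    fix ts assume ts: "sorted ts" "set ts \<subseteq> {0..t}"
    show "polygon_length (linepath v w) ts \<le> ennreal (t * dist v w)"
    proof (cases ts)
      case (Cons x us)
      have "last ts \<in> {0..t}" "x \<in> {0..t}" using ts Cons last_in_set[of ts] by auto
      then have "(last ts - x) * dist v w \<le> t * dist v w" by (intro mult_right_mono) auto
      then show ?thesis using polygon_length_linepath[of x us v w] ts Cons by (auto intro: ennreal_leI)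
    qed simp
  qed
  show "ennreal (t * dist v w) \<le> curve_length (linepath v w) 0 t"
    using polygon_length_le_curve_length[of "[0, t]" 0 t "linepath v w"] assms
    by (simp add: dist_linepath)
qed

text \<open>The segment itself is the competing curve; its length function is linear and the density
  is at most 1 / m along it.\<close>

lemma hdist_segment_le:
  assumes seg: "closed_segment v w \<subseteq> H" and m: "0 < m" and ge: "\<And>z. z \<in> closed_segment v w \<Longrightarrow> m \<le> depth z"
  shows "hdist H v w \<le> ennreal (dist v w / m)"
proof -
  let ?\<gamma> = "linepath v w"
  have F: "length_fun ?\<gamma> = (\<lambda>t. max 0 (min 1 t) * dist v w)"
    by (auto simp: length_fun_def curve_length_linepath)
  have rp: "rectifiable_path ?\<gamma>" by (auto simp: rectifiable_path_def curve_length_linepath)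
  have "hdist H v w \<le> arclength_integral (\<lambda>z. 1 / norm (ypart z)) ?\<gamma>"
    unfolding hdist_def using rp seg by (intro INF_lower) auto
  also have "\<dots> = (\<integral>\<^sup>+t\<in>{0..1}. ennreal (1 / depth (?\<gamma> t)) \<partial>interval_measure (length_fun ?\<gamma>))"
    by (simp add: arclength_integral_def depth_def length_fun_def[abs_def])
  also have "\<dots> \<le> (\<integral>\<^sup>+t. ennreal (1 / m) * indicator {0..1} t \<partial>interval_measure (length_fun ?\<gamma>))"
  proof (rule nn_integral_mono)
    fix t
    show "ennreal (1 / depth (?\<gamma> t)) * indicator {0..1} t \<le> ennreal (1 / m) * indicator {0..1} t"
    proof (cases "t \<in> {0..1}")
      case True
      then have "?\<gamma> t \<in> closed_segment v w" using linepath_in_path by blast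
      from ge[OF this] show ?thesis using m by (auto intro!: ennreal_leI mult_right_mono divide_left_mono)
    qed simp
  qed
  also have "\<dots> = ennreal (1 / m) * emeasure (interval_measure (length_fun ?\<gamma>)) {0..1}"
    by (subst nn_integral_cmult_indicator) auto
  also have "emeasure (interval_measure (length_fun ?\<gamma>)) {0..1} = ennreal (dist v w)"
    unfolding F by (subst emeasure_interval_measure_Icc) (auto intro!: continuous_intros mult_right_mono)
  also have "ennreal (1 / m) * ennreal (dist v w) = ennreal (dist v w / m)"
    using m by (subst ennreal_mult[symmetric]) auto
  finally show ?thesis .
qed

text \<open>A division-free form of the Lipschitz estimate with constant M * depth (f z) / depth z.
  One of the two points is the centre of the ball, since this is what the distance comparison yields
  directly; arbitrary pairs in a smaller ball are treated later.\<close>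

definition conformal_ball_bound :: "real \<Rightarrow> real \<Rightarrow> (real ^ ('k::finite + 'p::finite)) set \<Rightarrow> (real ^ ('k + 'p) \<Rightarrow> real ^ ('k + 'p)) \<Rightarrow> bool" where
  "conformal_ball_bound c M H f \<longleftrightarrow>
     (\<forall>z\<in>H. \<forall>w. dist z w < c * depth z \<longrightarrow> dist (f z) (f w) * depth z \<le> M * depth (f z) * dist z w)"

text \<open>The segment from z to w stays at depth at least half that of z, so its ends are at
  quasihyperbolic distance at most 2 * dist z w / depth z. The radius 1 / (16 * L) keeps L times
  this below 1/4; the truncation in \<open>hdist_ge\<close> is then inactive and its second term
  gives the factor 4 * L.\<close>

lemma hdist_lipschitz_imp_conformal_ball_bound:
  fixes f :: "real ^ ('k::finite + 'p::finite) \<Rightarrow> real ^ ('k + 'p)"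
  assumes H: "\<And>z. z \<in> H \<Longrightarrow> 0 < depth z" "\<And>z. z \<in> H \<Longrightarrow> ball z (depth z) \<subseteq> H"
    and fH: "f ` H \<subseteq> H" and L: "1 \<le> L"
    and lip: "\<And>w w'. w \<in> H \<Longrightarrow> w' \<in> H \<Longrightarrow> hdist H (f w) (f w') \<le> ennreal L * hdist H w w'"
  shows "conformal_ball_bound (1 / (16 * L)) (4 * L) H f"
  unfolding conformal_ball_bound_def
proof (intro ballI allI impI)
  fix z w assume z: "z \<in> H" and zw: "dist z w < 1 / (16 * L) * depth z"
  have d: "depth z > 0" using H z by auto
  have dL: "dist z w * (16 * L) < depth z" using zw L by (simp add: field_simps)
  have "dist z w * 16 \<le> dist z w * (16 * L)" using L by (intro mult_left_mono) auto
  then have zw2: "dist z w < depth z / 2" using dL zero_le_dist[of z w] by linarith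
  have sub: "x \<in> ball z (depth z / 2)" if "x \<in> closed_segment z w" for x
    using closed_segment_subset[of z "ball z (depth z / 2)" w] that zw2 d by auto
  have w: "w \<in> H" using H(2)[OF z] zw2 d by auto
  have "hdist H z w \<le> ennreal (dist z w / (depth z / 2))"
  proof (rule hdist_segment_le)
    show "closed_segment z w \<subseteq> H" using sub H(2)[OF z] d by (fastforce)
    fix x assume "x \<in> closed_segment z w"
    from sub[OF this] show "depth z / 2 \<le> depth x" using depth_dist_le(1)[of z x] by auto
  qed (use d in auto)
  then have "hdist H (f z) (f w) \<le> ennreal L * ennreal (dist z w / (depth z / 2))"
    using lip[OF z w] by (meson mult_left_mono order_trans zero_le)
  also have "\<dots> = ennreal (2 * L * dist z w / depth z)"
    using L d by (subst ennreal_mult[symmetric]) (auto simp: field_simps)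
  finally have "ennreal (min (1/4) (dist (f z) (f w) / (2 * depth (f z)))) \<le> ennreal (2 * L * dist z w / depth z)"
    using hdist_ge[of H "f z" "f w"] H(1) fH z by (meson image_subset_iff order_trans)
  then have m: "min (1/4) (dist (f z) (f w) / (2 * depth (f z))) \<le> 2 * L * dist z w / depth z"
    using L d by (subst (asm) ennreal_le_iff) auto
  have "2 * L * dist z w / depth z < 1/4" using dL d by (simp add: field_simps)
  with m have "dist (f z) (f w) / (2 * depth (f z)) \<le> 2 * L * dist z w / depth z" by (auto simp: min_def split: if_splits)
  moreover have "depth (f z) > 0" using H(1) fH z by blast
  ultimately show "dist (f z) (f w) * depth z \<le> 4 * L * depth (f z) * dist z w"
    using d by (simp add: field_simps)
qed

section \<open>Integrals of powers of the depth\<close>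

lemma ball_in_sets_borel [measurable]: "ball x r \<in> sets borel"
  by (rule borel_open) simp

lemma borel_measurable_depth [measurable]: "depth \<in> borel_measurable borel"
  by (intro borel_measurable_continuous_onI continuous_intros)

lemma dyadic_scale:
  fixes a :: real
  assumes "1 \<le> a"
  obtains k :: nat where "2 ^ k \<le> a" "a < 2 ^ Suc k"
proof -
  have ex: "\<exists>n. a < 2 ^ n" using real_arch_pow[of 2 a] by simp
  define n where "n = (LEAST n. a < 2 ^ n)"
  have n: "a < 2 ^ n" unfolding n_def by (rule LeastI_ex[OF ex])
  have "n \<noteq> 0" using n assms by (cases n) auto
  then obtain k where k: "n = Suc k" by (cases n) auto
  have "\<not> a < 2 ^ k" using not_less_Least[of k "\<lambda>n. a < 2 ^ n"] k by (simp add: n_def)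
  then show ?thesis using that[of k] n k by auto
qed

lemma suminf_ennreal_geometric:
  assumes "0 \<le> c" "0 \<le> q" "q < 1"
  shows "(\<Sum>k. ennreal (c * q ^ k)) = ennreal (c / (1 - q))"
proof -
  have s: "(\<lambda>k. c * q ^ k) sums (c * (1 / (1 - q)))"
    using assms by (intro sums_mult geometric_sums) auto
  have "(\<Sum>k. ennreal (c * q ^ k)) = ennreal (\<Sum>k. c * q ^ k)"
    using assms s by (intro suminf_ennreal2) (auto simp: sums_iff)
  then show ?thesis using s by (simp add: sums_iff)
qed

text \<open>Dyadic shells: on the shell at distance about 2^k * t the kernel times the volume of the
  enclosing ball is a multiple of (2^k * t) powr (-\<beta>), a geometric series in k.\<close>

lemma nn_integral_tail_le:
  fixes x :: "'a::euclidean_space"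
  assumes t: "0 < t" and \<beta>: "0 < \<beta>"
  shows "(\<integral>\<^sup>+y\<in>{y. t \<le> dist x y}. ennreal (dist x y powr (- (real DIM('a) + \<beta>))) \<partial>lborel)
     \<le> ennreal (unit_ball_vol (real DIM('a)) * 2 ^ DIM('a) / (1 - 2 powr (-\<beta>)) * t powr (-\<beta>))"
proof -
  let ?n = "real DIM('a)" and ?V = "unit_ball_vol (real DIM('a))"
  define g where "g k y = ennreal ((2 ^ k * t) powr (- (?n + \<beta>))) * indicator (ball x (2 ^ Suc k * t)) y" for k :: nat and y
  have g_meas: "g k \<in> borel_measurable lborel" for k unfolding g_def by measurable
  have "(\<integral>\<^sup>+y\<in>{y. t \<le> dist x y}. ennreal (dist x y powr (- (?n + \<beta>))) \<partial>lborel) \<le> (\<integral>\<^sup>+y. (\<Sum>k. g k y) \<partial>lborel)"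
  proof (rule nn_integral_mono)
    fix y
    show "ennreal (dist x y powr (- (?n + \<beta>))) * indicator {y. t \<le> dist x y} y \<le> (\<Sum>k. g k y)"
    proof (cases "t \<le> dist x y")
      case True
      then obtain k :: nat where k: "2 ^ k \<le> dist x y / t" "dist x y / t < 2 ^ Suc k"
        using dyadic_scale[of "dist x y / t"] t by (auto simp: field_simps)
      have "dist x y powr (- (?n + \<beta>)) \<le> (2 ^ k * t) powr (- (?n + \<beta>))"
        using k(1) t \<beta> by (intro powr_mono2') (auto simp: field_simps)
      then have "ennreal (dist x y powr (- (?n + \<beta>))) * indicator {y. t \<le> dist x y} y \<le> g k y"
        using k(2) t True by (auto simp: g_def field_simps intro: ennreal_leI)
      also have "\<dots> \<le> (\<Sum>k. g k y)" using sum_le_suminf[of "\<lambda>k. g k y" "{k}"] by simp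
      finally show ?thesis .
    qed simp
  qed
  also have "\<dots> = (\<Sum>k. \<integral>\<^sup>+y. g k y \<partial>lborel)"
    by (rule nn_integral_suminf) (rule g_meas)
  also have "(\<lambda>k. \<integral>\<^sup>+y. g k y \<partial>lborel) = (\<lambda>k. ennreal (?V * 2 ^ DIM('a) * t powr (-\<beta>) * (2 powr (-\<beta>)) ^ k))"
  proof
    fix k
    have "(\<integral>\<^sup>+y. g k y \<partial>lborel) = ennreal ((2 ^ k * t) powr (- (?n + \<beta>))) * emeasure lborel (ball x (2 ^ Suc k * t))"
      unfolding g_def by (rule nn_integral_cmult_indicator) auto
    also have "\<dots> = ennreal ((2 ^ k * t) powr (- (?n + \<beta>)) * (?V * (2 ^ Suc k * t) ^ DIM('a)))"
      using t by (subst emeasure_ball) (auto simp: ennreal_mult)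
    also have "(2 ^ k * t) powr (- (?n + \<beta>)) * (?V * (2 ^ Suc k * t) ^ DIM('a)) = ?V * 2 ^ DIM('a) * t powr (-\<beta>) * (2 powr (-\<beta>)) ^ k"
    proof -
      have p: "0 < 2 ^ k * t" using t by simp
      have "(2 ^ Suc k * t) ^ DIM('a) = 2 ^ DIM('a) * (2 ^ k * t) powr ?n"
        using p by (simp add: powr_realpow power_mult_distrib mult.assoc)
      moreover have "(2 ^ k * t) powr (- (?n + \<beta>)) * (2 ^ k * t) powr ?n = (2 ^ k * t) powr (-\<beta>)"
        using p by (simp add: powr_add[symmetric])
      moreover have "(2 ^ k * t) powr (-\<beta>) = t powr (-\<beta>) * (2 powr (-\<beta>)) ^ k"
      proof -
        have "(2 ^ k :: real) powr (-\<beta>) = (2 powr (-\<beta>)) ^ k"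
          by (simp add: powr_realpow[symmetric] powr_powr mult.commute)
        then show ?thesis using t by (simp add: powr_mult)
      qed
      ultimately show ?thesis by (simp add: mult_ac)
    qed
    finally show "(\<integral>\<^sup>+y. g k y \<partial>lborel) = ennreal (?V * 2 ^ DIM('a) * t powr (-\<beta>) * (2 powr (-\<beta>)) ^ k)" .
  qed
  also have "(\<Sum>k. ennreal (?V * 2 ^ DIM('a) * t powr (-\<beta>) * (2 powr (-\<beta>)) ^ k)) = ennreal (?V * 2 ^ DIM('a) * t powr (-\<beta>) / (1 - 2 powr (-\<beta>)))"
    using \<beta> by (intro suminf_ennreal_geometric) (auto simp: powr_less_one)
  finally show ?thesis by (simp add: field_simps)
qed

text \<open>The set lies in a box with sides 2 * r along the subspace and 2 * s across it.\<close>

lemma emeasure_ball_near_subspace_le: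
  fixes x0 :: "real ^ ('k::finite + 'p::finite)"
  assumes r: "0 \<le> r" and s: "0 \<le> s"
  shows "emeasure lborel (ball x0 r \<inter> {z. depth z < s}) \<le> ennreal ((2 * r) ^ CARD('k) * (2 * s) ^ CARD('p))"
proof -
  define a :: "real ^ ('k + 'p)" where "a = (\<chi> i. case i of Inl j \<Rightarrow> x0 $ Inl j - r | Inr j \<Rightarrow> - s)"
  define b :: "real ^ ('k + 'p)" where "b = (\<chi> i. case i of Inl j \<Rightarrow> x0 $ Inl j + r | Inr j \<Rightarrow> s)"
  have sub: "ball x0 r \<inter> {z. depth z < s} \<subseteq> cbox a b"
  proof
    fix z assume z: "z \<in> ball x0 r \<inter> {z. depth z < s}"
    have "\<bar>(x0 - z) $ i\<bar> \<le> r" for i using component_le_norm_cart[of "x0 - z" i] z by (simp add: dist_norm)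
    moreover have "\<bar>ypart z $ j\<bar> \<le> s" for j using component_le_norm_cart[of "ypart z" j] z by (simp add: depth_def)
    ultimately show "z \<in> cbox a b"
      unfolding mem_box_cart a_def b_def by (auto simp: abs_le_iff ypart_def algebra_simps minus_le_iff split: sum.split)
  qed
  have ab: "a $ i \<le> b $ i" for i using r s by (auto simp: a_def b_def split: sum.split)
  have "emeasure lborel (ball x0 r \<inter> {z. depth z < s}) \<le> emeasure lborel (cbox a b)"
    using sub by (intro emeasure_mono) auto
  also have "\<dots> = ennreal (measure lborel (cbox a b))" using emeasure_lborel_cbox_finite[of a b] by (intro emeasure_eq_ennreal_measure) auto
  also have "measure lborel (cbox a b) = (\<Prod>i\<in>UNIV. b $ i - a $ i)"
    using ab by (intro content_cbox_cart) (auto simp: interval_eq_empty_cart not_less)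
  also have "\<dots> = (\<Prod>i\<in>UNIV <+> UNIV. b $ i - a $ i)" by (simp add: UNIV_Plus_UNIV)
  also have "\<dots> = (2 * r) ^ CARD('k) * (2 * s) ^ CARD('p)"
    by (subst prod.Plus) (auto simp: a_def b_def)
  finally show ?thesis .
qed

text \<open>Dyadic layers in the depth: halving the depth multiplies the integrand by 2 powr \<beta>
  and the volume bound by 2 powr (-p), so the layers sum geometrically exactly because \<beta> is
  less than p. Depths above r are covered by the first summand of C.\<close>

lemma nn_integral_depth_powr_le:
  fixes x0 :: "real ^ ('k::finite + 'p::finite)"
  assumes \<beta>: "0 \<le> \<beta>" "\<beta> < real CARD('p)"
  obtains C where "0 < C" "\<And>(x0 :: real ^ ('k + 'p)) r. 0 < r \<Longrightarrow>
    (\<integral>\<^sup>+z\<in>ball x0 r. ennreal (depth z powr (-\<beta>)) \<partial>lborel) \<le> ennreal (C * r powr (real CARD('k + 'p) - \<beta>))"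
proof -
  let ?p = "CARD('p)" and ?k = "CARD('k)"
  define q where "q = 2 powr (\<beta> - real ?p)"
  have q: "0 < q" "q < 1" using \<beta> by (auto simp: q_def powr_less_one)
  define c where "c = 2 powr \<beta> * 2 ^ ?k * 2 ^ ?p"
  define V where "V = unit_ball_vol (real CARD('k + 'p))"
  have V: "V > 0" by (simp add: V_def)
  define C where "C = V + c / (1 - q)"
  have c: "c > 0" by (simp add: c_def)
  show thesis
  proof (rule that[of C])
    show "0 < C" using V c q by (simp add: C_def add_pos_pos)
    fix x0 :: "real ^ ('k + 'p)" and r :: real assume r: "0 < r"
    define g where "g k z = ennreal ((r / 2 ^ Suc k) powr (-\<beta>)) * indicator (ball x0 r \<inter> {z. depth z < r / 2 ^ k}) z"
      for k :: nat and z :: "real ^ ('k + 'p)"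
    have meas [measurable]: "ball x0 r \<inter> {z. depth z < s} \<in> sets borel" for s
    proof -
      have "open {z :: real ^ ('k + 'p). depth z < s}"
        by (intro open_Collect_less continuous_intros)
      then have "open (ball x0 r \<inter> {z :: real ^ ('k + 'p). depth z < s})" by (intro open_Int open_ball)
      then show ?thesis by simp
    qed
    have g_meas [measurable]: "g k \<in> borel_measurable lborel" for k unfolding g_def by measurable
    have "(\<integral>\<^sup>+z\<in>ball x0 r. ennreal (depth z powr (-\<beta>)) \<partial>lborel)
        \<le> (\<integral>\<^sup>+z. ennreal (r powr (-\<beta>)) * indicator (ball x0 r) z + (\<Sum>k. g k z) \<partial>lborel)"
    proof (rule nn_integral_mono)
      fix z :: "real ^ ('k + 'p)"
      show "ennreal (depth z powr (-\<beta>)) * indicator (ball x0 r) z \<le> ennreal (r powr (-\<beta>)) * indicator (ball x0 r) z + (\<Sum>k. g k z)"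
      proof (cases "z \<in> ball x0 r")
        case True
        consider "depth z = 0" | "r \<le> depth z" | "0 < depth z" "depth z < r" using depth_nonneg[of z] by linarith
        then show ?thesis
        proof cases
          \<comment> \<open>Here \<open>0 powr x = 0\<close>, so points of the subspace contribute
            nothing.\<close>
          case 1 then show ?thesis by simp
        next
          case 2
          then have "depth z powr (-\<beta>) \<le> r powr (-\<beta>)" using r \<beta> by (intro powr_mono2') auto
          then show ?thesis using True by (auto intro!: add_increasing2 ennreal_leI)
        next
          case 3
          then obtain k :: nat where k: "2 ^ k \<le> r / depth z" "r / depth z < 2 ^ Suc k"
            using dyadic_scale[of "r / depth z"] by (auto simp: field_simps)
          have kk: "r / 2 ^ Suc k \<le> depth z" "depth z \<le> r / 2 ^ k" using k 3 by (auto simp: field_simps)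
          \<comment> \<open>\<open>dyadic_scale\<close> closes the layers at the upper end, whereas
            \<open>g\<close> needs strict inequality there; a point on the boundary is moved to the
            preceding layer.\<close>
          obtain j where j: "r / 2 ^ Suc j \<le> depth z" "depth z < r / 2 ^ j"
          proof (cases "depth z < r / 2 ^ k")
            case True then show ?thesis using that[of k] kk by auto
          next
            case False
            then have e: "depth z = r / 2 ^ k" using kk by auto
            then have "k \<noteq> 0" using 3 by (cases k) auto
            then obtain j where "k = Suc j" by (cases k) auto
            then show ?thesis using that[of j] e r by (auto simp: field_simps)
          qed
          have "depth z powr (-\<beta>) \<le> (r / 2 ^ Suc j) powr (-\<beta>)" using j r \<beta> by (intro powr_mono2') auto
          then have "ennreal (depth z powr (-\<beta>)) * indicator (ball x0 r) z \<le> g j z"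
            using True j by (auto simp: g_def intro: ennreal_leI)
          also have "\<dots> \<le> (\<Sum>k. g k z)" using sum_le_suminf[of "\<lambda>k. g k z" "{j}"] by simp
          finally show ?thesis by (simp add: add_increasing)
        qed
      qed simp
    qed
    also have "\<dots> = (\<integral>\<^sup>+z. ennreal (r powr (-\<beta>)) * indicator (ball x0 r) z \<partial>lborel) + (\<integral>\<^sup>+z. (\<Sum>k. g k z) \<partial>lborel)"
      by (rule nn_integral_add) measurable
    also have "(\<integral>\<^sup>+z. (\<Sum>k. g k z) \<partial>lborel) = (\<Sum>k. \<integral>\<^sup>+z. g k z \<partial>lborel)"
      by (rule nn_integral_suminf) (rule g_meas)
    also have "(\<integral>\<^sup>+z. ennreal (r powr (-\<beta>)) * indicator (ball x0 r) z \<partial>lborel) = ennreal (V * r powr (real CARD('k + 'p) - \<beta>))"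
    proof -
      have "(\<integral>\<^sup>+z. ennreal (r powr (-\<beta>)) * indicator (ball x0 r) z \<partial>lborel) = ennreal (r powr (-\<beta>)) * emeasure lborel (ball x0 r)"
        by (rule nn_integral_cmult_indicator) auto
      also have "\<dots> = ennreal (r powr (-\<beta>) * (V * r ^ CARD('k + 'p)))"
        using r by (subst emeasure_ball) (auto simp: ennreal_mult V_def)
      also have "r ^ CARD('k + 'p) = r powr real CARD('k + 'p)" using r by (subst powr_realpow) auto
      also have "r powr (-\<beta>) * (V * r powr real CARD('k + 'p)) = V * r powr (real CARD('k + 'p) - \<beta>)"
        by (simp add: powr_diff powr_minus field_simps)
      finally show ?thesis .
    qed
    also have "(\<Sum>k. \<integral>\<^sup>+z. g k z \<partial>lborel) \<le> (\<Sum>k. ennreal (c * r powr (real CARD('k + 'p) - \<beta>) * q ^ k))"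
    proof (intro suminf_le summableI)
      fix k
      have "(\<integral>\<^sup>+z. g k z \<partial>lborel) = ennreal ((r / 2 ^ Suc k) powr (-\<beta>)) * emeasure lborel (ball x0 r \<inter> {z. depth z < r / 2 ^ k})"
        unfolding g_def using meas by (intro nn_integral_cmult_indicator) auto
      also have "\<dots> \<le> ennreal ((r / 2 ^ Suc k) powr (-\<beta>)) * ennreal ((2 * r) ^ ?k * (2 * (r / 2 ^ k)) ^ ?p)"
        using r by (intro mult_left_mono emeasure_ball_near_subspace_le) auto
      also have "\<dots> = ennreal ((r / 2 ^ Suc k) powr (-\<beta>) * ((2 * r) ^ ?k * (2 * (r / 2 ^ k)) ^ ?p))"
        using r by (subst ennreal_mult[symmetric]) auto
      also have "(r / 2 ^ Suc k) powr (-\<beta>) * ((2 * r) ^ ?k * (2 * (r / 2 ^ k)) ^ ?p) = c * r powr (real CARD('k + 'p) - \<beta>) * q ^ k"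
      proof -
        have e: "(2::real) ^ Suc k = 2 powr (real k + 1)" "(2::real) ^ k = 2 powr (real k)"
          by (simp_all add: powr_realpow powr_add)
        have e2: "q ^ k = 2 powr ((\<beta> - real ?p) * real k)" by (simp add: q_def powr_power mult.commute)
        have a: "((2::real) ^ k) ^ ?p = 2 powr (real k * real ?p)"
        proof -
          have "2 powr (real k * real ?p) = 2 powr real (k * ?p)" by simp
          also have "\<dots> = 2 ^ (k * ?p)" by (rule powr_realpow) simp
          finally show ?thesis by (simp only: power_mult)
        qed
        have e3: "(2 * (r / 2 ^ k)) ^ ?p = 2 ^ ?p * r powr (real ?p) * 2 powr (- (real k * real ?p))"
          unfolding power_mult_distrib power_divide a powr_realpow[OF r] by (simp add: powr_minus divide_inverse)
        have e4: "(2 * r) ^ ?k = 2 ^ ?k * r powr (real ?k)"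
          unfolding power_mult_distrib powr_realpow[OF r] ..
        have e5: "(r / 2 ^ Suc k) powr (-\<beta>) = r powr (-\<beta>) * 2 powr (\<beta> * (real k + 1))"
        proof -
          have "(r / 2 ^ Suc k) powr (-\<beta>) = r powr (-\<beta>) / (2 powr (real k + 1)) powr (-\<beta>)"
            unfolding e(1) by (rule powr_divide)
          also have "(2 powr (real k + 1)) powr (-\<beta>) = 1 / (2 powr (\<beta> * (real k + 1)))"
          proof -
            have eq: "(real k + 1) * (-\<beta>) = - (\<beta> * (real k + 1))" by (simp add: algebra_simps)
            show ?thesis by (subst powr_powr, subst eq, rule powr_minus_divide)
          qed
          finally show ?thesis by simp
        qed
        have e6: "r powr (real CARD('k + 'p) - \<beta>) = r powr (-\<beta>) * r powr real ?p * r powr real ?k"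
        proof -
          have "real CARD('k + 'p) - \<beta> = -\<beta> + real ?p + real ?k" by simp
          then show ?thesis by (simp only: powr_add)
        qed
        have e7: "2 powr (\<beta> * (real k + 1)) * 2 powr (- (real k * real ?p)) = 2 powr \<beta> * 2 powr ((\<beta> - real ?p) * real k)"
        proof -
          have "\<beta> * (real k + 1) + - (real k * real ?p) = \<beta> + (\<beta> - real ?p) * real k" by (simp add: algebra_simps)
          then show ?thesis by (simp only: powr_add[symmetric])
        qed
        define X where "X = 2 powr (\<beta> * (real k + 1))"
        define Y where "Y = 2 powr (- (real k * real ?p))"
        have "r powr (-\<beta>) * X * (2 ^ ?k * r powr (real ?k) * (2 ^ ?p * r powr (real ?p) * Y)) =
            (X * Y) * (r powr (-\<beta>) * (2 ^ ?k * r powr (real ?k) * (2 ^ ?p * r powr (real ?p))))" by (simp only: mult_ac)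
        also have "X * Y = 2 powr \<beta> * 2 powr ((\<beta> - real ?p) * real k)" unfolding X_def Y_def by (rule e7)
        finally show ?thesis unfolding e3 e4 e5 e6 e2 c_def X_def Y_def by (simp only: mult_ac)
      qed
      finally show "(\<integral>\<^sup>+z. g k z \<partial>lborel) \<le> ennreal (c * r powr (real CARD('k + 'p) - \<beta>) * q ^ k)" .
    qed
    also have "(\<Sum>k. ennreal (c * r powr (real CARD('k + 'p) - \<beta>) * q ^ k)) = ennreal (c * r powr (real CARD('k + 'p) - \<beta>) / (1 - q))"
      using q c by (intro suminf_ennreal_geometric) auto
    also have "ennreal (V * r powr (real CARD('k + 'p) - \<beta>)) + ennreal (c * r powr (real CARD('k + 'p) - \<beta>) / (1 - q)) =
        ennreal (C * r powr (real CARD('k + 'p) - \<beta>))"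
    proof -
      define R where "R = r powr (real CARD('k + 'p) - \<beta>)"
      have "C * R = V * R + c * R / (1 - q)" by (simp add: C_def distrib_right)
      moreover have "0 \<le> V * R" "0 \<le> c * R / (1 - q)" using V c q by (auto simp: R_def)
      ultimately show ?thesis unfolding R_def[symmetric] by (simp add: ennreal_plus)
    qed
    finally show "(\<integral>\<^sup>+z\<in>ball x0 r. ennreal (depth z powr (-\<beta>)) \<partial>lborel) \<le> ennreal (C * r powr (real CARD('k + 'p) - \<beta>))"
      by (simp add: add_left_mono)
  qed
qed

section \<open>Change of variables on Whitney balls\<close>

definition Qkernel :: "real \<Rightarrow> (real ^ 'n \<Rightarrow> real) \<Rightarrow> real ^ 'n \<Rightarrow> real ^ 'n \<Rightarrow> ennreal" where
  "Qkernel \<alpha> u x y = ennreal (\<bar>u x - u y\<bar>\<^sup>2 / norm (x - y) powr (real CARD('n) + 2 * \<alpha>))"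

text \<open>The unnormalised double integral of \<open>Q_norm\<close>, taken over
  \<open>lborel\<close> because Fubini and the measurability prover work with Borel sets. Passing to
  the completion does not change its value.\<close>

definition Qenergy :: "real \<Rightarrow> (real ^ 'n \<Rightarrow> real) \<Rightarrow> real ^ 'n \<Rightarrow> real \<Rightarrow> ennreal" where
  "Qenergy \<alpha> u x0 r = (\<integral>\<^sup>+y\<in>ball x0 r. (\<integral>\<^sup>+x\<in>ball x0 r. Qkernel \<alpha> u x y \<partial>lborel) \<partial>lborel)"

lemma borel_measurable_Qkernel [measurable]:
  assumes [measurable]: "u \<in> borel_measurable borel" "a \<in> M \<rightarrow>\<^sub>M borel" "b \<in> M \<rightarrow>\<^sub>M borel"
  shows "(\<lambda>p. Qkernel \<alpha> u (a p) (b p)) \<in> borel_measurable M"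
  unfolding Qkernel_def by measurable

lemma Qkernel_commute: "Qkernel \<alpha> u x y = Qkernel \<alpha> u y x"
  unfolding Qkernel_def by (simp add: norm_minus_commute power2_commute)

lemma borel_measurable_ball_integral [measurable]:
  fixes F :: "'a::euclidean_space \<Rightarrow> 'b::euclidean_space \<Rightarrow> ennreal"
  assumes [measurable]: "(\<lambda>p. F (fst p) (snd p)) \<in> borel_measurable (borel \<Otimes>\<^sub>M borel)"
  shows "(\<lambda>y. \<integral>\<^sup>+x\<in>ball x0 r. F y x \<partial>lborel) \<in> borel_measurable borel"
  by measurable

lemma nn_integral_cmult_cmult:
  "H \<in> borel_measurable N \<Longrightarrow> (\<integral>\<^sup>+y. a * (b * H y) \<partial>N) = a * (b * (\<integral>\<^sup>+y. H y \<partial>N))"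
  by (simp add: nn_integral_cmult)

text \<open>The same c and M serve both directions, so the assumptions are invariant under
  exchanging f and fi, and each result about f also holds for its inverse by interpretation.\<close>

locale whitney_map =
  fixes f fi :: "real ^ ('k::finite + 'p::finite) \<Rightarrow> real ^ ('k + 'p)" and c M :: real
  assumes hom: "homeomorphism UNIV UNIV f fi"
    and depth0: "depth (f z) = 0 \<longleftrightarrow> depth z = 0"
    and c: "0 < c" "c \<le> 1" and M: "1 \<le> M"
    and cb: "conformal_ball_bound c M {z. 0 < depth z} f"
    and cbi: "conformal_ball_bound c M {z. 0 < depth z} fi"
    and refl: "CARD('p) = 1 \<Longrightarrow> f (reflect z) = reflect (f z)"
begin

lemma f_fi [simp]: "f (fi z) = z" and fi_f [simp]: "fi (f z) = z"
  using hom by (auto simp: homeomorphism_def)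

lemma continuous_f: "continuous_on S f" and continuous_fi: "continuous_on S fi"
  using hom by (auto simp: homeomorphism_def intro: continuous_on_subset)

lemma borel_f [measurable]: "f \<in> borel \<rightarrow>\<^sub>M borel" and borel_fi [measurable]: "fi \<in> borel \<rightarrow>\<^sub>M borel"
  by (auto intro: borel_measurable_continuous_onI continuous_f continuous_fi)

lemma inverse_map: "whitney_map fi f c M"
proof
  show "homeomorphism UNIV UNIV fi f" using hom by (rule homeomorphism_symD)
  show "depth (fi z) = 0 \<longleftrightarrow> depth z = 0" for z using depth0[of "fi z"] by simp
  show "fi (reflect z) = reflect (fi z)" if "CARD('p) = 1" for z
    using refl[OF that, of "fi z"] by (metis f_fi fi_f)
qed (use c M cb cbi in auto)

lemma depth_f_pos: "0 < depth (f z) \<longleftrightarrow> 0 < depth z"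
  using depth0[of z] depth_nonneg[of z] depth_nonneg[of "f z"] by linarith

lemma dist_f_le: "0 < depth z \<Longrightarrow> dist z w < c * depth z \<Longrightarrow> dist (f z) (f w) * depth z \<le> M * depth (f z) * dist z w"
  using cb by (auto simp: conformal_ball_bound_def)

lemma depth_f_le:
  assumes z: "0 < depth z" and w: "dist z w < c * depth z"
  shows "depth (f w) \<le> 2 * M * depth (f z)"
proof -
  have "dist (f z) (f w) * depth z \<le> M * depth (f z) * dist z w" by (rule dist_f_le[OF z w])
  also have "\<dots> \<le> M * depth (f z) * depth z"
  proof (intro mult_left_mono)
    have "c * depth z \<le> 1 * depth z" using c by (intro mult_right_mono) auto
    then show "dist z w \<le> depth z" using w by simp
  qed (use M in auto)
  finally have "dist (f z) (f w) \<le> M * depth (f z)" using z by simp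
  moreover have "depth (f z) \<le> M * depth (f z)" using M mult_right_mono[of 1 M "depth (f z)"] by simp
  ultimately show ?thesis using depth_lipschitz[of "f w" "f z"] by (simp add: dist_commute)
qed

text \<open>In K one factor M is the Lipschitz bound centred at a point w of the ball, a factor 2 *
  M compares depth (f w) with depth (f z), and the remaining 2 covers the change of depth from z to
  w. The radius r0 is so small that f maps the ball of relative radius r0 into the ball of relative
  radius c / 4 about f z, where the inverse satisfies the same bound; moreover K * r0 = c /
  4.\<close>

definition K :: real where "K = 4 * M\<^sup>2"
definition r0 :: real where "r0 = c / (16 * M\<^sup>2)"

lemma M2: "1 \<le> M\<^sup>2" "M \<le> M\<^sup>2"
  using M power_mono[of 1 M 2] mult_left_mono[of 1 M M] by (auto simp: power2_eq_square)

lemma K: "4 \<le> K" "M \<le> K" using M2 M by (auto simp: K_def)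

lemma r0: "0 < r0" "r0 \<le> 1 / 16" "r0 \<le> c / 4" "M * r0 \<le> c / 4"
proof -
  show "0 < r0" using c M by (auto simp: r0_def intro!: divide_pos_pos)
  show "r0 \<le> 1 / 16" unfolding r0_def using c M2 by (intro frac_le) auto
  show "r0 \<le> c / 4" unfolding r0_def using c M2 by (intro divide_left_mono) auto
  have "M * c \<le> M\<^sup>2 * c" using M2 c by (intro mult_right_mono) auto
  moreover have "0 \<le> M\<^sup>2 * c" using c by simp
  ultimately show "M * r0 \<le> c / 4" unfolding r0_def using M by (simp add: field_simps)
qed

text \<open>Two arbitrary points are compared by taking w itself as centre: its depth is at least
  3/4 of that of z, so w' lies in the admissible ball about w.\<close>

lemma lipschitz_on_ball:
  assumes z: "0 < depth z" and w: "dist z w < c / 4 * depth z" and w': "dist z w' < c / 4 * depth z"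
  shows "dist (f w) (f w') * depth z \<le> K * depth (f z) * dist w w'"
proof -
  have cz: "c * depth z \<le> depth z" using c z by simp
  have dw: "3/4 * depth z \<le> depth w" using depth_dist_le(1)[of z w] w cz by simp
  then have dw0: "0 < depth w" using z by simp
  have "dist w w' < c / 2 * depth z" using dist_triangle3[of w w' z] w w' by simp
  also have "\<dots> \<le> c * depth w" using mult_left_mono[OF dw, of c] c z by simp
  finally have 1: "dist (f w) (f w') * depth w \<le> M * depth (f w) * dist w w'" by (rule dist_f_le[OF dw0])
  have "c / 4 * depth z \<le> c * depth z" using c z by simp
  with w have "dist z w < c * depth z" by linarith
  from depth_f_le[OF z this] have "M * depth (f w) * dist w w' \<le> M * (2 * M * depth (f z)) * dist w w'"
    using M by (intro mult_right_mono mult_left_mono) auto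
  with 1 have "dist (f w) (f w') * depth w \<le> M * (2 * M * depth (f z)) * dist w w'" by simp
  moreover have "dist (f w) (f w') * (3/4 * depth z) \<le> dist (f w) (f w') * depth w"
    using dw by (intro mult_left_mono) auto
  ultimately have a: "dist (f w) (f w') * (3/4 * depth z) \<le> M * (2 * M * depth (f z)) * dist w w'" by simp
  have "dist (f w) (f w') * depth z \<le> 4/3 * (M * (2 * M * depth (f z)) * dist w w')" using a by simp
  also have "\<dots> \<le> 2 * (M * (2 * M * depth (f z)) * dist w w')"
    using M by (intro mult_right_mono) auto
  finally show ?thesis by (simp add: K_def power2_eq_square mult_ac)
qed

lemma bilipschitz_upper:
  assumes z: "0 < depth z" and w: "dist z w < r0 * depth z" and w': "dist z w' < r0 * depth z"
  shows "dist (f w) (f w') * depth z \<le> K * depth (f z) * dist w w'"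
proof -
  have "r0 * depth z \<le> c / 4 * depth z" using r0 z by (intro mult_right_mono) auto
  then show ?thesis using lipschitz_on_ball[OF z] w w' by simp
qed

text \<open>This is the upper estimate for the inverse map. The image points lie within c / 4 *
  depth (f z) of f z because M * r0 \<le> c / 4.\<close>

lemma bilipschitz_lower:
  assumes z: "0 < depth z" and w: "dist z w < r0 * depth z" and w': "dist z w' < r0 * depth z"
  shows "depth (f z) * dist w w' \<le> K * depth z * dist (f w) (f w')"
proof -
  have *: "dist (f z) (f w) < c / 4 * depth (f z)" if "dist z w < r0 * depth z" for w
  proof -
    have "r0 * depth z \<le> c * depth z" using r0 c z by (intro mult_right_mono) auto
    with that have cz: "dist z w < c * depth z" by linarith
    have "dist (f z) (f w) * depth z \<le> M * depth (f z) * dist z w" by (rule dist_f_le[OF z cz])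
    also have "\<dots> < M * depth (f z) * (r0 * depth z)"
      using that M z depth_f_pos[of z] by (intro mult_strict_left_mono) auto
    also have "\<dots> = (M * r0) * depth (f z) * depth z" by simp
    also have "\<dots> \<le> c / 4 * depth (f z) * depth z" using r0(4) by (intro mult_right_mono) auto
    finally show ?thesis using z by simp
  qed
  interpret i: whitney_map fi f c M by (rule inverse_map)
  have "i.K = K" by (simp add: i.K_def K_def)
  then show ?thesis
    using i.lipschitz_on_ball[of "f z" "f w" "f w'"] *[OF w] *[OF w'] z depth_f_pos[of z] by (simp add: mult_ac)
qed

text \<open>On the Whitney ball at \<open>z\<close> the map is bilipschitz up to the scaling factor \<open>ratio z\<close>, which is
  therefore comparable with the size of its derivative.\<close>

definition ratio :: "real ^ ('k + 'p) \<Rightarrow> real" where "ratio z = depth (f z) / depth z"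

lemma ratio_pos: "0 < depth z \<Longrightarrow> 0 < ratio z"
  by (simp add: ratio_def depth_f_pos)

lemma dist_image_le:
  assumes z: "0 < depth z" and w: "dist z w < r0 * depth z" and w': "dist z w' < r0 * depth z"
  shows "dist (f w) (f w') \<le> K * ratio z * dist w w'" "dist w w' \<le> K / ratio z * dist (f w) (f w')"
  using bilipschitz_upper[OF assms] bilipschitz_lower[OF assms] z depth_f_pos[of z]
  by (auto simp: ratio_def field_simps)

text \<open>On the image of the ball the inverse is Lipschitz with constant K / ratio z, so
  preimages have measure at most (2 * K / ratio z)^n times that of the set. The image itself is
  enlarged to a ball, the domain on which energies of u are known.\<close>

lemma nn_integral_ball_image_le:
  assumes z: "0 < depth z" and s: "0 < s" "s \<le> r0 * depth z" and F: "F \<in> borel_measurable borel"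
  shows "(\<integral>\<^sup>+x\<in>ball z s. F (f x) \<partial>lborel) \<le>
    ennreal ((2 * K / ratio z) ^ CARD('k + 'p)) * (\<integral>\<^sup>+x\<in>ball (f z) (K * ratio z * s). F x \<partial>lborel)"
proof -
  have inj: "inj f" by (metis fi_f injI)
  define V where "V = f ` ball z s"
  have "V = fi -` ball z s" unfolding V_def
  proof (intro equalityI subsetI)
    fix x assume "x \<in> fi -` ball z s"
    then show "x \<in> f ` ball z s" by (intro image_eqI[of x f "fi x"]) auto
  qed auto
  then have V: "V \<in> sets borel" using measurable_sets[OF borel_fi, of "ball z s"] by simp
  have in_ball: "dist z w < r0 * depth z" if "w \<in> ball z s" for w using that s by auto
  have rz: "0 < ratio z" by (rule ratio_pos[OF z])
  have "(\<integral>\<^sup>+x\<in>ball z s. F (f x) \<partial>lborel) \<le> ennreal ((2 * K / ratio z) ^ CARD('k + 'p)) * (\<integral>\<^sup>+x\<in>V. F x \<partial>lborel)"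
  proof (rule nn_integral_image_le)
    fix A assume A: "A \<in> sets borel" "A \<subseteq> V"
    have eq: "ball z s \<inter> f -` A = fi ` A"
    proof (intro equalityI subsetI)
      fix x assume "x \<in> ball z s \<inter> f -` A" then show "x \<in> fi ` A" by (auto intro!: image_eqI[of _ fi "f x"])
    next
      fix x assume "x \<in> fi ` A" then show "x \<in> ball z s \<inter> f -` A" using A(2) by (auto simp: V_def)
    qed
    have "f -` A \<in> sets borel" using measurable_sets[OF borel_f A(1)] by simp
    then have b: "ball z s \<inter> f -` A \<in> sets borel" by auto
    have "emeasure lborel (ball z s \<inter> f -` A) = emeasure lebesgue (fi ` A)" using b by (simp add: eq emeasure_completion)
    also have "\<dots> \<le> ennreal ((2 * (K / ratio z)) ^ DIM(real ^ ('k + 'p))) * emeasure lebesgue A"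
    proof (rule emeasure_lipschitz_image_le)
      fix x y assume "x \<in> A" "y \<in> A"
      then have "x \<in> f ` ball z s" "y \<in> f ` ball z s" using A(2) by (auto simp: V_def)
      then obtain v w where "x = f v" "y = f w" "v \<in> ball z s" "w \<in> ball z s" by (elim imageE)
      then show "dist (fi x) (fi y) \<le> K / ratio z * dist x y"
        using dist_image_le(2)[OF z in_ball in_ball] by simp
    qed (use A K rz in auto)
    finally show "emeasure lborel (ball z s \<inter> f -` A) \<le> ennreal ((2 * K / ratio z) ^ CARD('k + 'p)) * emeasure lborel A"
      using A by (simp add: emeasure_completion)
  qed (use V F in \<open>auto simp: V_def\<close>)
  also have "(\<integral>\<^sup>+x\<in>V. F x \<partial>lborel) \<le> (\<integral>\<^sup>+x\<in>ball (f z) (K * ratio z * s). F x \<partial>lborel)"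
  proof (rule nn_set_integral_set_mono)
    show "V \<subseteq> ball (f z) (K * ratio z * s)"
    proof
      fix x assume "x \<in> V"
      then obtain w where w: "x = f w" "w \<in> ball z s" by (auto simp: V_def)
      have "dist (f z) (f w) \<le> K * ratio z * dist z w"
        using in_ball[OF w(2)] s z r0(1) by (intro dist_image_le(1)[OF z]) auto
      also have "\<dots> < K * ratio z * s" using w K rz by (intro mult_strict_left_mono) auto
      finally show "x \<in> ball (f z) (K * ratio z * s)" using w by simp
    qed
  qed
  finally show ?thesis by (simp add: mult_left_mono)
qed

text \<open>The factors come from the kernel, from the two changes of variables and from the radius
  of the image ball, in this order; all powers of \<open>ratio\<close> have cancelled.\<close>

definition C1 :: "real \<Rightarrow> real" where
  "C1 \<alpha> = K powr (real CARD('k + 'p) + 2 * \<alpha>) * ((2 * K) ^ CARD('k + 'p))\<^sup>2 * K powr (real CARD('k + 'p) - 2 * \<alpha>)"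

lemma Qkernel_comp_le:
  assumes z: "0 < depth z" and x: "dist z x < r0 * depth z" and y: "dist z y < r0 * depth z" and \<alpha>: "0 < \<alpha>"
  shows "Qkernel \<alpha> (u \<circ> f) x y \<le> ennreal ((K * ratio z) powr (real CARD('k + 'p) + 2 * \<alpha>)) * Qkernel \<alpha> u (f x) (f y)"
proof (cases "x = y")
  case False
  let ?e = "real CARD('k + 'p) + 2 * \<alpha>"
  have ne: "f x \<noteq> f y" using False by (metis fi_f)
  have p: "0 < norm (x - y) powr ?e" "0 < norm (f x - f y) powr ?e" using False ne by auto
  have "norm (f x - f y) powr ?e \<le> (K * ratio z * norm (x - y)) powr ?e"
    using dist_image_le(1)[OF z x y] \<alpha> by (intro powr_mono2) (auto simp: dist_norm)
  also have "\<dots> = (K * ratio z) powr ?e * norm (x - y) powr ?e"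
    using K ratio_pos[OF z] by (intro powr_mult)
  finally have le: "norm (f x - f y) powr ?e \<le> (K * ratio z) powr ?e * norm (x - y) powr ?e" .
  have "\<bar>u (f x) - u (f y)\<bar>\<^sup>2 / norm (x - y) powr ?e \<le> (K * ratio z) powr ?e * (\<bar>u (f x) - u (f y)\<bar>\<^sup>2 / norm (f x - f y) powr ?e)"
  proof -
    have "\<bar>u (f x) - u (f y)\<bar>\<^sup>2 * norm (f x - f y) powr ?e \<le> \<bar>u (f x) - u (f y)\<bar>\<^sup>2 * ((K * ratio z) powr ?e * norm (x - y) powr ?e)"
      using le by (intro mult_left_mono) auto
    then show ?thesis using p by (simp add: divide_simps mult_ac)
  qed
  then show ?thesis unfolding Qkernel_def comp_def
    by (subst ennreal_mult[symmetric]) (auto intro: ennreal_leI)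
qed (simp add: Qkernel_def)

text \<open>Both variables are transported to the image ball, where \<open>N\<close> bounds the
  energy of u. The exponents n + 2 * \<alpha>, -n, -n and n - 2 * \<alpha> of \<open>ratio z\<close>
  sum to zero, which makes the constant independent of z.\<close>

lemma Qenergy_comp_whitney_ball:
  assumes z: "0 < depth z" and s: "0 < s" "s \<le> r0 * depth z" and \<alpha>: "0 < \<alpha>"
    and u [measurable]: "u \<in> borel_measurable borel"
    and N: "\<And>x0 r. 0 < r \<Longrightarrow> Qenergy \<alpha> u x0 r \<le> ennreal (r powr (real CARD('k + 'p) - 2 * \<alpha>) * N\<^sup>2)"
  shows "Qenergy \<alpha> (u \<circ> f) z s \<le> ennreal (C1 \<alpha> * s powr (real CARD('k + 'p) - 2 * \<alpha>) * N\<^sup>2)"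
proof -
  let ?n = "real CARD('k + 'p)" and ?W = "ball z s" and ?B = "ball (f z) (K * ratio z * s)"
  define a where "a = ennreal ((K * ratio z) powr (?n + 2 * \<alpha>))"
  define b where "b = ennreal ((2 * K / ratio z) ^ CARD('k + 'p))"
  have rz: "0 < ratio z" by (rule ratio_pos[OF z])
  have Kp: "0 < K" using K by simp
  have in_ball: "dist z w < r0 * depth z" if "w \<in> ball z s" for w using that s by auto
  have inner: "(\<integral>\<^sup>+x\<in>?W. Qkernel \<alpha> (u \<circ> f) x y \<partial>lborel) \<le> a * (b * (\<integral>\<^sup>+x\<in>?B. Qkernel \<alpha> u x (f y) \<partial>lborel))"
    if y: "y \<in> ?W" for y
  proof -
    have "(\<integral>\<^sup>+x\<in>?W. Qkernel \<alpha> (u \<circ> f) x y \<partial>lborel) \<le> (\<integral>\<^sup>+x. a * (Qkernel \<alpha> u (f x) (f y) * indicator ?W x) \<partial>lborel)"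
      unfolding a_def using Qkernel_comp_le[OF z in_ball in_ball[OF y] \<alpha>, of _ u]
      by (intro nn_integral_mono) (auto split: split_indicator)
    also have "\<dots> = a * (\<integral>\<^sup>+x\<in>?W. Qkernel \<alpha> u (f x) (f y) \<partial>lborel)"
      by (rule nn_integral_cmult) measurable
    also have "(\<integral>\<^sup>+x\<in>?W. Qkernel \<alpha> u (f x) (f y) \<partial>lborel) \<le> b * (\<integral>\<^sup>+x\<in>?B. Qkernel \<alpha> u x (f y) \<partial>lborel)"
      unfolding b_def by (rule nn_integral_ball_image_le[OF z s]) measurable
    finally show ?thesis by (simp add: mult_left_mono)
  qed
  have "Qenergy \<alpha> (u \<circ> f) z s \<le> (\<integral>\<^sup>+y. a * (b * ((\<integral>\<^sup>+x\<in>?B. Qkernel \<alpha> u x (f y) \<partial>lborel) * indicator ?W y)) \<partial>lborel)"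
    unfolding Qenergy_def using inner by (intro nn_integral_mono) (auto split: split_indicator)
  also have "\<dots> = a * (b * (\<integral>\<^sup>+y\<in>?W. (\<integral>\<^sup>+x\<in>?B. Qkernel \<alpha> u x (f y) \<partial>lborel) \<partial>lborel))"
    by (rule nn_integral_cmult_cmult) measurable
  also have "(\<integral>\<^sup>+y\<in>?W. (\<integral>\<^sup>+x\<in>?B. Qkernel \<alpha> u x (f y) \<partial>lborel) \<partial>lborel) \<le> b * (\<integral>\<^sup>+y\<in>?B. (\<integral>\<^sup>+x\<in>?B. Qkernel \<alpha> u x y \<partial>lborel) \<partial>lborel)"
    unfolding b_def by (rule nn_integral_ball_image_le[OF z s]) measurable
  also have "(\<integral>\<^sup>+y\<in>?B. (\<integral>\<^sup>+x\<in>?B. Qkernel \<alpha> u x y \<partial>lborel) \<partial>lborel) \<le> ennreal ((K * ratio z * s) powr (?n - 2 * \<alpha>) * N\<^sup>2)"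
    using N[of "K * ratio z * s" "f z"] Kp rz s by (simp add: Qenergy_def)
  finally have "Qenergy \<alpha> (u \<circ> f) z s \<le> a * (b * (b * ennreal ((K * ratio z * s) powr (?n - 2 * \<alpha>) * N\<^sup>2)))"
    by (simp add: mult_left_mono)
  also have "\<dots> = ennreal ((K * ratio z) powr (?n + 2 * \<alpha>) * ((2 * K / ratio z) ^ CARD('k + 'p) * ((2 * K / ratio z) ^ CARD('k + 'p) * ((K * ratio z * s) powr (?n - 2 * \<alpha>) * N\<^sup>2))))"
    unfolding a_def b_def using Kp rz by (subst ennreal_mult[symmetric], simp, simp)+ simp
  also have "(K * ratio z) powr (?n + 2 * \<alpha>) * ((2 * K / ratio z) ^ CARD('k + 'p) * ((2 * K / ratio z) ^ CARD('k + 'p) * ((K * ratio z * s) powr (?n - 2 * \<alpha>) * N\<^sup>2)))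
      = C1 \<alpha> * s powr (?n - 2 * \<alpha>) * N\<^sup>2"
  proof -
    define l where "l = ratio z"
    have l: "0 < l" using rz by (simp add: l_def)
    have "l powr (?n + 2 * \<alpha>) * l powr (?n - 2 * \<alpha>) = l powr ?n * l powr ?n"
      by (simp add: powr_add[symmetric])
    also have "\<dots> = (l ^ CARD('k + 'p)) * (l ^ CARD('k + 'p))" using powr_realpow[OF l, of "CARD('k + 'p)"] by simp
    finally have l1: "l powr (?n + 2 * \<alpha>) * l powr (?n - 2 * \<alpha>) = (l ^ CARD('k + 'p)) * (l ^ CARD('k + 'p))" .
    have e: "(K * l) powr (?n + 2 * \<alpha>) = K powr (?n + 2 * \<alpha>) * l powr (?n + 2 * \<alpha>)"
      "(K * l * s) powr (?n - 2 * \<alpha>) = K powr (?n - 2 * \<alpha>) * l powr (?n - 2 * \<alpha>) * s powr (?n - 2 * \<alpha>)"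
      by (simp_all only: powr_mult)
    define S where "S = s powr (?n - 2 * \<alpha>)"
    define R where "R = (2 * K / l) ^ CARD('k + 'p)"
    have R: "R * (R * (l powr (?n + 2 * \<alpha>) * l powr (?n - 2 * \<alpha>))) = ((2 * K) ^ CARD('k + 'p))\<^sup>2"
      unfolding l1 R_def power_divide using l by (simp add: power2_eq_square)
    have "K powr (?n + 2 * \<alpha>) * l powr (?n + 2 * \<alpha>) * (R * (R * (K powr (?n - 2 * \<alpha>) * l powr (?n - 2 * \<alpha>) * S * N\<^sup>2)))
       = K powr (?n + 2 * \<alpha>) * (R * (R * (l powr (?n + 2 * \<alpha>) * l powr (?n - 2 * \<alpha>)))) * K powr (?n - 2 * \<alpha>) * S * N\<^sup>2"
      by (simp only: mult_ac)
    also have "R * (R * (l powr (?n + 2 * \<alpha>) * l powr (?n - 2 * \<alpha>))) = ((2 * K) ^ CARD('k + 'p))\<^sup>2" by (rule R)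
    finally show ?thesis unfolding l_def[symmetric] e C1_def S_def R_def by (simp only: mult_ac)
  qed
  finally show ?thesis .
qed

end

section \<open>Pairs of points in a common Whitney ball\<close>

lemma nn_integral_lborel_swap:
  fixes F :: "'a::euclidean_space \<Rightarrow> 'b::euclidean_space \<Rightarrow> ennreal"
  assumes "(\<lambda>p. F (fst p) (snd p)) \<in> borel_measurable (borel \<Otimes>\<^sub>M borel)"
  shows "(\<integral>\<^sup>+x. \<integral>\<^sup>+y. F x y \<partial>lborel \<partial>lborel) = (\<integral>\<^sup>+y. \<integral>\<^sup>+x. F x y \<partial>lborel \<partial>lborel)"
proof -
  have "(\<lambda>(x, y). F x y) \<in> borel_measurable (lborel \<Otimes>\<^sub>M lborel)"
    using assms by (simp add: case_prod_beta' cong: measurable_cong_sets sets_pair_measure_cong)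
  from lborel_pair.Fubini'[OF this] show ?thesis by simp
qed

context whitney_map
begin

text \<open>\<open>C2\<close>, \<open>C3\<close> and \<open>C4\<close> are the constants of
  \<open>near_pairs\<close>, \<open>center_exists\<close> and \<open>ctr_adjacent\<close>. Like all
  later ones they are defined before u and N are fixed, which makes the final bound uniform in
  u.\<close>

definition C2 :: "real \<Rightarrow> real \<Rightarrow> real" where
  "C2 \<alpha> CD = 2 ^ CARD('k + 'p) / (unit_ball_vol (real CARD('k + 'p)) * (r0 / 8) ^ CARD('k + 'p)) *
     (C1 \<alpha> * r0 powr (real CARD('k + 'p) - 2 * \<alpha>)) * (CD * 2 powr (real CARD('k + 'p) - 2 * \<alpha>))"

definition C3 :: "real \<Rightarrow> real" where
  "C3 \<alpha> = 2 * (2 powr (real CARD('k + 'p) + 2 * \<alpha>) * C1 \<alpha>) / unit_ball_vol (real CARD('k + 'p))"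

definition C4 :: "real \<Rightarrow> real" where
  "C4 \<alpha> = sqrt (2 * (C3 \<alpha> * (1 + 2 ^ CARD('k + 'p))) / (unit_ball_vol (real CARD('k + 'p)) * (r0 / 4) ^ CARD('k + 'p)))"

lemma C1_pos: "0 < C1 \<alpha>" using K by (auto simp: C1_def intro!: mult_pos_pos)
lemma C3_pos: "0 < C3 \<alpha>" using C1_pos by (auto simp: C3_def intro!: mult_pos_pos divide_pos_pos)
lemma C4_pos: "0 < C4 \<alpha>" using C3_pos r0 by (auto simp: C4_def intro!: mult_pos_pos divide_pos_pos add_pos_pos)

end

text \<open>Here \<open>N\<close> is an upper bound for the Q-norm of \<open>u\<close>; the power of the depth is integrable exactly
  when \<open>2 * \<alpha>\<close> is less than the codimension \<open>CARD('p)\<close>.\<close>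

locale whitney_Q = whitney_map f fi c M
  for f fi :: "real ^ ('k::finite + 'p::finite) \<Rightarrow> real ^ ('k + 'p)" and c M +
  fixes \<alpha> CD N :: real and u :: "real ^ ('k + 'p) \<Rightarrow> real"
  assumes \<alpha>: "0 < \<alpha>" and CD: "0 < CD" and Npos: "0 < N"
    and u [measurable]: "u \<in> borel_measurable borel"
    and depth_integral: "\<And>(x0 :: real ^ ('k + 'p)) r. 0 < r \<Longrightarrow>
      (\<integral>\<^sup>+z\<in>ball x0 r. ennreal (depth z powr (- (2 * \<alpha>))) \<partial>lborel) \<le> ennreal (CD * r powr (real CARD('k + 'p) - 2 * \<alpha>))"
    and N: "\<And>x0 r. 0 < r \<Longrightarrow> Qenergy \<alpha> u x0 r \<le> ennreal (r powr (real CARD('k + 'p) - 2 * \<alpha>) * N\<^sup>2)"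
begin

definition v :: "real ^ ('k + 'p) \<Rightarrow> real" where "v = u \<circ> f"

lemma borel_v [measurable]: "v \<in> borel_measurable borel"
  unfolding v_def comp_def by measurable

lemma Qenergy_v:
  "0 < depth z \<Longrightarrow> 0 < s \<Longrightarrow> s \<le> r0 * depth z \<Longrightarrow> Qenergy \<alpha> v z s \<le> ennreal (C1 \<alpha> * s powr (real CARD('k + 'p) - 2 * \<alpha>) * N\<^sup>2)"
  unfolding v_def by (rule Qenergy_comp_whitney_ball[OF _ _ _ \<alpha> u N])

text \<open>If |x - y| < r0 / 4 * depth x, then both points lie in the Whitney ball of every z
  within r0 / 8 * depth x of x. Averaging over these z and exchanging the integrals leaves Whitney
  energies divided by depth z^n, hence a multiple of depth z powr (- 2 * \<alpha>). The condition on
  x0 keeps the centres z inside the ball of radius 2 * r.\<close>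

lemma near_pairs:
  assumes r: "0 < r" and x0: "r0 * depth x0 \<le> r"
  shows "(\<integral>\<^sup>+x\<in>ball x0 r. (\<integral>\<^sup>+y. (if dist x y < r0 / 4 * depth x then Qkernel \<alpha> v x y else 0) \<partial>lborel) \<partial>lborel)
    \<le> ennreal (C2 \<alpha> CD * r powr (real CARD('k + 'p) - 2 * \<alpha>) * N\<^sup>2)"
proof -
  let ?V = "unit_ball_vol (real CARD('k + 'p))"
  \<comment> \<open>Chosen so that A / (2 * depth x)^n is the reciprocal of the volume of the
    averaging ball; since depth z \<le> 2 * depth x, the density A / depth z^n is at least as large
    and depends on z alone.\<close>
  define A where "A = 2 ^ CARD('k + 'p) / (?V * (r0 / 8) ^ CARD('k + 'p))"
  have A: "A > 0" using r0 by (auto simp: A_def)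
  define T where "T x y z = (if dist x0 z < 2 * r \<and> 0 < depth z \<and> dist z x < r0 * depth z \<and> dist z y < r0 * depth z
      then ennreal (A / depth z ^ CARD('k + 'p)) * Qkernel \<alpha> v x y else 0)" for x y z
  have T1: "(if dist x y < r0 / 4 * depth x then Qkernel \<alpha> v x y else 0) \<le> (\<integral>\<^sup>+z. T x y z \<partial>lborel)"
    if x: "x \<in> ball x0 r" for x y
  proof (cases "dist x y < r0 / 4 * depth x")
    case True
    have dx: "0 < depth x" using True r0 zero_le_dist[of x y] by (smt (verit) depth_nonneg mult_eq_0_iff)
    define t where "t = r0 / 8 * depth x"
    have t: "0 < t" "t \<le> depth x / 128" using r0 dx by (auto simp: t_def)
    have "depth x \<le> depth x0 + r" using depth_dist_le(1)[of x x0] x by (simp add: dist_commute)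
    then have "r0 * depth x \<le> r0 * depth x0 + r0 * r" using r0 by (simp add: distrib_left[symmetric])
    also have "\<dots> \<le> r + 1/16 * r" using x0 r0 r by (intro add_mono mult_right_mono) auto
    finally have tr: "t \<le> r" using r by (simp add: t_def)
    have "Qkernel \<alpha> v x y = ennreal (1 / (?V * t ^ CARD('k + 'p))) * Qkernel \<alpha> v x y * emeasure lborel (ball x t)"
    proof -
      define X where "X = ?V * t ^ CARD('k + 'p)"
      have X: "X > 0" unfolding X_def using t(1) by (intro mult_pos_pos) auto
      have e: "emeasure lborel (ball x t) = ennreal X"
        unfolding X_def using emeasure_ball[of t x] t(1) by simp
      have "ennreal (1 / X) * ennreal X = ennreal (1 / X * X)"
        using X by (intro ennreal_mult[symmetric]) auto
      also have "\<dots> = 1" using X by simp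
      finally have "Qkernel \<alpha> v x y = (ennreal (1 / X) * ennreal X) * Qkernel \<alpha> v x y" by simp
      then show ?thesis unfolding e X_def[symmetric] by (simp only: mult_ac)
    qed
    also have "\<dots> = (\<integral>\<^sup>+z. ennreal (1 / (?V * t ^ CARD('k + 'p))) * Qkernel \<alpha> v x y * indicator (ball x t) z \<partial>lborel)"
      by (rule nn_integral_cmult_indicator[symmetric]) simp
    also have "\<dots> \<le> (\<integral>\<^sup>+z. T x y z \<partial>lborel)"
    proof (rule nn_integral_mono)
      fix z
      show "ennreal (1 / (?V * t ^ CARD('k + 'p))) * Qkernel \<alpha> v x y * indicator (ball x t) z \<le> T x y z"
      proof (cases "z \<in> ball x t")
        case z: True
        have zx: "dist z x < t" using z by (simp add: dist_commute)
        have dz: "depth x \<le> depth z + t" "depth z \<le> depth x + t"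
          using depth_lipschitz[of z x] zx by auto
        have dz2: "depth x / 2 \<le> depth z" "depth z \<le> 2 * depth x" "0 < depth z" using dz t dx by auto
        have tz: "4 * t \<le> r0 * depth z"
        proof -
          have "4 * t = r0 * (depth x / 2)" by (simp add: t_def)
          also have "\<dots> \<le> r0 * depth z" using r0 dz2(1) by (intro mult_left_mono) auto
          finally show ?thesis .
        qed
        have 1: "dist z x < r0 * depth z" using zx tz t(1) by linarith
        have "dist z y \<le> dist z x + dist x y" by (rule dist_triangle)
        also have "\<dots> < t + 2 * t"
        proof -
          have "r0 / 4 * depth x = 2 * t" by (simp add: t_def)
          then show ?thesis using zx True by linarith
        qed
        also have "\<dots> \<le> r0 * depth z" using tz t(1) by linarith
        finally have 2: "dist z y < r0 * depth z" .
        have 3: "dist x0 z < 2 * r" using dist_triangle[of x0 z x] x zx tr by (simp add: dist_commute)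
        have "1 / (?V * t ^ CARD('k + 'p)) = A / (2 * depth x) ^ CARD('k + 'p)"
          using r0 dx by (simp add: A_def t_def power_mult_distrib field_simps)
        also have "\<dots> \<le> A / depth z ^ CARD('k + 'p)"
          using A dz2 by (intro divide_left_mono power_mono mult_pos_pos zero_less_power) auto
        finally have "ennreal (1 / (?V * t ^ CARD('k + 'p))) \<le> ennreal (A / depth z ^ CARD('k + 'p))" by (rule ennreal_leI)
        then show ?thesis using 1 2 3 dz2 z by (simp add: T_def mult_right_mono)
      qed simp
    qed
    finally show ?thesis using True by simp
  qed simp
  have [measurable]: "(\<lambda>p. T (g1 p) (g2 p) (g3 p)) \<in> borel_measurable Q"
    if [measurable]: "g1 \<in> Q \<rightarrow>\<^sub>M borel" "g2 \<in> Q \<rightarrow>\<^sub>M borel" "g3 \<in> Q \<rightarrow>\<^sub>M borel" for g1 g2 g3 and Q :: "'q measure"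
    unfolding T_def by measurable
  have "(\<integral>\<^sup>+x\<in>ball x0 r. (\<integral>\<^sup>+y. (if dist x y < r0 / 4 * depth x then Qkernel \<alpha> v x y else 0) \<partial>lborel) \<partial>lborel)
     \<le> (\<integral>\<^sup>+x. \<integral>\<^sup>+y. \<integral>\<^sup>+z. T x y z \<partial>lborel \<partial>lborel \<partial>lborel)"
    using T1 by (intro nn_integral_mono) (auto split: split_indicator intro!: nn_integral_mono)
  also have "\<dots> = (\<integral>\<^sup>+x. \<integral>\<^sup>+z. \<integral>\<^sup>+y. T x y z \<partial>lborel \<partial>lborel \<partial>lborel)"
    by (intro nn_integral_cong nn_integral_lborel_swap) measurable
  also have "\<dots> = (\<integral>\<^sup>+z. \<integral>\<^sup>+x. \<integral>\<^sup>+y. T x y z \<partial>lborel \<partial>lborel \<partial>lborel)"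
    by (intro nn_integral_lborel_swap) measurable
  also have "\<dots> \<le> (\<integral>\<^sup>+z. ennreal (A * (C1 \<alpha> * r0 powr (real CARD('k + 'p) - 2 * \<alpha>)) * N\<^sup>2) * (ennreal (depth z powr (- (2 * \<alpha>))) * indicator (ball x0 (2 * r)) z) \<partial>lborel)"
  proof (rule nn_integral_mono)
    fix z :: "real ^ ('k + 'p)"
    show "(\<integral>\<^sup>+x. \<integral>\<^sup>+y. T x y z \<partial>lborel \<partial>lborel) \<le> ennreal (A * (C1 \<alpha> * r0 powr (real CARD('k + 'p) - 2 * \<alpha>)) * N\<^sup>2) * (ennreal (depth z powr (- (2 * \<alpha>))) * indicator (ball x0 (2 * r)) z)"
    proof (cases "dist x0 z < 2 * r \<and> 0 < depth z")
      case True
      then have dz: "0 < depth z" by simp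
      have "(\<integral>\<^sup>+x. \<integral>\<^sup>+y. T x y z \<partial>lborel \<partial>lborel)
         = (\<integral>\<^sup>+x. ennreal (A / depth z ^ CARD('k + 'p)) * ((\<integral>\<^sup>+y\<in>ball z (r0 * depth z). Qkernel \<alpha> v y x \<partial>lborel) * indicator (ball z (r0 * depth z)) x) \<partial>lborel)"
      proof (rule nn_integral_cong)
        fix x
        have "(\<integral>\<^sup>+y. T x y z \<partial>lborel) = (\<integral>\<^sup>+y. ennreal (A / depth z ^ CARD('k + 'p)) * indicator (ball z (r0 * depth z)) x * (Qkernel \<alpha> v y x * indicator (ball z (r0 * depth z)) y) \<partial>lborel)"
          by (intro nn_integral_cong) (use True in \<open>auto simp: T_def Qkernel_commute[of \<alpha> v x] split: split_indicator\<close>)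
        also have "\<dots> = ennreal (A / depth z ^ CARD('k + 'p)) * indicator (ball z (r0 * depth z)) x * (\<integral>\<^sup>+y\<in>ball z (r0 * depth z). Qkernel \<alpha> v y x \<partial>lborel)"
          by (rule nn_integral_cmult) measurable
        finally show "(\<integral>\<^sup>+y. T x y z \<partial>lborel) = ennreal (A / depth z ^ CARD('k + 'p)) * ((\<integral>\<^sup>+y\<in>ball z (r0 * depth z). Qkernel \<alpha> v y x \<partial>lborel) * indicator (ball z (r0 * depth z)) x)"
          by (simp add: mult_ac)
      qed
      also have "\<dots> = ennreal (A / depth z ^ CARD('k + 'p)) * Qenergy \<alpha> v z (r0 * depth z)"
        unfolding Qenergy_def by (rule nn_integral_cmult) measurable
      also have "\<dots> \<le> ennreal (A / depth z ^ CARD('k + 'p)) * ennreal (C1 \<alpha> * (r0 * depth z) powr (real CARD('k + 'p) - 2 * \<alpha>) * N\<^sup>2)"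
        using dz r0 by (intro mult_left_mono Qenergy_v) auto
      also have "\<dots> = ennreal (A / depth z ^ CARD('k + 'p) * (C1 \<alpha> * (r0 * depth z) powr (real CARD('k + 'p) - 2 * \<alpha>) * N\<^sup>2))"
        using A dz C1_pos[of \<alpha>] by (intro ennreal_mult[symmetric]) auto
      also have "A / depth z ^ CARD('k + 'p) * (C1 \<alpha> * (r0 * depth z) powr (real CARD('k + 'p) - 2 * \<alpha>) * N\<^sup>2)
          = A * (C1 \<alpha> * r0 powr (real CARD('k + 'p) - 2 * \<alpha>)) * N\<^sup>2 * depth z powr (- (2 * \<alpha>))"
      proof -
        have "depth z powr (real CARD('k + 'p) - 2 * \<alpha>) = depth z powr real CARD('k + 'p) * depth z powr (- (2 * \<alpha>))"
          by (simp add: powr_add[symmetric])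
        also have "depth z powr real CARD('k + 'p) = depth z ^ CARD('k + 'p)" using dz by (rule powr_realpow)
        finally have e: "depth z powr (real CARD('k + 'p) - 2 * \<alpha>) = depth z ^ CARD('k + 'p) * depth z powr (- (2 * \<alpha>))" .
        have "depth z ^ CARD('k + 'p) \<noteq> 0" using dz by simp
        then show ?thesis unfolding powr_mult e by (simp add: field_simps)
      qed
      also have "ennreal (A * (C1 \<alpha> * r0 powr (real CARD('k + 'p) - 2 * \<alpha>)) * N\<^sup>2 * depth z powr (- (2 * \<alpha>)))
         = ennreal (A * (C1 \<alpha> * r0 powr (real CARD('k + 'p) - 2 * \<alpha>)) * N\<^sup>2) * ennreal (depth z powr (- (2 * \<alpha>)))"
        using A C1_pos[of \<alpha>] by (intro ennreal_mult) auto
      finally show ?thesis using True by simp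
    next
      case False
      then have "T x y z = 0" for x y by (auto simp: T_def)
      then show ?thesis by simp
    qed
  qed
  also have "\<dots> = ennreal (A * (C1 \<alpha> * r0 powr (real CARD('k + 'p) - 2 * \<alpha>)) * N\<^sup>2) * (\<integral>\<^sup>+z\<in>ball x0 (2 * r). ennreal (depth z powr (- (2 * \<alpha>))) \<partial>lborel)"
    by (rule nn_integral_cmult) measurable
  also have "\<dots> \<le> ennreal (A * (C1 \<alpha> * r0 powr (real CARD('k + 'p) - 2 * \<alpha>)) * N\<^sup>2) * ennreal (CD * (2 * r) powr (real CARD('k + 'p) - 2 * \<alpha>))"
    using r by (intro mult_left_mono depth_integral) auto
  also have "\<dots> = ennreal (A * (C1 \<alpha> * r0 powr (real CARD('k + 'p) - 2 * \<alpha>)) * N\<^sup>2 * (CD * (2 * r) powr (real CARD('k + 'p) - 2 * \<alpha>)))"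
    using A C1_pos[of \<alpha>] CD by (intro ennreal_mult[symmetric]) auto
  also have "A * (C1 \<alpha> * r0 powr (real CARD('k + 'p) - 2 * \<alpha>)) * N\<^sup>2 * (CD * (2 * r) powr (real CARD('k + 'p) - 2 * \<alpha>)) = C2 \<alpha> CD * r powr (real CARD('k + 'p) - 2 * \<alpha>) * N\<^sup>2"
    unfolding C2_def A_def powr_mult by (simp only: mult_ac)
  finally show ?thesis .
qed

end

section \<open>Chains of Whitney balls\<close>

lemma abs_diff_sq_le: "\<bar>a - c\<bar>\<^sup>2 \<le> 2 * \<bar>a - b\<bar>\<^sup>2 + 2 * \<bar>b - (c::real)\<bar>\<^sup>2"
proof -
  have "0 \<le> ((a - b) - (b - c))\<^sup>2" by simp
  then show ?thesis by (simp add: power2_eq_square algebra_simps)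
qed

text \<open>The function cannot exceed twice its mean bound everywhere. The factor 2 together with A
  > 0 provides the strict contradiction.\<close>

lemma nn_integral_exists_le:
  fixes \<phi> :: "'a::euclidean_space \<Rightarrow> ennreal"
  assumes A: "0 < A" and s: "0 < s" and le: "(\<integral>\<^sup>+y\<in>ball z s. \<phi> y \<partial>lborel) \<le> ennreal A"
  shows "\<exists>y\<in>ball z s. \<phi> y \<le> ennreal (2 * A / (unit_ball_vol (real DIM('a)) * s ^ DIM('a)))"
proof (rule ccontr)
  define X where "X = unit_ball_vol (real DIM('a)) * s ^ DIM('a)"
  have X: "0 < X" using s by (auto simp: X_def)
  assume "\<not> ?thesis"
  then have gt: "ennreal (2 * A / X) \<le> \<phi> y" if "y \<in> ball z s" for y using that by (auto simp: X_def not_le less_imp_le)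
  have "ennreal (2 * A) = ennreal (2 * A / X) * emeasure lborel (ball z s)"
    using s X A by (simp add: emeasure_ball X_def[symmetric] ennreal_mult[symmetric])
  also have "\<dots> = (\<integral>\<^sup>+y. ennreal (2 * A / X) * indicator (ball z s) y \<partial>lborel)"
    by (rule nn_integral_cmult_indicator[symmetric]) simp
  also have "\<dots> \<le> (\<integral>\<^sup>+y\<in>ball z s. \<phi> y \<partial>lborel)"
    using gt by (intro nn_integral_mono) (auto split: split_indicator)
  also have "\<dots> \<le> ennreal A" by (rule le)
  finally show False using A by (simp add: ennreal_le_iff)
qed

text \<open>Two points of the ball are at most 2 * s apart, which bounds the denominator of the
  kernel; on the diagonal both sides vanish.\<close>

lemma square_diff_le_Qkernel:
  fixes w :: "real ^ 'n \<Rightarrow> real"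
  assumes [measurable]: "w \<in> borel_measurable borel" and \<alpha>: "0 < \<alpha>" and y: "y \<in> ball z s"
  shows "(\<integral>\<^sup>+x\<in>ball z s. ennreal (\<bar>w x - w y\<bar>\<^sup>2) \<partial>lborel) \<le>
    ennreal ((2 * s) powr (real CARD('n) + 2 * \<alpha>)) * (\<integral>\<^sup>+x\<in>ball z s. Qkernel \<alpha> w x y \<partial>lborel)" (is "?L \<le> _")
proof -
  let ?e = "real CARD('n) + 2 * \<alpha>"
  have "?L \<le> (\<integral>\<^sup>+x. ennreal ((2 * s) powr ?e) * (Qkernel \<alpha> w x y * indicator (ball z s) x) \<partial>lborel)"
  proof (rule nn_integral_mono)
    fix x
    show "ennreal (\<bar>w x - w y\<bar>\<^sup>2) * indicator (ball z s) x \<le> ennreal ((2 * s) powr ?e) * (Qkernel \<alpha> w x y * indicator (ball z s) x)"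
    proof (cases "x \<in> ball z s \<and> x \<noteq> y")
      case True
      have "norm (x - y) \<le> 2 * s" using True y dist_triangle3[of x y z] by (simp add: dist_norm)
      then have le: "norm (x - y) powr ?e \<le> (2 * s) powr ?e" using \<alpha> by (intro powr_mono2) auto
      have p: "0 < norm (x - y) powr ?e" using True by simp
      have "\<bar>w x - w y\<bar>\<^sup>2 * norm (x - y) powr ?e \<le> \<bar>w x - w y\<bar>\<^sup>2 * (2 * s) powr ?e"
        using le by (intro mult_left_mono) auto
      then have "\<bar>w x - w y\<bar>\<^sup>2 \<le> (2 * s) powr ?e * (\<bar>w x - w y\<bar>\<^sup>2 / norm (x - y) powr ?e)"
        using p by (simp add: field_simps)
      then have "ennreal (\<bar>w x - w y\<bar>\<^sup>2) \<le> ennreal ((2 * s) powr ?e) * Qkernel \<alpha> w x y"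
        unfolding Qkernel_def by (subst ennreal_mult[symmetric]) (auto intro: ennreal_leI)
      then show ?thesis using True by simp
    qed (auto split: split_indicator)
  qed
  also have "\<dots> = ennreal ((2 * s) powr ?e) * (\<integral>\<^sup>+x\<in>ball z s. Qkernel \<alpha> w x y \<partial>lborel)"
    by (rule nn_integral_cmult) measurable
  finally show ?thesis .
qed

context whitney_Q
begin

text \<open>The constant is a value v y at a point y where the inner integral is at most twice its
  average over the ball. The energy s^(n - 2 * \<alpha>) times the kernel factor s^(n + 2 *
  \<alpha>), divided by the volume, leaves s^n. Positivity of N enters through A > 0.\<close>

lemma center_exists:
  assumes z: "0 < depth z"
  shows "\<exists>a. (\<integral>\<^sup>+x\<in>ball z (r0 * depth z). ennreal (\<bar>v x - a\<bar>\<^sup>2) \<partial>lborel) \<le> ennreal (C3 \<alpha> * depth z ^ CARD('k + 'p) * N\<^sup>2)"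
proof -
  define s where "s = r0 * depth z"
  have s: "0 < s" "s \<le> depth z" using z r0 by (auto simp: s_def)
  let ?e = "real CARD('k + 'p) + 2 * \<alpha>"
  define \<phi> where "\<phi> y = (\<integral>\<^sup>+x\<in>ball z s. ennreal (\<bar>v x - v y\<bar>\<^sup>2) \<partial>lborel)" for y
  define A where "A = 2 powr ?e * C1 \<alpha> * s ^ (2 * CARD('k + 'p)) * N\<^sup>2"
  have A: "0 < A" using s C1_pos[of \<alpha>] Npos by (simp add: A_def)
  have \<phi>: "\<phi> y \<le> ennreal ((2 * s) powr ?e) * (\<integral>\<^sup>+x\<in>ball z s. Qkernel \<alpha> v x y \<partial>lborel)" if y: "y \<in> ball z s" for y
    unfolding \<phi>_def using square_diff_le_Qkernel[OF borel_v \<alpha> y] by simp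
  have "(\<integral>\<^sup>+y\<in>ball z s. \<phi> y \<partial>lborel) \<le> (\<integral>\<^sup>+y. ennreal ((2 * s) powr ?e) * ((\<integral>\<^sup>+x\<in>ball z s. Qkernel \<alpha> v x y \<partial>lborel) * indicator (ball z s) y) \<partial>lborel)"
    using \<phi> by (intro nn_integral_mono) (auto split: split_indicator)
  also have "\<dots> = ennreal ((2 * s) powr ?e) * Qenergy \<alpha> v z s"
    unfolding Qenergy_def by (rule nn_integral_cmult) measurable
  also have "\<dots> \<le> ennreal ((2 * s) powr ?e) * ennreal (C1 \<alpha> * s powr (real CARD('k + 'p) - 2 * \<alpha>) * N\<^sup>2)"
    using z s by (intro mult_left_mono Qenergy_v) (auto simp: s_def)
  also have "\<dots> = ennreal ((2 * s) powr ?e * (C1 \<alpha> * s powr (real CARD('k + 'p) - 2 * \<alpha>) * N\<^sup>2))"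
    using C1_pos[of \<alpha>] by (intro ennreal_mult[symmetric]) auto
  also have "(2 * s) powr ?e * (C1 \<alpha> * s powr (real CARD('k + 'p) - 2 * \<alpha>) * N\<^sup>2) = A"
  proof -
    have "s powr ?e * s powr (real CARD('k + 'p) - 2 * \<alpha>) = s powr (real (2 * CARD('k + 'p)))"
      by (simp add: powr_add[symmetric])
    also have "\<dots> = s ^ (2 * CARD('k + 'p))" by (rule powr_realpow[OF s(1)])
    finally have e: "s powr ?e * s powr (real CARD('k + 'p) - 2 * \<alpha>) = s ^ (2 * CARD('k + 'p))" .
    have "(2 * s) powr ?e * (C1 \<alpha> * s powr (real CARD('k + 'p) - 2 * \<alpha>) * N\<^sup>2)
       = 2 powr ?e * C1 \<alpha> * (s powr ?e * s powr (real CARD('k + 'p) - 2 * \<alpha>)) * N\<^sup>2"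
      by (simp only: powr_mult mult_ac)
    then show ?thesis unfolding e A_def .
  qed
  finally have "(\<integral>\<^sup>+y\<in>ball z s. \<phi> y \<partial>lborel) \<le> ennreal A" .
  from nn_integral_exists_le[OF A s(1) this] obtain y where
    y: "\<phi> y \<le> ennreal (2 * A / (unit_ball_vol (real CARD('k + 'p)) * s ^ CARD('k + 'p)))" by auto
  have "2 * A / (unit_ball_vol (real CARD('k + 'p)) * s ^ CARD('k + 'p)) = C3 \<alpha> * s ^ CARD('k + 'p) * N\<^sup>2"
  proof -
    define P where "P = s ^ CARD('k + 'p)"
    define V where "V = unit_ball_vol (real CARD('k + 'p))"
    define E where "E = 2 powr ?e * C1 \<alpha>"
    have P: "0 < P" "s ^ (2 * CARD('k + 'p)) = P * P" using s by (simp_all add: P_def mult_2 power_add)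
    have V: "0 < V" by (simp add: V_def)
    have "2 * (E * (P * P) * N\<^sup>2) / (V * P) = 2 * E / V * P * N\<^sup>2" using P(1) V by (simp add: field_simps)
    then show ?thesis unfolding A_def C3_def P(2) P_def[symmetric] V_def[symmetric] E_def[symmetric] .
  qed
  also have "\<dots> \<le> C3 \<alpha> * depth z ^ CARD('k + 'p) * N\<^sup>2"
    using s C3_pos[of \<alpha>] by (intro mult_right_mono mult_left_mono power_mono) auto
  finally have "\<phi> y \<le> ennreal (C3 \<alpha> * depth z ^ CARD('k + 'p) * N\<^sup>2)" using y by (meson ennreal_leI order_trans)
  then show ?thesis unfolding \<phi>_def s_def by blast
qed

text \<open>A substitute for the mean of \<open>v\<close> over the Whitney ball at \<open>z\<close>: taking any good constant avoids
  showing that \<open>v\<close> is integrable there.\<close>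

definition ctr :: "real ^ ('k + 'p) \<Rightarrow> real" where
  "ctr z = (SOME a. (\<integral>\<^sup>+x\<in>ball z (r0 * depth z). ennreal (\<bar>v x - a\<bar>\<^sup>2) \<partial>lborel) \<le> ennreal (C3 \<alpha> * depth z ^ CARD('k + 'p) * N\<^sup>2))"

lemma ctr:
  assumes "0 < depth z"
  shows "(\<integral>\<^sup>+x\<in>ball z (r0 * depth z). ennreal (\<bar>v x - ctr z\<bar>\<^sup>2) \<partial>lborel) \<le> ennreal (C3 \<alpha> * depth z ^ CARD('k + 'p) * N\<^sup>2)"
  unfolding ctr_def by (rule someI_ex[OF center_exists[OF assms]])

text \<open>The ball of radius t about z lies in both Whitney balls, so both constants approximate v
  there in the mean square sense. The depths differ by at most a factor 2, whence the term 2^n in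
  \<open>C4\<close>.\<close>

lemma ctr_adjacent:
  assumes z: "0 < depth z" and zw: "dist z w \<le> r0 / 4 * depth z"
  shows "\<bar>ctr z - ctr w\<bar> \<le> C4 \<alpha> * N"
proof -
  define t where "t = r0 / 4 * depth z"
  have "r0 * depth z \<le> 1/16 * depth z" using r0 z by (intro mult_right_mono) auto
  then have t: "0 < t" "4 * t \<le> depth z / 16" using r0 z by (auto simp: t_def)
  have zt: "dist z w \<le> t" using zw by (simp add: t_def)
  have dw: "depth z - t \<le> depth w" "depth w \<le> depth z + t" using depth_lipschitz[of z w] zt by auto
  then have dw2: "depth z / 2 \<le> depth w" "depth w \<le> 2 * depth z" using t z by auto
  have dw0: "0 < depth w" using dw2 z by simp
  have tw: "2 * t \<le> r0 * depth w"
  proof -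
    have "2 * t = r0 * (depth z / 2)" by (simp add: t_def)
    also have "\<dots> \<le> r0 * depth w" using dw2 r0 by (intro mult_left_mono) auto
    finally show ?thesis .
  qed
  have sub1: "ball z t \<subseteq> ball z (r0 * depth z)" unfolding t_def using r0 z by (intro subset_ball mult_right_mono) auto
  have sub2: "ball z t \<subseteq> ball w (r0 * depth w)"
  proof
    fix x assume "x \<in> ball z t"
    then show "x \<in> ball w (r0 * depth w)" using dist_triangle3[of w x z] zt tw by (simp add: dist_commute)
  qed
  define X where "X = unit_ball_vol (real CARD('k + 'p)) * t ^ CARD('k + 'p)"
  have X: "0 < X" unfolding X_def using t(1) by (intro mult_pos_pos) auto
  define B where "B = C3 \<alpha> * (1 + 2 ^ CARD('k + 'p)) * depth z ^ CARD('k + 'p) * N\<^sup>2"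
  have B: "0 \<le> B" using C3_pos[of \<alpha>] z by (simp add: B_def)
  have "ennreal (\<bar>ctr z - ctr w\<bar>\<^sup>2 * X) = ennreal (\<bar>ctr z - ctr w\<bar>\<^sup>2) * emeasure lborel (ball z t)"
  proof -
    have e: "emeasure lborel (ball z t) = ennreal X"
      unfolding X_def using emeasure_ball[of t z] t(1) by simp
    show ?thesis unfolding e using X by (intro ennreal_mult) auto
  qed
  also have "\<dots> = (\<integral>\<^sup>+x. ennreal (\<bar>ctr z - ctr w\<bar>\<^sup>2) * indicator (ball z t) x \<partial>lborel)"
    by (rule nn_integral_cmult_indicator[symmetric]) simp
  also have "\<dots> \<le> (\<integral>\<^sup>+x. 2 * (ennreal (\<bar>v x - ctr z\<bar>\<^sup>2) * indicator (ball z (r0 * depth z)) x)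
       + 2 * (ennreal (\<bar>v x - ctr w\<bar>\<^sup>2) * indicator (ball w (r0 * depth w)) x) \<partial>lborel)"
  proof (rule nn_integral_mono)
    fix x
    show "ennreal (\<bar>ctr z - ctr w\<bar>\<^sup>2) * indicator (ball z t) x \<le> 2 * (ennreal (\<bar>v x - ctr z\<bar>\<^sup>2) * indicator (ball z (r0 * depth z)) x)
       + 2 * (ennreal (\<bar>v x - ctr w\<bar>\<^sup>2) * indicator (ball w (r0 * depth w)) x)"
    proof (cases "x \<in> ball z t")
      case True
      have "\<bar>ctr z - ctr w\<bar>\<^sup>2 \<le> 2 * \<bar>v x - ctr z\<bar>\<^sup>2 + 2 * \<bar>v x - ctr w\<bar>\<^sup>2"
        using abs_diff_sq_le[of "ctr z" "ctr w" "v x"] by (simp add: abs_minus_commute)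
      then have "ennreal (\<bar>ctr z - ctr w\<bar>\<^sup>2) \<le> ennreal (2 * \<bar>v x - ctr z\<bar>\<^sup>2 + 2 * \<bar>v x - ctr w\<bar>\<^sup>2)"
        by (rule ennreal_leI)
      also have "\<dots> = 2 * ennreal (\<bar>v x - ctr z\<bar>\<^sup>2) + 2 * ennreal (\<bar>v x - ctr w\<bar>\<^sup>2)"
        by (simp add: ennreal_mult)
      finally show ?thesis using True sub1 sub2 by (simp add: subset_iff)
    qed simp
  qed
  also have "\<dots> = 2 * (\<integral>\<^sup>+x\<in>ball z (r0 * depth z). ennreal (\<bar>v x - ctr z\<bar>\<^sup>2) \<partial>lborel) +
      2 * (\<integral>\<^sup>+x\<in>ball w (r0 * depth w). ennreal (\<bar>v x - ctr w\<bar>\<^sup>2) \<partial>lborel)"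
    by (subst nn_integral_add, measurable, (subst nn_integral_cmult, measurable)+)
  also have "\<dots> \<le> 2 * ennreal (C3 \<alpha> * depth z ^ CARD('k + 'p) * N\<^sup>2) + 2 * ennreal (C3 \<alpha> * depth w ^ CARD('k + 'p) * N\<^sup>2)"
    using z dw0 by (intro add_mono mult_left_mono ctr) auto
  also have "\<dots> \<le> 2 * ennreal (C3 \<alpha> * depth z ^ CARD('k + 'p) * N\<^sup>2) + 2 * ennreal (C3 \<alpha> * (2 * depth z) ^ CARD('k + 'p) * N\<^sup>2)"
    using dw2 C3_pos[of \<alpha>] by (intro add_mono mult_left_mono ennreal_leI mult_right_mono power_mono) auto
  also have "\<dots> = ennreal (2 * (C3 \<alpha> * depth z ^ CARD('k + 'p) * N\<^sup>2) + 2 * (C3 \<alpha> * (2 * depth z) ^ CARD('k + 'p) * N\<^sup>2))"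
  proof -
    have "0 \<le> C3 \<alpha> * depth z ^ CARD('k + 'p) * N\<^sup>2" "0 \<le> C3 \<alpha> * (2 * depth z) ^ CARD('k + 'p) * N\<^sup>2"
      using C3_pos[of \<alpha>] z by auto
    then show ?thesis by (metis (mono_tags, opaque_lifting) ennreal_mult' ennreal_numeral ennreal_plus mult_nonneg_nonneg zero_le_numeral)
  qed
  also have "2 * (C3 \<alpha> * depth z ^ CARD('k + 'p) * N\<^sup>2) + 2 * (C3 \<alpha> * (2 * depth z) ^ CARD('k + 'p) * N\<^sup>2) = 2 * B"
    unfolding B_def power_mult_distrib by (simp only: distrib_left distrib_right mult_1_left mult_1_right mult_ac)
  finally have "\<bar>ctr z - ctr w\<bar>\<^sup>2 * X \<le> 2 * B" using B by (simp add: ennreal_le_iff)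
  also have "2 * B = (C4 \<alpha> * N)\<^sup>2 * X"
  proof -
    define Y where "Y = unit_ball_vol (real CARD('k + 'p)) * (r0 / 4) ^ CARD('k + 'p)"
    have Y: "0 < Y" unfolding Y_def using r0 by (intro mult_pos_pos) auto
    have "(C4 \<alpha>)\<^sup>2 = 2 * (C3 \<alpha> * (1 + 2 ^ CARD('k + 'p))) / Y"
      unfolding C4_def Y_def[symmetric] using C3_pos[of \<alpha>] Y by (intro real_sqrt_pow2) auto
    then have "(C4 \<alpha>)\<^sup>2 * Y = 2 * (C3 \<alpha> * (1 + 2 ^ CARD('k + 'p)))" using Y by simp
    moreover have "X = Y * depth z ^ CARD('k + 'p)" by (simp only: X_def Y_def t_def power_mult_distrib mult_ac)
    ultimately have "(C4 \<alpha> * N)\<^sup>2 * X = 2 * (C3 \<alpha> * (1 + 2 ^ CARD('k + 'p))) * depth z ^ CARD('k + 'p) * N\<^sup>2"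
      by (simp add: power_mult_distrib mult_ac)
    then show ?thesis by (simp only: B_def mult_ac)
  qed
  finally have "\<bar>ctr z - ctr w\<bar>\<^sup>2 * X \<le> (C4 \<alpha> * N)\<^sup>2 * X" .
  then have "\<bar>ctr z - ctr w\<bar>\<^sup>2 \<le> (C4 \<alpha> * N)\<^sup>2" using X by (rule mult_right_le_imp_le)
  then show ?thesis by (rule power2_le_imp_le) (use C4_pos[of \<alpha>] Npos in simp)
qed

text \<open>Walking along the segment in m equal steps, each of length at most r0 / 4 * \<rho>,
  hence at most r0 / 4 times the depth of the current point.\<close>

lemma ctr_chain:
  assumes \<rho>: "0 < \<rho>" and seg: "\<And>z. z \<in> closed_segment x y \<Longrightarrow> \<rho> \<le> depth z" and d: "dist x y \<le> real m * (r0 / 4 * \<rho>)"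
  shows "\<bar>ctr x - ctr y\<bar> \<le> real m * (C4 \<alpha> * N)"
  using seg d
proof (induction m arbitrary: x)
  case 0
  then show ?case by simp
next
  case (Suc m)
  define S where "S = real (Suc m)"
  have S: "0 < S" "S - 1 = real m" "1 \<le> S" by (simp_all add: S_def)
  have dS: "dist x y \<le> S * (r0 / 4 * \<rho>)" using Suc.prems(2) by (simp only: S_def)
  \<comment> \<open>One of S = m + 1 equal steps; the remaining fraction 1 - 1 / S of the segment
    then has exactly the length allowed for m steps.\<close>
  define x1 where "x1 = x + (1 / S) *\<^sub>R (y - x)"
  have x1: "x1 \<in> closed_segment x y" unfolding in_segment
    by (rule exI[of _ "1 / S"]) (use S in \<open>simp add: x1_def algebra_simps\<close>)
  have "x - x1 = (1 / S) *\<^sub>R (x - y)" by (simp add: x1_def algebra_simps)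
  then have "dist x x1 = 1 / S * dist x y" unfolding dist_norm using S by simp
  also have "\<dots> \<le> 1 / S * (S * (r0 / 4 * \<rho>))" using S by (intro mult_left_mono dS) auto
  also have "\<dots> = r0 / 4 * \<rho>" using S by simp
  also have "\<dots> \<le> r0 / 4 * depth x" using Suc.prems(1)[of x] r0 by (intro mult_left_mono) auto
  finally have 1: "\<bar>ctr x - ctr x1\<bar> \<le> C4 \<alpha> * N"
    using Suc.prems(1)[of x] \<rho> by (intro ctr_adjacent) auto
  have "x1 - y = (1 - 1 / S) *\<^sub>R (x - y)" by (simp add: x1_def algebra_simps)
  then have "dist x1 y = (1 - 1 / S) * dist x y" unfolding dist_norm using S by simp
  also have "\<dots> \<le> (1 - 1 / S) * (S * (r0 / 4 * \<rho>))" using S by (intro mult_left_mono dS) auto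
  also have "\<dots> = ((1 - 1 / S) * S) * (r0 / 4 * \<rho>)" by (simp only: mult.assoc)
  also have "(1 - 1 / S) * S = S - 1" using S by (simp add: left_diff_distrib)
  also have "S - 1 = real m" by (rule S(2))
  finally have "\<bar>ctr x1 - ctr y\<bar> \<le> real m * (C4 \<alpha> * N)"
    using Suc.prems(1) subset_closed_segment[of x1 y x y] x1 by (intro Suc.IH) auto
  with 1 have "\<bar>ctr x - ctr y\<bar> \<le> C4 \<alpha> * N + real m * (C4 \<alpha> * N)" by linarith
  then show ?case by (simp add: algebra_simps)
qed

end

section \<open>Reflection in the subspace and displacement across it\<close>

lemma reflect_nth: "reflect z $ Inl a = z $ Inl a" "reflect z $ Inr b = - z $ Inr b"
  by (simp_all add: reflect_def)

lemma reflect_reflect [simp]: "reflect (reflect z) = z"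
  by (simp add: reflect_def vec_eq_iff split: sum.split)

lemma ypart_reflect [simp]: "ypart (reflect z) = - ypart z"
  by (simp add: ypart_def reflect_nth vec_eq_iff)

lemma depth_reflect [simp]: "depth (reflect z) = depth z"
  by (simp add: depth_def)

lemma dist_reflect [simp]: "dist (reflect z) (reflect w) = dist z w"
proof -
  have "(reflect z - reflect w) $ i = (z - w) $ i \<or> (reflect z - reflect w) $ i = - (z - w) $ i" for i
    by (cases i) (auto simp: reflect_nth)
  then have "((reflect z - reflect w) $ i)\<^sup>2 = ((z - w) $ i)\<^sup>2" for i by (metis power2_minus)
  then show ?thesis by (simp only: dist_norm norm_vec_def L2_set_def real_norm_def power2_abs)
qed

lemma borel_reflect [measurable]: "reflect \<in> borel \<rightarrow>\<^sub>M borel"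
proof (rule borel_measurable_continuous_onI, rule lipschitz_on_continuous_on)
  show "1-lipschitz_on UNIV reflect" by (simp add: lipschitz_on_def)
qed

text \<open>Describes moves perpendicular to the subspace. The base point is a full vector, so that
  x itself and its mirror image are both of the form \<open>join x a\<close>.\<close>

definition join :: "real ^ ('k::finite + 'p::finite) \<Rightarrow> real ^ 'p \<Rightarrow> real ^ ('k + 'p)" where
  "join x \<eta> = (\<chi> i. case i of Inl a \<Rightarrow> x $ Inl a | Inr b \<Rightarrow> \<eta> $ b)"

lemma ypart_join [simp]: "ypart (join x \<eta>) = \<eta>"
  by (simp add: join_def ypart_def vec_eq_iff)

lemma join_ypart [simp]: "join x (ypart x) = x"
  by (simp add: join_def ypart_def vec_eq_iff split: sum.split)

lemma join_join [simp]: "join (join x a) b = join x b"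
  by (simp add: join_def vec_eq_iff split: sum.split)

lemma reflect_eq_join: "reflect x = join x (- ypart x)"
  by (simp add: join_def reflect_def ypart_def vec_eq_iff split: sum.split)

lemma dist_join_le: "dist (join x a) (join y b) \<le> dist x y + norm (a - b)"
proof -
  have "(norm (join x a - join y b))\<^sup>2 = (\<Sum>i\<in>UNIV <+> UNIV. ((join x a - join y b) $ i)\<^sup>2)"
    by (simp add: norm_vec_def L2_set_def UNIV_Plus_UNIV sum_nonneg)
  also have "\<dots> = (\<Sum>i\<in>UNIV. ((x - y) $ Inl i)\<^sup>2) + (norm (a - b))\<^sup>2"
    by (subst sum.Plus) (auto simp: join_def norm_vec_def L2_set_def sum_nonneg)
  also have "(\<Sum>i\<in>UNIV. ((x - y) $ Inl i)\<^sup>2) \<le> (\<Sum>i\<in>UNIV <+> UNIV. ((x - y) $ i)\<^sup>2)"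
    by (subst sum.Plus) (auto intro: sum_nonneg)
  also have "\<dots> = (norm (x - y))\<^sup>2"
    by (simp add: norm_vec_def L2_set_def UNIV_Plus_UNIV sum_nonneg)
  finally have "(norm (join x a - join y b))\<^sup>2 \<le> (norm (x - y))\<^sup>2 + (norm (a - b))\<^sup>2" by simp
  also have "\<dots> \<le> (norm (x - y) + norm (a - b))\<^sup>2" by (simp add: power2_sum)
  finally show ?thesis unfolding dist_norm by (rule power2_le_imp_le) simp
qed

lemma dist_reflect_self: "dist z (reflect z) \<le> 2 * depth z"
proof -
  have "dist (join z (ypart z)) (join z (- ypart z)) \<le> dist z z + norm (ypart z - (- ypart z))" by (rule dist_join_le)
  also have "ypart z - (- ypart z) = 2 *\<^sub>R ypart z" by (simp add: scaleR_2)
  finally show ?thesis by (simp add: reflect_eq_join depth_def)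
qed

text \<open>Reflection is an isometry; the factor 2^n is the price of reusing the general Lipschitz
  image bound.\<close>

lemma nn_integral_ball_reflect_le:
  fixes F :: "real ^ ('k::finite + 'p::finite) \<Rightarrow> ennreal"
  assumes F: "F \<in> borel_measurable borel"
  shows "(\<integral>\<^sup>+y\<in>ball z s. F (reflect y) \<partial>lborel) \<le> ennreal (2 ^ CARD('k + 'p)) * (\<integral>\<^sup>+y\<in>ball (reflect z) s. F y \<partial>lborel)"
proof (rule nn_integral_image_le)
  fix A :: "(real ^ ('k + 'p)) set" assume A: "A \<in> sets borel" "A \<subseteq> ball (reflect z) s"
  have eq: "ball z s \<inter> reflect -` A = reflect ` A"
  proof (intro equalityI subsetI)
    fix x assume "x \<in> ball z s \<inter> reflect -` A"
    then show "x \<in> reflect ` A" by (intro image_eqI[of x reflect "reflect x"]) auto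
  next
    fix x assume "x \<in> reflect ` A"
    then obtain y where y: "y \<in> A" "x = reflect y" by auto
    then have "dist (reflect z) y < s" using A(2) by auto
    then show "x \<in> ball z s \<inter> reflect -` A" using y dist_reflect[of "reflect z" y] by simp
  qed
  have b: "ball z s \<inter> reflect -` A \<in> sets borel"
    using measurable_sets[OF borel_reflect A(1)] by auto
  have "emeasure lborel (ball z s \<inter> reflect -` A) = emeasure lebesgue (reflect ` A)"
    using b by (simp add: eq emeasure_completion)
  also have "\<dots> \<le> ennreal ((2 * 1) ^ DIM(real ^ ('k + 'p))) * emeasure lebesgue A"
    using A by (intro emeasure_lipschitz_image_le) auto
  finally show "emeasure lborel (ball z s \<inter> reflect -` A) \<le> ennreal (2 ^ CARD('k + 'p)) * emeasure lborel A"
    using A by (simp add: emeasure_completion)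
next
  show "reflect ` ball z s \<subseteq> ball (reflect z) s" by auto
qed (use F in auto)

context whitney_map
begin

text \<open>The constant of \<open>reflected_oscillation\<close>: two changes of variables, one
  reflection, and the kernel and energy on a ball of radius four times the depth of its
  centre.\<close>

definition Cx :: "real \<Rightarrow> real" where
  "Cx \<alpha> = ((2 * K) ^ CARD('k + 'p))\<^sup>2 * 2 ^ CARD('k + 'p) * (8 powr (real CARD('k + 'p) + 2 * \<alpha>) * 4 powr (real CARD('k + 'p) - 2 * \<alpha>))"

definition C5 :: "real \<Rightarrow> real" where
  "C5 \<alpha> = (let X = unit_ball_vol (real CARD('k + 'p)) * r0 ^ CARD('k + 'p) in
     sqrt ((2 * C3 \<alpha> * X + 4 * Cx \<alpha> + 4 * X * (2 ^ CARD('k + 'p) * C3 \<alpha>)) / X\<^sup>2))"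

end

context whitney_Q
begin

text \<open>Symmetry turns v (reflect y) into u (reflect (f y)). In the image, points near f z are
  thus compared with points near its mirror image; the two image balls lie in the ball of radius 4 *
  \<delta> about f z, as 2 * \<delta> + s' is less than that. This ball crosses the subspace, which
  is allowed because the energy bound for u holds on all balls.\<close>

lemma reflected_oscillation:
  assumes p: "CARD('p) = 1" and z: "0 < depth z"
  shows "(\<integral>\<^sup>+y\<in>ball z (r0 * depth z). (\<integral>\<^sup>+x\<in>ball z (r0 * depth z). ennreal (\<bar>v x - v (reflect y)\<bar>\<^sup>2) \<partial>lborel) \<partial>lborel)
    \<le> ennreal (Cx \<alpha> * depth z ^ (2 * CARD('k + 'p)) * N\<^sup>2)"
proof -
  define s where "s = r0 * depth z"
  define \<delta> where "\<delta> = depth (f z)"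
  have s: "0 < s" "s \<le> r0 * depth z" using z r0 by (auto simp: s_def)
  have \<delta>: "0 < \<delta>" using z by (simp add: \<delta>_def depth_f_pos)
  have rz: "0 < ratio z" by (rule ratio_pos[OF z])
  define b where "b = ennreal ((2 * K / ratio z) ^ CARD('k + 'p))"
  define s' where "s' = K * ratio z * s"
  \<comment> \<open>By the choice of r0 the product K * r0 is c / 4, so the image ball has radius at
    most the depth of its centre.\<close>
  have "s' = (K * r0) * \<delta>" using z by (simp add: s'_def s_def ratio_def \<delta>_def)
  also have "K * r0 = c / 4" using M by (simp add: K_def r0_def)
  also have "c / 4 * \<delta> \<le> 1 * \<delta>" using c \<delta> by (intro mult_right_mono) auto
  finally have s': "s' \<le> \<delta>" by simp
  let ?B = "ball (f z) s'" and ?B2 = "ball (f z) (4 * \<delta>)"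
  have v1: "v x = u (f x)" "v (reflect y) = u (reflect (f y))" for x y
    by (simp_all add: v_def refl[OF p])
  have inner: "(\<integral>\<^sup>+x\<in>ball z s. ennreal (\<bar>v x - v (reflect y)\<bar>\<^sup>2) \<partial>lborel) \<le> b * (\<integral>\<^sup>+x\<in>?B. ennreal (\<bar>u x - u (reflect (f y))\<bar>\<^sup>2) \<partial>lborel)" for y
    unfolding v1(2) unfolding v1(1) b_def s'_def by (rule nn_integral_ball_image_le[OF z s]) measurable
  have "(\<integral>\<^sup>+y\<in>ball z s. (\<integral>\<^sup>+x\<in>ball z s. ennreal (\<bar>v x - v (reflect y)\<bar>\<^sup>2) \<partial>lborel) \<partial>lborel)
     \<le> (\<integral>\<^sup>+y. b * ((\<integral>\<^sup>+x\<in>?B. ennreal (\<bar>u x - u (reflect (f y))\<bar>\<^sup>2) \<partial>lborel) * indicator (ball z s) y) \<partial>lborel)"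
    using inner by (intro nn_integral_mono) (auto split: split_indicator)
  also have "\<dots> = b * (\<integral>\<^sup>+y\<in>ball z s. (\<integral>\<^sup>+x\<in>?B. ennreal (\<bar>u x - u (reflect (f y))\<bar>\<^sup>2) \<partial>lborel) \<partial>lborel)"
    by (rule nn_integral_cmult) measurable
  also have "(\<integral>\<^sup>+y\<in>ball z s. (\<integral>\<^sup>+x\<in>?B. ennreal (\<bar>u x - u (reflect (f y))\<bar>\<^sup>2) \<partial>lborel) \<partial>lborel)
     \<le> b * (\<integral>\<^sup>+y\<in>?B. (\<integral>\<^sup>+x\<in>?B. ennreal (\<bar>u x - u (reflect y)\<bar>\<^sup>2) \<partial>lborel) \<partial>lborel)"
    unfolding b_def s'_def by (rule nn_integral_ball_image_le[OF z s]) measurable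
  also have "(\<integral>\<^sup>+y\<in>?B. (\<integral>\<^sup>+x\<in>?B. ennreal (\<bar>u x - u (reflect y)\<bar>\<^sup>2) \<partial>lborel) \<partial>lborel)
     \<le> ennreal (2 ^ CARD('k + 'p)) * (\<integral>\<^sup>+y\<in>ball (reflect (f z)) s'. (\<integral>\<^sup>+x\<in>?B. ennreal (\<bar>u x - u y\<bar>\<^sup>2) \<partial>lborel) \<partial>lborel)"
    by (rule nn_integral_ball_reflect_le) measurable
  also have "(\<integral>\<^sup>+y\<in>ball (reflect (f z)) s'. (\<integral>\<^sup>+x\<in>?B. ennreal (\<bar>u x - u y\<bar>\<^sup>2) \<partial>lborel) \<partial>lborel)
     \<le> (\<integral>\<^sup>+y\<in>?B2. (\<integral>\<^sup>+x\<in>?B2. ennreal (\<bar>u x - u y\<bar>\<^sup>2) \<partial>lborel) \<partial>lborel)"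
  proof -
    have sub1: "?B \<subseteq> ?B2" using s' \<delta> by (intro subset_ball) auto
    have sub2: "ball (reflect (f z)) s' \<subseteq> ?B2"
    proof
      fix x assume "x \<in> ball (reflect (f z)) s'"
      then have "dist (f z) x < 2 * \<delta> + s'"
        using dist_triangle[of "f z" x "reflect (f z)"] dist_reflect_self[of "f z"] by (simp add: \<delta>_def)
      then show "x \<in> ?B2" using s' \<delta> by simp
    qed
    have le: "(\<integral>\<^sup>+x\<in>?B. ennreal (\<bar>u x - u y\<bar>\<^sup>2) \<partial>lborel) \<le> (\<integral>\<^sup>+x\<in>?B2. ennreal (\<bar>u x - u y\<bar>\<^sup>2) \<partial>lborel)" for y
      by (rule nn_set_integral_set_mono[OF sub1])
    have "(\<integral>\<^sup>+y\<in>ball (reflect (f z)) s'. (\<integral>\<^sup>+x\<in>?B. ennreal (\<bar>u x - u y\<bar>\<^sup>2) \<partial>lborel) \<partial>lborel)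
      \<le> (\<integral>\<^sup>+y\<in>ball (reflect (f z)) s'. (\<integral>\<^sup>+x\<in>?B2. ennreal (\<bar>u x - u y\<bar>\<^sup>2) \<partial>lborel) \<partial>lborel)"
      by (rule nn_integral_mono, rule mult_right_mono, rule le) simp
    also have "\<dots> \<le> (\<integral>\<^sup>+y\<in>?B2. (\<integral>\<^sup>+x\<in>?B2. ennreal (\<bar>u x - u y\<bar>\<^sup>2) \<partial>lborel) \<partial>lborel)"
      by (rule nn_set_integral_set_mono[OF sub2])
    finally show ?thesis .
  qed
  also have "(\<integral>\<^sup>+y\<in>?B2. (\<integral>\<^sup>+x\<in>?B2. ennreal (\<bar>u x - u y\<bar>\<^sup>2) \<partial>lborel) \<partial>lborel)
     \<le> (\<integral>\<^sup>+y. ennreal ((2 * (4 * \<delta>)) powr (real CARD('k + 'p) + 2 * \<alpha>)) * ((\<integral>\<^sup>+x\<in>?B2. Qkernel \<alpha> u x y \<partial>lborel) * indicator ?B2 y) \<partial>lborel)"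
    using square_diff_le_Qkernel[OF u \<alpha>, of _ "f z" "4 * \<delta>"]
    by (intro nn_integral_mono) (auto split: split_indicator)
  also have "\<dots> = ennreal ((2 * (4 * \<delta>)) powr (real CARD('k + 'p) + 2 * \<alpha>)) * Qenergy \<alpha> u (f z) (4 * \<delta>)"
    unfolding Qenergy_def by (rule nn_integral_cmult) measurable
  also have "Qenergy \<alpha> u (f z) (4 * \<delta>) \<le> ennreal ((4 * \<delta>) powr (real CARD('k + 'p) - 2 * \<alpha>) * N\<^sup>2)"
    using \<delta> by (intro N) simp
  finally have "(\<integral>\<^sup>+y\<in>ball z s. (\<integral>\<^sup>+x\<in>ball z s. ennreal (\<bar>v x - v (reflect y)\<bar>\<^sup>2) \<partial>lborel) \<partial>lborel)
     \<le> b * (b * (ennreal (2 ^ CARD('k + 'p)) * (ennreal ((2 * (4 * \<delta>)) powr (real CARD('k + 'p) + 2 * \<alpha>)) *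
        ennreal ((4 * \<delta>) powr (real CARD('k + 'p) - 2 * \<alpha>) * N\<^sup>2))))"
    by (simp add: mult_left_mono)
  also have "\<dots> = ennreal ((2 * K / ratio z) ^ CARD('k + 'p) * ((2 * K / ratio z) ^ CARD('k + 'p) * (2 ^ CARD('k + 'p) *
      ((2 * (4 * \<delta>)) powr (real CARD('k + 'p) + 2 * \<alpha>) * ((4 * \<delta>) powr (real CARD('k + 'p) - 2 * \<alpha>) * N\<^sup>2)))))"
    unfolding b_def using K rz by (subst ennreal_mult[symmetric], simp, simp)+ simp
  also have "(2 * K / ratio z) ^ CARD('k + 'p) * ((2 * K / ratio z) ^ CARD('k + 'p) * (2 ^ CARD('k + 'p) *
      ((2 * (4 * \<delta>)) powr (real CARD('k + 'p) + 2 * \<alpha>) * ((4 * \<delta>) powr (real CARD('k + 'p) - 2 * \<alpha>) * N\<^sup>2))))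
     = Cx \<alpha> * depth z ^ (2 * CARD('k + 'p)) * N\<^sup>2"
  proof -
    let ?n = "CARD('k + 'p)"
    have "\<delta> powr (real ?n + 2 * \<alpha>) * \<delta> powr (real ?n - 2 * \<alpha>) = \<delta> powr real ?n * \<delta> powr real ?n"
      by (simp add: powr_add[symmetric])
    also have "\<dots> = \<delta> ^ ?n * \<delta> ^ ?n" using powr_realpow[OF \<delta>, of ?n] by simp
    finally have d1: "\<delta> powr (real ?n + 2 * \<alpha>) * \<delta> powr (real ?n - 2 * \<alpha>) = \<delta> ^ ?n * \<delta> ^ ?n" .
    have r: "2 * K / ratio z = 2 * K * depth z / \<delta>" by (simp add: ratio_def \<delta>_def)
    have r2: "(2 * K / ratio z) ^ ?n * \<delta> ^ ?n = (2 * K) ^ ?n * depth z ^ ?n"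
      unfolding r using \<delta> by (simp add: power_divide power_mult_distrib)
    have e8: "(2 * (4 * \<delta>)) = 8 * \<delta>" by simp
    have d2: "depth z ^ (2 * ?n) = depth z ^ ?n * depth z ^ ?n" by (simp add: mult_2 power_add)
    define P where "P = \<delta> ^ ?n"
    define Q where "Q = (2 * K / ratio z) ^ ?n"
    define A8 where "A8 = (8::real) powr (real ?n + 2 * \<alpha>)"
    define A4 where "A4 = (4::real) powr (real ?n - 2 * \<alpha>)"
    define D where "D = depth z ^ ?n"
    define K2 where "K2 = (2 * K) ^ ?n"
    have QP: "Q * P = K2 * D" using r2 by (simp only: P_def Q_def D_def K2_def)
    have "Q * (Q * (2 ^ ?n * (A8 * \<delta> powr (real ?n + 2 * \<alpha>) * (A4 * \<delta> powr (real ?n - 2 * \<alpha>) * N\<^sup>2))))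
      = Q * (Q * (2 ^ ?n * (A8 * (A4 * (\<delta> powr (real ?n + 2 * \<alpha>) * \<delta> powr (real ?n - 2 * \<alpha>)) * N\<^sup>2))))"
      by (simp only: mult_ac)
    also have "\<delta> powr (real ?n + 2 * \<alpha>) * \<delta> powr (real ?n - 2 * \<alpha>) = P * P" unfolding P_def by (rule d1)
    also have "Q * (Q * (2 ^ ?n * (A8 * (A4 * (P * P) * N\<^sup>2)))) = (Q * P) * (Q * P) * (2 ^ ?n * (A8 * A4) * N\<^sup>2)"
      by (simp only: mult_ac)
    also have "\<dots> = K2\<^sup>2 * 2 ^ ?n * (A8 * A4) * (D * D) * N\<^sup>2"
      unfolding QP by (simp only: power2_eq_square mult_ac)
    finally show ?thesis
      unfolding Cx_def e8 powr_mult d2 A8_def A4_def Q_def D_def K2_def .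
  qed
  finally show ?thesis unfolding s_def .
qed

text \<open>Insert v x and v (reflect y) between the two constants and integrate over x and y in the
  Whitney ball W at z. The three errors are the deviation at z, the oscillation between the ball and
  its mirror image, and the deviation at reflect z. No chain could join these points when the
  complement is disconnected.\<close>

lemma ctr_reflect:
  assumes p: "CARD('p) = 1" and z: "0 < depth z"
  shows "\<bar>ctr z - ctr (reflect z)\<bar> \<le> C5 \<alpha> * N"
proof -
  let ?n = "CARD('k + 'p)"
  define W where "W = ball z (r0 * depth z)"
  define X where "X = unit_ball_vol (real ?n) * r0 ^ ?n"
  have X: "0 < X" unfolding X_def using r0 by (intro mult_pos_pos) auto
  define D where "D = depth z ^ ?n"
  have D: "0 < D" using z by (simp add: D_def)
  have mW: "emeasure lborel W = ennreal (X * D)"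
  proof -
    have "emeasure lborel W = ennreal (unit_ball_vol (real ?n) * (r0 * depth z) ^ ?n)"
      unfolding W_def using emeasure_ball[of "r0 * depth z" z] r0 z by simp
    then show ?thesis by (simp only: X_def D_def power_mult_distrib mult_ac)
  qed
  define q where "q = \<bar>ctr z - ctr (reflect z)\<bar>\<^sup>2"
  define A where "A = C3 \<alpha> * D * N\<^sup>2"
  have A: "0 \<le> A" using C3_pos[of \<alpha>] D by (simp add: A_def)
  have [measurable]: "W \<in> sets borel" by (simp add: W_def)
  define \<phi> where "\<phi> y = (\<integral>\<^sup>+x\<in>W. ennreal (\<bar>v x - v (reflect y)\<bar>\<^sup>2) \<partial>lborel)" for y
  have [measurable]: "\<phi> \<in> borel_measurable borel" unfolding \<phi>_def by measurable
  define \<psi> where "\<psi> y = ennreal (\<bar>v (reflect y) - ctr (reflect z)\<bar>\<^sup>2)" for y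
  have [measurable]: "\<psi> \<in> borel_measurable borel" unfolding \<psi>_def by measurable
  have 1: "ennreal (q * (X * D)) \<le> 2 * ennreal A + (4 * \<phi> y + 4 * ennreal (X * D) * \<psi> y)" for y
  proof -
    have "ennreal (q * (X * D)) = (\<integral>\<^sup>+x. ennreal q * indicator W x \<partial>lborel)"
      using X D by (subst nn_integral_cmult_indicator) (auto simp: mW q_def ennreal_mult)
    also have "\<dots> \<le> (\<integral>\<^sup>+x. 2 * (ennreal (\<bar>v x - ctr z\<bar>\<^sup>2) * indicator W x) + (4 * (ennreal (\<bar>v x - v (reflect y)\<bar>\<^sup>2) * indicator W x) + 4 * \<psi> y * indicator W x) \<partial>lborel)"
    proof (rule nn_integral_mono)
      fix x
      have "q \<le> 2 * \<bar>v x - ctr z\<bar>\<^sup>2 + 2 * \<bar>v x - ctr (reflect z)\<bar>\<^sup>2"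
        unfolding q_def using abs_diff_sq_le[of "ctr z" "ctr (reflect z)" "v x"] by (simp add: abs_minus_commute)
      also have "\<bar>v x - ctr (reflect z)\<bar>\<^sup>2 \<le> 2 * \<bar>v x - v (reflect y)\<bar>\<^sup>2 + 2 * \<bar>v (reflect y) - ctr (reflect z)\<bar>\<^sup>2"
        by (rule abs_diff_sq_le)
      finally have "q \<le> 2 * \<bar>v x - ctr z\<bar>\<^sup>2 + (4 * \<bar>v x - v (reflect y)\<bar>\<^sup>2 + 4 * \<bar>v (reflect y) - ctr (reflect z)\<bar>\<^sup>2)" by simp
      then have "ennreal q \<le> ennreal (2 * \<bar>v x - ctr z\<bar>\<^sup>2 + (4 * \<bar>v x - v (reflect y)\<bar>\<^sup>2 + 4 * \<bar>v (reflect y) - ctr (reflect z)\<bar>\<^sup>2))"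
        by (rule ennreal_leI)
      also have "\<dots> = 2 * ennreal (\<bar>v x - ctr z\<bar>\<^sup>2) + (4 * ennreal (\<bar>v x - v (reflect y)\<bar>\<^sup>2) + 4 * \<psi> y)"
        by (simp add: \<psi>_def ennreal_mult)
      finally show "ennreal q * indicator W x \<le> 2 * (ennreal (\<bar>v x - ctr z\<bar>\<^sup>2) * indicator W x) + (4 * (ennreal (\<bar>v x - v (reflect y)\<bar>\<^sup>2) * indicator W x) + 4 * \<psi> y * indicator W x)"
        by (simp split: split_indicator)
    qed
    also have "\<dots> = (\<integral>\<^sup>+x. 2 * (ennreal (\<bar>v x - ctr z\<bar>\<^sup>2) * indicator W x) \<partial>lborel) + ((\<integral>\<^sup>+x. 4 * (ennreal (\<bar>v x - v (reflect y)\<bar>\<^sup>2) * indicator W x) \<partial>lborel) + (\<integral>\<^sup>+x. 4 * \<psi> y * indicator W x \<partial>lborel))"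
      by (subst nn_integral_add, measurable)+
    also have "(\<integral>\<^sup>+x. 2 * (ennreal (\<bar>v x - ctr z\<bar>\<^sup>2) * indicator W x) \<partial>lborel) = 2 * (\<integral>\<^sup>+x\<in>W. ennreal (\<bar>v x - ctr z\<bar>\<^sup>2) \<partial>lborel)"
      by (rule nn_integral_cmult) measurable
    also have "(\<integral>\<^sup>+x\<in>W. ennreal (\<bar>v x - ctr z\<bar>\<^sup>2) \<partial>lborel) \<le> ennreal A"
      unfolding W_def A_def D_def by (rule ctr[OF z])
    also have "(\<integral>\<^sup>+x. 4 * (ennreal (\<bar>v x - v (reflect y)\<bar>\<^sup>2) * indicator W x) \<partial>lborel) = 4 * \<phi> y"
      unfolding \<phi>_def by (rule nn_integral_cmult) measurable
    also have "(\<integral>\<^sup>+x. 4 * \<psi> y * indicator W x \<partial>lborel) = 4 * ennreal (X * D) * \<psi> y"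
      by (subst nn_integral_cmult_indicator) (auto simp: mW mult_ac)
    finally show ?thesis by (simp add: mult_left_mono)
  qed
  have "ennreal (q * (X * D) * (X * D)) = (\<integral>\<^sup>+y. ennreal (q * (X * D)) * indicator W y \<partial>lborel)"
    using X D by (subst nn_integral_cmult_indicator) (auto simp: mW q_def ennreal_mult)
  also have "\<dots> \<le> (\<integral>\<^sup>+y. 2 * ennreal A * indicator W y + (4 * (\<phi> y * indicator W y) + 4 * ennreal (X * D) * (\<psi> y * indicator W y)) \<partial>lborel)"
    using 1 by (intro nn_integral_mono) (auto split: split_indicator)
  also have "\<dots> = (\<integral>\<^sup>+y. 2 * ennreal A * indicator W y \<partial>lborel) + ((\<integral>\<^sup>+y. 4 * (\<phi> y * indicator W y) \<partial>lborel) + (\<integral>\<^sup>+y. 4 * ennreal (X * D) * (\<psi> y * indicator W y) \<partial>lborel))"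
    by (subst nn_integral_add, measurable)+
  also have "(\<integral>\<^sup>+y. 2 * ennreal A * indicator W y \<partial>lborel) = 2 * ennreal A * ennreal (X * D)"
    by (subst nn_integral_cmult_indicator) (auto simp: mW)
  also have "(\<integral>\<^sup>+y. 4 * (\<phi> y * indicator W y) \<partial>lborel) = 4 * (\<integral>\<^sup>+y\<in>W. \<phi> y \<partial>lborel)"
    by (rule nn_integral_cmult) measurable
  also have "(\<integral>\<^sup>+y\<in>W. \<phi> y \<partial>lborel) \<le> ennreal (Cx \<alpha> * (D * D) * N\<^sup>2)"
  proof -
    have DD: "depth z ^ (2 * ?n) = D * D" unfolding D_def mult_2 by (rule power_add)
    show ?thesis unfolding \<phi>_def W_def by (rule reflected_oscillation[OF p z, unfolded DD])
  qed
  also have "(\<integral>\<^sup>+y. 4 * ennreal (X * D) * (\<psi> y * indicator W y) \<partial>lborel) = 4 * ennreal (X * D) * (\<integral>\<^sup>+y\<in>W. \<psi> y \<partial>lborel)"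
    by (rule nn_integral_cmult) measurable
  also have "(\<integral>\<^sup>+y\<in>W. \<psi> y \<partial>lborel) \<le> ennreal (2 ^ ?n) * (\<integral>\<^sup>+y\<in>ball (reflect z) (r0 * depth z). ennreal (\<bar>v y - ctr (reflect z)\<bar>\<^sup>2) \<partial>lborel)"
    unfolding \<psi>_def W_def by (rule nn_integral_ball_reflect_le) measurable
  also have "(\<integral>\<^sup>+y\<in>ball (reflect z) (r0 * depth z). ennreal (\<bar>v y - ctr (reflect z)\<bar>\<^sup>2) \<partial>lborel) \<le> ennreal A"
    using ctr[of "reflect z"] z by (simp add: A_def D_def)
  finally have "ennreal (q * (X * D) * (X * D)) \<le> 2 * ennreal A * ennreal (X * D) + (4 * ennreal (Cx \<alpha> * (D * D) * N\<^sup>2) + 4 * ennreal (X * D) * (ennreal (2 ^ ?n) * ennreal A))"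
    by (simp add: mult_left_mono add_mono)
  also have "\<dots> = ennreal (2 * A * (X * D) + (4 * (Cx \<alpha> * (D * D) * N\<^sup>2) + 4 * (X * D) * (2 ^ ?n * A)))"
  proof -
    have Cx0: "0 \<le> Cx \<alpha> * (D * D) * N\<^sup>2" using D by (simp add: Cx_def)
    have n0: "0 \<le> X * D" "0 \<le> 2 ^ ?n * A" using X D A by auto
    have "2 * ennreal A * ennreal (X * D) = ennreal (2 * A * (X * D))" using A n0 by (simp add: ennreal_mult)
    moreover have "4 * ennreal (Cx \<alpha> * (D * D) * N\<^sup>2) = ennreal (4 * (Cx \<alpha> * (D * D) * N\<^sup>2))"
      using Cx0 by (subst ennreal_mult) auto
    moreover have "4 * ennreal (X * D) * (ennreal (2 ^ ?n) * ennreal A) = ennreal (4 * (X * D) * (2 ^ ?n * A))"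
    proof -
      have "ennreal (4 * (X * D) * (2 ^ ?n * A)) = ennreal (4 * (X * D)) * ennreal (2 ^ ?n * A)" using n0 by (intro ennreal_mult) auto
      also have "ennreal (4 * (X * D)) = 4 * ennreal (X * D)" using n0 by (subst ennreal_mult) auto
      also have "ennreal (2 ^ ?n * A) = ennreal (2 ^ ?n) * ennreal A" using A by (intro ennreal_mult) auto
      finally show ?thesis ..
    qed
    ultimately show ?thesis using A n0 Cx0 by (simp only: ennreal_plus[symmetric] mult_nonneg_nonneg zero_le_numeral add_nonneg_nonneg)
  qed
  finally have "q * (X * D) * (X * D) \<le> 2 * A * (X * D) + (4 * (Cx \<alpha> * (D * D) * N\<^sup>2) + 4 * (X * D) * (2 ^ ?n * A))"
    using X D A by (subst (asm) ennreal_le_iff) (auto simp: Cx_def)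
  then have "(q * X\<^sup>2) * (D * D) \<le> ((2 * C3 \<alpha> * X + 4 * Cx \<alpha> + 4 * X * (2 ^ ?n * C3 \<alpha>)) * N\<^sup>2) * (D * D)"
    by (simp only: A_def power2_eq_square distrib_right distrib_left mult_ac add_ac)
  then have "q * X\<^sup>2 \<le> (2 * C3 \<alpha> * X + 4 * Cx \<alpha> + 4 * X * (2 ^ ?n * C3 \<alpha>)) * N\<^sup>2"
    by (rule mult_right_le_imp_le) (use D in simp)
  then have "q \<le> (2 * C3 \<alpha> * X + 4 * Cx \<alpha> + 4 * X * (2 ^ ?n * C3 \<alpha>)) / X\<^sup>2 * N\<^sup>2"
    using X by (simp add: pos_le_divide_eq)
  also have "\<dots> = (C5 \<alpha> * N)\<^sup>2"
    unfolding C5_def Let_def X_def[symmetric] power_mult_distrib using X C3_pos[of \<alpha>]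
    by (subst real_sqrt_pow2) (auto simp: Cx_def intro!: divide_nonneg_nonneg add_nonneg_nonneg mult_nonneg_nonneg)
  finally have "\<bar>ctr z - ctr (reflect z)\<bar>\<^sup>2 \<le> (C5 \<alpha> * N)\<^sup>2" unfolding q_def .
  moreover have "0 \<le> C5 \<alpha> * N" using Npos C3_pos[of \<alpha>] X
    unfolding C5_def Let_def X_def[symmetric]
    by (intro mult_nonneg_nonneg real_sqrt_ge_zero divide_nonneg_nonneg add_nonneg_nonneg) (auto simp: Cx_def)
  ultimately show ?thesis by (rule power2_le_imp_le)
qed

end

text \<open>Bernoulli's inequality. With q slightly above 1 it trades a number of doublings for a
  small power of the factor gained by them.\<close>

lemma linear_le_geometric:
  assumes q: "1 < (q::real)"
  shows "real k + 1 \<le> (1 + 1 / (q - 1)) * q ^ k"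
proof -
  define x where "x = q - 1"
  have x: "0 < x" "q = 1 + x" using q by (auto simp: x_def)
  have b: "1 + real k * x \<le> q ^ k" using Bernoulli_inequality[of x k] x by simp
  have "real k = (real k * x) / x" using x by simp
  also have "\<dots> \<le> (q ^ k) / x" using b x by (intro divide_right_mono) auto
  finally have "real k \<le> 1 / x * q ^ k" by simp
  moreover have "1 \<le> q ^ k" using q by simp
  ultimately have "real k + 1 \<le> 1 / x * q ^ k + q ^ k" by linarith
  then show ?thesis by (simp add: x_def distrib_right add.commute)
qed

text \<open>An intermediate direction that makes an angle of at most ninety degrees with both a and
  b; the sign of \<eta> is free and settles the second condition.\<close>

lemma exists_orthogonal_vector:
  fixes a b :: "real ^ 'p::finite"
  assumes p: "CARD('p) \<noteq> 1" and d: "0 < d"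
  obtains \<eta> where "norm \<eta> = d" "a \<bullet> \<eta> = 0" "0 \<le> \<eta> \<bullet> b"
proof -
  have "2 \<le> CARD('p)" using p zero_less_card_finite[where 'a='p] by linarith
  then have "2 \<le> DIM(real ^ 'p)" by simp
  then obtain y where y: "y \<noteq> 0" "orthogonal a y" using orthogonal_to_vector_exists by metis
  define \<eta> where "\<eta> = (d / norm y) *\<^sub>R y"
  have \<eta>: "norm \<eta> = d" "a \<bullet> \<eta> = 0" using y d by (auto simp: \<eta>_def orthogonal_def)
  show thesis
  proof (cases "0 \<le> \<eta> \<bullet> b")
    case True
    then show ?thesis using that \<eta> by blast
  next
    case False
    then show ?thesis using that[of "-\<eta>"] \<eta> by simp
  qed
qed

text \<open>Without an obtuse angle the cross term is nonnegative, and (1 - t)^2 + t^2 is at least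
  1/2, more than the 1/4 required.\<close>

lemma norm_convex_combination_ge:
  fixes a b :: "'a::real_inner"
  assumes "d \<le> norm a" "d \<le> norm b" "0 \<le> a \<bullet> b" "0 \<le> t" "t \<le> 1" "0 \<le> d"
  shows "d / 2 \<le> norm ((1 - t) *\<^sub>R a + t *\<^sub>R b)"
proof -
  have "(norm ((1 - t) *\<^sub>R a + t *\<^sub>R b))\<^sup>2 = (1 - t)\<^sup>2 * (norm a)\<^sup>2 + 2 * (t * (1 - t) * (a \<bullet> b)) + t\<^sup>2 * (norm b)\<^sup>2"
    unfolding power2_norm_eq_inner inner_add_left inner_add_right inner_scaleR_left inner_scaleR_right inner_commute[of b a]
    by (simp add: power2_eq_square algebra_simps)
  also have "\<dots> \<ge> (1 - t)\<^sup>2 * d\<^sup>2 + 0 + t\<^sup>2 * d\<^sup>2"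
    using assms by (intro add_mono mult_left_mono power_mono) auto
  also have "(1 - t)\<^sup>2 * d\<^sup>2 + 0 + t\<^sup>2 * d\<^sup>2 = (1/2 + 2 * (t - 1/2)\<^sup>2) * d\<^sup>2"
    by (simp add: power2_eq_square algebra_simps)
  finally have "(1/2 + 2 * (t - 1/2)\<^sup>2) * d\<^sup>2 \<le> (norm ((1 - t) *\<^sub>R a + t *\<^sub>R b))\<^sup>2" .
  moreover have "1/4 * d\<^sup>2 \<le> (1/2 + 2 * (t - 1/2)\<^sup>2) * d\<^sup>2" by (intro mult_right_mono) auto
  ultimately have "(d / 2)\<^sup>2 \<le> (norm ((1 - t) *\<^sub>R a + t *\<^sub>R b))\<^sup>2" by (simp add: power_divide)
  then show ?thesis by (rule power2_le_imp_le) simp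
qed

section \<open>Logarithmic chains between points that are far apart\<close>

context whitney_map
begin

text \<open>Enough steps of length r0 / 4 * (d / 2) to cover the distance (2 + 16 / r0) * d. Such a
  distance occurs between points at heights up to 8 / r0 * d over base points at most d
  apart.\<close>

definition steps :: nat where "steps = nat \<lceil>(2 + 16 / r0) * (8 / r0)\<rceil>"

text \<open>Covers either one chain of bounded length or one jump to the mirror image.\<close>

definition C6 :: "real \<Rightarrow> real" where "C6 \<alpha> = real steps * C4 \<alpha> + \<bar>C5 \<alpha>\<bar>"

text \<open>The bracket bounds k + 1 by a multiple of 2 powr (\<alpha> / 2 * k), the last factor
  accounts for 2^k being at most 8 / r0 times the relative distance, and the leading 2 comes from
  squaring a sum.\<close>

definition C7 :: "real \<Rightarrow> real" where
  "C7 \<alpha> = 2 * (C6 \<alpha> * (1 + 1 / (2 powr (\<alpha> / 2) - 1)))\<^sup>2 * (8 / r0) powr \<alpha>"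

lemma C6_nonneg: "0 \<le> C6 \<alpha>" using C4_pos[of \<alpha>] by (simp add: C6_def)
lemma C7_nonneg: "0 \<le> C7 \<alpha>" by (simp add: C7_def)

text \<open>Raising a point by doublings until its height is comparable with d. If the height a
  already exceeds d, no doubling is made and \<open>ad\<close> limits the excess.\<close>

lemma dilation_count:
  assumes a: "0 < a" and d: "0 < d" and ad: "r0 / 4 * a \<le> d"
  obtains k :: nat where "d \<le> 2 ^ k * a" "2 ^ k * a \<le> 8 / r0 * d"
proof (cases "d \<le> a")
  case True
  have "a \<le> 4 / r0 * d" using ad r0 by (simp add: field_simps)
  also have "\<dots> \<le> 8 / r0 * d" using r0 d by (intro mult_right_mono divide_right_mono) auto
  finally show ?thesis using that[of 0] True by simp
next
  case False
  then obtain k :: nat where k: "2 ^ k \<le> d / a" "d / a < 2 ^ Suc k"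
    using dyadic_scale[of "d / a"] a by auto
  have 1: "d \<le> 2 ^ Suc k * a" using k(2) a by (simp add: field_simps)
  have "2 ^ k * a \<le> d" using k(1) a by (simp add: field_simps)
  then have "2 ^ Suc k * a \<le> 2 * d" by simp
  also have "\<dots> \<le> 8 / r0 * d"
  proof (rule mult_right_mono)
    show "2 \<le> 8 / r0" using r0 by (simp add: field_simps)
  qed (use d in simp)
  finally show ?thesis using that[of "Suc k"] 1 by simp
qed

end

context whitney_Q
begin

text \<open>The nonnegative scalar product keeps the whole segment at depth at least d / 2, so a
  chain with a fixed number of links works.\<close>

lemma ctr_join_le:
  assumes d: "0 < d" and a: "d \<le> norm a" and b: "d \<le> norm b" and ab: "0 \<le> a \<bullet> b"
    and dist: "dist (join x a) (join y b) \<le> (2 + 16 / r0) * d"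
  shows "\<bar>ctr (join x a) - ctr (join y b)\<bar> \<le> real steps * (C4 \<alpha> * N)"
proof (rule ctr_chain[of "d / 2"])
  fix z assume "z \<in> closed_segment (join x a) (join y b)"
  then obtain t where t: "0 \<le> t" "t \<le> 1" "z = (1 - t) *\<^sub>R join x a + t *\<^sub>R join y b"
    by (auto simp: in_segment)
  then have "ypart z = (1 - t) *\<^sub>R a + t *\<^sub>R b" by simp
  then show "d / 2 \<le> depth z"
    unfolding depth_def using norm_convex_combination_ge[OF a b ab t(1,2)] d by simp
next
  have "(2 + 16 / r0) * (8 / r0) \<le> real steps" unfolding steps_def by (rule real_nat_ceiling_ge)
  then have "(2 + 16 / r0) * (8 / r0) * (r0 / 4 * (d / 2)) \<le> real steps * (r0 / 4 * (d / 2))"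
    using r0 d by (intro mult_right_mono) auto
  moreover have "(2 + 16 / r0) * (8 / r0) * (r0 / 4 * (d / 2)) = (2 + 16 / r0) * d"
    using r0(1) by simp
  ultimately show "dist (join x a) (join y b) \<le> real steps * (r0 / 4 * (d / 2))" using dist by linarith
qed (use d in simp)

text \<open>One doubling of the height costs boundedly many Whitney balls at every scale, hence k
  doublings cost k times as many.\<close>

lemma ctr_dilation:
  assumes a: "a \<noteq> 0"
  shows "\<bar>ctr (join x a) - ctr (join x ((2 ^ k) *\<^sub>R a))\<bar> \<le> real k * (real steps * (C4 \<alpha> * N))"
proof (induction k)
  case 0
  then show ?case by simp
next
  case (Suc k)
  define b where "b = (2 ^ k) *\<^sub>R a"
  have b2: "(2 ^ Suc k) *\<^sub>R a = 2 *\<^sub>R b" by (simp add: b_def)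
  have nb: "0 < norm b" using a by (simp add: b_def)
  have "\<bar>ctr (join x b) - ctr (join x (2 *\<^sub>R b))\<bar> \<le> real steps * (C4 \<alpha> * N)"
  proof (rule ctr_join_le[of "norm b"])
    have "dist (join x b) (join x (2 *\<^sub>R b)) \<le> dist x x + norm (b - 2 *\<^sub>R b)" by (rule dist_join_le)
    also have "b - 2 *\<^sub>R b = - b" by (simp add: scaleR_2)
    also have "dist x x + norm (- b) = 1 * norm b" by simp
    also have "1 * norm b \<le> (2 + 16 / r0) * norm b" using r0(1) by (intro mult_right_mono) auto
    finally show "dist (join x b) (join x (2 *\<^sub>R b)) \<le> (2 + 16 / r0) * norm b" .
  qed (use nb in auto)
  with Suc have "\<bar>ctr (join x a) - ctr (join x (2 *\<^sub>R b))\<bar> \<le> real k * (real steps * (C4 \<alpha> * N)) + real steps * (C4 \<alpha> * N)"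
    unfolding b_def[symmetric] by linarith
  then show ?case unfolding b2 by (simp add: algebra_simps)
qed

text \<open>Only an obtuse angle between a and b is a problem, as the segment may then approach the
  subspace. In codimension one, -b makes an acute angle and the mirror image is reached by
  \<open>ctr_reflect\<close>; in higher codimension an orthogonal \<eta> of length d serves as a
  stopover.\<close>

lemma ctr_same_height:
  assumes d: "0 < d" and a: "d \<le> norm a" "norm a \<le> 8 / r0 * d" and b: "d \<le> norm b" "norm b \<le> 8 / r0 * d"
    and xy: "dist x y \<le> d"
  shows "\<bar>ctr (join x a) - ctr (join y b)\<bar> \<le> 2 * (C6 \<alpha> * N)"
proof -
  have N0: "0 \<le> N" and C40: "0 \<le> C4 \<alpha>" using Npos C4_pos[of \<alpha>] by auto
  have steps: "real steps * (C4 \<alpha> * N) \<le> C6 \<alpha> * N"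
    using N0 by (simp add: C6_def distrib_right)
  have ds: "dist (join x' a') (join y' b') \<le> (2 + 16 / r0) * d"
    if "norm a' \<le> 8 / r0 * d" "norm b' \<le> 8 / r0 * d" "dist x' y' \<le> d" for x' y' a' b'
  proof -
    have "dist (join x' a') (join y' b') \<le> d + (8 / r0 * d + 8 / r0 * d)"
      using dist_join_le[of x' a' y' b'] norm_triangle_ineq4[of a' b'] that by linarith
    also have "\<dots> = (1 + 16 / r0) * d" by (simp add: algebra_simps)
    also have "\<dots> \<le> (2 + 16 / r0) * d" using d by (intro mult_right_mono) auto
    finally show ?thesis .
  qed
  show ?thesis
  proof (cases "0 \<le> a \<bullet> b")
    case True
    have "\<bar>ctr (join x a) - ctr (join y b)\<bar> \<le> real steps * (C4 \<alpha> * N)"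
      by (rule ctr_join_le[OF d a(1) b(1) True ds[OF a(2) b(2) xy]])
    moreover have "0 \<le> C6 \<alpha> * N" using N0 C6_nonneg by simp
    ultimately show ?thesis using steps by linarith
  next
    case False
    show ?thesis
    proof (cases "CARD('p) = 1")
      case True
      have ab: "0 \<le> a \<bullet> (- b)" using False by simp
      have "\<bar>ctr (join x a) - ctr (join y (- b))\<bar> \<le> real steps * (C4 \<alpha> * N)"
        using b by (intro ctr_join_le[OF d a(1) _ ab] ds xy a) auto
      moreover have "0 < norm b" using b d by linarith
      then have "\<bar>ctr (join y b) - ctr (reflect (join y b))\<bar> \<le> C5 \<alpha> * N"
        by (intro ctr_reflect True) (simp add: depth_def)
      moreover have "reflect (join y b) = join y (- b)" by (simp add: reflect_eq_join)
      moreover have "C5 \<alpha> * N \<le> C6 \<alpha> * N" using N0 C40 by (intro mult_right_mono) (auto simp: C6_def add_increasing)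
      ultimately show ?thesis using steps by (smt (verit))
    next
      case p: False
      obtain \<eta> where \<eta>: "norm \<eta> = d" "a \<bullet> \<eta> = 0" "0 \<le> \<eta> \<bullet> b" using exists_orthogonal_vector[OF p d] by metis
      have "1 * d \<le> 8 / r0 * d" using r0 d by (intro mult_right_mono) auto
      then have \<eta>2: "norm \<eta> \<le> 8 / r0 * d" using \<eta> by simp
      have "\<bar>ctr (join x a) - ctr (join x \<eta>)\<bar> \<le> real steps * (C4 \<alpha> * N)"
        using \<eta> \<eta>2 d by (intro ctr_join_le[OF d a(1)] ds a) auto
      moreover have "\<bar>ctr (join x \<eta>) - ctr (join y b)\<bar> \<le> real steps * (C4 \<alpha> * N)"
        using \<eta> \<eta>2 d by (intro ctr_join_le[OF d _ b(1)] ds b xy) auto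
      ultimately show ?thesis using steps by linarith
    qed
  qed
qed

text \<open>Both points are lifted to heights comparable with their distance and compared there. The
  total number of links is linear in the numbers k and l of doublings, i.e. logarithmic in the
  relative distances.\<close>

lemma ctr_far:
  assumes x: "0 < depth x" and y: "0 < depth y"
    and dx: "r0 / 4 * depth x \<le> dist x y" and dy: "r0 / 4 * depth y \<le> dist x y"
  shows "\<bar>ctr x - ctr y\<bar>\<^sup>2 \<le> C7 \<alpha> * N\<^sup>2 * ((dist x y / depth x) powr \<alpha> + (dist x y / depth y) powr \<alpha>)"
proof -
  define d where "d = dist x y"
  have "0 < r0 / 4 * depth x" using r0 x by simp
  then have d: "0 < d" using dx unfolding d_def by linarith
  \<comment> \<open>The exponent is halved so that the square of the chain length is bounded by the
    power \<alpha>. This leaves the kernel tail integrable and finally gives depth powr (- 2 *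
    \<alpha>).\<close>
  define q where "q = 2 powr (\<alpha> / 2)"
  have q: "1 < q" using \<alpha> by (simp add: q_def)
  define B where "B = 1 + 1 / (q - 1)"
  have B: "0 < B" using q by (simp add: B_def add_pos_pos)
  have N0: "0 \<le> C6 \<alpha> * N" using Npos C6_nonneg by simp
  have steps: "real steps * (C4 \<alpha> * N) \<le> C6 \<alpha> * N"
    using Npos by (simp add: C6_def distrib_right)
  have count: "\<exists>k::nat. d \<le> 2 ^ k * depth w \<and> 2 ^ k * depth w \<le> 8 / r0 * d \<and> (real k + 1)\<^sup>2 \<le> B\<^sup>2 * (8 / r0) powr \<alpha> * (d / depth w) powr \<alpha>"
    if w: "0 < depth w" "r0 / 4 * depth w \<le> d" for w
  proof -
    obtain k :: nat where k: "d \<le> 2 ^ k * depth w" "2 ^ k * depth w \<le> 8 / r0 * d"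
      using dilation_count[OF w(1) d w(2)] by blast
    have "(real k + 1)\<^sup>2 \<le> (B * q ^ k)\<^sup>2" using linear_le_geometric[OF q, of k] by (intro power_mono) (auto simp: B_def)
    also have "\<dots> = B\<^sup>2 * (q ^ k)\<^sup>2" by (simp add: power_mult_distrib)
    also have "(q ^ k)\<^sup>2 = (2 ^ k) powr \<alpha>"
    proof -
      have "(q ^ k)\<^sup>2 = (q\<^sup>2) ^ k" by (simp add: power_mult[symmetric] mult.commute)
      also have "q\<^sup>2 = 2 powr \<alpha>" by (simp add: q_def power2_eq_square powr_add[symmetric])
      also have "(2 powr \<alpha>) ^ k = (2 ^ k) powr \<alpha>"
        by (simp add: powr_power powr_powr powr_realpow[symmetric] mult.commute)
      finally show ?thesis .
    qed
    also have "(2 ^ k) powr \<alpha> \<le> (8 / r0 * (d / depth w)) powr \<alpha>"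
    proof (rule powr_mono2)
      have "2 ^ k = 2 ^ k * depth w / depth w" using w(1) by simp
      also have "\<dots> \<le> 8 / r0 * d / depth w" using w(1) by (intro divide_right_mono k(2)) simp
      finally show "2 ^ k \<le> 8 / r0 * (d / depth w)" by simp
    qed (use \<alpha> in auto)
    also have "\<dots> = (8 / r0) powr \<alpha> * (d / depth w) powr \<alpha>" by (rule powr_mult)
    finally show ?thesis using k by (intro exI[of _ k]) (simp add: mult.assoc mult_left_mono)
  qed
  obtain k where k: "d \<le> 2 ^ k * depth x" "2 ^ k * depth x \<le> 8 / r0 * d" "(real k + 1)\<^sup>2 \<le> B\<^sup>2 * (8 / r0) powr \<alpha> * (d / depth x) powr \<alpha>"
    using count[OF x] dx by (auto simp: d_def)
  obtain l where l: "d \<le> 2 ^ l * depth y" "2 ^ l * depth y \<le> 8 / r0 * d" "(real l + 1)\<^sup>2 \<le> B\<^sup>2 * (8 / r0) powr \<alpha> * (d / depth y) powr \<alpha>"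
    using count[OF y] dy by (auto simp: d_def)
  let ?a = "(2 ^ k) *\<^sub>R ypart x" and ?b = "(2 ^ l) *\<^sub>R ypart y"
  have 1: "\<bar>ctr x - ctr (join x ?a)\<bar> \<le> real k * (real steps * (C4 \<alpha> * N))"
    using ctr_dilation[of "ypart x" x k] x by (auto simp: depth_def)
  have 2: "\<bar>ctr y - ctr (join y ?b)\<bar> \<le> real l * (real steps * (C4 \<alpha> * N))"
    using ctr_dilation[of "ypart y" y l] y by (auto simp: depth_def)
  have 3: "\<bar>ctr (join x ?a) - ctr (join y ?b)\<bar> \<le> 2 * (C6 \<alpha> * N)"
    using k l by (intro ctr_same_height[OF d]) (auto simp: depth_def d_def)
  have "real k * (real steps * (C4 \<alpha> * N)) \<le> real k * (C6 \<alpha> * N)" "real l * (real steps * (C4 \<alpha> * N)) \<le> real l * (C6 \<alpha> * N)"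
    using steps by (auto intro: mult_left_mono)
  with 1 2 3 have "\<bar>ctr x - ctr y\<bar> \<le> real k * (C6 \<alpha> * N) + real l * (C6 \<alpha> * N) + 2 * (C6 \<alpha> * N)" by linarith
  also have "\<dots> = ((real k + 1) + (real l + 1)) * (C6 \<alpha> * N)" by (simp add: algebra_simps)
  finally have "\<bar>ctr x - ctr y\<bar>\<^sup>2 \<le> (((real k + 1) + (real l + 1)) * (C6 \<alpha> * N))\<^sup>2" by (intro power_mono) auto
  also have "\<dots> = ((real k + 1) + (real l + 1))\<^sup>2 * (C6 \<alpha> * N)\<^sup>2" by (rule power_mult_distrib)
  also have "((real k + 1) + (real l + 1))\<^sup>2 \<le> 2 * (real k + 1)\<^sup>2 + 2 * (real l + 1)\<^sup>2"
  proof -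
    have "(a + b)\<^sup>2 \<le> 2 * a\<^sup>2 + 2 * b\<^sup>2" for a b :: real
      using zero_le_power2[of "a - b"] by (simp add: power2_eq_square algebra_simps)
    then show ?thesis .
  qed
  also have "\<dots> \<le> 2 * (B\<^sup>2 * (8 / r0) powr \<alpha> * (d / depth x) powr \<alpha>) + 2 * (B\<^sup>2 * (8 / r0) powr \<alpha> * (d / depth y) powr \<alpha>)"
    using k(3) l(3) by linarith
  also have "(2 * (B\<^sup>2 * (8 / r0) powr \<alpha> * (d / depth x) powr \<alpha>) + 2 * (B\<^sup>2 * (8 / r0) powr \<alpha> * (d / depth y) powr \<alpha>)) * (C6 \<alpha> * N)\<^sup>2
     = C7 \<alpha> * N\<^sup>2 * ((d / depth x) powr \<alpha> + (d / depth y) powr \<alpha>)"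
    unfolding C7_def q_def[symmetric] B_def[symmetric] by (simp add: power_mult_distrib algebra_simps)
  finally show ?thesis by (simp add: d_def mult_right_mono)
qed

end

section \<open>The energy of the composition\<close>

lemma negligible_depth_zero: "negligible {z :: real ^ ('k::finite + 'p::finite). depth z = 0}"
proof (rule negligible_subset)
  show "negligible {z :: real ^ ('k + 'p). z $ Inr undefined = 0}" by (rule negligible_standard_hyperplane_cart)
  show "{z :: real ^ ('k + 'p). depth z = 0} \<subseteq> {z. z $ Inr undefined = 0}"
    by (auto simp: depth_def ypart_def vec_eq_iff)
qed

lemma AE_depth_pos: "AE z in lborel. 0 < depth (z :: real ^ ('k::finite + 'p::finite))"
proof -
  have b: "{z :: real ^ ('k + 'p). depth z = 0} \<in> sets borel" by measurable
  have "emeasure lborel {z :: real ^ ('k + 'p). depth z = 0} = 0"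
    using negligible_depth_zero[where 'k='k and 'p='p] b
    by (simp add: negligible_iff_null_sets null_sets_def emeasure_completion)
  then have "{z :: real ^ ('k + 'p). depth z = 0} \<in> null_sets lborel" using b by (auto simp: null_sets_def)
  then show ?thesis
    by (rule AE_I') (auto simp: not_less intro!: antisym)
qed

lemma ennreal_le_divide:
  assumes X: "0 < X" and q: "0 \<le> q" and a: "0 \<le> a" and b: "0 \<le> b" and le: "ennreal (q * X) \<le> ennreal a * R + ennreal b"
  shows "ennreal q \<le> ennreal (a / X) * R + ennreal (b / X)"
proof -
  have "ennreal q = ennreal (1 / X) * ennreal (q * X)" using X q by (subst ennreal_mult[symmetric]) auto
  also have "\<dots> \<le> ennreal (1 / X) * (ennreal a * R + ennreal b)" by (intro mult_left_mono le) simp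
  also have "\<dots> = (ennreal (1 / X) * ennreal a) * R + ennreal (1 / X) * ennreal b" by (simp only: distrib_left mult.assoc)
  also have "ennreal (1 / X) * ennreal a = ennreal (a / X)" using X a by (subst ennreal_mult[symmetric]) auto
  also have "ennreal (1 / X) * ennreal b = ennreal (b / X)" using X b by (subst ennreal_mult[symmetric]) auto
  finally show ?thesis .
qed

lemma abs_diff_sq_le3: "\<bar>a - d\<bar>\<^sup>2 \<le> 3 * \<bar>a - b\<bar>\<^sup>2 + 3 * \<bar>b - c\<bar>\<^sup>2 + 3 * \<bar>d - (c::real)\<bar>\<^sup>2"
proof -
  define p q s where "p = a - b" "q = b - c" "s = c - d"
  have "0 \<le> (p - q)\<^sup>2 + (q - s)\<^sup>2 + (p - s)\<^sup>2" by simp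
  then have "(p + q + s)\<^sup>2 \<le> 3 * p\<^sup>2 + 3 * q\<^sup>2 + 3 * s\<^sup>2" by (simp add: power2_eq_square algebra_simps)
  moreover have "p + q + s = a - d" "s\<^sup>2 = (d - c)\<^sup>2" by (simp_all add: p_q_s_def power2_commute)
  ultimately show ?thesis by (simp add: p_q_s_def)
qed

context whitney_map
begin

text \<open>\<open>Ct\<close> is the constant of \<open>nn_integral_tail_le\<close>,
  \<open>C8\<close> that of \<open>deviation_from_center\<close>. \<open>C9\<close> collects the
  constant error at a point and the chain error, and the factor 2 in \<open>C10\<close> stands for
  the two orders of a pair.\<close>

definition Ct :: "real \<Rightarrow> real" where "Ct \<beta> = unit_ball_vol (real CARD('k + 'p)) * 2 ^ CARD('k + 'p) / (1 - 2 powr (-\<beta>))"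
definition C8 :: "real \<Rightarrow> real" where "C8 \<alpha> = 2 * C3 \<alpha> / (unit_ball_vol (real CARD('k + 'p)) * (r0 / 4) ^ CARD('k + 'p))"
definition C9 :: "real \<Rightarrow> real" where "C9 \<alpha> = 3 * C8 \<alpha> / (r0 / 4) powr \<alpha> + 3 * C7 \<alpha>"
definition C10 :: "real \<Rightarrow> real \<Rightarrow> real" where
  "C10 \<alpha> CD = 2 * ((1 + 6 * Ct (2 * \<alpha>) / unit_ball_vol (real CARD('k + 'p))) * C2 \<alpha> CD + C9 \<alpha> * Ct \<alpha> * (r0 / 4) powr (-\<alpha>) * CD)"

lemma vol_pos: "0 < unit_ball_vol (real CARD('k + 'p))" by simp

lemma C8_pos: "0 < C8 \<alpha>"
  unfolding C8_def using C3_pos[of \<alpha>] r0 by (intro divide_pos_pos mult_pos_pos) auto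

lemma C9_nonneg: "0 \<le> C9 \<alpha>"
  unfolding C9_def using C8_pos[of \<alpha>] C7_nonneg[of \<alpha>] by (intro add_nonneg_nonneg divide_nonneg_nonneg) auto

lemma Ct_pos: "0 < \<beta> \<Longrightarrow> 0 < Ct \<beta>"
  unfolding Ct_def by (intro divide_pos_pos mult_pos_pos) (auto simp: powr_less_one)

end

context whitney_Q
begin

definition near :: "real ^ ('k + 'p) \<Rightarrow> real ^ ('k + 'p) \<Rightarrow> ennreal" where
  "near x y = (if dist x y < r0 / 4 * depth x then Qkernel \<alpha> v x y else 0)"

text \<open>The energy density of v at x coming from close pairs. It may be large or infinite at
  single points, but \<open>near_pairs\<close> controls its integral over a ball.\<close>

definition Near :: "real ^ ('k + 'p) \<Rightarrow> ennreal" where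
  "Near x = (\<integral>\<^sup>+y. near x y \<partial>lborel)"

text \<open>The share of x in the kernel of a distant pair: the deviation of v x from its local
  constant and half of the chain estimate. It depends on y only through the distance, so it can be
  integrated over all y explicitly.\<close>

definition far :: "real ^ ('k + 'p) \<Rightarrow> real ^ ('k + 'p) \<Rightarrow> ennreal" where
  "far x y = (if r0 / 4 * depth x \<le> dist x y \<and> 0 < depth x
     then (ennreal (6 * (r0 / 4 * depth x) powr (2 * \<alpha>) / unit_ball_vol (real CARD('k + 'p))) * Near x + ennreal (C9 \<alpha> * N\<^sup>2 * (dist x y / depth x) powr \<alpha>))
       * ennreal (dist x y powr (- (real CARD('k + 'p) + 2 * \<alpha>))) else 0)"

lemma borel_near [measurable]:
  assumes [measurable]: "a \<in> Q \<rightarrow>\<^sub>M borel" "b \<in> Q \<rightarrow>\<^sub>M borel"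
  shows "(\<lambda>p. near (a p) (b p)) \<in> borel_measurable Q"
  unfolding near_def by measurable

lemma borel_Near [measurable]: "Near \<in> borel_measurable borel"
  unfolding Near_def by measurable

lemma borel_far [measurable]:
  assumes [measurable]: "a \<in> Q \<rightarrow>\<^sub>M borel" "b \<in> Q \<rightarrow>\<^sub>M borel"
  shows "(\<lambda>p. far (a p) (b p)) \<in> borel_measurable Q"
  unfolding far_def by measurable

text \<open>Average over w in a small ball at x. The differences v x - v w are bounded by the energy
  density at x, and v w is close to \<open>ctr x\<close> in the mean square sense.\<close>

lemma deviation_from_center:
  assumes x: "0 < depth x"
  shows "ennreal (\<bar>v x - ctr x\<bar>\<^sup>2) \<le> ennreal (2 * (r0 / 4 * depth x) powr (2 * \<alpha>) / unit_ball_vol (real CARD('k + 'p))) * Near x + ennreal (C8 \<alpha> * N\<^sup>2)"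
proof -
  let ?n = "CARD('k + 'p)" and ?e = "real CARD('k + 'p) + 2 * \<alpha>"
  define t where "t = r0 / 4 * depth x"
  have t: "0 < t" using r0 x by (simp add: t_def)
  have sub: "ball x t \<subseteq> ball x (r0 * depth x)" unfolding t_def using r0 x by (intro subset_ball mult_right_mono) auto
  define q where "q = \<bar>v x - ctr x\<bar>\<^sup>2"
  define X where "X = unit_ball_vol (real CARD('k + 'p)) * t ^ ?n"
  have X: "0 < X" unfolding X_def using t by (intro mult_pos_pos) auto
  have mX: "emeasure lborel (ball x t) = ennreal X" unfolding X_def using emeasure_ball[of t x] t by simp
  have 1: "ennreal (\<bar>v x - v w\<bar>\<^sup>2) * indicator (ball x t) w \<le> ennreal (t powr ?e) * near x w" for w
  proof (cases "w \<in> ball x t \<and> w \<noteq> x")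
    case True
    then have d: "dist x w < t" "0 < norm (x - w)" by auto
    have le: "norm (x - w) powr ?e \<le> t powr ?e" using d \<alpha> by (intro powr_mono2) (auto simp: dist_norm)
    have p: "0 < norm (x - w) powr ?e" using d by simp
    have "\<bar>v x - v w\<bar>\<^sup>2 = \<bar>v x - v w\<bar>\<^sup>2 / norm (x - w) powr ?e * norm (x - w) powr ?e" using p by simp
    also have "\<dots> \<le> \<bar>v x - v w\<bar>\<^sup>2 / norm (x - w) powr ?e * t powr ?e" using le by (intro mult_left_mono) auto
    finally have "ennreal (\<bar>v x - v w\<bar>\<^sup>2) \<le> ennreal (t powr ?e) * Qkernel \<alpha> v x w"
      unfolding Qkernel_def by (subst ennreal_mult[symmetric]) (auto intro: ennreal_leI simp: mult.commute)
    then show ?thesis using True d(1) by (simp add: near_def t_def)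
  qed (auto split: split_indicator)
  have "ennreal (q * X) = (\<integral>\<^sup>+w. ennreal q * indicator (ball x t) w \<partial>lborel)"
    using X by (subst nn_integral_cmult_indicator) (auto simp: mX q_def ennreal_mult)
  also have "\<dots> \<le> (\<integral>\<^sup>+w. 2 * (ennreal (t powr ?e) * near x w) + 2 * (ennreal (\<bar>v w - ctr x\<bar>\<^sup>2) * indicator (ball x (r0 * depth x)) w) \<partial>lborel)"
  proof (rule nn_integral_mono)
    fix w
    have "q \<le> 2 * \<bar>v x - v w\<bar>\<^sup>2 + 2 * \<bar>v w - ctr x\<bar>\<^sup>2" unfolding q_def by (rule abs_diff_sq_le)
    then have "ennreal q \<le> ennreal (2 * \<bar>v x - v w\<bar>\<^sup>2 + 2 * \<bar>v w - ctr x\<bar>\<^sup>2)" by (rule ennreal_leI)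
    also have "\<dots> = 2 * ennreal (\<bar>v x - v w\<bar>\<^sup>2) + 2 * ennreal (\<bar>v w - ctr x\<bar>\<^sup>2)" by (simp add: ennreal_mult)
    finally have "ennreal q * indicator (ball x t) w \<le> 2 * (ennreal (\<bar>v x - v w\<bar>\<^sup>2) * indicator (ball x t) w) + 2 * (ennreal (\<bar>v w - ctr x\<bar>\<^sup>2) * indicator (ball x (r0 * depth x)) w)"
      using sub by (auto split: split_indicator)
    also have "\<dots> \<le> 2 * (ennreal (t powr ?e) * near x w) + 2 * (ennreal (\<bar>v w - ctr x\<bar>\<^sup>2) * indicator (ball x (r0 * depth x)) w)"
      using 1 by (intro add_right_mono mult_left_mono) auto
    finally show "ennreal q * indicator (ball x t) w \<le> 2 * (ennreal (t powr ?e) * near x w) + 2 * (ennreal (\<bar>v w - ctr x\<bar>\<^sup>2) * indicator (ball x (r0 * depth x)) w)" .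
  qed
  also have "\<dots> = (\<integral>\<^sup>+w. 2 * (ennreal (t powr ?e) * near x w) \<partial>lborel) + (\<integral>\<^sup>+w. 2 * (ennreal (\<bar>v w - ctr x\<bar>\<^sup>2) * indicator (ball x (r0 * depth x)) w) \<partial>lborel)"
    by (rule nn_integral_add) measurable
  also have "(\<integral>\<^sup>+w. 2 * (ennreal (t powr ?e) * near x w) \<partial>lborel) = 2 * (ennreal (t powr ?e) * Near x)"
    unfolding Near_def by (rule nn_integral_cmult_cmult) measurable
  also have "(\<integral>\<^sup>+w. 2 * (ennreal (\<bar>v w - ctr x\<bar>\<^sup>2) * indicator (ball x (r0 * depth x)) w) \<partial>lborel)
      = 2 * (\<integral>\<^sup>+w\<in>ball x (r0 * depth x). ennreal (\<bar>v w - ctr x\<bar>\<^sup>2) \<partial>lborel)"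
    by (rule nn_integral_cmult) measurable
  also have "(\<integral>\<^sup>+w\<in>ball x (r0 * depth x). ennreal (\<bar>v w - ctr x\<bar>\<^sup>2) \<partial>lborel) \<le> ennreal (C3 \<alpha> * depth x ^ ?n * N\<^sup>2)"
    by (rule ctr[OF x])
  finally have "ennreal (q * X) \<le> 2 * (ennreal (t powr ?e) * Near x) + 2 * ennreal (C3 \<alpha> * depth x ^ ?n * N\<^sup>2)"
    by (simp add: add_left_mono mult_left_mono)
  also have "2 * (ennreal (t powr ?e) * Near x) = ennreal (2 * t powr ?e) * Near x"
    by (simp add: ennreal_mult mult.assoc)
  also have "2 * ennreal (C3 \<alpha> * depth x ^ ?n * N\<^sup>2) = ennreal (2 * (C3 \<alpha> * depth x ^ ?n * N\<^sup>2))"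
    using C3_pos[of \<alpha>] by (subst ennreal_mult) auto
  finally have "ennreal q \<le> ennreal (2 * t powr ?e / X) * Near x + ennreal (2 * (C3 \<alpha> * depth x ^ ?n * N\<^sup>2) / X)"
    using C3_pos[of \<alpha>] by (intro ennreal_le_divide X) (auto simp: q_def)
  also have "2 * t powr ?e / X = 2 * t powr (2 * \<alpha>) / unit_ball_vol (real CARD('k + 'p))"
  proof -
    have "t powr ?e = t powr real ?n * t powr (2 * \<alpha>)" by (rule powr_add)
    also have "t powr real ?n = t ^ ?n" by (rule powr_realpow[OF t])
    finally have "t powr ?e = t ^ ?n * t powr (2 * \<alpha>)" .
    moreover have "t ^ ?n \<noteq> 0" using t by simp
    ultimately show ?thesis unfolding X_def by simp
  qed
  also have "2 * (C3 \<alpha> * depth x ^ ?n * N\<^sup>2) / X = C8 \<alpha> * N\<^sup>2"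
  proof -
    have "depth x ^ ?n \<noteq> 0" using x by simp
    then show ?thesis unfolding X_def t_def C8_def power_mult_distrib by simp
  qed
  finally show ?thesis by (simp only: q_def t_def)
qed

text \<open>A pair is close for x, close for y, or distant for both. In the last case v x - v y is
  split at \<open>ctr x\<close> and \<open>ctr y\<close>, and every resulting term is assigned to
  one of the two points.\<close>

lemma Qkernel_le_near_far:
  assumes x: "0 < depth x" and y: "0 < depth y"
  shows "Qkernel \<alpha> v x y \<le> (near x y + far x y) + (near y x + far y x)"
proof -
  consider "dist x y < r0 / 4 * depth x" | "dist y x < r0 / 4 * depth y"
    | "r0 / 4 * depth x \<le> dist x y" "r0 / 4 * depth y \<le> dist x y" by (force simp: dist_commute)
  then show ?thesis
  proof cases
    case 1
    then have "Qkernel \<alpha> v x y = near x y" by (simp add: near_def)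
    then show ?thesis by (simp add: add_increasing2)
  next
    case 2
    then have "Qkernel \<alpha> v x y = near y x" by (simp add: near_def Qkernel_commute)
    then show ?thesis by (simp add: add_increasing add_increasing2)
  next
    case 3
    define d where "d = dist x y"
    have d: "0 < d" using 3(1) x r0 mult_pos_pos[of "r0 / 4" "depth x"] unfolding d_def by linarith
    define e where "e = ennreal (d powr (- (real CARD('k + 'p) + 2 * \<alpha>)))"
    define J where "J x = ennreal (6 * (r0 / 4 * depth x) powr (2 * \<alpha>) / unit_ball_vol (real CARD('k + 'p))) * Near x + ennreal (C9 \<alpha> * N\<^sup>2 * (d / depth x) powr \<alpha>)" for x
    define H where "H x = ennreal (6 * (r0 / 4 * depth x) powr (2 * \<alpha>) / unit_ball_vol (real CARD('k + 'p))) * Near x" for x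
    have far: "far x y = J x * e" "far y x = J y * e"
      using 3 x y by (auto simp: far_def J_def e_def d_def dist_commute)
    have dev: "3 * ennreal (\<bar>v w - ctr w\<bar>\<^sup>2) \<le> H w + ennreal (3 * C8 \<alpha> * N\<^sup>2)" if w: "0 < depth w" for w
    proof -
      have "3 * ennreal (\<bar>v w - ctr w\<bar>\<^sup>2) \<le> 3 * (ennreal (2 * (r0 / 4 * depth w) powr (2 * \<alpha>) / unit_ball_vol (real CARD('k + 'p))) * Near w + ennreal (C8 \<alpha> * N\<^sup>2))"
        by (intro mult_left_mono deviation_from_center w) simp
      also have "\<dots> = (3 * ennreal (2 * (r0 / 4 * depth w) powr (2 * \<alpha>) / unit_ball_vol (real CARD('k + 'p)))) * Near w + 3 * ennreal (C8 \<alpha> * N\<^sup>2)"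
        by (simp only: distrib_left mult.assoc)
      also have "3 * ennreal (2 * (r0 / 4 * depth w) powr (2 * \<alpha>) / unit_ball_vol (real CARD('k + 'p))) = ennreal (6 * (r0 / 4 * depth w) powr (2 * \<alpha>) / unit_ball_vol (real CARD('k + 'p)))"
      proof -
        have "ennreal (3 * (2 * (r0 / 4 * depth w) powr (2 * \<alpha>) / unit_ball_vol (real CARD('k + 'p)))) = ennreal 3 * ennreal (2 * (r0 / 4 * depth w) powr (2 * \<alpha>) / unit_ball_vol (real CARD('k + 'p)))"
          using vol_pos by (intro ennreal_mult) auto
        then show ?thesis by simp
      qed
      also have "3 * ennreal (C8 \<alpha> * N\<^sup>2) = ennreal (3 * C8 \<alpha> * N\<^sup>2)"
      proof -
        have "ennreal (3 * (C8 \<alpha> * N\<^sup>2)) = ennreal 3 * ennreal (C8 \<alpha> * N\<^sup>2)"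
          using C8_pos[of \<alpha>] by (intro ennreal_mult) auto
        then show ?thesis by (simp add: mult.assoc)
      qed
      finally show ?thesis by (simp only: H_def)
    qed
    \<comment> \<open>For distant pairs d / depth w is at least r0 / 4, so a constant error can be
      absorbed into the power of d / depth w.\<close>
    have one: "3 * C8 \<alpha> * N\<^sup>2 \<le> 3 * C8 \<alpha> / (r0 / 4) powr \<alpha> * N\<^sup>2 * (d / depth w) powr \<alpha>" if w: "0 < depth w" "r0 / 4 * depth w \<le> d" for w
    proof -
      have "r0 / 4 \<le> d / depth w" using w by (simp add: pos_le_divide_eq)
      then have "(r0 / 4) powr \<alpha> \<le> (d / depth w) powr \<alpha>" using r0 \<alpha> by (intro powr_mono2) auto
      moreover have p: "0 < (r0 / 4) powr \<alpha>" using r0 by simp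
      ultimately have "1 \<le> (d / depth w) powr \<alpha> / (r0 / 4) powr \<alpha>" by (simp add: pos_le_divide_eq)
      then have "3 * C8 \<alpha> * N\<^sup>2 * 1 \<le> 3 * C8 \<alpha> * N\<^sup>2 * ((d / depth w) powr \<alpha> / (r0 / 4) powr \<alpha>)"
        using C8_pos[of \<alpha>] by (intro mult_left_mono) auto
      then show ?thesis by (simp add: mult_ac)
    qed
    have tri: "\<bar>v x - v y\<bar>\<^sup>2 \<le> 3 * \<bar>v x - ctr x\<bar>\<^sup>2 + 3 * \<bar>ctr x - ctr y\<bar>\<^sup>2 + 3 * \<bar>v y - ctr y\<bar>\<^sup>2"
      by (rule abs_diff_sq_le3)
    define A where "A = (d / depth x) powr \<alpha>"
    define B where "B = (d / depth y) powr \<alpha>"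
    have cc: "3 * \<bar>ctr x - ctr y\<bar>\<^sup>2 \<le> 3 * C7 \<alpha> * N\<^sup>2 * A + 3 * C7 \<alpha> * N\<^sup>2 * B"
      using ctr_far[OF x y 3] by (simp add: A_def B_def d_def algebra_simps)
    have "ennreal (\<bar>v x - v y\<bar>\<^sup>2) \<le> ennreal (3 * \<bar>v x - ctr x\<bar>\<^sup>2 + (3 * \<bar>v y - ctr y\<bar>\<^sup>2 + (3 * C7 \<alpha> * N\<^sup>2 * A + 3 * C7 \<alpha> * N\<^sup>2 * B)))"
      using tri cc by (intro ennreal_leI) linarith
    also have "\<dots> = 3 * ennreal (\<bar>v x - ctr x\<bar>\<^sup>2) + (3 * ennreal (\<bar>v y - ctr y\<bar>\<^sup>2) + ennreal (3 * C7 \<alpha> * N\<^sup>2 * A + 3 * C7 \<alpha> * N\<^sup>2 * B))"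
      using C7_nonneg[of \<alpha>] by (simp add: ennreal_mult ennreal_plus[symmetric] A_def B_def del: ennreal_plus) (simp add: ennreal_plus ennreal_mult)
    also have "\<dots> \<le> (H x + ennreal (3 * C8 \<alpha> * N\<^sup>2)) + ((H y + ennreal (3 * C8 \<alpha> * N\<^sup>2)) + ennreal (3 * C7 \<alpha> * N\<^sup>2 * A + 3 * C7 \<alpha> * N\<^sup>2 * B))"
      by (intro add_mono dev x y order_refl)
    also have "\<dots> \<le> (H x + ennreal (3 * C8 \<alpha> / (r0 / 4) powr \<alpha> * N\<^sup>2 * A)) + ((H y + ennreal (3 * C8 \<alpha> / (r0 / 4) powr \<alpha> * N\<^sup>2 * B)) + ennreal (3 * C7 \<alpha> * N\<^sup>2 * A + 3 * C7 \<alpha> * N\<^sup>2 * B))"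
      unfolding A_def B_def using 3 by (intro add_mono ennreal_leI one x y order_refl) (auto simp: d_def)
    also have "\<dots> = J x + J y"
    proof -
      have nn: "0 \<le> 3 * C8 \<alpha> / (r0 / 4) powr \<alpha> * N\<^sup>2 * A" "0 \<le> 3 * C8 \<alpha> / (r0 / 4) powr \<alpha> * N\<^sup>2 * B"
        "0 \<le> 3 * C7 \<alpha> * N\<^sup>2 * A" "0 \<le> 3 * C7 \<alpha> * N\<^sup>2 * B"
        using C8_pos[of \<alpha>] C7_nonneg[of \<alpha>] by (auto simp: A_def B_def)
      have s: "ennreal (3 * C7 \<alpha> * N\<^sup>2 * A + 3 * C7 \<alpha> * N\<^sup>2 * B) = ennreal (3 * C7 \<alpha> * N\<^sup>2 * A) + ennreal (3 * C7 \<alpha> * N\<^sup>2 * B)"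
        using nn by (intro ennreal_plus) auto
      have j: "ennreal (C9 \<alpha> * N\<^sup>2 * a) = ennreal (3 * C8 \<alpha> / (r0 / 4) powr \<alpha> * N\<^sup>2 * a) + ennreal (3 * C7 \<alpha> * N\<^sup>2 * a)"
        if "0 \<le> a" for a
      proof -
        have "C9 \<alpha> * N\<^sup>2 * a = 3 * C8 \<alpha> / (r0 / 4) powr \<alpha> * N\<^sup>2 * a + 3 * C7 \<alpha> * N\<^sup>2 * a"
          by (simp add: C9_def distrib_right)
        then show ?thesis using that C8_pos[of \<alpha>] C7_nonneg[of \<alpha>] by (simp add: ennreal_plus)
      qed
      have "J x = H x + (ennreal (3 * C8 \<alpha> / (r0 / 4) powr \<alpha> * N\<^sup>2 * A) + ennreal (3 * C7 \<alpha> * N\<^sup>2 * A))"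
        unfolding J_def H_def A_def by (subst j) auto
      moreover have "J y = H y + (ennreal (3 * C8 \<alpha> / (r0 / 4) powr \<alpha> * N\<^sup>2 * B) + ennreal (3 * C7 \<alpha> * N\<^sup>2 * B))"
        unfolding J_def H_def B_def by (subst j) auto
      ultimately show ?thesis unfolding s by (simp only: add_ac)
    qed
    finally have le: "ennreal (\<bar>v x - v y\<bar>\<^sup>2) \<le> J x + J y" .
    have "Qkernel \<alpha> v x y = ennreal (\<bar>v x - v y\<bar>\<^sup>2 * d powr (- (real CARD('k + 'p) + 2 * \<alpha>)))"
      by (simp only: Qkernel_def d_def dist_norm powr_minus divide_inverse)
    also have "\<dots> = ennreal (\<bar>v x - v y\<bar>\<^sup>2) * e" unfolding e_def by (intro ennreal_mult) auto
    also have "\<dots> \<le> (J x + J y) * e" by (intro mult_right_mono le) simp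
    also have "\<dots> = far x y + far y x" by (simp only: far distrib_right)
    also have "\<dots> \<le> (near x y + far x y) + (near y x + far y x)" by (intro add_mono) (auto simp: add_increasing)
    finally show ?thesis .
  qed
qed

text \<open>Both tails start at t = r0 / 4 * depth x. In the first term t powr (2 * \<alpha>)
  cancels the tail and leaves \<open>Near x\<close>; in the second, depth x powr (-\<alpha>) meets a
  tail of the same order and gives the exponent - 2 * \<alpha>.\<close>

lemma nn_integral_far_le:
  assumes x: "0 < depth x"
  shows "(\<integral>\<^sup>+y. far x y \<partial>lborel) \<le> ennreal (6 * Ct (2 * \<alpha>) / unit_ball_vol (real CARD('k + 'p))) * Near x + ennreal (C9 \<alpha> * Ct \<alpha> * (r0 / 4) powr (-\<alpha>) * N\<^sup>2) * ennreal (depth x powr (- (2 * \<alpha>)))"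
proof -
  let ?n = "CARD('k + 'p)"
  define t where "t = r0 / 4 * depth x"
  have t: "0 < t" using r0 x by (simp add: t_def)
  have Ct0: "0 < Ct (2 * \<alpha>)" "0 < Ct \<alpha>" using \<alpha> by (auto intro: Ct_pos)
  define H where "H = ennreal (6 * t powr (2 * \<alpha>) / unit_ball_vol (real CARD('k + 'p))) * Near x"
  have tail: "(\<integral>\<^sup>+y\<in>{y. t \<le> dist x y}. ennreal (dist x y powr (- (real ?n + \<beta>))) \<partial>lborel) \<le> ennreal (Ct \<beta> * t powr (-\<beta>))" if "0 < \<beta>" for \<beta>
    using nn_integral_tail_le[OF t that, of x] by (simp add: Ct_def)
  have "(\<integral>\<^sup>+y. far x y \<partial>lborel) = (\<integral>\<^sup>+y. H * (ennreal (dist x y powr (- (real ?n + 2 * \<alpha>))) * indicator {y. t \<le> dist x y} y)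
      + ennreal (C9 \<alpha> * N\<^sup>2 * depth x powr (-\<alpha>)) * (ennreal (dist x y powr (- (real ?n + \<alpha>))) * indicator {y. t \<le> dist x y} y) \<partial>lborel)"
  proof (rule nn_integral_cong)
    fix y
    show "far x y = H * (ennreal (dist x y powr (- (real ?n + 2 * \<alpha>))) * indicator {y. t \<le> dist x y} y)
      + ennreal (C9 \<alpha> * N\<^sup>2 * depth x powr (-\<alpha>)) * (ennreal (dist x y powr (- (real ?n + \<alpha>))) * indicator {y. t \<le> dist x y} y)"
    proof (cases "t \<le> dist x y")
      case True
      have "ennreal (C9 \<alpha> * N\<^sup>2 * (dist x y / depth x) powr \<alpha>) * ennreal (dist x y powr (- (real ?n + 2 * \<alpha>)))
        = ennreal (C9 \<alpha> * N\<^sup>2 * depth x powr (-\<alpha>)) * ennreal (dist x y powr (- (real ?n + \<alpha>)))"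
      proof -
        have ab: "dist x y powr \<alpha> * dist x y powr (- (real ?n + 2 * \<alpha>)) = dist x y powr (- (real ?n + \<alpha>))"
          by (simp add: powr_add[symmetric])
        have pd: "(dist x y / depth x) powr \<alpha> = dist x y powr \<alpha> * depth x powr (-\<alpha>)"
          unfolding powr_divide powr_minus by (rule divide_inverse)
        have "C9 \<alpha> * N\<^sup>2 * (dist x y powr \<alpha> * depth x powr (-\<alpha>)) * dist x y powr (- (real ?n + 2 * \<alpha>)) =
          C9 \<alpha> * N\<^sup>2 * depth x powr (-\<alpha>) * (dist x y powr \<alpha> * dist x y powr (- (real ?n + 2 * \<alpha>)))"
          by (simp only: mult_ac)
        then have "C9 \<alpha> * N\<^sup>2 * (dist x y / depth x) powr \<alpha> * dist x y powr (- (real ?n + 2 * \<alpha>)) = C9 \<alpha> * N\<^sup>2 * depth x powr (-\<alpha>) * dist x y powr (- (real ?n + \<alpha>))"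
          unfolding pd ab .
        then show ?thesis using C9_nonneg[of \<alpha>] by (simp only: ennreal_mult[symmetric] mult_nonneg_nonneg powr_ge_zero zero_le_power2)
      qed
      then show ?thesis using True x by (simp add: far_def H_def t_def distrib_right mult.assoc)
    qed (simp add: far_def t_def)
  qed
  also have "\<dots> = H * (\<integral>\<^sup>+y\<in>{y. t \<le> dist x y}. ennreal (dist x y powr (- (real ?n + 2 * \<alpha>))) \<partial>lborel)
     + ennreal (C9 \<alpha> * N\<^sup>2 * depth x powr (-\<alpha>)) * (\<integral>\<^sup>+y\<in>{y. t \<le> dist x y}. ennreal (dist x y powr (- (real ?n + \<alpha>))) \<partial>lborel)"
    by (subst nn_integral_add, measurable, (subst nn_integral_cmult, measurable)+)
  also have "\<dots> \<le> H * ennreal (Ct (2 * \<alpha>) * t powr (- (2 * \<alpha>))) + ennreal (C9 \<alpha> * N\<^sup>2 * depth x powr (-\<alpha>)) * ennreal (Ct \<alpha> * t powr (-\<alpha>))"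
    using \<alpha> by (intro add_mono mult_left_mono tail) auto
  also have "H * ennreal (Ct (2 * \<alpha>) * t powr (- (2 * \<alpha>))) = ennreal (6 * Ct (2 * \<alpha>) / unit_ball_vol (real CARD('k + 'p))) * Near x"
  proof -
    have e: "6 * t powr (2 * \<alpha>) / unit_ball_vol (real CARD('k + 'p)) * (Ct (2 * \<alpha>) * t powr (- (2 * \<alpha>))) = 6 * Ct (2 * \<alpha>) / unit_ball_vol (real CARD('k + 'p))"
      using t by (simp add: powr_minus field_simps)
    have "H * ennreal (Ct (2 * \<alpha>) * t powr (- (2 * \<alpha>))) = (ennreal (6 * t powr (2 * \<alpha>) / unit_ball_vol (real CARD('k + 'p))) * ennreal (Ct (2 * \<alpha>) * t powr (- (2 * \<alpha>)))) * Near x"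
      unfolding H_def by (simp only: mult_ac)
    also have "ennreal (6 * t powr (2 * \<alpha>) / unit_ball_vol (real CARD('k + 'p))) * ennreal (Ct (2 * \<alpha>) * t powr (- (2 * \<alpha>))) = ennreal (6 * t powr (2 * \<alpha>) / unit_ball_vol (real CARD('k + 'p)) * (Ct (2 * \<alpha>) * t powr (- (2 * \<alpha>))))"
      using Ct0 vol_pos by (intro ennreal_mult[symmetric]) auto
    finally show ?thesis unfolding e .
  qed
  also have "ennreal (C9 \<alpha> * N\<^sup>2 * depth x powr (-\<alpha>)) * ennreal (Ct \<alpha> * t powr (-\<alpha>)) = ennreal (C9 \<alpha> * Ct \<alpha> * (r0 / 4) powr (-\<alpha>) * N\<^sup>2) * ennreal (depth x powr (- (2 * \<alpha>)))"
  proof -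
    have dd: "depth x powr (- (2 * \<alpha>)) = depth x powr (-\<alpha>) * depth x powr (-\<alpha>)" by (simp add: powr_add[symmetric])
    have e: "C9 \<alpha> * Ct \<alpha> * (r0 / 4) powr (-\<alpha>) * N\<^sup>2 * depth x powr (- (2 * \<alpha>)) = C9 \<alpha> * N\<^sup>2 * depth x powr (-\<alpha>) * (Ct \<alpha> * t powr (-\<alpha>))"
      unfolding t_def powr_mult dd by (simp only: mult_ac)
    have "ennreal (C9 \<alpha> * N\<^sup>2 * depth x powr (-\<alpha>)) * ennreal (Ct \<alpha> * t powr (-\<alpha>)) = ennreal (C9 \<alpha> * N\<^sup>2 * depth x powr (-\<alpha>) * (Ct \<alpha> * t powr (-\<alpha>)))"
      using C9_nonneg[of \<alpha>] Ct0 by (intro ennreal_mult[symmetric]) auto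
    also have "\<dots> = ennreal (C9 \<alpha> * Ct \<alpha> * (r0 / 4) powr (-\<alpha>) * N\<^sup>2) * ennreal (depth x powr (- (2 * \<alpha>)))"
      unfolding e[symmetric] using C9_nonneg[of \<alpha>] Ct0 by (intro ennreal_mult) auto
    finally show ?thesis .
  qed
  finally show ?thesis .
qed

text \<open>A ball small compared with the depth of its centre is a Whitney ball and was treated
  before. For other balls the kernel is majorised by the sum of T x y and T y x, and each half is
  bounded by \<open>near_pairs\<close> and the integral of the power of the depth.\<close>

lemma Qenergy_v_le:
  assumes r: "0 < r"
  shows "Qenergy \<alpha> v x0 r \<le> ennreal ((C1 \<alpha> + C10 \<alpha> CD) * r powr (real CARD('k + 'p) - 2 * \<alpha>) * N\<^sup>2)"
proof (cases "r0 * depth x0 \<le> r")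
  case False
  then have "0 < depth x0" using r r0 by (smt (verit) depth_nonneg mult_eq_0_iff)
  then have "Qenergy \<alpha> v x0 r \<le> ennreal (C1 \<alpha> * r powr (real CARD('k + 'p) - 2 * \<alpha>) * N\<^sup>2)"
    using False r by (intro Qenergy_v) auto
  also have "\<dots> \<le> ennreal ((C1 \<alpha> + C10 \<alpha> CD) * r powr (real CARD('k + 'p) - 2 * \<alpha>) * N\<^sup>2)"
  proof (intro ennreal_leI mult_right_mono)
    have "0 \<le> C2 \<alpha> CD" unfolding C2_def using C1_pos[of \<alpha>] CD r0 by (auto intro!: mult_nonneg_nonneg divide_nonneg_nonneg)
    then show "C1 \<alpha> \<le> C1 \<alpha> + C10 \<alpha> CD" unfolding C10_def
      using C9_nonneg[of \<alpha>] Ct_pos[of \<alpha>] Ct_pos[of "2 * \<alpha>"] \<alpha> CD vol_pos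
      by (auto intro!: mult_nonneg_nonneg add_nonneg_nonneg divide_nonneg_nonneg)
  qed auto
  finally show ?thesis .
next
  case True
  let ?B = "ball x0 r" and ?R = "r powr (real CARD('k + 'p) - 2 * \<alpha>)"
  define T where "T x y = near x y + far x y" for x y
  have [measurable]: "(\<lambda>p. T (a p) (b p)) \<in> borel_measurable Q"
    if [measurable]: "a \<in> Q \<rightarrow>\<^sub>M borel" "b \<in> Q \<rightarrow>\<^sub>M borel" for a b and Q :: "'q measure"
    unfolding T_def by measurable
  define a where "a = 6 * Ct (2 * \<alpha>) / unit_ball_vol (real CARD('k + 'p))"
  define b where "b = C9 \<alpha> * Ct \<alpha> * (r0 / 4) powr (-\<alpha>)"
  have ab: "0 \<le> a" "0 \<le> b" using Ct_pos[of \<alpha>] Ct_pos[of "2 * \<alpha>"] \<alpha> C9_nonneg[of \<alpha>] vol_pos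
    by (auto simp: a_def b_def)
  have C20: "0 \<le> C2 \<alpha> CD" unfolding C2_def using C1_pos[of \<alpha>] CD r0 by (auto intro!: mult_nonneg_nonneg divide_nonneg_nonneg)
  define S where "S = (\<integral>\<^sup>+x\<in>?B. (\<integral>\<^sup>+y. T x y \<partial>lborel) \<partial>lborel)"
  have S: "S \<le> ennreal (((1 + a) * C2 \<alpha> CD + b * CD) * ?R * N\<^sup>2)"
  proof -
    have "S \<le> (\<integral>\<^sup>+x. ennreal (1 + a) * (Near x * indicator ?B x) + ennreal (b * N\<^sup>2) * (ennreal (depth x powr (- (2 * \<alpha>))) * indicator ?B x) \<partial>lborel)"
      unfolding S_def
    proof (rule nn_integral_mono_AE)
      show "AE x in lborel. (\<integral>\<^sup>+y. T x y \<partial>lborel) * indicator ?B x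
        \<le> ennreal (1 + a) * (Near x * indicator ?B x) + ennreal (b * N\<^sup>2) * (ennreal (depth x powr (- (2 * \<alpha>))) * indicator ?B x)"
        using AE_depth_pos
      proof eventually_elim
        case (elim x)
        have "(\<integral>\<^sup>+y. T x y \<partial>lborel) = Near x + (\<integral>\<^sup>+y. far x y \<partial>lborel)"
          unfolding T_def Near_def by (rule nn_integral_add) measurable
        also have "\<dots> \<le> Near x + (ennreal a * Near x + ennreal (b * N\<^sup>2) * ennreal (depth x powr (- (2 * \<alpha>))))"
          using nn_integral_far_le[OF elim] by (intro add_left_mono) (simp add: a_def b_def)
        also have "\<dots> = ennreal (1 + a) * Near x + ennreal (b * N\<^sup>2) * ennreal (depth x powr (- (2 * \<alpha>)))"
          using ab by (simp add: ennreal_plus distrib_right add.assoc)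
        finally show ?case by (simp split: split_indicator)
      qed
    qed
    also have "\<dots> = ennreal (1 + a) * (\<integral>\<^sup>+x\<in>?B. Near x \<partial>lborel) + ennreal (b * N\<^sup>2) * (\<integral>\<^sup>+x\<in>?B. ennreal (depth x powr (- (2 * \<alpha>))) \<partial>lborel)"
      by (subst nn_integral_add, measurable, (subst nn_integral_cmult, measurable)+)
    also have "\<dots> \<le> ennreal (1 + a) * ennreal (C2 \<alpha> CD * ?R * N\<^sup>2) + ennreal (b * N\<^sup>2) * ennreal (CD * ?R)"
      using near_pairs[OF r True] depth_integral[OF r, of x0]
      by (intro add_mono mult_left_mono) (auto simp: Near_def near_def)
    also have "\<dots> = ennreal ((1 + a) * (C2 \<alpha> CD * ?R * N\<^sup>2) + b * N\<^sup>2 * (CD * ?R))"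
      using ab C20 CD by (subst ennreal_plus) (auto simp: ennreal_mult)
    also have "(1 + a) * (C2 \<alpha> CD * ?R * N\<^sup>2) + b * N\<^sup>2 * (CD * ?R) = ((1 + a) * C2 \<alpha> CD + b * CD) * ?R * N\<^sup>2"
      by (simp add: algebra_simps)
    finally show ?thesis .
  qed
  \<comment> \<open>In this half the outer variable is the second argument of T, so the integrals
    are exchanged before y is released from the ball; the other half already has the order used in
    S.\<close>
  have sw: "(\<integral>\<^sup>+y. (\<integral>\<^sup>+x. T x y * indicator ?B x * indicator ?B y \<partial>lborel) \<partial>lborel) \<le> S"
  proof -
    have ind: "(\<lambda>p. indicator ?B (c p) :: ennreal) \<in> borel_measurable Q" if "c \<in> Q \<rightarrow>\<^sub>M borel"
      for c and Q :: "(real ^ ('k + 'p) \<times> real ^ ('k + 'p)) measure"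
      using that borel_measurable_indicator[OF ball_in_sets_borel] by (rule measurable_compose)
    have "(\<integral>\<^sup>+y. (\<integral>\<^sup>+x. T x y * indicator ?B x * indicator ?B y \<partial>lborel) \<partial>lborel) = (\<integral>\<^sup>+x. (\<integral>\<^sup>+y. T x y * indicator ?B x * indicator ?B y \<partial>lborel) \<partial>lborel)"
      by (rule nn_integral_lborel_swap) (intro borel_measurable_times_ennreal ind; measurable)
    also have "\<dots> \<le> S" unfolding S_def
    proof (rule nn_integral_mono)
      fix x
      have "(\<integral>\<^sup>+y. T x y * indicator ?B x * indicator ?B y \<partial>lborel) \<le> (\<integral>\<^sup>+y. T x y * indicator ?B x \<partial>lborel)"
        by (intro nn_integral_mono) (auto split: split_indicator)
      also have "\<dots> = (\<integral>\<^sup>+y. T x y \<partial>lborel) * indicator ?B x"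
        by (rule nn_integral_multc) measurable
      finally show "(\<integral>\<^sup>+y. T x y * indicator ?B x * indicator ?B y \<partial>lborel) \<le> (\<integral>\<^sup>+y. T x y \<partial>lborel) * indicator ?B x" .
    qed
    finally show ?thesis .
  qed
  have "Qenergy \<alpha> v x0 r \<le> (\<integral>\<^sup>+y. (\<integral>\<^sup>+x. T x y * indicator ?B x * indicator ?B y \<partial>lborel) + (\<integral>\<^sup>+x. T y x * indicator ?B x * indicator ?B y \<partial>lborel) \<partial>lborel)"
    unfolding Qenergy_def
  proof (rule nn_integral_mono_AE)
    show "AE y in lborel. (\<integral>\<^sup>+x\<in>?B. Qkernel \<alpha> v x y \<partial>lborel) * indicator ?B y
      \<le> (\<integral>\<^sup>+x. T x y * indicator ?B x * indicator ?B y \<partial>lborel) + (\<integral>\<^sup>+x. T y x * indicator ?B x * indicator ?B y \<partial>lborel)"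
      using AE_depth_pos
    proof eventually_elim
      case y: (elim y)
      have "(\<integral>\<^sup>+x\<in>?B. Qkernel \<alpha> v x y \<partial>lborel) * indicator ?B y = (\<integral>\<^sup>+x. Qkernel \<alpha> v x y * indicator ?B x * indicator ?B y \<partial>lborel)"
        by (rule nn_integral_multc[symmetric]) measurable
      also have "\<dots> \<le> (\<integral>\<^sup>+x. T x y * indicator ?B x * indicator ?B y + T y x * indicator ?B x * indicator ?B y \<partial>lborel)"
      proof (rule nn_integral_mono_AE)
        show "AE x in lborel. Qkernel \<alpha> v x y * indicator ?B x * indicator ?B y \<le> T x y * indicator ?B x * indicator ?B y + T y x * indicator ?B x * indicator ?B y"
          using AE_depth_pos
        proof eventually_elim
          case (elim x)
          then show ?case using Qkernel_le_near_far[OF elim y] by (simp add: T_def split: split_indicator)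
        qed
      qed
      also have "\<dots> = (\<integral>\<^sup>+x. T x y * indicator ?B x * indicator ?B y \<partial>lborel) + (\<integral>\<^sup>+x. T y x * indicator ?B x * indicator ?B y \<partial>lborel)"
        by (rule nn_integral_add) measurable
      finally show ?case .
    qed
  qed
  also have "\<dots> = (\<integral>\<^sup>+y. (\<integral>\<^sup>+x. T x y * indicator ?B x * indicator ?B y \<partial>lborel) \<partial>lborel) + (\<integral>\<^sup>+y. (\<integral>\<^sup>+x. T y x * indicator ?B x * indicator ?B y \<partial>lborel) \<partial>lborel)"
  proof (rule nn_integral_add)
    have m: "(\<lambda>y. (\<integral>\<^sup>+x. T x y * indicator ?B x \<partial>lborel) * indicator ?B y) \<in> borel_measurable lborel"
      "(\<lambda>y. (\<integral>\<^sup>+x. T y x * indicator ?B x \<partial>lborel) * indicator ?B y) \<in> borel_measurable lborel" by measurable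
    have e: "(\<integral>\<^sup>+x. T x y * indicator ?B x * indicator ?B y \<partial>lborel) = (\<integral>\<^sup>+x. T x y * indicator ?B x \<partial>lborel) * indicator ?B y"
      "(\<integral>\<^sup>+x. T y x * indicator ?B x * indicator ?B y \<partial>lborel) = (\<integral>\<^sup>+x. T y x * indicator ?B x \<partial>lborel) * indicator ?B y" for y
      by (rule nn_integral_multc, measurable)+
    show "(\<lambda>y. \<integral>\<^sup>+x. T x y * indicator ?B x * indicator ?B y \<partial>lborel) \<in> borel_measurable lborel"
      "(\<lambda>y. \<integral>\<^sup>+x. T y x * indicator ?B x * indicator ?B y \<partial>lborel) \<in> borel_measurable lborel" unfolding e by (rule m)+
  qed
  also have "\<dots> \<le> S + S"
  proof (rule add_mono[OF sw])
    show "(\<integral>\<^sup>+y. (\<integral>\<^sup>+x. T y x * indicator ?B x * indicator ?B y \<partial>lborel) \<partial>lborel) \<le> S" unfolding S_def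
    proof (rule nn_integral_mono)
      fix y
      have "(\<integral>\<^sup>+x. T y x * indicator ?B x * indicator ?B y \<partial>lborel) \<le> (\<integral>\<^sup>+x. T y x * indicator ?B y \<partial>lborel)"
        by (intro nn_integral_mono) (auto split: split_indicator)
      also have "\<dots> = (\<integral>\<^sup>+x. T y x \<partial>lborel) * indicator ?B y"
        by (rule nn_integral_multc) measurable
      finally show "(\<integral>\<^sup>+x. T y x * indicator ?B x * indicator ?B y \<partial>lborel) \<le> (\<integral>\<^sup>+x. T y x \<partial>lborel) * indicator ?B y" .
    qed
  qed
  also have "\<dots> \<le> ennreal (((1 + a) * C2 \<alpha> CD + b * CD) * ?R * N\<^sup>2) + ennreal (((1 + a) * C2 \<alpha> CD + b * CD) * ?R * N\<^sup>2)"
    by (intro add_mono S)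
  also have "\<dots> = ennreal (((1 + a) * C2 \<alpha> CD + b * CD) * ?R * N\<^sup>2 + ((1 + a) * C2 \<alpha> CD + b * CD) * ?R * N\<^sup>2)"
    using ab C20 CD by (intro ennreal_plus[symmetric]) auto
  also have "((1 + a) * C2 \<alpha> CD + b * CD) * ?R * N\<^sup>2 + ((1 + a) * C2 \<alpha> CD + b * CD) * ?R * N\<^sup>2 = C10 \<alpha> CD * ?R * N\<^sup>2"
    by (simp add: C10_def a_def b_def algebra_simps)
  also have "ennreal (C10 \<alpha> CD * ?R * N\<^sup>2) \<le> ennreal ((C1 \<alpha> + C10 \<alpha> CD) * ?R * N\<^sup>2)"
    using C1_pos[of \<alpha>] by (intro ennreal_leI mult_right_mono) auto
  finally show ?thesis .
qed

end

section \<open>Q-norms and composition for Lebesgue measurable functions\<close>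

lemma lebesgue_measurable_AE_cong:
  fixes g g' :: "'a::euclidean_space \<Rightarrow> real"
  assumes g': "g' \<in> borel_measurable borel" and ae: "AE x in lborel. g x = g' x"
  shows "g \<in> borel_measurable lebesgue"
proof (rule borel_measurable_AE)
  show "g' \<in> borel_measurable lebesgue" using g' by (auto intro: measurable_completion)
  show "AE x in lebesgue. g' x = g x" using ae by (intro AE_completion) (auto elim: eventually_mono)
qed

lemma Q_norm_eq: "Q_norm \<alpha> u = (SUP (x0, r)\<in>UNIV \<times> {0<..}. ennreal_sqrt (ennreal (r powr (2 * \<alpha> - real CARD('n))) * Qenergy \<alpha> u x0 r))"
  for u :: "real ^ 'n \<Rightarrow> real"
  unfolding Q_norm_def Qenergy_def Qkernel_def by (simp only: nn_integral_completion)

lemma Qenergy_cong_AE: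
  assumes "AE x in lborel. u x = w x"
  shows "Qenergy \<alpha> u x0 r = Qenergy \<alpha> w x0 r"
  unfolding Qenergy_def
proof (rule nn_integral_cong_AE)
  show "AE y in lborel. (\<integral>\<^sup>+x\<in>ball x0 r. Qkernel \<alpha> u x y \<partial>lborel) * indicator (ball x0 r) y = (\<integral>\<^sup>+x\<in>ball x0 r. Qkernel \<alpha> w x y \<partial>lborel) * indicator (ball x0 r) y"
    using assms
  proof eventually_elim
    case (elim y)
    have "(\<integral>\<^sup>+x\<in>ball x0 r. Qkernel \<alpha> u x y \<partial>lborel) = (\<integral>\<^sup>+x\<in>ball x0 r. Qkernel \<alpha> w x y \<partial>lborel)"
    proof (rule nn_integral_cong_AE)
      show "AE x in lborel. Qkernel \<alpha> u x y * indicator (ball x0 r) x = Qkernel \<alpha> w x y * indicator (ball x0 r) x"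
        using assms by eventually_elim (simp add: Qkernel_def elim)
    qed
    then show ?case by simp
  qed
qed

lemma ennreal_sqrt_le_iff:
  assumes "0 \<le> N"
  shows "ennreal_sqrt t \<le> ennreal N \<longleftrightarrow> t \<le> ennreal (N\<^sup>2)"
proof (cases t)
  case (real a)
  then have "ennreal_sqrt t = ennreal (sqrt a)" by (simp add: ennreal_sqrt_def)
  moreover have "sqrt a \<le> N \<longleftrightarrow> a \<le> N\<^sup>2"
    using assms real by (metis real_sqrt_le_iff real_sqrt_abs abs_of_nonneg)
  ultimately show ?thesis using real assms by (simp add: ennreal_le_iff)
qed (auto simp: ennreal_sqrt_def top_unique)

text \<open>Turns the supremum of normalised square roots into the family of energy inequalities in
  which \<open>whitney_Q\<close> is phrased.\<close>

lemma Q_norm_le_iff: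
  fixes u :: "real ^ 'n \<Rightarrow> real"
  assumes N: "0 \<le> N"
  shows "Q_norm \<alpha> u \<le> ennreal N \<longleftrightarrow>
    (\<forall>x0 r. 0 < r \<longrightarrow> Qenergy \<alpha> u x0 r \<le> ennreal (r powr (real CARD('n) - 2 * \<alpha>) * N\<^sup>2))"
proof -
  have *: "ennreal_sqrt (ennreal (r powr (2 * \<alpha> - real CARD('n))) * Qenergy \<alpha> u x0 r) \<le> ennreal N \<longleftrightarrow>
     Qenergy \<alpha> u x0 r \<le> ennreal (r powr (real CARD('n) - 2 * \<alpha>) * N\<^sup>2)" if r: "0 < r" for x0 :: "real ^ 'n" and r
  proof -
    define a where "a = r powr (2 * \<alpha> - real CARD('n))"
    define b where "b = r powr (real CARD('n) - 2 * \<alpha>)"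
    have ab: "0 < a" "0 < b" "a * b = 1" using r by (auto simp: a_def b_def powr_add[symmetric])
    have ab': "ennreal a * ennreal b = 1" using ab by (simp add: ennreal_mult[symmetric])
    have "ennreal a * Qenergy \<alpha> u x0 r \<le> ennreal (N\<^sup>2) \<longleftrightarrow> Qenergy \<alpha> u x0 r \<le> ennreal b * ennreal (N\<^sup>2)"
    proof
      assume "ennreal a * Qenergy \<alpha> u x0 r \<le> ennreal (N\<^sup>2)"
      then have "ennreal b * (ennreal a * Qenergy \<alpha> u x0 r) \<le> ennreal b * ennreal (N\<^sup>2)" by (rule mult_left_mono) simp
      moreover have "ennreal b * (ennreal a * Qenergy \<alpha> u x0 r) = (ennreal a * ennreal b) * Qenergy \<alpha> u x0 r" by (simp only: mult_ac)
      ultimately show "Qenergy \<alpha> u x0 r \<le> ennreal b * ennreal (N\<^sup>2)" unfolding ab' by simp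
    next
      assume "Qenergy \<alpha> u x0 r \<le> ennreal b * ennreal (N\<^sup>2)"
      then have "ennreal a * Qenergy \<alpha> u x0 r \<le> ennreal a * (ennreal b * ennreal (N\<^sup>2))" by (rule mult_left_mono) simp
      also have "\<dots> = (ennreal a * ennreal b) * ennreal (N\<^sup>2)" by (simp only: mult_ac)
      finally show "ennreal a * Qenergy \<alpha> u x0 r \<le> ennreal (N\<^sup>2)" unfolding ab' by simp
    qed
    then show ?thesis
      using ab by (simp add: ennreal_sqrt_le_iff[OF N] a_def[symmetric] b_def[symmetric] ennreal_mult)
  qed
  have "Q_norm \<alpha> u \<le> ennreal N \<longleftrightarrow> (\<forall>x0 r. 0 < r \<longrightarrow> ennreal_sqrt (ennreal (r powr (2 * \<alpha> - real CARD('n))) * Qenergy \<alpha> u x0 r) \<le> ennreal N)"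
    unfolding Q_norm_eq SUP_le_iff by auto
  then show ?thesis using * by auto
qed

text \<open>Finite energy yields a point y with a finite inner integral, so w - w y is square
  integrable on the ball, and adding a constant changes nothing there.\<close>

lemma local_L2_from_Qenergy:
  fixes w :: "real ^ 'n \<Rightarrow> real"
  assumes w [measurable]: "w \<in> borel_measurable borel" and \<alpha>: "0 < \<alpha>" and r: "0 < r"
    and fin: "Qenergy \<alpha> w x0 r < top"
  shows "(\<integral>\<^sup>+x\<in>ball x0 r. ennreal ((w x)\<^sup>2) \<partial>lborel) < top"
proof -
  define A where "A = enn2real (Qenergy \<alpha> w x0 r) + 1"
  have A: "0 < A" "Qenergy \<alpha> w x0 r \<le> ennreal A"
  proof -
    have "Qenergy \<alpha> w x0 r = ennreal (enn2real (Qenergy \<alpha> w x0 r))" using fin by simp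
    also have "\<dots> \<le> ennreal A" unfolding A_def by (intro ennreal_leI) simp
    finally show "Qenergy \<alpha> w x0 r \<le> ennreal A" .
  qed (simp add: A_def add_nonneg_pos)
  obtain y where y: "y \<in> ball x0 r" "(\<integral>\<^sup>+x\<in>ball x0 r. Qkernel \<alpha> w x y \<partial>lborel) \<le> ennreal (2 * A / (unit_ball_vol (real DIM(real ^ 'n)) * r ^ DIM(real ^ 'n)))"
    using nn_integral_exists_le[OF A(1) r, where z = x0 and \<phi> = "\<lambda>y. \<integral>\<^sup>+x\<in>ball x0 r. Qkernel \<alpha> w x y \<partial>lborel"] A(2)
    unfolding Qenergy_def by blast
  have "(\<integral>\<^sup>+x\<in>ball x0 r. ennreal (\<bar>w x - w y\<bar>\<^sup>2) \<partial>lborel) \<le>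
    ennreal ((2 * r) powr (real CARD('n) + 2 * \<alpha>)) * (\<integral>\<^sup>+x\<in>ball x0 r. Qkernel \<alpha> w x y \<partial>lborel)"
    by (rule square_diff_le_Qkernel[OF w \<alpha> y(1)])
  also have "\<dots> < top" using y(2) by (simp add: ennreal_mult_less_top le_less_trans)
  finally have f1: "(\<integral>\<^sup>+x\<in>ball x0 r. ennreal (\<bar>w x - w y\<bar>\<^sup>2) \<partial>lborel) < top" .
  have "(\<integral>\<^sup>+x\<in>ball x0 r. ennreal ((w x)\<^sup>2) \<partial>lborel) \<le> (\<integral>\<^sup>+x. 2 * (ennreal (\<bar>w x - w y\<bar>\<^sup>2) * indicator (ball x0 r) x) + ennreal (2 * (w y)\<^sup>2) * indicator (ball x0 r) x \<partial>lborel)"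
  proof (rule nn_integral_mono)
    fix x
    have "(w x)\<^sup>2 \<le> 2 * \<bar>w x - w y\<bar>\<^sup>2 + 2 * (w y)\<^sup>2" using abs_diff_sq_le[of "w x" 0 "w y"] by simp
    then have "ennreal ((w x)\<^sup>2) \<le> ennreal (2 * \<bar>w x - w y\<bar>\<^sup>2 + 2 * (w y)\<^sup>2)" by (rule ennreal_leI)
    also have "\<dots> = 2 * ennreal (\<bar>w x - w y\<bar>\<^sup>2) + ennreal (2 * (w y)\<^sup>2)" by (simp add: ennreal_mult)
    finally show "ennreal ((w x)\<^sup>2) * indicator (ball x0 r) x \<le> 2 * (ennreal (\<bar>w x - w y\<bar>\<^sup>2) * indicator (ball x0 r) x) + ennreal (2 * (w y)\<^sup>2) * indicator (ball x0 r) x"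
      by (auto split: split_indicator)
  qed
  also have "\<dots> = 2 * (\<integral>\<^sup>+x\<in>ball x0 r. ennreal (\<bar>w x - w y\<bar>\<^sup>2) \<partial>lborel) + ennreal (2 * (w y)\<^sup>2) * emeasure lborel (ball x0 r)"
  proof -
    have "(\<integral>\<^sup>+x. 2 * (ennreal (\<bar>w x - w y\<bar>\<^sup>2) * indicator (ball x0 r) x) \<partial>lborel) = 2 * (\<integral>\<^sup>+x\<in>ball x0 r. ennreal (\<bar>w x - w y\<bar>\<^sup>2) \<partial>lborel)"
      by (rule nn_integral_cmult) measurable
    moreover have "(\<integral>\<^sup>+x. ennreal (2 * (w y)\<^sup>2) * indicator (ball x0 r) x \<partial>lborel) = ennreal (2 * (w y)\<^sup>2) * emeasure lborel (ball x0 r)"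
      by (rule nn_integral_cmult_indicator) simp
    ultimately show ?thesis by (subst nn_integral_add) simp_all
  qed
  also have "\<dots> < top"
    using f1 r by (simp add: ennreal_mult_less_top emeasure_ball)
  finally show ?thesis .
qed

context whitney_map
begin

text \<open>Off the subspace the preimage is the image of S under the locally Lipschitz inverse, and
  the subspace itself is null. This permits replacing u by a Borel representative before composing
  with f.\<close>

lemma negligible_vimage: "negligible S \<Longrightarrow> negligible (f -` S)"
proof -
  assume S: "negligible S"
  interpret i: whitney_map fi f c M by (rule inverse_map)
  have "f -` S \<subseteq> {z. depth z = 0} \<union> fi ` (S \<inter> {z. 0 < depth z})"
  proof
    fix x assume x: "x \<in> f -` S"
    show "x \<in> {z. depth z = 0} \<union> fi ` (S \<inter> {z. 0 < depth z})"
    proof (cases "depth x = 0")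
      case False
      then have "0 < depth (f x)" using depth_f_pos[of x] depth_nonneg[of x] by auto
      then show ?thesis using x by (intro UnI2 image_eqI[of x fi "f x"]) auto
    qed simp
  qed
  moreover have "negligible (fi ` (S \<inter> {z. 0 < depth z}))"
  proof (rule negligible_locally_Lipschitz_image)
    show "negligible (S \<inter> {z. 0 < depth z})" using S by (rule negligible_subset) auto
    fix x assume "x \<in> S \<inter> {z. 0 < depth z}"
    then have x: "0 < depth x" by simp
    show "\<exists>T B. open T \<and> x \<in> T \<and> (\<forall>y\<in>S \<inter> {z. 0 < depth z} \<inter> T. norm (fi y - fi x) \<le> B * norm (y - x))"
    proof (intro exI[of _ "ball x (i.r0 * depth x)"] exI[of _ "i.K * i.ratio x"] conjI ballI)
      fix y assume "y \<in> S \<inter> {z. 0 < depth z} \<inter> ball x (i.r0 * depth x)"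
      then have "dist x y < i.r0 * depth x" by simp
      then show "norm (fi y - fi x) \<le> i.K * i.ratio x * norm (y - x)"
        using i.dist_image_le(1)[OF x, of x y] x i.r0(1) by (simp add: dist_norm norm_minus_commute)
    qed (use x i.r0 in auto)
  qed simp
  ultimately show "negligible (f -` S)"
    using negligible_depth_zero negligible_Un negligible_subset by blast
qed

lemma AE_comp:
  assumes "AE x in lborel. P x"
  shows "AE x in lborel. P (f x)"
proof -
  obtain S where S: "S \<in> null_sets lborel" "{x \<in> space lborel. \<not> P x} \<subseteq> S" using assms by (auto elim!: AE_E simp: null_sets_def)
  then have "negligible S" by (simp add: negligible_iff_null_sets null_sets_completionI)
  then have "negligible (f -` S)" by (rule negligible_vimage)
  moreover have "f -` S \<in> sets borel" using measurable_sets[OF borel_f, of S] S(1) by auto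
  ultimately have "f -` S \<in> null_sets lborel"
    by (auto simp: negligible_iff_null_sets null_sets_def emeasure_completion)
  then show ?thesis using S(2) by (intro AE_I') auto
qed

lemma composition_bounded_f:
  assumes \<alpha>: "0 < \<alpha>" "2 * \<alpha> < real CARD('p)"
  shows "composition_bounded \<alpha> f"
proof -
  obtain CD where CD: "0 < CD" "\<And>(x0 :: real ^ ('k + 'p)) r. 0 < r \<Longrightarrow>
      (\<integral>\<^sup>+z\<in>ball x0 r. ennreal (depth z powr (- (2 * \<alpha>))) \<partial>lborel) \<le> ennreal (CD * r powr (real CARD('k + 'p) - 2 * \<alpha>))"
    using nn_integral_depth_powr_le[of "2 * \<alpha>", where 'k='k and 'p='p] \<alpha> by auto
  \<comment> \<open>N enters the energy bound squared, hence the root; the absolute value makes the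
    root legitimate at once.\<close>
  define A where "A = sqrt \<bar>C1 \<alpha> + C10 \<alpha> CD\<bar>"
  have A: "0 \<le> A" by (simp add: A_def)
  have main: "u \<circ> f \<in> Q_space \<alpha> \<and> Q_norm \<alpha> (u \<circ> f) \<le> ennreal A * Q_norm \<alpha> u" if u: "u \<in> Q_space \<alpha>" for u
  proof -
    have "u \<in> borel_measurable lebesgue" and fin: "Q_norm \<alpha> u < top" using u by (auto simp: Q_space_def)
    then obtain u' where u' [measurable]: "u' \<in> borel_measurable borel" and ae: "AE x in lborel. u x = u' x"
      using completion_ex_borel_measurable_real by force
    have ae2: "AE x in lborel. (u \<circ> f) x = (u' \<circ> f) x" using AE_comp[OF ae] by simp
    have le: "Q_norm \<alpha> (u \<circ> f) \<le> ennreal (A * N)" if NN: "0 < N" "Q_norm \<alpha> u \<le> ennreal N" for N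
    proof -
      interpret whitney_Q f fi c M \<alpha> CD N u'
      proof
        show "Qenergy \<alpha> u' x0 r \<le> ennreal (r powr (real CARD('k + 'p) - 2 * \<alpha>) * N\<^sup>2)" if "0 < r" for x0 r
        proof -
          have "Qenergy \<alpha> u x0 r \<le> ennreal (r powr (real CARD('k + 'p) - 2 * \<alpha>) * N\<^sup>2)"
            using Q_norm_le_iff[OF less_imp_le[OF NN(1)], of \<alpha> u] NN(2) that by blast
          then show ?thesis by (simp only: Qenergy_cong_AE[OF ae])
        qed
      qed (use \<alpha> CD NN u' in auto)
      have AN: "0 \<le> A * N" using A NN by simp
      show ?thesis unfolding Q_norm_le_iff[OF AN]
      proof (intro allI impI)
        fix x0 :: "real ^ ('k + 'p)" and r :: real assume r: "0 < r"
        have "Qenergy \<alpha> (u \<circ> f) x0 r = Qenergy \<alpha> v x0 r" unfolding v_def by (rule Qenergy_cong_AE[OF ae2])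
        also have "\<dots> \<le> ennreal ((C1 \<alpha> + C10 \<alpha> CD) * r powr (real CARD('k + 'p) - 2 * \<alpha>) * N\<^sup>2)" by (rule Qenergy_v_le[OF r])
        also have "\<dots> \<le> ennreal (\<bar>C1 \<alpha> + C10 \<alpha> CD\<bar> * r powr (real CARD('k + 'p) - 2 * \<alpha>) * N\<^sup>2)"
          by (intro ennreal_leI mult_right_mono) auto
        also have "\<bar>C1 \<alpha> + C10 \<alpha> CD\<bar> * r powr (real CARD('k + 'p) - 2 * \<alpha>) * N\<^sup>2 = r powr (real CARD('k + 'p) - 2 * \<alpha>) * (A * N)\<^sup>2"
          by (simp add: A_def power_mult_distrib)
        finally show "Qenergy \<alpha> (u \<circ> f) x0 r \<le> ennreal (r powr (real CARD('k + 'p) - 2 * \<alpha>) * (A * N)\<^sup>2)" .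
      qed
    qed
    define Q where "Q = enn2real (Q_norm \<alpha> u)"
    have Q: "Q_norm \<alpha> u = ennreal Q" "0 \<le> Q" using fin by (auto simp: Q_def)
    have bound: "Q_norm \<alpha> (u \<circ> f) \<le> ennreal A * Q_norm \<alpha> u"
    proof (rule ennreal_le_epsilon)
      fix e :: real assume e: "0 < e"
      \<comment> \<open>The Q-norm of u may vanish, while the energy argument needs a positive
        bound; the surplus contributes at most e after multiplication by A.\<close>
      define N where "N = Q + e / (A + 1)"
      have ea: "0 < e / (A + 1)" using e A by simp
      have "Q_norm \<alpha> (u \<circ> f) \<le> ennreal (A * N)" using Q ea by (intro le) (auto simp: N_def intro!: ennreal_leI add_nonneg_pos)
      also have "A * N \<le> A * Q + e"
      proof -
        have "A * (e / (A + 1)) \<le> e" using A e by (simp add: field_simps)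
        then show ?thesis by (simp add: N_def distrib_left)
      qed
      finally show "Q_norm \<alpha> (u \<circ> f) \<le> ennreal A * Q_norm \<alpha> u + ennreal e"
        using A Q e by (simp add: ennreal_mult[symmetric] ennreal_plus[symmetric] ennreal_leI del: ennreal_plus)
    qed
    have fin2: "Q_norm \<alpha> (u \<circ> f) < top" using bound fin by (auto simp: ennreal_mult_less_top intro: le_less_trans)
    have meas: "u \<circ> f \<in> borel_measurable lebesgue"
      by (rule lebesgue_measurable_AE_cong[OF _ ae2]) (simp add: comp_def)
    have "locally_integrable UNIV (\<lambda>x. ((u \<circ> f) x)\<^sup>2)"
      unfolding locally_integrable_def
    proof (intro allI impI)
      fix S :: "(real ^ ('k + 'p)) set" assume S: "compact S \<and> S \<subseteq> UNIV"
      obtain r where r: "0 < r" "S \<subseteq> ball 0 r"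
        using compact_imp_bounded[of S] S bounded_subset_ballD[of S 0] by auto
      have "Qenergy \<alpha> (u \<circ> f) 0 r < top"
      proof -
        have "Q_norm \<alpha> (u \<circ> f) \<le> ennreal (enn2real (Q_norm \<alpha> (u \<circ> f)))" using fin2 by simp
        then have "Qenergy \<alpha> (u \<circ> f) 0 r \<le> ennreal (r powr (real CARD('k + 'p) - 2 * \<alpha>) * (enn2real (Q_norm \<alpha> (u \<circ> f)))\<^sup>2)"
          using Q_norm_le_iff[OF enn2real_nonneg, of \<alpha> "u \<circ> f"] r(1) by blast
        then show ?thesis by (rule le_less_trans) simp
      qed
      then have "Qenergy \<alpha> (u' \<circ> f) 0 r < top" by (simp only: Qenergy_cong_AE[OF ae2])
      then have "(\<integral>\<^sup>+x\<in>ball 0 r. ennreal (((u' \<circ> f) x)\<^sup>2) \<partial>lborel) < top"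
        using \<alpha> r by (intro local_L2_from_Qenergy) (auto simp: comp_def)
      also have "(\<integral>\<^sup>+x\<in>ball 0 r. ennreal (((u' \<circ> f) x)\<^sup>2) \<partial>lborel) = (\<integral>\<^sup>+x\<in>ball 0 r. ennreal (((u \<circ> f) x)\<^sup>2) \<partial>lborel)"
        by (rule nn_integral_cong_AE) (use ae2 in eventually_elim, simp)
      finally have f: "(\<integral>\<^sup>+x\<in>ball 0 r. ennreal (((u \<circ> f) x)\<^sup>2) \<partial>lborel) < top" .
      have Sm: "S \<in> sets lebesgue" using S by (simp add: compact_imp_closed)
      show "(\<lambda>x. ((u \<circ> f) x)\<^sup>2) absolutely_integrable_on S"
        unfolding set_integrable_def
      proof (rule integrableI_bounded)
        have [measurable]: "u \<circ> f \<in> borel_measurable lebesgue" "S \<in> sets lebesgue" by (fact meas Sm)+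
        show "(\<lambda>x. indicat_real S x *\<^sub>R ((u \<circ> f) x)\<^sup>2) \<in> borel_measurable lebesgue" by measurable
        have "(\<integral>\<^sup>+x. ennreal (norm (indicat_real S x *\<^sub>R ((u \<circ> f) x)\<^sup>2)) \<partial>lebesgue) \<le> (\<integral>\<^sup>+x\<in>ball 0 r. ennreal (((u \<circ> f) x)\<^sup>2) \<partial>lebesgue)"
          using r by (intro nn_integral_mono) (auto split: split_indicator)
        also have "\<dots> < \<infinity>" using f by (simp add: nn_integral_completion)
        finally show "(\<integral>\<^sup>+x. ennreal (norm (indicat_real S x *\<^sub>R ((u \<circ> f) x)\<^sup>2)) \<partial>lebesgue) < \<infinity>" .
      qed
    qed
    then show ?thesis using meas fin2 bound by (simp add: Q_space_def)
  qed
  show ?thesis unfolding composition_bounded_def using main by blast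
qed

end

section \<open>The inverse of a Tukia-Vaisala extension\<close>

lemma depth_embed [simp]: "depth (embed x) = 0"
  by (simp add: depth_def ypart_def embed_def vec_eq_iff)

lemma depth_zero_iff: "depth z = 0 \<longleftrightarrow> z \<in> range embed"
proof
  assume "depth z = 0"
  then have "z $ Inr j = 0" for j by (auto simp: depth_def ypart_def vec_eq_iff)
  then have "z = embed (\<chi> a. z $ Inl a)" by (auto simp: embed_def vec_eq_iff split: sum.split)
  then show "z \<in> range embed" by blast
qed auto

lemma reflect_depth_zero: "depth z = 0 \<Longrightarrow> reflect z = z"
  by (auto simp: depth_def ypart_def reflect_def vec_eq_iff split: sum.split)

lemma CARD_one_depth:
  assumes p: "CARD('p::finite) = 1"
  shows "depth (z :: real ^ ('k::finite + 'p)) = \<bar>ypart z $ j\<bar>"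
proof -
  obtain i where "(UNIV :: 'p set) = {i}" using p card_1_singletonE by blast
  then have "UNIV = {j}" by (metis UNIV_I singletonD)
  then have "norm (ypart z) = L2_set (\<lambda>i. norm (ypart z $ i)) {j}" by (simp only: norm_vec_def)
  then show ?thesis by (simp add: depth_def)
qed

lemma CARD_one_all: 
  assumes p: "CARD('p::finite) = 1"
  shows "(\<forall>i::'p. P i) \<longleftrightarrow> P j"
proof -
  obtain i where "(UNIV :: 'p set) = {i}" using p card_1_singletonE by blast
  then show ?thesis by (metis UNIV_I singletonD)
qed

lemma closed_half_space_iff: "CARD('p::finite) = 1 \<Longrightarrow> (z :: real ^ ('k::finite + 'p)) \<in> closed_half_space \<longleftrightarrow> 0 \<le> ypart z $ j"
  unfolding closed_half_space_def using CARD_one_all[of "\<lambda>i. 0 \<le> ypart z $ i" j] by simp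

lemma upper_half_space_iff: "CARD('p::finite) = 1 \<Longrightarrow> (z :: real ^ ('k::finite + 'p)) \<in> upper_half_space \<longleftrightarrow> 0 < ypart z $ j"
  unfolding upper_half_space_def using CARD_one_all[of "\<lambda>i. 0 < ypart z $ i" j] by simp

text \<open>The lower bilipschitz inequality at preimages is the upper one for the inverse, so one
  Lipschitz lemma serves both maps with the same constants.\<close>

lemma hdist_bilipschitz_ball_bounds:
  fixes f fi :: "real ^ ('k::finite + 'p::finite) \<Rightarrow> real ^ ('k + 'p)"
  assumes H: "\<And>z. z \<in> H \<Longrightarrow> 0 < depth z" "\<And>z. z \<in> H \<Longrightarrow> ball z (depth z) \<subseteq> H"
    and fH: "f ` H \<subseteq> H" and fiH: "fi ` H \<subseteq> H" and inv: "\<And>z. z \<in> H \<Longrightarrow> f (fi z) = z"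
    and bil: "hdist_bilipschitz H f"
  obtains c M where "0 < c" "c \<le> 1" "1 \<le> M" "conformal_ball_bound c M H f" "conformal_ball_bound c M H fi"
proof -
  obtain L where L: "1 \<le> L" and lip: "\<And>w w'. w \<in> H \<Longrightarrow> w' \<in> H \<Longrightarrow>
        ennreal (1 / L) * hdist H w w' \<le> hdist H (f w) (f w') \<and> hdist H (f w) (f w') \<le> ennreal L * hdist H w w'"
    using bil unfolding hdist_bilipschitz_def by blast
  have "conformal_ball_bound (1 / (16 * L)) (4 * L) H f"
    using lip by (intro hdist_lipschitz_imp_conformal_ball_bound H fH L) auto
  moreover have "conformal_ball_bound (1 / (16 * L)) (4 * L) H fi"
  proof (intro hdist_lipschitz_imp_conformal_ball_bound H fiH L)
    fix w w' assume w: "w \<in> H" "w' \<in> H"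
    then have "ennreal (1 / L) * hdist H (fi w) (fi w') \<le> hdist H w w'"
      using lip[of "fi w" "fi w'"] fiH inv by (simp add: image_subset_iff)
    then have "ennreal L * (ennreal (1 / L) * hdist H (fi w) (fi w')) \<le> ennreal L * hdist H w w'"
      by (rule mult_left_mono) simp
    moreover have "ennreal L * (ennreal (1 / L) * hdist H (fi w) (fi w')) = hdist H (fi w) (fi w')"
    proof -
      have "ennreal L * ennreal (1 / L) = 1" using L by (simp add: ennreal_mult[symmetric])
      then show ?thesis by (simp add: mult.assoc[symmetric])
    qed
    ultimately show "hdist H (fi w) (fi w') \<le> ennreal L * hdist H w w'" by simp
  qed
  ultimately show thesis using L by (intro that[of "1 / (16 * L)" "4 * L"]) auto
qed

text \<open>The two formulas for h agree on the common boundary, whose points and their images are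
  fixed by \<open>reflect\<close>; continuity follows by pasting on two closed half-spaces. Used for
  the extension and for its inverse.\<close>

lemma reflection_extension:
  fixes h :: "real ^ ('k::finite + 'p::finite) \<Rightarrow> real ^ ('k + 'p)"
  assumes p: "CARD('p) = 1" and cont: "continuous_on closed_half_space h"
    and E: "\<And>z. depth z = 0 \<Longrightarrow> depth (h z) = 0"
    and ext: "\<And>z. z \<notin> closed_half_space \<Longrightarrow> h z = reflect (h (reflect z))"
  shows "continuous_on UNIV h" "h (reflect z) = reflect (h z)"
proof -
  fix j :: 'p
  let ?C = "closed_half_space :: (real ^ ('k + 'p)) set"
  have C: "z \<in> ?C \<longleftrightarrow> 0 \<le> ypart z $ j" for z using closed_half_space_iff[OF p, of z j] .
  have eq: "h z = reflect (h (reflect z))" if "ypart z $ j \<le> 0" for z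
  proof (cases "z \<in> ?C")
    case True
    then have "depth z = 0" using that C CARD_one_depth[OF p, of z j] by simp
    then show ?thesis using E[of z] by (simp add: reflect_depth_zero)
  qed (rule ext)
  show "h (reflect z) = reflect (h z)" for z
    using eq[of z] eq[of "reflect z"] by (cases "ypart z $ j \<le> 0") auto
  have cr: "continuous_on UNIV (reflect :: real ^ ('k + 'p) \<Rightarrow> _)"
    by (rule lipschitz_on_continuous_on[of 1]) (simp add: lipschitz_on_def)
  let ?D = "{z :: real ^ ('k + 'p). ypart z $ j \<le> 0}"
  have "continuous_on ?D (\<lambda>z. reflect (h (reflect z)))"
  proof (rule continuous_on_compose2[OF cr])
    show "continuous_on ?D (\<lambda>z. h (reflect z))"
      by (rule continuous_on_compose2[OF cont continuous_on_subset[OF cr]]) (auto simp: C)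
  qed auto
  then have cD: "continuous_on ?D h" by (rule continuous_on_eq) (use eq in auto)
  have cy: "continuous_on UNIV (\<lambda>z :: real ^ ('k + 'p). ypart z $ j)" unfolding ypart_def by (simp add: continuous_intros)
  have cd: "closed ?D" by (intro closed_Collect_le cy continuous_intros)
  have CC: "?C = {z. 0 \<le> ypart z $ j}"
  proof (rule set_eqI)
    fix z :: "real ^ ('k + 'p)"
    show "z \<in> ?C \<longleftrightarrow> z \<in> {z. 0 \<le> ypart z $ j}" unfolding C mem_Collect_eq ..
  qed
  have "closed ?C" unfolding CC by (intro closed_Collect_le cy continuous_on_const)
  then have un: "continuous_on (?C \<union> ?D) h" by (rule continuous_on_closed_Un[OF _ cd cont cD])
  have UN: "?C \<union> ?D = UNIV"
  proof (intro set_eqI iffI UNIV_I)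
    fix z :: "real ^ ('k + 'p)"
    show "z \<in> ?C \<union> ?D" using linear[of 0 "ypart z $ j"] C[of z] by blast
  qed
  show "continuous_on UNIV h" using un unfolding UN .
qed

lemma conformal_ball_bound_reflect:
  fixes h :: "real ^ ('k::finite + 'p::finite) \<Rightarrow> real ^ ('k + 'p)"
  assumes p: "CARD('p) = 1" and refl: "\<And>z. h (reflect z) = reflect (h z)"
    and cb: "conformal_ball_bound c M upper_half_space h"
  shows "conformal_ball_bound c M {z. 0 < depth z} h"
  unfolding conformal_ball_bound_def
proof (intro ballI allI impI)
  fix z w :: "real ^ ('k + 'p)" assume z: "z \<in> {z. 0 < depth z}" and zw: "dist z w < c * depth z"
  fix j :: 'p
  show "dist (h z) (h w) * depth z \<le> M * depth (h z) * dist z w"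
  proof (cases "0 < ypart z $ j")
    case True
    then have "z \<in> upper_half_space" using upper_half_space_iff[OF p] by blast
    then show ?thesis using cb zw by (auto simp: conformal_ball_bound_def)
  next
    case False
    have "ypart z $ j \<noteq> 0" using z CARD_one_depth[OF p, of z j] by auto
    then have "0 < ypart (reflect z) $ j" using False by simp
    then have "reflect z \<in> upper_half_space" using upper_half_space_iff[OF p] by blast
    then have "dist (h (reflect z)) (h (reflect w)) * depth (reflect z) \<le> M * depth (h (reflect z)) * dist (reflect z) (reflect w)"
      using zw by (intro cb[unfolded conformal_ball_bound_def, rule_format]) auto
    then show ?thesis by (simp add: refl)
  qed
qed

text \<open>Since g is onto, f maps the subspace onto itself, and injectivity forces points off the
  subspace to stay off it. With the bilipschitz property this gives the ball bounds in both
  directions; in codimension one they are carried to the lower half-space by symmetry.\<close>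

lemma tukia_vaisala_whitney_map:
  fixes g :: "real ^ 'k::finite \<Rightarrow> real ^ 'k" and f :: "real ^ ('k + 'p::finite) \<Rightarrow> real ^ ('k + 'p)"
  assumes g: "if CARD('k) = 1 then quasisymmetric g else quasiconformal g"
    and f: "tukia_vaisala_extension g f"
  shows "\<exists>fi c M. whitney_map f fi c M"
proof -
  obtain g' where g': "homeomorphism UNIV UNIV g g'"
    using g by (auto simp: quasisymmetric_def quasiconformal_def split: if_splits)
  have gg: "g (g' x) = x" for x using g' by (auto simp: homeomorphism_def)
  have fe: "f (embed x) = embed (g x)" for x using f by (auto simp: tukia_vaisala_extension_def)
  have E1: "depth (f z) = 0" if "depth z = 0" for z using that by (auto simp: depth_zero_iff fe)
  have E2: "\<exists>x. depth x = 0 \<and> f x = z" if "depth z = 0" for z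
  proof -
    have "z \<in> range embed" using that depth_zero_iff[of z] by simp
    then obtain w where "z = embed w" by blast
    then have "f (embed (g' w)) = z" by (simp add: fe gg)
    then show ?thesis by (intro exI[of _ "embed (g' w)"]) simp
  qed
  show ?thesis
  proof (cases "CARD('p) = 1")
    case False
    obtain fi where hom: "homeomorphism UNIV UNIV f fi" and bil: "hdist_bilipschitz complement_space f"
      using f False by (auto simp: tukia_vaisala_extension_def quasiconformal_def)
    have inv: "f (fi z) = z" "fi (f z) = z" for z using hom by (auto simp: homeomorphism_def)
    have d0: "depth (f z) = 0 \<longleftrightarrow> depth z = 0" for z
      using E1[of z] E2[of "f z"] inv by metis
    have H: "(complement_space :: (real ^ ('k + 'p)) set) = {z. 0 < depth z}"
      by (auto simp: complement_space_def depth_def)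
    have pos: "0 < depth (f z) \<longleftrightarrow> 0 < depth z" for z using d0[of z] by (simp add: less_le)
    obtain c M where "0 < c" "c \<le> 1" "1 \<le> M" "conformal_ball_bound c M complement_space f" "conformal_ball_bound c M complement_space fi"
    proof (rule hdist_bilipschitz_ball_bounds[of "complement_space :: (real ^ ('k + 'p)) set" f fi])
      show "ball z (depth z) \<subseteq> complement_space" for z :: "real ^ ('k + 'p)"
      proof
        fix w assume "w \<in> ball z (depth z)"
        then show "w \<in> complement_space" unfolding H using depth_lipschitz[of z w] by simp
      qed
      show "fi ` complement_space \<subseteq> complement_space"
      proof
        fix x assume "x \<in> fi ` complement_space"
        then obtain z where "x = fi z" "0 < depth z" unfolding H by auto
        then show "x \<in> complement_space" unfolding H using pos[of x] inv by simp
      qed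
    qed (use inv bil pos in \<open>auto simp: H\<close>)
    then have "whitney_map f fi c M" using hom d0 False by unfold_locales (auto simp: H)
    then show ?thesis by blast
  next
    case p: True
    fix j :: 'p
    let ?C = "closed_half_space :: (real ^ ('k + 'p)) set" and ?U = "upper_half_space :: (real ^ ('k + 'p)) set"
    obtain f' where hom: "homeomorphism ?C ?C f f'" and bil: "hdist_bilipschitz ?U f"
      and ext: "\<And>z. z \<notin> ?C \<Longrightarrow> f z = reflect (f (reflect z))"
      using f p by (auto simp: tukia_vaisala_extension_def)
    have fC: "f z \<in> ?C" "f' (f z) = z" "f' z \<in> ?C" "f (f' z) = z" if "z \<in> ?C" for z
      using hom that by (auto simp: homeomorphism_def)
    have C: "z \<in> ?C \<longleftrightarrow> 0 \<le> ypart z $ j" and U: "z \<in> ?U \<longleftrightarrow> 0 < ypart z $ j" for z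
      using closed_half_space_iff[OF p, of z j] upper_half_space_iff[OF p, of z j] by auto
    have d: "depth z = \<bar>ypart z $ j\<bar>" for z :: "real ^ ('k + 'p)" by (rule CARD_one_depth[OF p])
    have UC: "z \<in> ?U \<longleftrightarrow> z \<in> ?C \<and> depth z \<noteq> 0" for z using C U d by auto
    have EC: "z \<in> ?C" if "depth z = 0" for z using that C d by simp
    have d0C: "depth (f z) = 0 \<longleftrightarrow> depth z = 0" if z: "z \<in> ?C" for z
    proof
      assume "depth (f z) = 0"
      then obtain x where "depth x = 0" "f x = f z" using E2 by blast
      then show "depth z = 0" using fC(2)[of x] fC(2)[of z] EC z by metis
    qed (rule E1)
    have d0C': "depth (f' z) = 0 \<longleftrightarrow> depth z = 0" if z: "z \<in> ?C" for z
      using d0C[of "f' z"] fC(3,4)[OF z] by simp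
    \<comment> \<open>The given inverse lives on the closed half-space only; it is continued by the
      same reflection rule as f.\<close>
    define fi where "fi z = (if z \<in> ?C then f' z else reflect (f' (reflect z)))" for z
    have RC: "reflect z \<in> ?C \<and> reflect z \<in> ?U" if "z \<notin> ?C" for z using that by (simp add: C U)
    have fU: "f z \<in> ?U" if "z \<in> ?U" for z using that d0C fC(1) UC by auto
    have f'U: "f' z \<in> ?U" if "z \<in> ?U" for z using that d0C' fC(3) UC by auto
    have RU: "reflect z \<notin> ?C" if "z \<in> ?U" for z using that by (simp add: C U)
    have fif: "fi (f z) = z" for z
    proof (cases "z \<in> ?C")
      case False
      have "f (reflect z) \<in> ?U" using RC[OF False] fU by blast
      then have "f z \<notin> ?C" using ext[OF False] RU by simp
      then show ?thesis using ext[OF False] RC[OF False] fC(2)[of "reflect z"] by (simp add: fi_def)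
    qed (simp add: fi_def fC)
    have ffi: "f (fi z) = z" for z
    proof (cases "z \<in> ?C")
      case False
      have "f' (reflect z) \<in> ?U" using RC[OF False] f'U by blast
      then have "fi z \<notin> ?C" using False RU by (simp add: fi_def)
      then show ?thesis using ext[of "fi z"] False RC[OF False] fC(4)[of "reflect z"] by (simp add: fi_def)
    qed (simp add: fi_def fC)
    have cont: "continuous_on ?C f" and cont': "continuous_on ?C fi"
    proof -
      show "continuous_on ?C f" using hom by (simp add: homeomorphism_def)
      have "continuous_on ?C f'" using hom by (simp add: homeomorphism_def)
      then show "continuous_on ?C fi" by (rule continuous_on_eq) (simp add: fi_def)
    qed
    have ext': "fi z = reflect (fi (reflect z))" if "z \<notin> ?C" for z using that RC[OF that] by (simp add: fi_def)
    have E': "depth (fi z) = 0" if "depth z = 0" for z using that EC[OF that] d0C'[of z] by (simp add: fi_def)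
    note rf = reflection_extension[OF p cont E1 ext] and rfi = reflection_extension[OF p cont' E' ext']
    have hom2: "homeomorphism UNIV UNIV f fi"
    proof -
      have "range f = UNIV" using ffi by (rule surjI)
      moreover have "range fi = UNIV" using fif by (rule surjI)
      ultimately show ?thesis unfolding homeomorphism_def using rf(1) rfi(1) ffi fif by simp
    qed
    have d0: "depth (f z) = 0 \<longleftrightarrow> depth z = 0" for z using E1[of z] E'[of "f z"] fif by auto
    obtain c M where cM: "0 < c" "c \<le> 1" "1 \<le> M" "conformal_ball_bound c M ?U f" "conformal_ball_bound c M ?U fi"
    proof (rule hdist_bilipschitz_ball_bounds[of ?U f fi])
      show "0 < depth z" if "z \<in> ?U" for z using that U d by auto
      show "ball z (depth z) \<subseteq> ?U" if "z \<in> ?U" for z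
      proof
        fix w assume "w \<in> ball z (depth z)"
        then have "norm (ypart (z - w)) < depth z" using norm_ypart_le[of "z - w"] by (simp add: dist_norm)
        then have "\<bar>ypart (z - w) $ j\<bar> < depth z" using component_le_norm_cart[of "ypart (z - w)" j] by linarith
        then show "w \<in> ?U" using that U d[of z] by auto
      qed
      show "fi ` ?U \<subseteq> ?U" using f'U UC by (auto simp: fi_def)
    qed (use ffi fU bil in auto)
    have "whitney_map f fi c M"
      using hom2 d0 cM rf(2) conformal_ball_bound_reflect[OF p rf(2) cM(4)] conformal_ball_bound_reflect[OF p rfi(2) cM(5)]
      by unfold_locales auto
    then show ?thesis by blast
  qed
qed

section \<open>Test functions\<close>

text \<open>The standard smooth function vanishing on the negative axis, with powers of t in the
  denominator so that the family is closed under differentiation up to linear combinations.\<close>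

definition flat :: "nat \<Rightarrow> real \<Rightarrow> real" where
  "flat m t = (if 0 < t then exp (- (1 / t)) / t ^ m else 0)"

lemma flat_nonneg: "0 \<le> flat m t"
  by (simp add: flat_def)

text \<open>The exponential beats every power: (s / k)^k is at most exp s with k = m + 2 and s = 1 /
  t. The two extra powers make the derivative at zero vanish.\<close>

lemma flat_le_square: "flat m t \<le> real (m + 2) ^ (m + 2) * t\<^sup>2"
proof (cases "0 < t")
  case True
  define s where "s = 1 / t"
  have s: "0 < s" using True by (simp add: s_def)
  let ?k = "m + 2"
  have k: "0 < real ?k" by simp
  have "(s / real ?k) ^ ?k \<le> (exp (s / real ?k)) ^ ?k"
  proof (rule power_mono)
    have "1 + s / real ?k \<le> exp (s / real ?k)" by (rule exp_ge_add_one_self)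
    then show "s / real ?k \<le> exp (s / real ?k)" by linarith
  qed (use s in simp)
  also have "\<dots> = exp (real ?k * (s / real ?k))" by (rule exp_of_nat_mult[symmetric])
  also have "real ?k * (s / real ?k) = s" by simp
  finally have "s ^ ?k / real ?k ^ ?k \<le> exp s" by (simp only: power_divide)
  then have "s ^ ?k \<le> exp s * real ?k ^ ?k" using k by (simp add: pos_divide_le_eq)
  then have "s ^ ?k * exp (-s) \<le> (exp s * real ?k ^ ?k) * exp (-s)" by (rule mult_right_mono) simp
  also have "\<dots> = real ?k ^ ?k" by (simp add: exp_minus)
  finally have 1: "s ^ ?k * exp (-s) \<le> real ?k ^ ?k" .
  have "flat m t = (s ^ ?k * exp (-s)) * t\<^sup>2"
    using True by (simp add: flat_def s_def power_divide power_add power2_eq_square)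
  also have "\<dots> \<le> real ?k ^ ?k * t\<^sup>2" by (rule mult_right_mono[OF 1]) simp
  finally show ?thesis .
qed (simp add: flat_def)

lemma flat_has_derivative: "(flat m has_real_derivative (flat (m + 2) t - real m * flat (m + 1) t)) (at t)"
proof -
  consider "0 < t" | "t < 0" | "t = 0" by linarith
  then show ?thesis
  proof cases
    case 1
    have "((\<lambda>t. exp (- (1 / t)) / t ^ m) has_real_derivative (flat (m + 2) t - real m * flat (m + 1) t)) (at t)"
    proof -
      have "((\<lambda>t. exp (- (1 / t)) / t ^ m) has_real_derivative
         ((exp (- (1 / t)) * (1 / t\<^sup>2)) * t ^ m - exp (- (1 / t)) * (real m * t ^ (m - 1))) / (t ^ m * t ^ m)) (at t)"
        using 1 by (auto intro!: derivative_eq_intros simp: power2_eq_square)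
      also have "((exp (- (1 / t)) * (1 / t\<^sup>2)) * t ^ m - exp (- (1 / t)) * (real m * t ^ (m - 1))) / (t ^ m * t ^ m) = flat (m + 2) t - real m * flat (m + 1) t"
      proof -
        have a: "(exp (- (1 / t)) * (1 / t\<^sup>2)) * t ^ m / (t ^ m * t ^ m) = flat (m + 2) t"
          using 1 by (simp add: flat_def power_add power2_eq_square)
        have b: "exp (- (1 / t)) * (real m * t ^ (m - 1)) / (t ^ m * t ^ m) = real m * flat (m + 1) t"
          using 1 by (cases m) (simp_all add: flat_def)
        show ?thesis unfolding diff_divide_distrib a b ..
      qed
      finally show ?thesis .
    qed
    then show ?thesis
    proof (rule has_field_derivative_transform_within[of _ _ _ _ t])
      show "0 < t" by fact
      fix s assume "dist s t < t"
      then show "exp (- (1 / s)) / s ^ m = flat m s" by (auto simp: flat_def dist_real_def)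
    qed simp
  next
    case 2
    have "((\<lambda>t. 0) has_real_derivative 0) (at t)" by simp
    then have "(flat m has_real_derivative 0) (at t)"
    proof (rule has_field_derivative_transform_within[of _ _ _ _ "-t"])
      show "0 < - t" using 2 by simp
      fix s assume "dist s t < - t"
      then show "0 = flat m s" by (auto simp: flat_def dist_real_def)
    qed simp
    then show ?thesis using 2 by (simp add: flat_def)
  next
    case 3
    define B where "B = real (m + 2) ^ (m + 2)"
    have "((\<lambda>s. flat m s / s) \<longlongrightarrow> 0) (at 0)"
    proof (rule Lim_null_comparison)
      show "\<forall>\<^sub>F s in at 0. norm (flat m s / s) \<le> B * \<bar>s\<bar>"
      proof (rule always_eventually, rule allI)
        fix s :: real
        have "\<bar>flat m s\<bar> \<le> B * \<bar>s\<bar> * \<bar>s\<bar>"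
          using flat_le_square[of m s] flat_nonneg[of m s] by (simp add: B_def power2_eq_square mult.assoc)
        then show "norm (flat m s / s) \<le> B * \<bar>s\<bar>" by (cases "s = 0") (simp_all add: pos_divide_le_eq B_def)
      qed
      have "((\<lambda>s. B * \<bar>s\<bar>) \<longlongrightarrow> B * \<bar>0\<bar>) (at 0)" by (intro tendsto_intros)
      then show "((\<lambda>s. B * \<bar>s\<bar>) \<longlongrightarrow> 0) (at 0)" by simp
    qed
    then show ?thesis using 3 by (simp add: has_field_derivative_iff flat_def)
  qed
qed

lemma Ck_continuous: "Ck k \<phi> \<Longrightarrow> continuous_on UNIV \<phi>"
proof (cases k)
  case (Suc j)
  assume "Ck k \<phi>"
  then have "\<phi> differentiable (at x)" for x using Suc by simp
  then show ?thesis using differentiable_imp_continuous_within by (blast intro: continuous_at_imp_continuous_on)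
qed simp

lemma Ck_pred: "Ck (Suc k) \<phi> \<Longrightarrow> Ck k \<phi>"
proof (induction k arbitrary: \<phi>)
  case 0
  then have "continuous_on UNIV \<phi>" by (rule Ck_continuous)
  then show ?case by simp
next
  case (Suc k)
  then show ?case by (metis Ck.simps(2))
qed

lemma Ck_SucI:
  assumes "\<And>x. (\<phi> has_derivative \<phi>' x) (at x)" "\<And>b. b \<in> Basis \<Longrightarrow> Ck k (\<lambda>x. \<phi>' x b)"
  shows "Ck (Suc k) \<phi>"
proof -
  have "frechet_derivative \<phi> (at x) = \<phi>' x" for x using frechet_derivative_at[OF assms(1)] by simp
  then show ?thesis using assms by (auto simp: differentiable_def)
qed

lemma Ck_SucD:
  assumes "Ck (Suc k) \<phi>"
  shows "(\<phi> has_derivative frechet_derivative \<phi> (at x)) (at x)" "b \<in> Basis \<Longrightarrow> Ck k (\<lambda>x. frechet_derivative \<phi> (at x) b)"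
  using assms by (simp_all add: frechet_derivative_works[symmetric])

lemma Ck_add: "Ck k \<phi> \<Longrightarrow> Ck k \<psi> \<Longrightarrow> Ck k (\<lambda>x. \<phi> x + \<psi> x)"
proof (induction k arbitrary: \<phi> \<psi>)
  case 0
  then show ?case by (simp add: continuous_on_add)
next
  case (Suc k)
  show ?case
    by (rule Ck_SucI[OF has_derivative_add[OF Ck_SucD(1)[OF Suc.prems(1)] Ck_SucD(1)[OF Suc.prems(2)]]])
      (intro Suc.IH Ck_SucD(2)[OF Suc.prems(1)] Ck_SucD(2)[OF Suc.prems(2)])
qed

lemma Ck_mult: "Ck k \<phi> \<Longrightarrow> Ck k \<psi> \<Longrightarrow> Ck k (\<lambda>x. \<phi> x * \<psi> x)"
proof (induction k arbitrary: \<phi> \<psi>)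
  case 0
  then show ?case by (simp add: continuous_on_mult)
next
  case (Suc k)
  show ?case
    by (rule Ck_SucI[OF has_derivative_mult[OF Ck_SucD(1)[OF Suc.prems(1)] Ck_SucD(1)[OF Suc.prems(2)]]])
      (intro Ck_add Suc.IH Ck_SucD(2)[OF Suc.prems(1)] Ck_SucD(2)[OF Suc.prems(2)] Ck_pred[OF Suc.prems(1)] Ck_pred[OF Suc.prems(2)])
qed

lemma Ck_const: "Ck k (\<lambda>x. c)"
proof (induction k arbitrary: c)
  case (Suc k)
  show ?case by (rule Ck_SucI[OF has_derivative_const]) (rule Suc)
qed simp

text \<open>The order m must vary in the induction, as the derivative involves the orders m + 1 and
  m + 2. The affine argument permits both signs of the coordinate.\<close>

lemma Ck_flat: "Ck k (\<lambda>x :: real ^ 'n. flat m (a * x $ j + b))"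
proof (induction k arbitrary: m)
  case 0
  have "continuous_on UNIV (flat m)"
    using flat_has_derivative[of m] by (intro DERIV_continuous_on) (auto intro: has_field_derivative_at_within)
  then have "continuous_on UNIV (\<lambda>x :: real ^ 'n. flat m (a * x $ j + b))"
    by (rule continuous_on_compose2) (auto intro!: continuous_intros)
  then show ?case by simp
next
  case (Suc k)
  show ?case
  proof (rule Ck_SucI)
    fix x :: "real ^ 'n"
    have "((\<lambda>x :: real ^ 'n. a * x $ j + b) has_derivative (\<lambda>h. a * h $ j)) (at x)"
      by (auto intro!: derivative_eq_intros bounded_linear.has_derivative[OF bounded_linear_vec_nth])
    from DERIV_compose_FDERIV[OF flat_has_derivative this]
    show "((\<lambda>x :: real ^ 'n. flat m (a * x $ j + b)) has_derivative
      (\<lambda>h. (a * h $ j) * (flat (m + 2) (a * x $ j + b) - real m * flat (m + 1) (a * x $ j + b)))) (at x)" .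
  next
    fix h :: "real ^ 'n"
    have "Ck k (\<lambda>x :: real ^ 'n. (a * h $ j) * (flat (m + 2) (a * x $ j + b) + (- real m) * flat (m + 1) (a * x $ j + b)))"
      by (intro Ck_mult Ck_add Ck_const Suc.IH)
    then show "Ck k (\<lambda>x :: real ^ 'n. (a * h $ j) * (flat (m + 2) (a * x $ j + b) - real m * flat (m + 1) (a * x $ j + b)))"
      by simp
  qed
qed

lemma Ck_prod: "finite I \<Longrightarrow> (\<And>i. i \<in> I \<Longrightarrow> Ck k (\<phi> i)) \<Longrightarrow> Ck k (\<lambda>x. \<Prod>i\<in>I. \<phi> i x)"
  by (induction I rule: finite_induct) (auto intro: Ck_mult Ck_const)

text \<open>Smooth functions supported in a box which tend to its indicator as k grows, since flat 0
  tends to 1 at infinity.\<close>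

definition box_bump :: "real ^ 'n \<Rightarrow> real ^ 'n \<Rightarrow> nat \<Rightarrow> real ^ 'n \<Rightarrow> real" where
  "box_bump a b k x = (\<Prod>j\<in>UNIV. flat 0 (real (Suc k) * (x $ j - a $ j)) * flat 0 (real (Suc k) * (b $ j - x $ j)))"

lemma box_bump_zero: "x \<notin> box a b \<Longrightarrow> box_bump a b k x = 0"
proof -
  assume "x \<notin> box a b"
  then obtain j where "\<not> (a $ j < x $ j \<and> x $ j < b $ j)" by (auto simp: mem_box_cart)
  then have "flat 0 (real (Suc k) * (x $ j - a $ j)) * flat 0 (real (Suc k) * (b $ j - x $ j)) = 0"
    by (auto simp: flat_def zero_less_mult_iff)
  then show ?thesis unfolding box_bump_def by (intro prod_zero) auto
qed

lemma test_function_box_bump: "test_function UNIV (box_bump a b k)"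
  unfolding test_function_def
proof (intro conjI allI)
  fix m
  have "Ck m (\<lambda>x. \<Prod>j\<in>UNIV. flat 0 (real (Suc k) * x $ j + - (real (Suc k) * a $ j)) * flat 0 ((- real (Suc k)) * x $ j + real (Suc k) * b $ j))"
    by (intro Ck_prod Ck_mult Ck_flat) simp
  then show "Ck m (box_bump a b k)" unfolding box_bump_def[abs_def] by (simp add: algebra_simps)
next
  have "{x. box_bump a b k x \<noteq> 0} \<subseteq> box a b" using box_bump_zero by blast
  then have "closure {x. box_bump a b k x \<noteq> 0} \<subseteq> cbox a b"
    by (meson box_subset_cbox closed_cbox closure_minimal order_trans)
  then show "compact (closure {x. box_bump a b k x \<noteq> 0})"
    using compact_cbox[of a b] closed_closure compact_Int_closed by (metis inf.absorb_iff2)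
qed simp

lemma flat_0_le_1: "flat 0 t \<le> 1"
  by (simp add: flat_def)

lemma box_bump_bounds: "0 \<le> box_bump a b k x" "box_bump a b k x \<le> indicator (box a b) x"
proof -
  show "0 \<le> box_bump a b k x" unfolding box_bump_def by (intro prod_nonneg mult_nonneg_nonneg) (auto simp: flat_nonneg)
  have "box_bump a b k x \<le> 1" unfolding box_bump_def
    by (intro prod_le_1 conjI mult_le_one mult_nonneg_nonneg flat_nonneg flat_0_le_1)
  then show "box_bump a b k x \<le> indicator (box a b) x" using box_bump_zero[of x a b k] by (auto split: split_indicator)
qed

lemma flat_0_tendsto: "0 < t \<Longrightarrow> (\<lambda>k. flat 0 (real (Suc k) * t)) \<longlonglongrightarrow> 1"
proof -
  assume t: "0 < t"
  have "(\<lambda>k. exp (- (1 / t * inverse (real (Suc k))))) \<longlonglongrightarrow> exp (- (1 / t * 0))"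
    by (intro tendsto_intros LIMSEQ_inverse_real_of_nat)
  moreover have "flat 0 (real (Suc k) * t) = exp (- (1 / t * inverse (real (Suc k))))" for k
  proof -
    have "0 < real (Suc k) * t" using t by (intro mult_pos_pos) auto
    then show ?thesis unfolding flat_def by (simp add: divide_inverse del: of_nat_Suc)
  qed
  ultimately show ?thesis by simp
qed

lemma box_bump_tendsto: "(\<lambda>k. box_bump a b k x) \<longlonglongrightarrow> indicator (box a b) x"
proof (cases "x \<in> box a b")
  case True
  then have "(\<lambda>k. box_bump a b k x) \<longlonglongrightarrow> (\<Prod>j\<in>(UNIV :: 'a set). 1 * 1)"
    unfolding box_bump_def by (intro tendsto_prod tendsto_mult flat_0_tendsto) (auto simp: mem_box_cart)
  then show ?thesis using True by simp
qed (simp add: box_bump_zero)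

text \<open>Open boxes form an intersection-stable generator of the Borel sets, so the measures with
  the positive and the negative part of h as densities coincide.\<close>

lemma integral_zero_on_boxes_imp_AE_zero:
  fixes h :: "real ^ 'n \<Rightarrow> real"
  assumes h [measurable]: "h \<in> borel_measurable borel"
    and int: "\<And>a b. integrable lborel (\<lambda>x. indicator (box a b) x * h x)"
    and zero: "\<And>a b. (LINT x|lborel. indicator (box a b) x * h x) = 0"
  shows "AE x in lborel. h x = 0"
proof -
  \<comment> \<open>\<open>ennreal\<close> sends negative reals to zero, so these densities are the
    positive and the negative part of h.\<close>
  let ?P = "density lborel (\<lambda>x. ennreal (h x))" and ?N = "density lborel (\<lambda>x. ennreal (- h x))"
  have box: "emeasure ?P (box a b) = emeasure ?N (box a b) \<and> emeasure ?P (box a b) \<noteq> \<infinity>" for a b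
  proof -
    have "(LINT x|lborel. indicator (box a b) x * h x) = enn2real (\<integral>\<^sup>+x. ennreal (indicator (box a b) x * h x) \<partial>lborel) - enn2real (\<integral>\<^sup>+x. ennreal (- (indicator (box a b) x * h x)) \<partial>lborel)"
      by (rule real_lebesgue_integral_def[OF int])
    moreover have "(\<integral>\<^sup>+x. ennreal (indicator (box a b) x * h x) \<partial>lborel) = emeasure ?P (box a b)"
      by (subst emeasure_density) (auto intro!: nn_integral_cong split: split_indicator)
    moreover have "(\<integral>\<^sup>+x. ennreal (- (indicator (box a b) x * h x)) \<partial>lborel) = emeasure ?N (box a b)"
      by (subst emeasure_density) (auto intro!: nn_integral_cong split: split_indicator)
    moreover have "(\<integral>\<^sup>+x. ennreal (indicator (box a b) x * h x) \<partial>lborel) \<noteq> \<infinity>" "(\<integral>\<^sup>+x. ennreal (- (indicator (box a b) x * h x)) \<partial>lborel) \<noteq> \<infinity>"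
      using int[of a b] by (auto simp: real_integrable_def)
    ultimately show ?thesis using zero[of a b]
      by (cases "emeasure ?P (box a b)"; cases "emeasure ?N (box a b)") auto
  qed
  have "?P = ?N"
  proof (rule measure_eqI_generator_eq[where E = "range (\<lambda>(a, b). box a b)" and \<Omega> = UNIV and A = "\<lambda>n. box (- (real n *\<^sub>R One)) (real n *\<^sub>R One)"])
    show "Int_stable (range (\<lambda>(a, b). box a b :: (real ^ 'n) set))"
      by (auto simp: Int_stable_def box_Int_box)
    show "\<And>X. X \<in> range (\<lambda>(a, b). box a b) \<Longrightarrow> emeasure ?P X = emeasure ?N X" using box by auto
    show "sets ?P = sigma_sets UNIV (range (\<lambda>(a, b). box a b))" "sets ?N = sigma_sets UNIV (range (\<lambda>(a, b). box a b))"
      by (simp_all add: borel_eq_box)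
    show "(\<Union>n. box (- (real n *\<^sub>R One)) (real n *\<^sub>R One)) = (UNIV :: (real ^ 'n) set)" by (rule UN_box_eq_UNIV)
    show "emeasure ?P (box (- (real n *\<^sub>R One)) (real n *\<^sub>R One)) \<noteq> \<infinity>" for n using box by blast
  qed auto
  then have "AE x in lborel. ennreal (h x) = ennreal (- h x)"
    by (subst (asm) sigma_finite_measure.density_unique_iff[OF sigma_finite_lborel]) auto
  then show ?thesis
  proof eventually_elim
    case (elim x)
    then show ?case by (cases "0 \<le> h x") (auto simp: ennreal_neg ennreal_eq_0_iff)
  qed
qed

lemma test_function_integral_zero_imp_AE_zero:
  fixes h :: "real ^ 'n \<Rightarrow> real"
  assumes h [measurable]: "h \<in> borel_measurable borel"
    and int: "\<And>a b. integrable lborel (\<lambda>x. indicator (box a b) x * h x)"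
    and zero: "\<And>\<phi>. test_function UNIV \<phi> \<Longrightarrow> (LINT x|lborel. \<phi> x * h x) = 0"
  shows "AE x in lborel. h x = 0"
proof (rule integral_zero_on_boxes_imp_AE_zero[OF h int])
  fix a b :: "real ^ 'n"
  have [measurable]: "box_bump a b k \<in> borel_measurable borel" for k
    using test_function_box_bump[of a b k] by (auto simp: test_function_def intro!: borel_measurable_continuous_onI Ck_continuous)
  have "(\<lambda>k. LINT x|lborel. box_bump a b k x * h x) \<longlonglongrightarrow> (LINT x|lborel. indicator (box a b) x * h x)"
  proof (rule integral_dominated_convergence[where w = "\<lambda>x. norm (indicator (box a b) x * h x)"])
    show "AE x in lborel. (\<lambda>k. box_bump a b k x * h x) \<longlonglongrightarrow> indicator (box a b) x * h x"
      by (intro AE_I2 tendsto_mult box_bump_tendsto tendsto_const)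
    show "AE x in lborel. norm (box_bump a b k x * h x) \<le> norm (indicator (box a b) x * h x)" for k
      using box_bump_bounds[of a b k] by (intro AE_I2) (auto simp: abs_mult intro!: mult_right_mono)
  qed (use int in auto)
  then show "(LINT x|lborel. indicator (box a b) x * h x) = 0"
    using zero[OF test_function_box_bump] by (simp add: LIMSEQ_const_iff)
qed

section \<open>Derivatives along lines\<close>

lemma nn_integral_lborel_translate:
  fixes a :: "'a::euclidean_space"
  assumes "F \<in> borel_measurable borel"
  shows "(\<integral>\<^sup>+x. F (x + a) \<partial>lborel) = (\<integral>\<^sup>+x. F x \<partial>lborel)"
proof -
  have "(\<integral>\<^sup>+x. F x \<partial>lborel) = (\<integral>\<^sup>+x. F x \<partial>distr lborel borel ((+) a))" by (simp add: lborel_distr_plus)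
  also have "\<dots> = (\<integral>\<^sup>+x. F (a + x) \<partial>lborel)" using assms by (subst nn_integral_distr) auto
  finally show ?thesis by (simp add: add.commute)
qed

text \<open>For each fixed t the translation by t times v preserves the integral over x; the
  parameter interval has length one.\<close>

lemma nn_integral_over_lines:
  fixes v :: "'a::euclidean_space"
  assumes F [measurable]: "F \<in> borel_measurable borel"
  shows "(\<integral>\<^sup>+x. (\<integral>\<^sup>+t\<in>{0..1::real}. F (x + t *\<^sub>R v) \<partial>lborel) \<partial>lborel) = (\<integral>\<^sup>+x. F x \<partial>lborel)"
proof -
  have ind: "(\<lambda>p. indicator {0..1::real} (snd p) :: ennreal) \<in> borel_measurable (borel \<Otimes>\<^sub>M borel)"
    by measurable
  have Fm: "(\<lambda>p. F (fst p + snd p *\<^sub>R v)) \<in> borel_measurable (borel \<Otimes>\<^sub>M borel)" by measurable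
  have "(\<integral>\<^sup>+x. (\<integral>\<^sup>+t\<in>{0..1::real}. F (x + t *\<^sub>R v) \<partial>lborel) \<partial>lborel) = (\<integral>\<^sup>+t. (\<integral>\<^sup>+x. F (x + t *\<^sub>R v) * indicator {0..1} t \<partial>lborel) \<partial>lborel)"
    by (rule nn_integral_lborel_swap) (rule borel_measurable_times_ennreal[OF Fm ind])
  also have "\<dots> = (\<integral>\<^sup>+t. (\<integral>\<^sup>+x. F x \<partial>lborel) * indicator {0..1::real} t \<partial>lborel)"
  proof (rule nn_integral_cong)
    fix t :: real
    have "(\<integral>\<^sup>+x. F (x + t *\<^sub>R v) * indicator {0..1} t \<partial>lborel) = (\<integral>\<^sup>+x. F (x + t *\<^sub>R v) \<partial>lborel) * indicator {0..1} t"
      by (rule nn_integral_multc) measurable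
    then show "(\<integral>\<^sup>+x. F (x + t *\<^sub>R v) * indicator {0..1} t \<partial>lborel) = (\<integral>\<^sup>+x. F x \<partial>lborel) * indicator {0..1} t"
      by (simp only: nn_integral_lborel_translate[OF F])
  qed
  also have "\<dots> = (\<integral>\<^sup>+x. F x \<partial>lborel) * emeasure lborel {0..1::real}"
    by (rule nn_integral_cmult_indicator) simp
  finally show ?thesis by simp
qed

text \<open>Averaging over translates along \<open>v\<close> replaces a choice of coordinates adapted to \<open>v\<close>.\<close>

lemma AE_from_lines:
  fixes v :: "'a::euclidean_space"
  assumes B [measurable]: "B \<in> sets borel" and line: "\<And>x. AE t in lborel. x + t *\<^sub>R v \<notin> B"
  shows "AE x in lborel. x \<notin> B"
proof -
  have "emeasure lborel B = (\<integral>\<^sup>+x. indicator B x \<partial>lborel)" by simp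
  also have "\<dots> = (\<integral>\<^sup>+x. (\<integral>\<^sup>+t\<in>{0..1::real}. indicator B (x + t *\<^sub>R v) \<partial>lborel) \<partial>lborel)"
    by (rule nn_integral_over_lines[symmetric]) measurable
  also have "\<dots> = (\<integral>\<^sup>+(x::'a). 0 \<partial>lborel)"
  proof (rule nn_integral_cong)
    fix x
    have "(\<integral>\<^sup>+t\<in>{0..1::real}. indicator B (x + t *\<^sub>R v) \<partial>lborel) = (\<integral>\<^sup>+(t::real). 0 \<partial>lborel)"
      by (rule nn_integral_cong_AE) (use line[of x] in eventually_elim, simp)
    then show "(\<integral>\<^sup>+t\<in>{0..1::real}. indicator B (x + t *\<^sub>R v) \<partial>lborel) = 0" by simp
  qed
  finally have "B \<in> null_sets lborel" using B by (auto simp: null_sets_def)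
  then show ?thesis by (rule AE_not_in)
qed

text \<open>The partial derivatives are continuous and vanish off the compact support, hence are
  bounded; the mean value inequality does the rest.\<close>

lemma test_function_lipschitz:
  fixes \<phi> :: "'a::euclidean_space \<Rightarrow> real"
  assumes "test_function UNIV \<phi>"
  obtains L where "0 \<le> L" "\<And>x y. \<bar>\<phi> x - \<phi> y\<bar> \<le> L * norm (x - y)" "\<And>x h. \<bar>frechet_derivative \<phi> (at x) h\<bar> \<le> L * norm h"
proof -
  define S where "S = closure {x. \<phi> x \<noteq> 0}"
  have S: "compact S" and C: "Ck (Suc 0) \<phi>" using assms by (auto simp: test_function_def S_def simp del: Ck.simps)
  have der: "(\<phi> has_derivative frechet_derivative \<phi> (at x)) (at x)" for x by (rule Ck_SucD(1)[OF C])
  have cont: "continuous_on UNIV (\<lambda>x. frechet_derivative \<phi> (at x) b)" if "b \<in> Basis" for b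
    using Ck_SucD(2)[OF C that] by simp
  have zero: "frechet_derivative \<phi> (at x) h = 0" if x: "x \<notin> S" for x h
  proof -
    have "open (- S)" using S by (simp add: compact_imp_closed open_Compl)
    have "(\<phi> has_derivative (\<lambda>h. 0)) (at x)"
    proof (rule has_derivative_transform_within_open[of "\<lambda>x. 0"])
      show "((\<lambda>x. 0) has_derivative (\<lambda>h. 0)) (at x)" by simp
      show "open (- S)" by fact
      show "x \<in> - S" using x by simp
      fix y assume "y \<in> - S"
      then have "y \<notin> {x. \<phi> x \<noteq> 0}" using closure_subset[of "{x. \<phi> x \<noteq> 0}"] unfolding S_def by auto
      then show "0 = \<phi> y" by simp
    qed
    from frechet_derivative_at[OF this] show ?thesis by (simp add: fun_eq_iff)
  qed
  have "\<exists>B. \<forall>x. \<bar>frechet_derivative \<phi> (at x) b\<bar> \<le> B" if b: "b \<in> Basis" for b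
  proof -
    have "compact ((\<lambda>x. frechet_derivative \<phi> (at x) b) ` S)"
      by (intro compact_continuous_image S continuous_on_subset[OF cont[OF b]]) simp
    then obtain B where B: "\<forall>y\<in>(\<lambda>x. frechet_derivative \<phi> (at x) b) ` S. norm y \<le> B"
      using compact_imp_bounded bounded_iff by blast
    have "\<bar>frechet_derivative \<phi> (at x) b\<bar> \<le> \<bar>B\<bar>" for x
    proof (cases "x \<in> S")
      case True
      then have "\<bar>frechet_derivative \<phi> (at x) b\<bar> \<le> B" using B by auto
      then show ?thesis by linarith
    qed (simp add: zero)
    then show ?thesis by blast
  qed
  then obtain B where B: "\<And>b x. b \<in> Basis \<Longrightarrow> \<bar>frechet_derivative \<phi> (at x) b\<bar> \<le> B b" by metis
  define L where "L = (\<Sum>b\<in>(Basis :: 'a set). \<bar>B b\<bar>)"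
  have L: "0 \<le> L" by (simp add: L_def sum_nonneg)
  have bd: "\<bar>frechet_derivative \<phi> (at x) h\<bar> \<le> L * norm h" for x h
  proof -
    interpret bounded_linear "frechet_derivative \<phi> (at x)" using der by (rule has_derivative_bounded_linear)
    have "frechet_derivative \<phi> (at x) h = frechet_derivative \<phi> (at x) (\<Sum>b\<in>Basis. (h \<bullet> b) *\<^sub>R b)" by (simp add: euclidean_representation)
    also have "\<dots> = (\<Sum>b\<in>Basis. (h \<bullet> b) * frechet_derivative \<phi> (at x) b)" by (simp add: sum scaleR)
    also have "\<bar>\<dots>\<bar> \<le> (\<Sum>b\<in>Basis. \<bar>(h \<bullet> b) * frechet_derivative \<phi> (at x) b\<bar>)" by (rule sum_abs)
    also have "\<dots> \<le> (\<Sum>b\<in>Basis. norm h * \<bar>B b\<bar>)"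
    proof (rule sum_mono)
      fix b :: 'a assume b: "b \<in> Basis"
      have "\<bar>frechet_derivative \<phi> (at x) b\<bar> \<le> \<bar>B b\<bar>" using B[OF b, of x] by linarith
      then show "\<bar>(h \<bullet> b) * frechet_derivative \<phi> (at x) b\<bar> \<le> norm h * \<bar>B b\<bar>"
        unfolding abs_mult using Basis_le_norm[OF b, of h] by (intro mult_mono) auto
    qed
    also have "\<dots> = L * norm h" by (simp add: L_def sum_distrib_left mult.commute)
    finally show ?thesis .
  qed
  have "norm (\<phi> x - \<phi> y) \<le> L * norm (x - y)" for x y
    by (rule differentiable_bound[of UNIV \<phi> "\<lambda>x. frechet_derivative \<phi> (at x)"])
      (auto intro!: der onorm_bound L bd)
  then show thesis using that[OF L _ bd] by simp
qed

text \<open>One fixed null sequence for all difference quotients. It makes directional derivatives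
  limits of sequences of Borel functions.\<close>

definition hs :: "nat \<Rightarrow> real" where "hs k = inverse (real (Suc k))"

lemma hs: "0 < hs k" "hs \<longlonglongrightarrow> 0"
  unfolding hs_def[abs_def] by (simp, rule LIMSEQ_inverse_real_of_nat)

lemma directional_derivative_limit:
  fixes \<phi> :: "'a::euclidean_space \<Rightarrow> real"
  assumes "\<phi> differentiable (at x)"
  shows "(\<lambda>k. (\<phi> (x + hs k *\<^sub>R v) - \<phi> x) / hs k) \<longlonglongrightarrow> frechet_derivative \<phi> (at x) v"
proof -
  have d: "(\<phi> has_derivative frechet_derivative \<phi> (at x)) (at x)" using assms by (simp add: frechet_derivative_works)
  then interpret bounded_linear "frechet_derivative \<phi> (at x)" by (rule has_derivative_bounded_linear)
  have "((\<lambda>t. x + t *\<^sub>R v) has_derivative (\<lambda>t. t *\<^sub>R v)) (at 0)" by (auto intro!: derivative_eq_intros)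
  from has_derivative_compose[OF this, of \<phi> "frechet_derivative \<phi> (at x)"] d
  have "((\<lambda>t. \<phi> (x + t *\<^sub>R v)) has_derivative (\<lambda>t. frechet_derivative \<phi> (at x) (t *\<^sub>R v))) (at 0)" by simp
  moreover have "(\<lambda>t. frechet_derivative \<phi> (at x) (t *\<^sub>R v)) = (*) (frechet_derivative \<phi> (at x) v)"
  proof
    fix t
    have "frechet_derivative \<phi> (at x) (t *\<^sub>R v) = t *\<^sub>R frechet_derivative \<phi> (at x) v" by (rule scaleR)
    then show "frechet_derivative \<phi> (at x) (t *\<^sub>R v) = frechet_derivative \<phi> (at x) v * t" by (simp only: real_scaleR_def mult.commute)
  qed
  ultimately have "((\<lambda>t. \<phi> (x + t *\<^sub>R v)) has_real_derivative frechet_derivative \<phi> (at x) v) (at 0)"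
    unfolding has_field_derivative_def by simp
  then have "((\<lambda>h. (\<phi> (x + h *\<^sub>R v) - \<phi> x) / h) \<longlongrightarrow> frechet_derivative \<phi> (at x) v) (at 0)"
    by (simp add: DERIV_def)
  moreover have "filterlim hs (at 0) sequentially"
  proof -
    have "hs k \<noteq> 0" for k using hs(1)[of k] by simp
    then show ?thesis unfolding filterlim_at by (simp add: hs(2))
  qed
  ultimately show ?thesis by (rule filterlim_compose)
qed

context whitney_map
begin

definition dirq :: "('k + 'p) \<Rightarrow> real ^ ('k + 'p) \<Rightarrow> nat \<Rightarrow> real ^ ('k + 'p) \<Rightarrow> real" where
  "dirq i v k x = (f (x + hs k *\<^sub>R v) $ i - f x $ i) / hs k"

text \<open>Where the quotients diverge, \<open>lim\<close> returns an unspecified value; this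
  happens only on a null set.\<close>

definition dird :: "('k + 'p) \<Rightarrow> real ^ ('k + 'p) \<Rightarrow> real ^ ('k + 'p) \<Rightarrow> real" where
  "dird i v x = lim (\<lambda>k. dirq i v k x)"

lemma borel_vec_nth_f: "(\<lambda>x. f x $ i) \<in> borel_measurable borel"
  by (intro borel_measurable_continuous_onI continuous_intros continuous_f)

lemma borel_dirq [measurable]: "dirq i v k \<in> borel_measurable borel"
  unfolding dirq_def[abs_def] by (intro borel_measurable_continuous_onI continuous_intros continuous_on_compose2[OF continuous_f[of UNIV]]) (use hs(1)[of k] in auto)

lemma borel_dird [measurable]: "dird i v \<in> borel_measurable borel"
  unfolding dird_def[abs_def] by measurable

lemma line_locally_lipschitz:
  assumes t: "0 < depth (x + t *\<^sub>R v)"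
  shows "\<exists>e>0. \<exists>L. \<forall>s\<in>ball t e. \<forall>s'\<in>ball t e. \<bar>f (x + s *\<^sub>R v) $ i - f (x + s' *\<^sub>R v) $ i\<bar> \<le> L * \<bar>s - s'\<bar>"
proof -
  define z where "z = x + t *\<^sub>R v"
  \<comment> \<open>The summand 1 avoids division by zero when v = 0.\<close>
  define e where "e = r0 * depth z / (norm v + 1)"
  have nv: "0 < norm v + 1" by (simp add: add_nonneg_pos)
  have e: "0 < e" unfolding e_def using t r0 nv by (intro divide_pos_pos mult_pos_pos) (auto simp: z_def)
  have inb: "dist z (x + s *\<^sub>R v) < r0 * depth z" if "s \<in> ball t e" for s
  proof -
    have "dist z (x + s *\<^sub>R v) = \<bar>t - s\<bar> * norm v"
      by (simp add: z_def dist_norm scaleR_diff_left[symmetric])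
    also have "\<dots> \<le> \<bar>t - s\<bar> * (norm v + 1)" by (intro mult_left_mono) auto
    also have "\<dots> < e * (norm v + 1)" using that nv by (intro mult_strict_right_mono) (auto simp: dist_real_def)
    also have "\<dots> = r0 * depth z" unfolding e_def using nv by simp
    finally show ?thesis .
  qed
  show ?thesis
  proof (rule exI[of _ e], rule conjI[OF e], rule exI[of _ "K * ratio z * norm v"], intro ballI)
    fix s s' assume s: "s \<in> ball t e" "s' \<in> ball t e"
    have "\<bar>f (x + s *\<^sub>R v) $ i - f (x + s' *\<^sub>R v) $ i\<bar> \<le> dist (f (x + s *\<^sub>R v)) (f (x + s' *\<^sub>R v))"
      unfolding dist_norm using component_le_norm_cart[of "f (x + s *\<^sub>R v) - f (x + s' *\<^sub>R v)" i] by simp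
    also have "\<dots> \<le> K * ratio z * dist (x + s *\<^sub>R v) (x + s' *\<^sub>R v)"
      using t inb s by (intro dist_image_le(1)) (auto simp: z_def)
    also have "dist (x + s *\<^sub>R v) (x + s' *\<^sub>R v) = \<bar>s - s'\<bar> * norm v"
      by (simp add: dist_norm scaleR_diff_left[symmetric])
    finally show "\<bar>f (x + s *\<^sub>R v) $ i - f (x + s' *\<^sub>R v) $ i\<bar> \<le> K * ratio z * norm v * \<bar>s - s'\<bar>" by (simp add: mult_ac)
  qed
qed

text \<open>On every line the exceptional parameters form a null set, by the one-dimensional
  theorem; \<open>AE_from_lines\<close> assembles these sections.\<close>

lemma AE_convergent_dirq: "AE x in lborel. convergent (\<lambda>k. dirq i v k x)"
proof -
  \<comment> \<open>The Cauchy condition is used because the set it defines is Borel by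
    \<open>sets_Collect_Cauchy\<close>.\<close>
  define B where "B = {x \<in> space borel. 0 < depth x} - {x \<in> space borel. Cauchy (\<lambda>k. dirq i v k x)}"
  have B: "B \<in> sets borel" unfolding B_def
  proof (rule sets.Diff)
    show "{x \<in> space borel. Cauchy (\<lambda>k. dirq i v k x)} \<in> sets borel" by (rule sets_Collect_Cauchy) (rule borel_dirq)
  qed measurable
  have "AE x in lborel. x \<notin> B"
  proof (rule AE_from_lines[OF B, of v])
    fix x
    let ?u = "\<lambda>t. f (x + t *\<^sub>R v) $ i"
    define N where "N = {t\<in>{t. 0 < depth (x + t *\<^sub>R v)}. \<not> convergent (\<lambda>k. (?u (t + hs k) - ?u t) / hs k)}"
    have "negligible N" unfolding N_def
      by (rule locally_lipschitz_quotients_converge[OF _ hs]) (rule line_locally_lipschitz, simp)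
    then have "AE t in lebesgue. t \<notin> N" by (intro AE_not_in) (simp add: negligible_iff_null_sets)
    then have "AE t in lborel. t \<notin> N" by (simp add: AE_completion_iff)
    then show "AE t in lborel. x + t *\<^sub>R v \<notin> B"
    proof eventually_elim
      case (elim t)
      then show ?case by (auto simp: N_def B_def dirq_def scaleR_add_left add.assoc Cauchy_convergent_iff)
    qed
  qed
  then show ?thesis using AE_depth_pos
    by eventually_elim (auto simp: B_def Cauchy_convergent_iff)
qed

text \<open>For small steps the quotients stay in the Whitney ball at x, and the bilipschitz
  inequalities pass to the limit.\<close>

lemma dird_bounds:
  assumes x: "0 < depth x" and conv: "\<And>i. convergent (\<lambda>k. dirq i v k x)"
  shows "norm (\<chi> i. dird i v x) \<le> K * ratio x * norm v" "ratio x * norm v \<le> K * norm (\<chi> i. dird i v x)"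
proof -
  define Q where "Q k = (\<chi> i. dirq i v k x)" for k
  have "Q \<longlonglongrightarrow> (\<chi> i. dird i v x)" unfolding Q_def[abs_def] dird_def
    by (intro tendsto_vec_lambda) (use conv in \<open>simp add: convergent_LIMSEQ_iff\<close>)
  then have lim: "(\<lambda>k. norm (Q k)) \<longlonglongrightarrow> norm (\<chi> i. dird i v x)" by (rule tendsto_norm)
  have Q: "Q k = (1 / hs k) *\<^sub>R (f (x + hs k *\<^sub>R v) - f x)" for k
    by (simp add: Q_def dirq_def vec_eq_iff)
  have nQ: "norm (Q k) = dist (f (x + hs k *\<^sub>R v)) (f x) / hs k" for k
    using hs(1)[of k] by (simp add: Q dist_norm)
  have nv: "0 < norm v + 1" by (simp add: add_nonneg_pos)
  have "0 < r0 * depth x / (norm v + 1)" using x r0 nv by (intro divide_pos_pos mult_pos_pos) auto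
  from order_tendstoD(2)[OF hs(2) this] have ev: "\<forall>\<^sub>F k in sequentially. dist x (x + hs k *\<^sub>R v) < r0 * depth x"
  proof eventually_elim
    case (elim k)
    have "dist x (x + hs k *\<^sub>R v) = hs k * norm v" using hs(1)[of k] by (simp add: dist_norm)
    also have "\<dots> \<le> hs k * (norm v + 1)" using hs(1)[of k] by (intro mult_left_mono) auto
    also have "\<dots> < r0 * depth x" using elim nv by (simp add: pos_less_divide_eq)
    finally show ?case .
  qed
  have xx: "dist x x < r0 * depth x" using x r0 by simp
  have hv: "dist (x + hs k *\<^sub>R v) x = hs k * norm v" for k using hs(1)[of k] by (simp add: dist_norm)
  show "norm (\<chi> i. dird i v x) \<le> K * ratio x * norm v"
  proof (rule tendsto_upperbound[OF lim])
    show "\<forall>\<^sub>F k in sequentially. norm (Q k) \<le> K * ratio x * norm v" using ev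
    proof eventually_elim
      case (elim k)
      have "dist (f (x + hs k *\<^sub>R v)) (f x) \<le> K * ratio x * (hs k * norm v)"
        using dist_image_le(1)[OF x elim xx] by (simp only: hv)
      then show ?case unfolding nQ using hs(1)[of k] by (simp add: pos_divide_le_eq mult_ac)
    qed
  qed simp
  show "ratio x * norm v \<le> K * norm (\<chi> i. dird i v x)"
  proof (rule tendsto_lowerbound)
    show "(\<lambda>k. K * norm (Q k)) \<longlonglongrightarrow> K * norm (\<chi> i. dird i v x)" by (intro tendsto_mult lim tendsto_const)
    show "\<forall>\<^sub>F k in sequentially. ratio x * norm v \<le> K * norm (Q k)" using ev
    proof eventually_elim
      case (elim k)
      have "hs k * norm v \<le> K / ratio x * dist (f (x + hs k *\<^sub>R v)) (f x)"
        using dist_image_le(2)[OF x elim xx] by (simp only: hv)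
      then have "ratio x * (hs k * norm v) \<le> ratio x * (K / ratio x * dist (f (x + hs k *\<^sub>R v)) (f x))"
        using ratio_pos[OF x] by (intro mult_left_mono) auto
      also have "\<dots> = K * dist (f (x + hs k *\<^sub>R v)) (f x)" using ratio_pos[OF x] by simp
      finally show ?case unfolding nQ using hs(1)[of k] by (simp add: pos_le_divide_eq mult_ac)
    qed
  qed simp
qed

lemma borel_ratio [measurable]: "ratio \<in> borel_measurable borel"
  unfolding ratio_def[abs_def] by measurable

text \<open>A substitute for the area formula: ratio x^n is at most a multiple of the volume of the
  image of the Whitney ball at x divided by that of the ball. Writing the image volume as an
  integral over w and exchanging the order bounds the total by the volume of the image of a larger
  ball, which is finite by continuity of f.\<close>

lemma ratio_power_integrable:
  shows "(\<integral>\<^sup>+x\<in>ball 0 R. ennreal (ratio x ^ CARD('k + 'p)) \<partial>lborel) < \<infinity>"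
proof (cases "0 < R")
  case R: True
  let ?n = "CARD('k + 'p)"
  define V where "V = unit_ball_vol (real ?n)"
  have V: "0 < V" by (simp add: V_def)
  define a where "a = (2 * K) ^ ?n / (V * r0 ^ ?n)"
  have a: "0 \<le> a" unfolding a_def using K r0 V by (intro divide_nonneg_nonneg mult_nonneg_nonneg) auto
  \<comment> \<open>For fixed x the relevant w fill the image of the Whitney ball at x; for fixed w
    the relevant x lie within 2 * r0 * depth of the point fi w, at comparable depth, so the integral
    over x is bounded by a constant.\<close>
  define T where "T x w = (if dist 0 x < R \<and> 0 < depth x \<and> dist x (fi w) < r0 * depth x then ennreal (a / depth x ^ ?n) else 0)" for x w
  have [measurable]: "(\<lambda>p. T (g1 p) (g2 p)) \<in> borel_measurable Q"
    if [measurable]: "g1 \<in> Q \<rightarrow>\<^sub>M borel" "g2 \<in> Q \<rightarrow>\<^sub>M borel" for g1 g2 and Q :: "'q measure"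
    unfolding T_def by measurable
  have 1: "ennreal (ratio x ^ ?n) \<le> (\<integral>\<^sup>+w. T x w \<partial>lborel)" if x: "0 < depth x" "x \<in> ball 0 R" for x
  proof -
    define s where "s = r0 * depth x"
    have s: "0 < s" using x r0 by (simp add: s_def)
    have rx: "0 < ratio x" by (rule ratio_pos[OF x(1)])
    define X where "X = V * s ^ ?n"
    have X: "0 < X" using V s by (simp add: X_def)
    have img: "f ` ball x s = fi -` ball x s"
    proof (intro equalityI subsetI)
      fix y assume "y \<in> fi -` ball x s"
      then show "y \<in> f ` ball x s" by (intro image_eqI[of y f "fi y"]) auto
    qed auto
    have m: "f ` ball x s \<in> sets borel" unfolding img using measurable_sets[OF borel_fi, of "ball x s"] by simp
    have "ennreal X = emeasure lborel (ball x s)" unfolding X_def V_def using emeasure_ball[of s x] s by simp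
    also have "\<dots> = emeasure lebesgue (fi ` (f ` ball x s))" by (simp add: image_image emeasure_completion)
    also have "\<dots> \<le> ennreal ((2 * (K / ratio x)) ^ DIM(real ^ ('k + 'p))) * emeasure lebesgue (f ` ball x s)"
    proof (rule emeasure_lipschitz_image_le)
      fix y y' assume "y \<in> f ` ball x s" "y' \<in> f ` ball x s"
      then obtain w w' where "y = f w" "y' = f w'" "dist x w < s" "dist x w' < s" by (auto simp: image_iff)
      then show "dist (fi y) (fi y') \<le> K / ratio x * dist y y'"
        using dist_image_le(2)[OF x(1), of w w'] by (simp add: s_def)
    qed (use m K rx in auto)
    also have "emeasure lebesgue (f ` ball x s) = (\<integral>\<^sup>+w. indicator (f ` ball x s) w \<partial>lborel)" using m by (simp add: emeasure_completion)
    finally have le: "ennreal X \<le> ennreal ((2 * K / ratio x) ^ ?n) * (\<integral>\<^sup>+w. indicator (f ` ball x s) w \<partial>lborel)" by simp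
    define c1 where "c1 = ratio x ^ ?n / X"
    have c1: "0 \<le> c1" using rx X by (simp add: c1_def)
    have "ennreal (ratio x ^ ?n) = ennreal c1 * ennreal X" using X rx by (simp add: c1_def ennreal_mult[symmetric])
    also have "\<dots> \<le> ennreal c1 * (ennreal ((2 * K / ratio x) ^ ?n) * (\<integral>\<^sup>+w. indicator (f ` ball x s) w \<partial>lborel))"
      by (intro mult_left_mono le) simp
    also have "\<dots> = ennreal (c1 * (2 * K / ratio x) ^ ?n) * (\<integral>\<^sup>+w. indicator (f ` ball x s) w \<partial>lborel)"
      using c1 K rx by (simp add: ennreal_mult mult.assoc)
    also have "c1 * (2 * K / ratio x) ^ ?n = a / depth x ^ ?n"
      unfolding c1_def X_def s_def a_def power_divide power_mult_distrib using rx by simp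
    also have "ennreal (a / depth x ^ ?n) * (\<integral>\<^sup>+w. indicator (f ` ball x s) w \<partial>lborel) = (\<integral>\<^sup>+w. ennreal (a / depth x ^ ?n) * indicator (f ` ball x s) w \<partial>lborel)"
      using m by (intro nn_integral_cmult[symmetric]) auto
    also have "\<dots> = (\<integral>\<^sup>+w. T x w \<partial>lborel)"
      unfolding img by (intro nn_integral_cong) (use x in \<open>auto simp: T_def s_def split: split_indicator\<close>)
    finally show ?thesis .
  qed
  define b where "b = a * (2 ^ ?n * (V * (2 * r0) ^ ?n))"
  have 2: "(\<integral>\<^sup>+x. T x w \<partial>lborel) \<le> ennreal b * indicator (f ` ball 0 (2 * R)) w" for w
  proof (cases "\<exists>x. T x w \<noteq> 0")
    case True
    define y where "y = fi w"
    have near: "depth y / 2 \<le> depth x" "dist y x < 2 * r0 * depth y" "norm y < 2 * R" if "T x w \<noteq> 0" for x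
    proof -
      have t: "norm x < R" "0 < depth x" "dist x y < r0 * depth x" using that by (auto simp: T_def y_def split: if_splits)
      have r: "r0 * depth x \<le> 1/16 * depth x" using r0 t by (intro mult_right_mono) auto
      have d: "\<bar>depth x - depth y\<bar> < r0 * depth x" using depth_lipschitz[of x y] t by linarith
      show "depth y / 2 \<le> depth x" using d r t by linarith
      have "depth x \<le> 2 * depth y" using d r t by linarith
      then have "r0 * depth x \<le> r0 * (2 * depth y)" using r0 by (intro mult_left_mono) auto
      then show "dist y x < 2 * r0 * depth y" using t by (simp add: dist_commute)
      have "depth x \<le> norm x" unfolding depth_def by (rule norm_ypart_le)
      moreover have "norm y \<le> norm x + dist x y" using norm_triangle_ineq2[of y x] by (simp add: dist_norm norm_minus_commute)
      ultimately show "norm y < 2 * R" using t r by linarith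
    qed
    obtain x0 where x0: "T x0 w \<noteq> 0" using True by blast
    have dy: "0 < depth y" using near(2)[OF x0] r0 zero_le_dist[of y x0] by (smt (verit) depth_nonneg mult_eq_0_iff)
    have "(\<integral>\<^sup>+x. T x w \<partial>lborel) \<le> (\<integral>\<^sup>+x. ennreal (a / (depth y / 2) ^ ?n) * indicator (ball y (2 * r0 * depth y)) x \<partial>lborel)"
    proof (rule nn_integral_mono)
      fix x
      show "T x w \<le> ennreal (a / (depth y / 2) ^ ?n) * indicator (ball y (2 * r0 * depth y)) x"
      proof (cases "T x w = 0")
        case False
        have "T x w \<le> ennreal (a / depth x ^ ?n)" by (simp add: T_def)
        also have "\<dots> \<le> ennreal (a / (depth y / 2) ^ ?n)"
          using near(1)[OF False] dy a by (intro ennreal_leI divide_left_mono power_mono mult_pos_pos zero_less_power) auto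
        finally show ?thesis using near(2)[OF False] by simp
      qed simp
    qed
    also have "\<dots> = ennreal (a / (depth y / 2) ^ ?n) * emeasure lborel (ball y (2 * r0 * depth y))"
      by (rule nn_integral_cmult_indicator) simp
    also have "emeasure lborel (ball y (2 * r0 * depth y)) = ennreal (V * (2 * r0 * depth y) ^ ?n)"
      unfolding V_def using emeasure_ball[of "2 * r0 * depth y" y] r0 by simp
    also have "ennreal (a / (depth y / 2) ^ ?n) * ennreal (V * (2 * r0 * depth y) ^ ?n) = ennreal (a / (depth y / 2) ^ ?n * (V * (2 * r0 * depth y) ^ ?n))"
      using a dy V r0 by (intro ennreal_mult[symmetric]) auto
    also have "a / (depth y / 2) ^ ?n * (V * (2 * r0 * depth y) ^ ?n) = b"
      unfolding b_def power_divide power_mult_distrib using dy by simp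
    finally have "(\<integral>\<^sup>+x. T x w \<partial>lborel) \<le> ennreal b" .
    moreover have "w \<in> f ` ball 0 (2 * R)" using near(3)[OF x0] by (intro image_eqI[of w f y]) (auto simp: y_def)
    ultimately show ?thesis by simp
  next
    case False
    then show ?thesis by simp
  qed
  have img: "f ` ball 0 (2 * R) = fi -` ball 0 (2 * R)"
  proof (intro equalityI subsetI)
    fix y assume "y \<in> fi -` ball 0 (2 * R)"
    then show "y \<in> f ` ball 0 (2 * R)" by (intro image_eqI[of y f "fi y"]) auto
  qed auto
  have m: "f ` ball 0 (2 * R) \<in> sets borel" unfolding img using measurable_sets[OF borel_fi, of "ball 0 (2 * R)"] by simp
  have "bounded (f ` cball 0 (2 * R))" by (intro compact_imp_bounded compact_continuous_image continuous_f) auto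
  then have "bounded (f ` ball 0 (2 * R))" by (rule bounded_subset) auto
  then obtain R' where R': "f ` ball 0 (2 * R) \<subseteq> ball 0 R'" using bounded_subset_ballD by blast
  have "emeasure lborel (f ` ball 0 (2 * R)) \<le> emeasure lborel (ball (0 :: real ^ ('k + 'p)) R')" by (rule emeasure_mono[OF R']) simp
  also have "\<dots> < \<infinity>" by (intro emeasure_bounded_finite bounded_ball)
  finally have fin: "emeasure lborel (f ` ball 0 (2 * R)) < \<infinity>" .
  have "(\<integral>\<^sup>+x\<in>ball 0 R. ennreal (ratio x ^ ?n) \<partial>lborel) \<le> (\<integral>\<^sup>+x. \<integral>\<^sup>+w. T x w \<partial>lborel \<partial>lborel)"
  proof (rule nn_integral_mono_AE)
    show "AE x in lborel. ennreal (ratio x ^ ?n) * indicator (ball 0 R) x \<le> (\<integral>\<^sup>+w. T x w \<partial>lborel)"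
      using AE_depth_pos by eventually_elim (use 1 in \<open>auto split: split_indicator\<close>)
  qed
  also have "\<dots> = (\<integral>\<^sup>+w. \<integral>\<^sup>+x. T x w \<partial>lborel \<partial>lborel)" by (rule nn_integral_lborel_swap) measurable
  also have "\<dots> \<le> (\<integral>\<^sup>+w. ennreal b * indicator (f ` ball 0 (2 * R)) w \<partial>lborel)" by (intro nn_integral_mono 2)
  also have "\<dots> = ennreal b * emeasure lborel (f ` ball 0 (2 * R))" using m by (intro nn_integral_cmult_indicator) simp
  also have "\<dots> < \<infinity>" using fin by (simp add: ennreal_mult_less_top)
  finally show ?thesis .
next
  case False
  then have e: "ball 0 R = ({} :: (real ^ ('k + 'p)) set)" by simp
  show ?thesis unfolding e by simp
qed

end

section \<open>Integration by parts along lines, with auxiliary facts on integrals and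
  determinants\<close>

lemma integral_lborel_translate:
  fixes F :: "'a::euclidean_space \<Rightarrow> real"
  assumes "F \<in> borel_measurable borel"
  shows "(LINT x|lborel. F (x + a)) = (LINT x|lborel. F x)" "integrable lborel (\<lambda>x. F (x + a)) \<longleftrightarrow> integrable lborel F"
proof -
  have "(LINT x|lborel. F x) = (LINT x|distr lborel borel ((+) a). F x)" by (simp add: lborel_distr_plus)
  also have "\<dots> = (LINT x|lborel. F (a + x))" using assms by (subst integral_distr) auto
  finally show "(LINT x|lborel. F (x + a)) = (LINT x|lborel. F x)" by (simp add: add.commute)
  have "integrable lborel F \<longleftrightarrow> integrable (distr lborel borel ((+) a)) F" by (simp add: lborel_distr_plus)
  also have "\<dots> \<longleftrightarrow> integrable lborel (\<lambda>x. F (a + x))" using assms by (subst integrable_distr_eq) auto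
  finally show "integrable lborel (\<lambda>x. F (x + a)) \<longleftrightarrow> integrable lborel F" by (simp add: add.commute)
qed

lemma integral_over_lines:
  fixes W :: "'a::euclidean_space \<Rightarrow> real"
  assumes W [measurable]: "W \<in> borel_measurable borel" and int: "integrable lborel W"
  shows "(LINT x|lborel. (LINT t|lborel. indicator {0..1::real} t * W (x + t *\<^sub>R v))) = (LINT x|lborel. W x)"
proof -
  let ?F = "\<lambda>x t. indicator {0..1::real} t * W (x + t *\<^sub>R v)"
  have m: "(\<lambda>(x, t). ?F x t) \<in> borel_measurable (lborel \<Otimes>\<^sub>M lborel)" by measurable
  have "integrable (lborel \<Otimes>\<^sub>M lborel) (\<lambda>(x, t). ?F x t)"
  proof (rule integrableI_bounded[OF m])
    have "(\<integral>\<^sup>+p. ennreal (norm (case p of (x, t) \<Rightarrow> ?F x t)) \<partial>(lborel \<Otimes>\<^sub>M lborel)) = (\<integral>\<^sup>+x. \<integral>\<^sup>+t. ennreal (norm (?F x t)) \<partial>lborel \<partial>lborel)"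
      by (subst lborel.nn_integral_fst[symmetric]) (use m in auto)
    also have "\<dots> = (\<integral>\<^sup>+x. (\<integral>\<^sup>+t\<in>{0..1::real}. ennreal (norm (W (x + t *\<^sub>R v))) \<partial>lborel) \<partial>lborel)"
      by (intro nn_integral_cong) (auto split: split_indicator)
    also have "\<dots> = (\<integral>\<^sup>+x. ennreal (norm (W x)) \<partial>lborel)"
      by (rule nn_integral_over_lines) measurable
    also have "\<dots> < \<infinity>" using int by (simp add: integrable_iff_bounded)
    finally show "(\<integral>\<^sup>+p. ennreal (norm (case p of (x, t) \<Rightarrow> ?F x t)) \<partial>(lborel \<Otimes>\<^sub>M lborel)) < \<infinity>" .
  qed
  from lborel_pair.Fubini_integral[OF this]
  have "(LINT x|lborel. (LINT t|lborel. ?F x t)) = (LINT t|lborel. (LINT x|lborel. ?F x t))" by simp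
  also have "\<dots> = (LINT t|lborel. indicator {0..1::real} t * (LINT x|lborel. W x))"
    by (intro Bochner_Integration.integral_cong refl) (simp add: integral_lborel_translate[OF W])
  also have "\<dots> = (LINT x|lborel. W x)" by simp
  finally show ?thesis .
qed

lemma integrable_vec:
  fixes g :: "'a \<Rightarrow> real ^ 'n"
  assumes "\<And>i. integrable Q (\<lambda>x. g x $ i)"
  shows "integrable Q g" "integral\<^sup>L Q g $ i = (LINT x|Q. g x $ i)"
proof -
  have "g = (\<lambda>x. \<Sum>i\<in>UNIV. g x $ i *\<^sub>R axis i 1)"
    by (auto simp: vec_eq_iff axis_def fun_eq_iff if_distrib cong: if_cong)
  moreover have "integrable Q (\<lambda>x. \<Sum>i\<in>UNIV. g x $ i *\<^sub>R axis i (1::real))"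
    by (intro Bochner_Integration.integrable_sum integrable_scaleR_left assms)
  ultimately show i: "integrable Q g" by simp
  show "integral\<^sup>L Q g $ i = (LINT x|Q. g x $ i)"
    by (rule integral_bounded_linear[OF bounded_linear_vec_nth i, symmetric])
qed

lemma abs_det_le:
  fixes A :: "real ^ 'n ^ 'n"
  assumes "\<And>i j. \<bar>A $ i $ j\<bar> \<le> c"
  shows "\<bar>det A\<bar> \<le> fact CARD('n) * c ^ CARD('n)"
proof -
  have "\<bar>det A\<bar> \<le> (\<Sum>p\<in>{p. p permutes (UNIV :: 'n set)}. \<bar>of_int (sign p) * (\<Prod>i\<in>UNIV. A $ i $ p i)\<bar>)"
    unfolding det_def by (rule sum_abs)
  also have "\<dots> \<le> (\<Sum>p\<in>{p. p permutes (UNIV :: 'n set)}. c ^ CARD('n))"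
  proof (rule sum_mono)
    fix p :: "'n \<Rightarrow> 'n"
    have "\<bar>of_int (sign p) * (\<Prod>i\<in>UNIV. A $ i $ p i)\<bar> = (\<Prod>i\<in>(UNIV :: 'n set). \<bar>A $ i $ p i\<bar>)"
      by (simp add: abs_mult abs_prod sign_def)
    also have "\<dots> \<le> (\<Prod>i\<in>(UNIV :: 'n set). c)" by (intro prod_mono) (use assms in auto)
    finally show "\<bar>of_int (sign p) * (\<Prod>i\<in>UNIV. A $ i $ p i)\<bar> \<le> c ^ CARD('n)" by simp
  qed
  also have "\<dots> = fact CARD('n) * c ^ CARD('n)"
    by (simp add: card_permutations[OF refl])
  finally show ?thesis .
qed

lemma abs_entry_le_of_norm_bound:
  fixes A :: "real ^ 'n ^ 'm"
  assumes "\<And>x. norm (A *v x) \<le> c * norm x"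
  shows "\<bar>A $ i $ j\<bar> \<le> c"
proof -
  have "(A *v axis j 1) $ i = A $ i $ j" by (simp add: matrix_vector_mult_basis column_def)
  then have "\<bar>A $ i $ j\<bar> \<le> norm (A *v axis j 1)" using component_le_norm_cart[of "A *v axis j 1" i] by simp
  also have "\<dots> \<le> c" using assms[of "axis j 1"] by simp
  finally show ?thesis .
qed

text \<open>The lower norm bound makes A invertible with inverse of norm at most 1 / a; the Leibniz
  bound for the determinant of the inverse gives the claim.\<close>

lemma abs_det_ge:
  fixes A :: "real ^ 'n ^ 'n"
  assumes a: "0 < a" and lower: "\<And>x. a * norm x \<le> norm (A *v x)"
  shows "a ^ CARD('n) / fact CARD('n) \<le> \<bar>det A\<bar>"
proof -
  have "inj ((*v) A)"
  proof (rule injI)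
    fix x y assume "A *v x = A *v y"
    then have "A *v (x - y) = 0" by (simp add: matrix_vector_mult_diff_distrib)
    then have "a * norm (x - y) \<le> 0" using lower[of "x - y"] by simp
    then show "x = y" using a by (simp add: mult_le_0_iff)
  qed
  then obtain B where "B ** A = mat 1" using matrix_left_invertible_injective by blast
  then have AB: "A ** B = mat 1" using matrix_left_right_inverse by blast
  have "norm (B *v x) \<le> 1 / a * norm x" for x
  proof -
    have "A *v (B *v x) = x" by (simp add: matrix_vector_mul_assoc AB)
    then show ?thesis using lower[of "B *v x"] a by (simp add: field_simps)
  qed
  from abs_det_le[OF abs_entry_le_of_norm_bound[OF this]]
  have 1: "\<bar>det B\<bar> \<le> fact CARD('n) * (1 / a) ^ CARD('n)" .
  have "det A * det B = 1" using AB by (metis det_I det_mul)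
  then have "1 = \<bar>det A\<bar> * \<bar>det B\<bar>" by (metis abs_1 abs_mult)
  also have "\<dots> \<le> \<bar>det A\<bar> * (fact CARD('n) * (1 / a) ^ CARD('n))" by (intro mult_left_mono 1) simp
  finally show ?thesis using a by (simp add: field_simps)
qed

context whitney_map
begin

text \<open>The derivative is bounded by the first power of \<open>ratio\<close>, which is at most 1
  + ratio^n.\<close>

lemma dird_locally_integrable: "(\<integral>\<^sup>+x\<in>ball 0 R. ennreal \<bar>dird i v x\<bar> \<partial>lborel) < \<infinity>"
proof -
  let ?n = "CARD('k + 'p)"
  have n: "1 \<le> ?n" using zero_less_card_finite[where 'a="'k + 'p"] by linarith
  have conv: "AE x in lborel. \<forall>i. convergent (\<lambda>k. dirq i v k x)"
    by (simp only: AE_all_countable AE_convergent_dirq) simp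
  have "(\<integral>\<^sup>+x\<in>ball 0 R. ennreal \<bar>dird i v x\<bar> \<partial>lborel) \<le> (\<integral>\<^sup>+x. ennreal (K * norm v) * (indicator (ball 0 R) x + ennreal (ratio x ^ ?n) * indicator (ball 0 R) x) \<partial>lborel)"
  proof (rule nn_integral_mono_AE)
    show "AE x in lborel. ennreal \<bar>dird i v x\<bar> * indicator (ball 0 R) x \<le> ennreal (K * norm v) * (indicator (ball 0 R) x + ennreal (ratio x ^ ?n) * indicator (ball 0 R) x)"
      using conv AE_depth_pos
    proof eventually_elim
      case (elim x)
      have r: "0 \<le> ratio x" using ratio_pos[OF elim(2)] by simp
      have "\<bar>dird i v x\<bar> \<le> norm (\<chi> i. dird i v x)" using component_le_norm_cart[of "\<chi> i. dird i v x" i] by simp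
      also have "\<dots> \<le> K * ratio x * norm v" using elim by (intro dird_bounds) auto
      also have "\<dots> \<le> K * norm v * (1 + ratio x ^ ?n)"
      proof -
        have "ratio x \<le> 1 + ratio x ^ ?n"
        proof (cases "ratio x \<le> 1")
          case False
          then have "ratio x ^ 1 \<le> ratio x ^ ?n" using n by (intro power_increasing) auto
          then show ?thesis by simp
        qed (use r in \<open>simp add: add_increasing2\<close>)
        then have "K * norm v * ratio x \<le> K * norm v * (1 + ratio x ^ ?n)" using K by (intro mult_left_mono) auto
        then show ?thesis by (simp add: mult_ac)
      qed
      finally have "ennreal \<bar>dird i v x\<bar> \<le> ennreal (K * norm v * (1 + ratio x ^ ?n))" by (rule ennreal_leI)
      also have "\<dots> = ennreal (K * norm v) * (1 + ennreal (ratio x ^ ?n))" using K r by (simp add: ennreal_mult)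
      finally show ?case by (auto split: split_indicator)
    qed
  qed
  also have "\<dots> = ennreal (K * norm v) * (\<integral>\<^sup>+x. indicator (ball 0 R) x + ennreal (ratio x ^ ?n) * indicator (ball 0 R) x \<partial>lborel)"
    by (rule nn_integral_cmult) measurable
  also have "(\<integral>\<^sup>+x. indicator (ball 0 R) x + ennreal (ratio x ^ ?n) * indicator (ball 0 R) x \<partial>lborel) = emeasure lborel (ball (0 :: real ^ ('k + 'p)) R) + (\<integral>\<^sup>+x\<in>ball 0 R. ennreal (ratio x ^ ?n) \<partial>lborel)"
    by (subst nn_integral_add) auto
  also have "ennreal (K * norm v) * \<dots> < \<infinity>"
    using ratio_power_integrable[of R] emeasure_bounded_finite[of "ball (0 :: real ^ ('k + 'p)) R"]
    by (simp add: ennreal_mult_less_top)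
  finally show ?thesis .
qed

lemma line_meets_subspace_once:
  assumes x: "0 < depth x"
  obtains t0 where "\<And>t. t \<noteq> t0 \<Longrightarrow> 0 < depth (x + t *\<^sub>R v)"
proof (cases "\<exists>t. depth (x + t *\<^sub>R v) = 0")
  case True
  then obtain t0 where t0: "ypart x + t0 *\<^sub>R ypart v = 0" by (auto simp: depth_def)
  have "0 < depth (x + t *\<^sub>R v)" if "t \<noteq> t0" for t
  proof (rule ccontr)
    assume "\<not> ?thesis"
    then have "ypart x + t *\<^sub>R ypart v = 0" by (simp add: depth_def)
    moreover have "(t - t0) *\<^sub>R ypart v = (ypart x + t *\<^sub>R ypart v) - (ypart x + t0 *\<^sub>R ypart v)" by (simp add: algebra_simps)
    ultimately have "(t - t0) *\<^sub>R ypart v = 0" using t0 by simp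
    then have "ypart v = 0" using that by simp
    then show False using t0 x by (simp add: depth_def)
  qed
  then show ?thesis using that by blast
next
  case False
  then have "0 < depth (x + t *\<^sub>R v)" for t using depth_nonneg[of "x + t *\<^sub>R v"] by (metis less_eq_real_def)
  then show ?thesis using that by blast
qed

text \<open>Let W be the derivative along v of hh, the product of \<phi> with a component of f. On
  almost every line W is integrable, and the fundamental theorem with one exceptional parameter
  gives hh (x + v) - hh x as the integral of W over the unit segment from x. Integrating over x and
  using translation invariance shows that W has integral zero, and the product rule for W is the
  assertion.\<close>

lemma integration_by_parts:
  assumes \<phi>: "test_function UNIV \<phi>"
  shows "integrable lborel (\<lambda>x. frechet_derivative \<phi> (at x) v * f x $ i)"
    and "integrable lborel (\<lambda>x. \<phi> x * dird i v x)"
    and "(LINT x|lborel. frechet_derivative \<phi> (at x) v * f x $ i) = - (LINT x|lborel. \<phi> x * dird i v x)"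
proof -
  obtain L where L: "0 \<le> L" "\<And>x y. \<bar>\<phi> x - \<phi> y\<bar> \<le> L * norm (x - y)" "\<And>x h. \<bar>frechet_derivative \<phi> (at x) h\<bar> \<le> L * norm h"
    using test_function_lipschitz[OF \<phi>] by metis
  have C: "Ck (Suc 0) \<phi>" using \<phi> by (auto simp: test_function_def simp del: Ck.simps)
  have c\<phi>: "continuous_on S \<phi>" for S using Ck_continuous[OF C] continuous_on_subset by blast
  have [measurable]: "\<phi> \<in> borel_measurable borel" by (intro borel_measurable_continuous_onI c\<phi>)
  have dif: "\<phi> differentiable (at x)" for x using C by simp
  define D where "D x = frechet_derivative \<phi> (at x) v" for x
  have lim\<phi>: "(\<lambda>k. (\<phi> (x + hs k *\<^sub>R v) - \<phi> x) / hs k) \<longlonglongrightarrow> D x" for x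
    unfolding D_def by (rule directional_derivative_limit[OF dif])
  have [measurable]: "D \<in> borel_measurable borel"
    by (rule borel_measurable_LIMSEQ_real[OF lim\<phi>]) measurable
  have "bounded {x. \<phi> x \<noteq> 0}" using \<phi> compact_imp_bounded closure_subset bounded_subset unfolding test_function_def by metis
  then obtain R where R: "0 < R" "{x. \<phi> x \<noteq> 0} \<subseteq> ball 0 R" using bounded_subset_ballD by blast
  have \<phi>0: "\<phi> x = 0" if "R \<le> norm x" for x using R(2) that by auto
  \<comment> \<open>The derivative of \<phi> is a limit of quotients that look ahead by at most norm
    v, since \<open>hs\<close> is at most 1.\<close>
  define R2 where "R2 = R + norm v"
  have D0: "D x = 0" if x: "R2 \<le> norm x" for x
  proof -
    have "\<phi> (x + hs k *\<^sub>R v) = 0" for k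
    proof (rule \<phi>0)
      have "hs k * norm v \<le> 1 * norm v" by (intro mult_right_mono) (auto simp: hs_def divide_simps)
      then show "R \<le> norm (x + hs k *\<^sub>R v)" using x norm_diff_ineq[of x "hs k *\<^sub>R v"] hs(1)[of k] by (simp add: R2_def)
    qed
    moreover have "\<phi> x = 0" using x by (intro \<phi>0) (simp add: R2_def add_increasing2, use norm_ge_zero[of v] in linarith)
    ultimately have "(\<lambda>k. 0 :: real) \<longlonglongrightarrow> D x" using lim\<phi>[of x] by simp
    then show ?thesis by (simp add: LIMSEQ_const_iff)
  qed
  have [measurable]: "(\<lambda>x. f x $ i) \<in> borel_measurable borel" by (rule borel_vec_nth_f)
  have cf: "continuous_on S (\<lambda>x. f x $ i)" for S by (intro continuous_intros continuous_f)
  have i1: "integrable lborel (\<lambda>x. D x * f x $ i)"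
  proof (rule Bochner_Integration.integrable_bound)
    show "integrable lborel (\<lambda>x. indicator (cball 0 R2) x *\<^sub>R (L * norm v * \<bar>f x $ i\<bar>))"
      by (intro borel_integrable_compact continuous_intros cf) auto
    show "AE x in lborel. norm (D x * f x $ i) \<le> norm (indicator (cball 0 R2) x *\<^sub>R (L * norm v * \<bar>f x $ i\<bar>))"
    proof (rule AE_I2)
      fix x
      show "norm (D x * f x $ i) \<le> norm (indicator (cball 0 R2) x *\<^sub>R (L * norm v * \<bar>f x $ i\<bar>))"
        using L(1) L(3)[of x v] D0[of x] by (cases "norm x \<le> R2") (auto simp: abs_mult D_def intro!: mult_right_mono)
    qed
  qed measurable
  then show "integrable lborel (\<lambda>x. frechet_derivative \<phi> (at x) v * f x $ i)" by (simp add: D_def)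
  define B where "B = \<bar>\<phi> 0\<bar> + L * R"
  have B: "\<bar>\<phi> x\<bar> \<le> B * indicator (ball 0 R) x" for x
  proof (cases "norm x < R")
    case True
    have "\<bar>\<phi> x - \<phi> 0\<bar> \<le> L * norm x" using L(2)[of x 0] by simp
    also have "\<dots> \<le> L * R" using True L(1) by (intro mult_left_mono) auto
    finally show ?thesis using True by (simp add: B_def)
  qed (use \<phi>0 in \<open>simp add: not_less\<close>)
  have B0: "0 \<le> B" using L R by (simp add: B_def)
  have i2: "integrable lborel (\<lambda>x. \<phi> x * dird i v x)"
  proof (rule integrableI_bounded)
    have "(\<integral>\<^sup>+x. ennreal (norm (\<phi> x * dird i v x)) \<partial>lborel) \<le> (\<integral>\<^sup>+x. ennreal B * (ennreal \<bar>dird i v x\<bar> * indicator (ball 0 R) x) \<partial>lborel)"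
    proof (rule nn_integral_mono)
      fix x
      have "norm (\<phi> x * dird i v x) \<le> B * indicator (ball 0 R) x * \<bar>dird i v x\<bar>" using B[of x] by (simp add: abs_mult mult_right_mono)
      then have "ennreal (norm (\<phi> x * dird i v x)) \<le> ennreal (B * indicator (ball 0 R) x * \<bar>dird i v x\<bar>)" by (rule ennreal_leI)
      also have "\<dots> = ennreal B * (ennreal \<bar>dird i v x\<bar> * indicator (ball 0 R) x)"
        using B0 by (auto simp: ennreal_mult split: split_indicator)
      finally show "ennreal (norm (\<phi> x * dird i v x)) \<le> ennreal B * (ennreal \<bar>dird i v x\<bar> * indicator (ball 0 R) x)" .
    qed
    also have "\<dots> = ennreal B * (\<integral>\<^sup>+x\<in>ball 0 R. ennreal \<bar>dird i v x\<bar> \<partial>lborel)" by (rule nn_integral_cmult) measurable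
    also have "\<dots> < \<infinity>" using dird_locally_integrable[of i v R] by (simp add: ennreal_mult_less_top)
    finally show "(\<integral>\<^sup>+x. ennreal (norm (\<phi> x * dird i v x)) \<partial>lborel) < \<infinity>" .
  qed measurable
  then show "integrable lborel (\<lambda>x. \<phi> x * dird i v x)" .
  define hh where "hh x = \<phi> x * f x $ i" for x
  have [measurable]: "hh \<in> borel_measurable borel" unfolding hh_def[abs_def] by measurable
  have chh: "continuous_on S hh" for S unfolding hh_def[abs_def] by (intro continuous_intros c\<phi> cf)
  have ihh: "integrable lborel hh"
  proof -
    have "integrable lborel (\<lambda>x. indicator (cball 0 R) x *\<^sub>R hh x)" by (rule borel_integrable_compact[OF compact_cball chh])
    moreover have "(\<lambda>x. indicator (cball 0 R) x *\<^sub>R hh x) = hh"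
    proof
      fix x show "indicator (cball 0 R) x *\<^sub>R hh x = hh x"
        using \<phi>0[of x] by (cases "norm x \<le> R") (auto simp: hh_def)
    qed
    ultimately show ?thesis by simp
  qed
  define W where "W x = lim (\<lambda>k. (hh (x + hs k *\<^sub>R v) - hh x) / hs k)" for x
  have [measurable]: "W \<in> borel_measurable borel" unfolding W_def[abs_def] by measurable
  have Weq: "AE x in lborel. W x = D x * f x $ i + \<phi> x * dird i v x"
    using AE_convergent_dirq[of i v]
  proof eventually_elim
    case (elim x)
    have l1: "(\<lambda>k. dirq i v k x) \<longlonglongrightarrow> dird i v x" using elim by (simp add: dird_def convergent_LIMSEQ_iff)
    have "(\<lambda>k. x + hs k *\<^sub>R v) \<longlonglongrightarrow> x + 0 *\<^sub>R v" by (intro tendsto_intros hs)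
    then have l2: "(\<lambda>k. \<phi> (x + hs k *\<^sub>R v)) \<longlonglongrightarrow> \<phi> x"
      using continuous_on_tendsto_compose[OF c\<phi>[of UNIV], of "\<lambda>k. x + hs k *\<^sub>R v" x sequentially] by simp
    have "(\<lambda>k. \<phi> (x + hs k *\<^sub>R v) * dirq i v k x + (\<phi> (x + hs k *\<^sub>R v) - \<phi> x) / hs k * f x $ i) \<longlonglongrightarrow> \<phi> x * dird i v x + D x * f x $ i"
      by (intro tendsto_intros l1 l2 lim\<phi>)
    moreover have "\<phi> (x + hs k *\<^sub>R v) * dirq i v k x + (\<phi> (x + hs k *\<^sub>R v) - \<phi> x) / hs k * f x $ i = (hh (x + hs k *\<^sub>R v) - hh x) / hs k" for k
      by (simp add: hh_def dirq_def diff_divide_distrib algebra_simps)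
    ultimately show ?case unfolding W_def by (simp add: limI add.commute)
  qed
  have iW: "integrable lborel W"
  proof -
    have "integrable lborel (\<lambda>x. D x * f x $ i + \<phi> x * dird i v x)" by (intro Bochner_Integration.integrable_add i1 i2)
    then show ?thesis by (rule integrable_cong_AE_imp) (use Weq in \<open>auto elim: eventually_mono\<close>)
  qed
  have lines: "AE x in lborel. (LINT t|lborel. indicator {0..1::real} t * W (x + t *\<^sub>R v)) = hh (x + v) - hh x"
  proof -
    have "(\<integral>\<^sup>+x. (\<integral>\<^sup>+t\<in>{0..1::real}. ennreal (norm (W (x + t *\<^sub>R v))) \<partial>lborel) \<partial>lborel) = (\<integral>\<^sup>+x. ennreal (norm (W x)) \<partial>lborel)"
      by (rule nn_integral_over_lines) measurable
    also have "\<dots> < \<infinity>" using iW by (simp add: integrable_iff_bounded)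
    finally have fin: "(\<integral>\<^sup>+x. (\<integral>\<^sup>+t\<in>{0..1::real}. ennreal (norm (W (x + t *\<^sub>R v))) \<partial>lborel) \<partial>lborel) \<noteq> \<infinity>" by simp
    have "AE x in lborel. (\<integral>\<^sup>+t\<in>{0..1::real}. ennreal (norm (W (x + t *\<^sub>R v))) \<partial>lborel) \<noteq> \<infinity>"
      by (rule nn_integral_PInf_AE[OF _ fin]) measurable
    then show ?thesis using AE_depth_pos
    proof eventually_elim
      case (elim x)
      have si: "set_integrable lborel {0..1} (\<lambda>t. W (x + t *\<^sub>R v))" unfolding set_integrable_def
      proof (rule integrableI_bounded)
        have "(\<integral>\<^sup>+t. ennreal (norm (indicat_real {0..1} t *\<^sub>R W (x + t *\<^sub>R v))) \<partial>lborel) = (\<integral>\<^sup>+t\<in>{0..1::real}. ennreal (norm (W (x + t *\<^sub>R v))) \<partial>lborel)"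
          by (intro nn_integral_cong) (auto split: split_indicator)
        then show "(\<integral>\<^sup>+t. ennreal (norm (indicat_real {0..1} t *\<^sub>R W (x + t *\<^sub>R v))) \<partial>lborel) < \<infinity>" using elim(1) by (simp add: less_top)
      qed measurable
      define u where "u t = hh (x + t *\<^sub>R v)" for t
      have Wu: "W (x + t *\<^sub>R v) = lim (\<lambda>k. (u (t + hs k) - u t) / hs k)" for t
        by (simp add: W_def u_def scaleR_add_left add.assoc)
      obtain t0 where t0: "\<And>t. t \<noteq> t0 \<Longrightarrow> 0 < depth (x + t *\<^sub>R v)" using line_meets_subspace_once[OF elim(2)] by blast
      have "integral {0..1} (\<lambda>t. lim (\<lambda>k. (u (t + hs k) - u t) / hs k)) = u 1 - u 0"
      proof (rule punctured_locally_lipschitz_FTC[where ?t0.0 = t0 and h = hs])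
        show "continuous_on UNIV u" unfolding u_def[abs_def]
          by (rule continuous_on_compose2[OF chh[of UNIV]]) (auto intro!: continuous_intros)
        show "(\<lambda>t. lim (\<lambda>k. (u (t + hs k) - u t) / hs k)) integrable_on {0..1}"
          using set_borel_integral_eq_integral(1)[OF si] by (simp only: Wu)
        fix t assume t: "t \<in> {0..1} - {t0}"
        obtain e A where e: "0 < e" and A: "\<And>s s'. s \<in> ball t e \<Longrightarrow> s' \<in> ball t e \<Longrightarrow> \<bar>f (x + s *\<^sub>R v) $ i - f (x + s' *\<^sub>R v) $ i\<bar> \<le> A * \<bar>s - s'\<bar>"
          using line_locally_lipschitz[OF t0[of t], of i] t by blast
        define F where "F = \<bar>f (x + t *\<^sub>R v) $ i\<bar> + \<bar>A\<bar> * e"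
        have F: "\<bar>f (x + s *\<^sub>R v) $ i\<bar> \<le> F" if "s \<in> ball t e" for s
        proof -
          have "\<bar>f (x + s *\<^sub>R v) $ i - f (x + t *\<^sub>R v) $ i\<bar> \<le> A * \<bar>s - t\<bar>" using that e by (intro A) auto
          also have "\<dots> \<le> \<bar>A\<bar> * e" using that by (intro mult_mono) (auto simp: dist_real_def)
          finally show ?thesis by (simp add: F_def)
        qed
        have Bx: "\<bar>\<phi> z\<bar> \<le> B" for z using B[of z] B0 by (auto split: split_indicator_asm)
        show "\<exists>e>0. \<exists>L. \<forall>s\<in>ball t e. \<forall>s'\<in>ball t e. \<bar>u s - u s'\<bar> \<le> L * \<bar>s - s'\<bar>"
        proof (rule exI[of _ e], rule conjI[OF e], rule exI[of _ "B * A + L * norm v * F"], intro ballI)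
          fix s s' assume s: "s \<in> ball t e" "s' \<in> ball t e"
          have "u s - u s' = \<phi> (x + s *\<^sub>R v) * (f (x + s *\<^sub>R v) $ i - f (x + s' *\<^sub>R v) $ i) + (\<phi> (x + s *\<^sub>R v) - \<phi> (x + s' *\<^sub>R v)) * f (x + s' *\<^sub>R v) $ i"
            by (simp add: u_def hh_def algebra_simps)
          then have "\<bar>u s - u s'\<bar> \<le> \<bar>\<phi> (x + s *\<^sub>R v)\<bar> * \<bar>f (x + s *\<^sub>R v) $ i - f (x + s' *\<^sub>R v) $ i\<bar> + \<bar>\<phi> (x + s *\<^sub>R v) - \<phi> (x + s' *\<^sub>R v)\<bar> * \<bar>f (x + s' *\<^sub>R v) $ i\<bar>"
            by (simp add: abs_mult[symmetric] abs_triangle_ineq)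
          also have "\<dots> \<le> B * (A * \<bar>s - s'\<bar>) + (L * norm ((x + s *\<^sub>R v) - (x + s' *\<^sub>R v))) * F"
            using B0 L(1) by (intro add_mono mult_mono Bx A s L(2) F) auto
          also have "norm ((x + s *\<^sub>R v) - (x + s' *\<^sub>R v)) = \<bar>s - s'\<bar> * norm v" by (simp add: scaleR_diff_left[symmetric])
          finally show "\<bar>u s - u s'\<bar> \<le> (B * A + L * norm v * F) * \<bar>s - s'\<bar>" by (simp add: algebra_simps)
        qed
      qed (simp_all add: hs)
      then show ?case using set_borel_integral_eq_integral(2)[OF si]
        by (simp add: set_lebesgue_integral_def Wu u_def)
    qed
  qed
  have "(LINT x|lborel. W x) = (LINT x|lborel. (LINT t|lborel. indicator {0..1::real} t * W (x + t *\<^sub>R v)))"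
    by (rule integral_over_lines[symmetric]) (use iW in auto)
  also have "\<dots> = (LINT x|lborel. hh (x + v) - hh x)"
    by (rule integral_cong_AE) (use lines in auto)
  also have "\<dots> = (LINT x|lborel. hh (x + v)) - (LINT x|lborel. hh x)"
    by (intro Bochner_Integration.integral_diff) (use ihh integral_lborel_translate(2)[of hh v] in auto)
  also have "\<dots> = 0" by (simp add: integral_lborel_translate(1))
  finally have "(LINT x|lborel. W x) = 0" .
  moreover have "(LINT x|lborel. W x) = (LINT x|lborel. D x * f x $ i + \<phi> x * dird i v x)"
    by (rule integral_cong_AE) (use Weq in auto)
  moreover have "\<dots> = (LINT x|lborel. D x * f x $ i) + (LINT x|lborel. \<phi> x * dird i v x)"
    by (intro Bochner_Integration.integral_add i1 i2)
  ultimately show "(LINT x|lborel. frechet_derivative \<phi> (at x) v * f x $ i) = - (LINT x|lborel. \<phi> x * dird i v x)"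
    by (simp add: D_def)
qed

end

section \<open>The Jacobian\<close>

lemma frechet_derivative_test_function_expand:
  fixes \<phi> :: "real ^ 'n \<Rightarrow> real"
  assumes "test_function UNIV \<phi>"
  shows "frechet_derivative \<phi> (at x) v = (\<Sum>j\<in>UNIV. v $ j * frechet_derivative \<phi> (at x) (axis j 1))"
proof -
  have C: "Ck (Suc 0) \<phi>" using assms by (auto simp: test_function_def simp del: Ck.simps)
  interpret bounded_linear "frechet_derivative \<phi> (at x)"
    by (rule has_derivative_bounded_linear[OF Ck_SucD(1)[OF C]])
  have "v = (\<Sum>j\<in>UNIV. v $ j *\<^sub>R axis j 1)"
    by (auto simp: vec_eq_iff axis_def if_distrib cong: if_cong)
  then have "frechet_derivative \<phi> (at x) v = frechet_derivative \<phi> (at x) (\<Sum>j\<in>UNIV. v $ j *\<^sub>R axis j 1)" by simp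
  then show ?thesis by (simp only: sum scaleR real_scaleR_def)
qed

lemma integrable_times_test_function:
  fixes h \<phi> :: "'a::euclidean_space \<Rightarrow> real"
  assumes \<phi>: "test_function UNIV \<phi>" and h: "locally_integrable UNIV h"
  shows "integrable lebesgue (\<lambda>x. \<phi> x * h x)"
proof -
  define S where "S = closure {x. \<phi> x \<noteq> 0}"
  have S: "compact S" using \<phi> by (simp add: S_def test_function_def)
  have C: "continuous_on UNIV \<phi>" using \<phi> Ck_continuous[of 0] unfolding test_function_def by blast
  have [measurable]: "\<phi> \<in> borel_measurable lebesgue"
    by (intro measurable_completion) (use borel_measurable_continuous_onI[OF C] in simp)
  have "compact (\<phi> ` S)" by (intro compact_continuous_image S continuous_on_subset[OF C]) simp
  then obtain B where B: "\<And>x. x \<in> S \<Longrightarrow> \<bar>\<phi> x\<bar> \<le> B" using compact_imp_bounded bounded_iff by (metis imageI real_norm_def)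
  have i: "integrable lebesgue (\<lambda>x. indicator S x *\<^sub>R h x)"
    using h S by (simp add: locally_integrable_def set_integrable_def)
  then have [measurable]: "(\<lambda>x. indicator S x *\<^sub>R h x) \<in> borel_measurable lebesgue" by (rule borel_measurable_integrable)
  have e: "(\<lambda>x. \<phi> x * h x) = (\<lambda>x. \<phi> x * (indicator S x *\<^sub>R h x))"
  proof
    fix x
    have "\<phi> x = 0" if "x \<notin> S" using that closure_subset[of "{x. \<phi> x \<noteq> 0}"] by (auto simp: S_def)
    then show "\<phi> x * h x = \<phi> x * (indicator S x *\<^sub>R h x)" by (cases "x \<in> S") auto
  qed
  show ?thesis unfolding e
  proof (rule Bochner_Integration.integrable_bound)
    show "integrable lebesgue (\<lambda>x. \<bar>B\<bar> * (indicator S x *\<^sub>R h x))" by (rule integrable_mult_right) (rule i)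
    show "AE x in lebesgue. norm (\<phi> x * (indicator S x *\<^sub>R h x)) \<le> norm (\<bar>B\<bar> * (indicator S x *\<^sub>R h x))"
    proof (rule AE_I2)
      fix x
      show "norm (\<phi> x * (indicator S x *\<^sub>R h x)) \<le> norm (\<bar>B\<bar> * (indicator S x *\<^sub>R h x))"
        using B[of x] by (cases "x \<in> S") (auto simp: abs_mult intro!: mult_right_mono)
    qed
  qed measurable
qed

lemma locally_integrable_measurable:
  fixes h :: "'a::euclidean_space \<Rightarrow> real"
  assumes h: "locally_integrable UNIV h"
  shows "h \<in> borel_measurable lebesgue"
proof (rule borel_measurable_LIMSEQ_real)
  show "(\<lambda>x. indicator (cball 0 (real k)) x *\<^sub>R h x) \<in> borel_measurable lebesgue" for k
    using h by (intro borel_measurable_integrable) (simp add: locally_integrable_def set_integrable_def)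
  fix x :: 'a
  obtain k0 :: nat where "norm x \<le> real k0" using real_arch_simple by blast
  then have "\<forall>\<^sub>F k in sequentially. indicator (cball 0 (real k)) x *\<^sub>R h x = h x"
    unfolding eventually_sequentially by (intro exI[of _ k0]) (auto simp: indicator_def)
  then show "(\<lambda>k. indicator (cball 0 (real k)) x *\<^sub>R h x) \<longlonglongrightarrow> h x" by (rule tendsto_eventually)
qed

lemma locally_integrable_entry:
  fixes D :: "real ^ 'm \<Rightarrow> real ^ 'm ^ 'm"
  assumes "locally_integrable U D"
  shows "locally_integrable U (\<lambda>x. D x $ i $ j)"
  unfolding locally_integrable_def
proof (intro allI impI)
  fix S assume "compact S \<and> S \<subseteq> U"
  then have "D absolutely_integrable_on S" using assms by (simp add: locally_integrable_def)
  from absolutely_integrable_component[OF this, of "axis i (axis j 1)"]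
  show "(\<lambda>x. D x $ i $ j) absolutely_integrable_on S" by (simp add: inner_axis)
qed

lemma locally_integrable_test_zero_imp_AE_zero:
  fixes h :: "real ^ 'n \<Rightarrow> real"
  assumes h: "locally_integrable UNIV h"
    and zero: "\<And>\<phi>. test_function UNIV \<phi> \<Longrightarrow> (LINT x|lebesgue. \<phi> x * h x) = 0"
  shows "AE x in lebesgue. h x = 0"
proof -
  have hm [measurable]: "h \<in> borel_measurable lebesgue" by (rule locally_integrable_measurable[OF h])
  obtain h' where h'0: "h' \<in> borel_measurable lborel" and eq: "AE x in lborel. h x = h' x"
    using completion_ex_borel_measurable_real[OF hm] by blast
  then have h' [measurable]: "h' \<in> borel_measurable borel" by simp
  have h'l [measurable]: "h' \<in> borel_measurable lebesgue" by (rule measurable_completion[OF h'0])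
  have eql: "AE x in lebesgue. h x = h' x" using eq by (rule AE_completion)
  have "AE x in lborel. h' x = 0"
  proof (rule test_function_integral_zero_imp_AE_zero[OF h'])
    fix a b :: "real ^ 'n"
    have "integrable lebesgue (\<lambda>x. indicator (cbox a b) x *\<^sub>R h x)" using h by (simp add: locally_integrable_def set_integrable_def)
    then have "integrable lebesgue (\<lambda>x. indicator (box a b) x *\<^sub>R (indicator (cbox a b) x *\<^sub>R h x))"
      by (rule integrable_mult_indicator[rotated]) simp
    then have "integrable lebesgue (\<lambda>x. indicator (box a b) x * h' x)"
    proof (rule integrable_cong_AE_imp)
      show "AE x in lebesgue. indicator (box a b) x *\<^sub>R (indicator (cbox a b) x *\<^sub>R h x) = indicator (box a b) x * h' x"
        using eql by eventually_elim (use box_subset_cbox[of a b] in \<open>auto split: split_indicator\<close>)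
      show "(\<lambda>x. indicator (box a b) x * h' x) \<in> borel_measurable lebesgue"
        by (intro measurable_completion) simp
    qed
    then show "integrable lborel (\<lambda>x. indicator (box a b) x * h' x)"
      by (subst (asm) integrable_completion) auto
  next
    fix \<phi> :: "real ^ 'n \<Rightarrow> real" assume \<phi>: "test_function UNIV \<phi>"
    have C: "continuous_on UNIV \<phi>" using \<phi> Ck_continuous[of 0] unfolding test_function_def by blast
    have [measurable]: "\<phi> \<in> borel_measurable borel" by (rule borel_measurable_continuous_onI[OF C])
    have [measurable]: "\<phi> \<in> borel_measurable lebesgue" by (rule measurable_completion) simp
    have "(LINT x|lborel. \<phi> x * h' x) = (LINT x|lebesgue. \<phi> x * h' x)"
      by (rule integral_completion[symmetric]) simp
    also have "\<dots> = (LINT x|lebesgue. \<phi> x * h x)"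
      by (rule integral_cong_AE) (use eql in \<open>auto elim: eventually_mono\<close>)
    finally show "(LINT x|lborel. \<phi> x * h' x) = 0" by (simp add: zero[OF \<phi>])
  qed
  then have "AE x in lebesgue. h' x = 0" by (rule AE_completion)
  then show ?thesis using eql by eventually_elim simp
qed

text \<open>Needed because \<open>jacobian\<close> selects some weak derivative. Two of them have
  the same integrals against all test functions, entry by entry.\<close>

lemma weak_derivative_unique:
  fixes D D' :: "real ^ 'm \<Rightarrow> real ^ 'm ^ 'm"
  assumes D: "has_weak_derivative_on h D UNIV" and D': "has_weak_derivative_on h D' UNIV"
  shows "AE x in lebesgue. D x = D' x"
proof -
  have ent: "(LINT x|lebesgue. \<phi> x * A x $ i $ j) = - (LINT x|lebesgue. frechet_derivative \<phi> (at x) (axis j 1) *\<^sub>R h x) $ i"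
    if A: "has_weak_derivative_on h A UNIV" and \<phi>: "test_function UNIV \<phi>" for A \<phi> i j
  proof -
    have "integrable lebesgue (\<lambda>x. (\<phi> x *\<^sub>R column j (A x)) $ i)" for i
      using integrable_times_test_function[OF \<phi> locally_integrable_entry[of UNIV A i j]] A
      by (simp add: has_weak_derivative_on_def column_def)
    from integrable_vec(2)[OF this, of i]
    have "(LINT x|lebesgue. \<phi> x *\<^sub>R column j (A x)) $ i = (LINT x|lebesgue. \<phi> x * A x $ i $ j)" by (simp add: column_def)
    then show ?thesis using A \<phi> by (simp add: has_weak_derivative_on_def)
  qed
  have "AE x in lebesgue. D x $ i $ j - D' x $ i $ j = 0" for i j
  proof (rule locally_integrable_test_zero_imp_AE_zero)
    have li: "locally_integrable UNIV (\<lambda>x. D x $ i $ j)" "locally_integrable UNIV (\<lambda>x. D' x $ i $ j)"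
      using D D' by (auto simp: has_weak_derivative_on_def intro: locally_integrable_entry)
    then show "locally_integrable UNIV (\<lambda>x. D x $ i $ j - D' x $ i $ j)"
      by (auto simp: locally_integrable_def intro!: set_integral_diff(1))
    fix \<phi> :: "real ^ 'm \<Rightarrow> real" assume \<phi>: "test_function UNIV \<phi>"
    have "(LINT x|lebesgue. \<phi> x * (D x $ i $ j - D' x $ i $ j)) = (LINT x|lebesgue. \<phi> x * D x $ i $ j) - (LINT x|lebesgue. \<phi> x * D' x $ i $ j)"
      by (simp only: right_diff_distrib) (intro Bochner_Integration.integral_diff integrable_times_test_function \<phi> li)
    then show "(LINT x|lebesgue. \<phi> x * (D x $ i $ j - D' x $ i $ j)) = 0" by (simp add: ent[OF D \<phi>] ent[OF D' \<phi>])
  qed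
  then have "AE x in lebesgue. \<forall>i j. D x $ i $ j - D' x $ i $ j = 0" by (simp only: AE_all_countable) simp
  then show ?thesis by eventually_elim (simp add: vec_eq_iff)
qed

context whitney_map
begin

definition grad :: "real ^ ('k + 'p) \<Rightarrow> real ^ ('k + 'p) ^ ('k + 'p)" where
  "grad x = (\<chi> i j. dird i (axis j 1) x)"

lemma locally_integrable_dird: "locally_integrable UNIV (dird i v)"
  unfolding locally_integrable_def set_integrable_def
proof (intro allI impI)
  fix S :: "(real ^ ('k + 'p)) set" assume S: "compact S \<and> S \<subseteq> UNIV"
  then obtain R where R: "S \<subseteq> ball 0 R" using compact_imp_bounded bounded_subset_ballD by blast
  have [measurable]: "S \<in> sets borel" using S by (simp add: borel_compact)
  have "integrable lborel (\<lambda>x. indicator S x *\<^sub>R dird i v x)"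
  proof (rule integrableI_bounded)
    have "(\<integral>\<^sup>+x. ennreal (norm (indicator S x *\<^sub>R dird i v x)) \<partial>lborel) \<le> (\<integral>\<^sup>+x\<in>ball 0 R. ennreal \<bar>dird i v x\<bar> \<partial>lborel)"
      by (intro nn_integral_mono) (use R in \<open>auto split: split_indicator\<close>)
    then show "(\<integral>\<^sup>+x. ennreal (norm (indicator S x *\<^sub>R dird i v x)) \<partial>lborel) < \<infinity>"
      using dird_locally_integrable[of i v R] by (rule le_less_trans)
  qed measurable
  then show "integrable lebesgue (\<lambda>x. indicator S x *\<^sub>R dird i v x)"
    by (subst integrable_completion) auto
qed

lemma weak_derivative_grad: "has_weak_derivative_on f grad UNIV"
  unfolding has_weak_derivative_on_def
proof (intro conjI allI impI)
  show "locally_integrable UNIV f" unfolding locally_integrable_def set_integrable_def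
  proof (intro allI impI)
    fix S :: "(real ^ ('k + 'p)) set" assume S: "compact S \<and> S \<subseteq> UNIV"
    have "integrable lborel (\<lambda>x. indicator S x *\<^sub>R f x)"
      by (rule borel_integrable_compact) (use S continuous_f in auto)
    then show "integrable lebesgue (\<lambda>x. indicator S x *\<^sub>R f x)"
      by (subst integrable_completion) (use borel_measurable_integrable in auto)
  qed
  show "locally_integrable UNIV grad" unfolding locally_integrable_def
  proof (intro allI impI, rule absolutely_integrable_componentwise)
    fix S :: "(real ^ ('k + 'p)) set" and b :: "real ^ ('k + 'p) ^ ('k + 'p)" assume S: "compact S \<and> S \<subseteq> UNIV" and "b \<in> Basis"
    then obtain i j where "b = axis i (axis j 1)" by (auto simp: Basis_vec_def)
    then have "(\<lambda>x. grad x \<bullet> b) = dird i (axis j 1)" by (simp add: fun_eq_iff inner_axis grad_def)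
    then show "(\<lambda>x. grad x \<bullet> b) absolutely_integrable_on S"
      using locally_integrable_dird S by (simp add: locally_integrable_def)
  qed
  fix \<phi> :: "real ^ ('k + 'p) \<Rightarrow> real" and j assume \<phi>: "test_function UNIV \<phi>"
  note ibp = integration_by_parts[OF \<phi>]
  have i1: "integrable lborel (\<lambda>x. (frechet_derivative \<phi> (at x) (axis j 1) *\<^sub>R f x) $ i)" for i
    using ibp(1)[of "axis j 1" i] by simp
  have i2: "integrable lborel (\<lambda>x. (\<phi> x *\<^sub>R column j (grad x)) $ i)" for i
    using ibp(2)[of i "axis j 1"] by (simp add: column_def grad_def)
  note I1 = integrable_vec[OF i1] and I2 = integrable_vec[OF i2]
  have "(LINT x|lborel. frechet_derivative \<phi> (at x) (axis j 1) *\<^sub>R f x) = - (LINT x|lborel. \<phi> x *\<^sub>R column j (grad x))"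
  proof (rule vec_eq_iff[THEN iffD2], rule allI)
    fix i
    show "(LINT x|lborel. frechet_derivative \<phi> (at x) (axis j 1) *\<^sub>R f x) $ i = (- (LINT x|lborel. \<phi> x *\<^sub>R column j (grad x))) $ i"
      using I1(2)[of i] I2(2)[of i] ibp(3)[of "axis j 1" i] by (simp add: column_def grad_def)
  qed
  moreover have "(LINT x|lebesgue. frechet_derivative \<phi> (at x) (axis j 1) *\<^sub>R f x) = (LINT x|lborel. frechet_derivative \<phi> (at x) (axis j 1) *\<^sub>R f x)"
    by (rule integral_completion) (rule borel_measurable_integrable[OF I1(1)])
  moreover have "(LINT x|lebesgue. \<phi> x *\<^sub>R column j (grad x)) = (LINT x|lborel. \<phi> x *\<^sub>R column j (grad x))"
    by (rule integral_completion) (rule borel_measurable_integrable[OF I2(1)])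
  ultimately show "(LINT x|lebesgue. frechet_derivative \<phi> (at x) (axis j 1) *\<^sub>R f x) = - (LINT x|lebesgue. \<phi> x *\<^sub>R column j (grad x))"
    by simp
qed

text \<open>Linearity in v is not evident for limits of quotients. Integrated against a test
  function, however, both sides move the derivative onto \<phi>, where it is linear in the
  direction.\<close>

lemma AE_grad_mult: "AE x in lebesgue. grad x *v v = (\<chi> i. dird i v x)"
proof -
  have "AE x in lebesgue. (\<Sum>j\<in>UNIV. v $ j * dird i (axis j 1) x) - dird i v x = 0" for i
  proof (rule locally_integrable_test_zero_imp_AE_zero)
    have "(\<lambda>x. v $ j * dird i (axis j 1) x) absolutely_integrable_on S" if "compact S" for j S
      using locally_integrable_dird[of i "axis j 1"] that by (auto simp: locally_integrable_def)
    then show "locally_integrable UNIV (\<lambda>x. (\<Sum>j\<in>UNIV. v $ j * dird i (axis j 1) x) - dird i v x)"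
      using locally_integrable_dird[of i v]
      by (auto simp: locally_integrable_def intro!: set_integral_diff(1) absolutely_integrable_sum)
    fix \<phi> :: "real ^ ('k + 'p) \<Rightarrow> real" assume \<phi>: "test_function UNIV \<phi>"
    note ibp = integration_by_parts[OF \<phi>]
    let ?d = "\<lambda>w x. frechet_derivative \<phi> (at x) w * f x $ i"
    have "(LINT x|lborel. \<phi> x * ((\<Sum>j\<in>UNIV. v $ j * dird i (axis j 1) x) - dird i v x)) = (LINT x|lborel. (\<Sum>j\<in>UNIV. v $ j * (\<phi> x * dird i (axis j 1) x)) - \<phi> x * dird i v x)"
      by (simp add: right_diff_distrib sum_distrib_left mult_ac)
    also have "\<dots> = (\<Sum>j\<in>UNIV. v $ j * (LINT x|lborel. \<phi> x * dird i (axis j 1) x)) - (LINT x|lborel. \<phi> x * dird i v x)"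
      by (subst Bochner_Integration.integral_diff)
        (auto intro!: Bochner_Integration.integrable_sum integrable_mult_right ibp simp: Bochner_Integration.integral_sum ibp(2))
    also have "\<dots> = - ((\<Sum>j\<in>UNIV. v $ j * (LINT x|lborel. ?d (axis j 1) x)) - (LINT x|lborel. ?d v x))"
      by (simp add: ibp(3) sum_negf)
    also have "(LINT x|lborel. ?d v x) = (LINT x|lborel. (\<Sum>j\<in>UNIV. v $ j * ?d (axis j 1) x))"
      by (subst frechet_derivative_test_function_expand[OF \<phi>]) (simp add: sum_distrib_right mult.assoc)
    also have "\<dots> = (\<Sum>j\<in>UNIV. v $ j * (LINT x|lborel. ?d (axis j 1) x))"
      by (simp add: Bochner_Integration.integral_sum ibp(1))
    finally have z: "(LINT x|lborel. \<phi> x * ((\<Sum>j\<in>UNIV. v $ j * dird i (axis j 1) x) - dird i v x)) = 0" by simp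
    have [measurable]: "\<phi> \<in> borel_measurable borel"
      using \<phi> Ck_continuous[of 0] borel_measurable_continuous_onI unfolding test_function_def by blast
    have "(LINT x|lebesgue. \<phi> x * ((\<Sum>j\<in>UNIV. v $ j * dird i (axis j 1) x) - dird i v x)) = (LINT x|lborel. \<phi> x * ((\<Sum>j\<in>UNIV. v $ j * dird i (axis j 1) x) - dird i v x))"
      by (rule integral_completion) simp
    then show "(LINT x|lebesgue. \<phi> x * ((\<Sum>j\<in>UNIV. v $ j * dird i (axis j 1) x) - dird i v x)) = 0" using z by simp
  qed
  then have "AE x in lebesgue. \<forall>i. (\<Sum>j\<in>UNIV. v $ j * dird i (axis j 1) x) - dird i v x = 0"
    by (simp only: AE_all_countable) simp
  then show ?thesis
    by eventually_elim (simp add: vec_eq_iff matrix_vector_mult_def grad_def mult.commute)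
qed

text \<open>The null set found for a single v depends on v; a countable dense set of directions
  gives a common one, and the set of good v is closed.\<close>

lemma AE_grad_bounds:
  "AE x in lebesgue. \<forall>v. ratio x / K * norm v \<le> norm (grad x *v v) \<and> norm (grad x *v v) \<le> K * ratio x * norm v"
proof -
  obtain C :: "(real ^ ('k + 'p)) set" where C: "countable C" "\<And>X. open X \<Longrightarrow> X \<noteq> {} \<Longrightarrow> \<exists>d\<in>C. d \<in> X"
    using countable_dense_setE by blast
  have conv: "AE x in lebesgue. \<forall>i. convergent (\<lambda>k. dirq i v k x)" for v
    by (rule AE_completion) (simp only: AE_all_countable AE_convergent_dirq, simp)
  have "AE x in lebesgue. ratio x / K * norm v \<le> norm (grad x *v v) \<and> norm (grad x *v v) \<le> K * ratio x * norm v" for v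
    using AE_grad_mult[of v] conv[of v] AE_completion[OF AE_depth_pos]
  proof eventually_elim
    case (elim x)
    have "norm (\<chi> i. dird i v x) \<le> K * ratio x * norm v" "ratio x * norm v \<le> K * norm (\<chi> i. dird i v x)"
      using elim by (intro dird_bounds; simp)+
    then show ?case using K elim(1) by (simp add: field_simps)
  qed
  then have "AE x in lebesgue. \<forall>v\<in>C. ratio x / K * norm v \<le> norm (grad x *v v) \<and> norm (grad x *v v) \<le> K * ratio x * norm v"
    using C(1) by (simp add: AE_ball_countable)
  then show ?thesis
  proof eventually_elim
    case (elim x)
    define S where "S = {v. ratio x / K * norm v \<le> norm (grad x *v v) \<and> norm (grad x *v v) \<le> K * ratio x * norm v}"
    have cont: "continuous_on UNIV (\<lambda>v. grad x *v v)" by (simp add: linear_continuous_on)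
    have "closed S" unfolding S_def by (intro closed_Collect_conj closed_Collect_le continuous_intros cont)
    then have "open (- S)" by (simp add: open_Compl)
    moreover have "C \<subseteq> S" using elim by (auto simp: S_def)
    ultimately have "- S = {}" using C(2)[of "- S"] by blast
    then have "v \<in> S" for v by blast
    then show ?case by (simp add: S_def)
  qed
qed

lemma jacobian_measurable: "jacobian f \<in> borel_measurable lebesgue"
  and AE_jacobian_eq: "AE x in lebesgue. jacobian f x = \<bar>det (grad x)\<bar>"
proof -
  define D where "D = (SOME D. has_weak_derivative_on f D UNIV)"
  have D: "has_weak_derivative_on f D UNIV" unfolding D_def by (rule someI[where P = "\<lambda>D. has_weak_derivative_on f D UNIV", OF weak_derivative_grad])
  have J: "jacobian f = (\<lambda>x. \<bar>det (D x)\<bar>)" by (simp add: fun_eq_iff jacobian_def D_def)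
  have [measurable]: "(\<lambda>x. D x $ i $ j) \<in> borel_measurable lebesgue" for i j
    using D by (intro locally_integrable_measurable locally_integrable_entry) (simp add: has_weak_derivative_on_def)
  show "jacobian f \<in> borel_measurable lebesgue" unfolding J det_def by measurable
  show "AE x in lebesgue. jacobian f x = \<bar>det (grad x)\<bar>"
    using weak_derivative_unique[OF D weak_derivative_grad] by eventually_elim (simp add: J)
qed

lemma AE_jacobian_bounds:
  "AE x in lebesgue. (ratio x / K) ^ CARD('k + 'p) / fact CARD('k + 'p) \<le> jacobian f x \<and>
    jacobian f x \<le> fact CARD('k + 'p) * (K * ratio x) ^ CARD('k + 'p)"
  using AE_grad_bounds AE_jacobian_eq AE_completion[OF AE_depth_pos]
proof eventually_elim
  case (elim x)
  have "0 < ratio x / K" using ratio_pos[OF elim(3)] K by simp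
  then have "(ratio x / K) ^ CARD('k + 'p) / fact CARD('k + 'p) \<le> \<bar>det (grad x)\<bar>" using elim(1) by (intro abs_det_ge) auto
  moreover have "\<bar>det (grad x)\<bar> \<le> fact CARD('k + 'p) * (K * ratio x) ^ CARD('k + 'p)"
    using elim(1) by (intro abs_det_le abs_entry_le_of_norm_bound) auto
  ultimately show ?case using elim(2) by simp
qed

text \<open>A walk in equal steps of length at most c / 2 * \<rho>. Each step stays in the ball
  where \<open>depth_f_le\<close> applies and costs a factor 2 * M.\<close>

lemma depth_f_chain:
  assumes \<rho>: "0 < \<rho>" and seg: "\<And>z. z \<in> closed_segment x y \<Longrightarrow> \<rho> \<le> depth z" and d: "dist x y \<le> real m * (c / 2 * \<rho>)"
  shows "depth (f y) \<le> (2 * M) ^ m * depth (f x)"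
  using seg d
proof (induction m arbitrary: x)
  case 0
  then show ?case by simp
next
  case (Suc m)
  define S where "S = real (Suc m)"
  have S: "0 < S" "S - 1 = real m" "1 \<le> S" by (simp_all add: S_def)
  have dS: "dist x y \<le> S * (c / 2 * \<rho>)" using Suc.prems(2) by (simp only: S_def)
  define x1 where "x1 = x + (1 / S) *\<^sub>R (y - x)"
  have x1: "x1 \<in> closed_segment x y" unfolding in_segment
    by (rule exI[of _ "1 / S"]) (use S in \<open>simp add: x1_def algebra_simps\<close>)
  have dx: "\<rho> \<le> depth x" using Suc.prems(1)[of x] by simp
  have "x - x1 = (1 / S) *\<^sub>R (x - y)" by (simp add: x1_def algebra_simps)
  then have "dist x x1 = 1 / S * dist x y" unfolding dist_norm using S by simp
  also have "\<dots> \<le> 1 / S * (S * (c / 2 * \<rho>))" using S by (intro mult_left_mono dS) auto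
  also have "\<dots> = c / 2 * \<rho>" using S by simp
  also have "\<dots> < c * \<rho>" using c \<rho> by simp
  also have "\<dots> \<le> c * depth x" using dx c by (intro mult_left_mono) auto
  finally have 1: "depth (f x1) \<le> 2 * M * depth (f x)" using dx \<rho> by (intro depth_f_le) auto
  have "x1 - y = (1 - 1 / S) *\<^sub>R (x - y)" by (simp add: x1_def algebra_simps)
  then have "dist x1 y = (1 - 1 / S) * dist x y" unfolding dist_norm using S by simp
  also have "\<dots> \<le> (1 - 1 / S) * (S * (c / 2 * \<rho>))" using S by (intro mult_left_mono dS) auto
  also have "\<dots> = ((1 - 1 / S) * S) * (c / 2 * \<rho>)" by (simp only: mult.assoc)
  also have "(1 - 1 / S) * S = S - 1" using S by (simp add: left_diff_distrib)
  also have "S - 1 = real m" by (rule S(2))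
  finally have "depth (f y) \<le> (2 * M) ^ m * depth (f x1)"
    using Suc.prems(1) subset_closed_segment[of x1 y x y] x1 by (intro Suc.IH) auto
  also have "\<dots> \<le> (2 * M) ^ m * (2 * M * depth (f x))" using M by (intro mult_left_mono 1) auto
  finally show ?case by (simp add: mult_ac)
qed

lemma ratio_comparable:
  obtains A where "0 < A" "\<And>x z. 0 < depth x \<Longrightarrow> dist x z < depth x / 2 \<Longrightarrow> ratio z \<le> A * ratio x \<and> ratio x \<le> A * ratio z"
proof -
  define m where "m = nat \<lceil>2 / c\<rceil>"
  define B where "B = (2 * M) ^ m"
  have B: "0 < B" using M by (simp add: B_def)
  have m: "2 / c \<le> real m" unfolding m_def by (rule real_nat_ceiling_ge)
  have "ratio z \<le> (2 * B) * ratio x \<and> ratio x \<le> (2 * B) * ratio z" if x: "0 < depth x" and z: "dist x z < depth x / 2" for x z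
  proof -
    have seg: "depth x / 2 \<le> depth w" if "w \<in> closed_segment x z" for w
    proof -
      have "dist w x \<le> dist x z" using that by (metis dist_commute dist_in_closed_segment)
      then show ?thesis using depth_lipschitz[of x w] z by (simp add: dist_commute)
    qed
    have "2 / c * (c / 2 * (depth x / 2)) \<le> real m * (c / 2 * (depth x / 2))" using m c x by (intro mult_right_mono) auto
    then have d: "dist x z \<le> real m * (c / 2 * (depth x / 2))" using z c by simp
    have fz: "depth (f z) \<le> B * depth (f x)" unfolding B_def
      by (rule depth_f_chain[OF _ seg d]) (use x in auto)
    have fx: "depth (f x) \<le> B * depth (f z)" unfolding B_def
      by (rule depth_f_chain[of "depth x / 2"]) (use x d seg in \<open>auto simp: dist_commute closed_segment_commute\<close>)
    have dz: "depth x \<le> 2 * depth z" "depth z \<le> 2 * depth x" using depth_lipschitz[of x z] z by linarith+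
    have fp: "0 \<le> depth (f x)" "0 \<le> depth (f z)" by simp_all
    have "depth (f z) * depth x \<le> (B * depth (f x)) * (2 * depth z)" using fz dz x B fp by (intro mult_mono) auto
    moreover have "depth (f x) * depth z \<le> (B * depth (f z)) * (2 * depth x)" using fx dz x B fp by (intro mult_mono) auto
    ultimately show ?thesis using x dz by (simp add: ratio_def field_simps)
  qed
  then show thesis using that[of "2 * B"] B by auto
qed

lemma infdist_range_embed_le: "infdist x (range (embed :: real ^ 'k \<Rightarrow> real ^ ('k + 'p))) \<le> depth x"
proof -
  have "join x 0 \<in> range (embed :: real ^ 'k \<Rightarrow> real ^ ('k + 'p))"
    unfolding depth_zero_iff[symmetric] by (simp add: depth_def)
  then have "infdist x (range (embed :: real ^ 'k \<Rightarrow> real ^ ('k + 'p))) \<le> dist x (join x 0)" by (rule infdist_le)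
  also have "\<dots> = dist (join x (ypart x)) (join x 0)" by simp
  also have "\<dots> \<le> dist x x + norm (ypart x - 0)" by (rule dist_join_le)
  finally show ?thesis by (simp add: depth_def)
qed

lemma local_A1_jacobian: "local_A1 (range (embed :: real ^ 'k \<Rightarrow> real ^ ('k + 'p))) (jacobian f)"
proof -
  let ?n = "CARD('k + 'p)"
  obtain A where A: "0 < A" "\<And>x z. 0 < depth x \<Longrightarrow> dist x z < depth x / 2 \<Longrightarrow> ratio z \<le> A * ratio x \<and> ratio x \<le> A * ratio z"
    using ratio_comparable by blast
  \<comment> \<open>U bounds the Jacobian from above in units of ratio x^n, and C is chosen so that
    C * l is exactly this upper bound, with l the lower bound defined below.\<close>
  define U where "U = fact ?n * (K * A) ^ ?n"
  define C where "C = U * (fact ?n * (K * A) ^ ?n)"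
  have U: "0 < U" and C: "0 < C" using A K by (simp_all add: U_def C_def)
  have main: "(\<integral>\<^sup>+z\<in>ball x r. ennreal (jacobian f z) \<partial>lebesgue) / emeasure lebesgue (ball x r)
      \<le> ennreal C * Liminf (ae_filter (lebesgue_on (ball x r))) (\<lambda>z. ennreal (jacobian f z))"
    if r: "0 < r" "2 * r < infdist x (range (embed :: real ^ 'k \<Rightarrow> real ^ ('k + 'p)))" for x r
  proof -
    have rx: "2 * r < depth x" using r(2) infdist_range_embed_le[of x] by linarith
    then have dx: "0 < depth x" using r(1) by linarith
    have px: "0 < ratio x" by (rule ratio_pos[OF dx])
    define l where "l = (ratio x / (K * A)) ^ ?n / fact ?n"
    have l: "0 \<le> l" using px K A by (simp add: l_def)
    have b: "AE z in lebesgue. z \<in> ball x r \<longrightarrow> l \<le> jacobian f z \<and> jacobian f z \<le> U * ratio x ^ ?n"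
      using AE_jacobian_bounds
    proof eventually_elim
      case (elim z)
      show ?case
      proof
        assume z: "z \<in> ball x r"
        then have c: "ratio z \<le> A * ratio x" "ratio x \<le> A * ratio z" using A(2)[OF dx, of z] rx by auto
        have pz: "0 \<le> ratio z" by (simp add: ratio_def)
        have "ratio x / (K * A) \<le> ratio z / K" using c(2) K A by (simp add: field_simps)
        then have "l \<le> (ratio z / K) ^ ?n / fact ?n" unfolding l_def
          using px K A by (intro divide_right_mono power_mono) auto
        moreover have "fact ?n * (K * ratio z) ^ ?n \<le> fact ?n * (K * (A * ratio x)) ^ ?n"
          using c(1) pz K by (intro mult_left_mono power_mono) auto
        moreover have "fact ?n * (K * (A * ratio x)) ^ ?n = U * ratio x ^ ?n" by (simp only: U_def power_mult_distrib mult_ac)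
        ultimately show "l \<le> jacobian f z \<and> jacobian f z \<le> U * ratio x ^ ?n" using elim by linarith
      qed
    qed
    have "AE z in lebesgue_on (ball x r). ennreal l \<le> ennreal (jacobian f z)"
    proof (subst AE_restrict_space_iff)
      show "AE z in lebesgue. z \<in> ball x r \<longrightarrow> ennreal l \<le> ennreal (jacobian f z)"
        using b by eventually_elim (auto intro: ennreal_leI)
    qed simp
    then have lim: "ennreal l \<le> Liminf (ae_filter (lebesgue_on (ball x r))) (\<lambda>z. ennreal (jacobian f z))" by (rule Liminf_bounded)
    have "(\<integral>\<^sup>+z\<in>ball x r. ennreal (jacobian f z) \<partial>lebesgue) \<le> (\<integral>\<^sup>+z. ennreal (U * ratio x ^ ?n) * indicator (ball x r) z \<partial>lebesgue)"
    proof (rule nn_integral_mono_AE)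
      show "AE z in lebesgue. ennreal (jacobian f z) * indicator (ball x r) z \<le> ennreal (U * ratio x ^ ?n) * indicator (ball x r) z"
        using b by eventually_elim (auto intro: ennreal_leI split: split_indicator)
    qed
    also have "\<dots> = ennreal (U * ratio x ^ ?n) * emeasure lebesgue (ball x r)" by (rule nn_integral_cmult_indicator) simp
    finally have "(\<integral>\<^sup>+z\<in>ball x r. ennreal (jacobian f z) \<partial>lebesgue) \<le> emeasure lebesgue (ball x r) * ennreal (U * ratio x ^ ?n)"
      by (simp only: mult.commute)
    moreover have "0 < emeasure lebesgue (ball x r)" using content_ball_pos[OF r(1), of x] emeasure_lborel_ball_finite[of x r]
      by (simp add: emeasure_completion measure_def enn2real_positive_iff)
    ultimately have "(\<integral>\<^sup>+z\<in>ball x r. ennreal (jacobian f z) \<partial>lebesgue) / emeasure lebesgue (ball x r) \<le> ennreal (U * ratio x ^ ?n)"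
      by (intro divide_le_posI_ennreal)
    also have "U * ratio x ^ ?n = C * l" using K A by (simp add: C_def l_def power_divide)
    also have "ennreal (C * l) = ennreal C * ennreal l" using C l by (simp add: ennreal_mult)
    also have "\<dots> \<le> ennreal C * Liminf (ae_filter (lebesgue_on (ball x r))) (\<lambda>z. ennreal (jacobian f z))"
      by (intro mult_left_mono lim) simp
    finally show ?thesis .
  qed
  show ?thesis unfolding local_A1_def
    using jacobian_measurable C main by (auto simp: jacobian_def[of f])
qed

lemma inv_f: "inv f = fi"
  by (rule inv_equality) simp_all

end

lemma composition_bounded_Q_space: "u \<in> Q_space \<alpha> \<Longrightarrow> composition_bounded \<alpha> f \<Longrightarrow> u \<circ> f \<in> Q_space \<alpha>"
  unfolding composition_bounded_def by (elim exE) (drule bspec, assumption, erule conjunct1)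

theorem corollary1p5:
  fixes g :: "real ^ 'k::finite \<Rightarrow> real ^ 'k"
    and f :: "real ^ ('k + 'p::finite) \<Rightarrow> real ^ ('k + 'p)"
  assumes g: "if CARD('k) = 1 then quasisymmetric g else quasiconformal g"
    and f: "tukia_vaisala_extension g f"
  shows "(local_A1 (range (embed :: real ^ 'k \<Rightarrow> real ^ ('k + 'p))) (jacobian f) \<and>
          local_A1 (range (embed :: real ^ 'k \<Rightarrow> real ^ ('k + 'p))) (jacobian (inv f))) \<and>
         (\<forall>\<alpha>. 0 < \<alpha> \<and> \<alpha> < (if CARD('p) = 1 then 1 / 2 else 1) \<longrightarrow>
           composition_bounded \<alpha> f \<and> composition_bounded \<alpha> (inv f) \<and>
           (\<forall>u. u \<in> Q_space \<alpha> \<longleftrightarrow> u \<circ> f \<in> Q_space \<alpha>))"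
proof -
  obtain fi c M where "whitney_map f fi c M" using tukia_vaisala_whitney_map[OF g f] by blast
  then interpret F: whitney_map f fi c M .
  interpret I: whitney_map fi f c M by (rule F.inverse_map)
  have Q: "composition_bounded \<alpha> f \<and> composition_bounded \<alpha> (inv f) \<and> (\<forall>u. u \<in> Q_space \<alpha> \<longleftrightarrow> u \<circ> f \<in> Q_space \<alpha>)"
    if \<alpha>: "0 < \<alpha>" "\<alpha> < (if CARD('p) = 1 then 1 / 2 else 1)" for \<alpha>
  proof -
    \<comment> \<open>The two ranges of \<alpha> are unified as 2 * \<alpha> < p: for p = 1 this
      means \<alpha> < 1/2, while for p at least 2 it follows from \<alpha> < 1.\<close>
    have "0 < CARD('p)" by simp
    then have "2 \<le> real CARD('p)" if "CARD('p) \<noteq> 1" using that by linarith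
    then have p: "2 * \<alpha> < real CARD('p)" using \<alpha>(2) by (cases "CARD('p) = 1") simp_all
    have b: "composition_bounded \<alpha> f" by (rule F.composition_bounded_f[OF \<alpha>(1) p])
    have bi: "composition_bounded \<alpha> fi" by (rule I.composition_bounded_f[OF \<alpha>(1) p])
    have "u \<in> Q_space \<alpha> \<longleftrightarrow> u \<circ> f \<in> Q_space \<alpha>" for u
    proof
      assume "u \<circ> f \<in> Q_space \<alpha>"
      then have "(u \<circ> f) \<circ> fi \<in> Q_space \<alpha>" using bi by (rule composition_bounded_Q_space)
      moreover have "(u \<circ> f) \<circ> fi = u" by (simp add: fun_eq_iff)
      ultimately show "u \<in> Q_space \<alpha>" by simp
    next
      assume "u \<in> Q_space \<alpha>"
      then show "u \<circ> f \<in> Q_space \<alpha>" using b by (rule composition_bounded_Q_space)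
    qed
    then show ?thesis unfolding F.inv_f by (intro conjI b bi allI)
  qed
  have "local_A1 (range (embed :: real ^ 'k \<Rightarrow> real ^ ('k + 'p))) (jacobian (inv f))"
    unfolding F.inv_f by (rule I.local_A1_jacobian)
  with F.local_A1_jacobian show ?thesis using Q by (intro conjI allI impI) (assumption+, blast+)
qed

end
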